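(* Let $\Gamma=N+S$ and let $n$ be a positive integer. For any positive integer $m$ and all $\tau\in\mathbb H$, $$J_{\Gamma,n}|T(m)(\tau)=\sum_{d\mid m}\bigl(J_{\Gamma,n}^{(d)}|U^*_{m/d}\bigr)(d\tau)=\sum_{d\mid \gcd(n,m)}d\,J^{(d)}_{\Gamma,\frac{mn}{d^2}}(\tau).$$
   Context: Groups. $\mathbb H$ is the complex upper half-plane, $\tau\in\mathbb H$, $q=e^{2\pi i\tau}$. For a positive integer $N$, an exact divisor of $N$ is $Q\mid N$ with $\gcd(Q,N/Q)=1$; $W_{Q,N}$ denotes any matrix $\begin{pmatrix}Qx&y\\ Nz&Qw\end{pmatrix}$ with $x,y,z,w\in\mathbb Z$ and determinant $Q$. For a set $S$ of exact divisors of $N$, $\Gamma=N+S$ is the subgroup of $\mathrm{PSL}_2(\mathbb R)$ generated by $\Gamma_0(N)$ and all $W_{Q,N}$, $Q\in S$. Among the sets of exact divisors $>1$ generating the same group, $S$ is taken to be the largest one, so $\Gamma$ is the disjoint union of $\Gamma_0(N)$ and the cosets $\Gamma_0(N)W_{Q,N}$, $Q\in S$. Groups $\Gamma^{(m)}$. For a prime $p$, $\Gamma^{(p)}=N^{(p)}+S^{(p)}$ where $N^{(p)}=N/\gcd(p,N)$ and $S^{(p)}$ is the set of $Q\in S$ dividing $N^{(p)}$. For $m=p_1p_2\cdots p_r$ (primes, repetitions allowed), $\Gamma^{(m)}=\Gamma^{(p_1)(p_2)\cdots(p_r)}$ is obtained by iterating; $\Gamma^{(1)}=\Gamma$. The functions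 $J_{\Gamma,n}$. Let $\Gamma_\infty=\{\pm\begin{pmatrix}1&t\\0&1\end{pmatrix}:t\in\mathbb Z\}$, $e(x)=e^{2\pi i x}$, and for $n\in\mathbb N$, $\mathrm{Re}(s)>1$ put $$G_{\Gamma,-n}(\tau,s)=2\pi\sum_{\gamma\in\Gamma_\infty\backslash\Gamma}f_n(\gamma\tau),\qquad f_n(\tau)=e(-n\,\mathrm{Re}\,\tau)\,(n\,\mathrm{Im}\,\tau)^{1/2}I_{s-\frac12}(2\pi n\,\mathrm{Im}\,\tau),$$ with $I$ the $I$-Bessel function. It continues analytically to $\mathrm{Re}(s)>1/2$; set $j_{\Gamma,n}(\tau)=G_{\Gamma,-n}(\tau,1)$, a $\Gamma$-invariant harmonic function with expansion $j_{\Gamma,n}=q^{-n}-\bar q^n+c_\Gamma(n,0)+\sum_{\ell\ge1}(c_\Gamma(n,\ell)q^\ell+c_\Gamma(n,-\ell)\bar q^\ell)$. Define $J_{\Gamma,n}=j_{\Gamma,n}-c_\Gamma(n,0)$ for $n\ge1$, $J_{\Gamma,0}=1$, and $J_{\Gamma,x}=0$ if $x$ is not an integer. The $m$-plicate is $J_{\Gamma,n}^{(m)}=J_{\Gamma^{(m)},n}$. Operators. $(f|U^*_m)(\tau)=\sum_{i=0}^{m-1}f\left(\frac{\tau+i}{m}\right)$. For a prime $p$ and $r\ge1$, $J_{\Gamma,n}|T(p^r)(\tau)=\sum_{i=0}^{r}\bigl(J^{(p^i)}_{\Gamma,n}|U^*_{p^{r-i}}\bigr)(p^i\tau)$. For $m=p_1^{k_1}\cdots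 p_r^{k_r}$ with distinct primes $p_i$, $T(m)=T(p_1^{k_1})\circ\cdots\circ T(p_r^{k_r})$ and $T(1)$ is the identity. In a composition, $J_{\Gamma,n}|T(p^k)$ is written as the finite combination $\sum_{p^j\mid\gcd(n,p^k)}p^jJ^{(p^j)}_{\Gamma,p^kn/p^{2j}}$ of functions $J_{\Gamma',n'}$ (to which it is equal), and the next operator acts on it term by term, linearly; the factors for distinct primes commute. *)

theory Defs
  imports
    "HOL-Complex_Analysis.Complex_Analysis"
    "HOL-Algebra.Coset"
    "HOL-Algebra.Generated_Groups"
    "HOL-Computational_Algebra.Primes"
begin

section \<open>The groups \<open>N+S\<close>\<close>

definition mat2 :: "real \<Rightarrow> real \<Rightarrow> real \<Rightarrow> real \<Rightarrow> real^2^2" where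
  "mat2 a b c d = vector [vector [a, b], vector [c, d]]"

definition SL2R :: "(real^2^2) monoid" where
  "SL2R = \<lparr>carrier = {A. det A = 1}, monoid.mult = (**), one = mat 1\<rparr>"

text \<open>Elements of \<open>PSL2R\<close> are the cosets \<open>{A, -A}\<close>.\<close>

definition PSL2R :: "(real^2^2) set monoid" where
  "PSL2R = SL2R Mod {mat 1, - mat 1}"

definition psl_class :: "real^2^2 \<Rightarrow> (real^2^2) set" where
  "psl_class A = {mat 1, - mat 1} #>\<^bsub>SL2R\<^esub> A"

definition moebius :: "real^2^2 \<Rightarrow> complex \<Rightarrow> complex" where
  "moebius A z = (of_real (A$1$1) * z + of_real (A$1$2)) / (of_real (A$2$1) * z + of_real (A$2$2))"

text \<open>The Moebius action does not depend on the sign of the representative, so the image below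
  is a singleton.\<close>

definition psl_act :: "(real^2^2) set \<Rightarrow> complex \<Rightarrow> complex" where
  "psl_act g z = the_elem ((\<lambda>A. moebius A z) ` g)"

definition Gamma0 :: "nat \<Rightarrow> (real^2^2) set set" where
  "Gamma0 N = {psl_class (mat2 (of_int a) (of_int b) (of_int c) (of_int d)) | a b c d :: int.
     a * d - b * c = 1 \<and> int N dvd c}"

definition exact_divisor :: "nat \<Rightarrow> nat \<Rightarrow> bool" where
  "exact_divisor Q N \<longleftrightarrow> Q dvd N \<and> gcd Q (N div Q) = 1"

text \<open>The integral matrices with rows \<open>(Q x, y)\<close>, \<open>(N z, Q w)\<close> have determinant \<open>Q\<close>; dividing
  by the square root of \<open>Q\<close> gives their image in \<open>PSL2R\<close>.\<close>

definition Atkin_Lehner :: "nat \<Rightarrow> nat \<Rightarrow> (real^2^2) set set" where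
  "Atkin_Lehner Q N =
     {psl_class ((1 / sqrt (real Q)) *\<^sub>R
        mat2 (of_int (int Q * x)) (of_int y) (of_int (int N * z)) (of_int (int Q * w))) | x y z w :: int.
      (int Q * x) * (int Q * w) - y * (int N * z) = int Q}"

text \<open>A pair \<open>(N, S)\<close> stands for \<open>N+S\<close>.\<close>

type_synonym level = "nat \<times> nat set"

fun level_group :: "level \<Rightarrow> (real^2^2) set set" where
  "level_group (N, S) = generate PSL2R (Gamma0 N \<union> (\<Union>Q\<in>S. Atkin_Lehner Q N))"

text \<open>\<open>S\<close> consists of exact divisors \<open>> 1\<close> of \<open>N\<close> and is the largest such set generating its
  group.\<close>

fun is_level :: "level \<Rightarrow> bool" where
  "is_level (N, S) \<longleftrightarrow>
     N > 0 \<and> S \<subseteq> {Q. exact_divisor Q N \<and> Q > 1} \<and>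
     (\<forall>S'. S' \<subseteq> {Q. exact_divisor Q N \<and> Q > 1} \<and> level_group (N, S') = level_group (N, S)
        \<longrightarrow> S' \<subseteq> S)"

fun plicate_prime :: "nat \<Rightarrow> level \<Rightarrow> level" where
  "plicate_prime p (N, S) = (N div gcd p N, {Q \<in> S. Q dvd N div gcd p N})"

text \<open>The level of \<open>\<Gamma>\<^sup>(\<^sup>m\<^sup>)\<close>: iterate over the prime factors of \<open>m\<close> with multiplicity. The order
  of the primes does not matter.\<close>

definition plicate :: "nat \<Rightarrow> level \<Rightarrow> level" where
  "plicate m L = fold plicate_prime (sorted_list_of_multiset (prime_factorization m)) L"


section \<open>The functions \<open>J\<close>\<close>

definition Bessel_I :: "complex \<Rightarrow> complex \<Rightarrow> complex" where
  "Bessel_I \<nu> z = (z / 2) powr \<nu> * (\<Sum>k. rGamma (\<nu> + of_nat k + 1) / fact k * (z / 2) ^ (2 * k))"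

definition ee :: "complex \<Rightarrow> complex" where
  "ee x = exp (2 * of_real pi * \<i> * x)"

definition seed :: "nat \<Rightarrow> complex \<Rightarrow> complex \<Rightarrow> complex" where
  "seed n s \<tau> = ee (- of_nat n * of_real (Re \<tau>)) * of_real (sqrt (real n * Im \<tau>)) *
     Bessel_I (s - 1/2) (of_real (2 * pi * real n * Im \<tau>))"

definition Gamma_inf :: "(real^2^2) set set" where
  "Gamma_inf = {psl_class (mat2 1 (of_int t) 0 1) | t :: int. True}"

text \<open>The sum over \<open>\<Gamma>\<^sub>\<infinity>\<close>-cosets in \<open>\<Gamma>\<close>; the summand is constant on each coset.\<close>

definition Niebur_G :: "level \<Rightarrow> nat \<Rightarrow> complex \<Rightarrow> complex \<Rightarrow> complex" where
  "Niebur_G L n \<tau> s = 2 * of_real pi *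
     (\<Sum>\<^sub>\<infinity>C \<in> rcosets\<^bsub>PSL2R\<lparr>carrier := level_group L\<rparr>\<^esub> Gamma_inf.
        the_elem ((\<lambda>\<gamma>. seed n s (psl_act \<gamma> \<tau>)) ` C))"

text \<open>The value at \<open>s = 1\<close> of the analytic continuation in \<open>s\<close> from \<open>Re s > 1\<close>. It is unique, being the
  limit of \<open>Niebur_G L n \<tau> s\<close> for \<open>s \<rightarrow> 1\<close> in \<open>Re s > 1\<close>. The domain of the continuation is left
  open: only its value at \<open>1\<close> is used, and holomorphy on all of \<open>Re s > 1/2\<close> involves the
  absence of exceptional Laplace eigenvalues.\<close>

definition j_fun :: "level \<Rightarrow> nat \<Rightarrow> complex \<Rightarrow> complex" where
  "j_fun L n \<tau> = (THE v. \<exists>U g. open U \<and> connected U \<and> {s. Re s > 1} \<subseteq> U \<and> 1 \<in> U \<and>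
     g holomorphic_on U \<and> (\<forall>s. Re s > 1 \<longrightarrow> g s = Niebur_G L n \<tau> s) \<and> v = g 1)"

text \<open>The coefficients of the expansion
  \<open>j = q\<^sup>-\<^sup>n - cnj q\<^sup>n + c(0) + \<Sum>\<^sub>l\<^sub>\<ge>\<^sub>1 (c(l) q\<^sup>l + c(-l) cnj q\<^sup>l)\<close>.\<close>

definition coeff_j :: "level \<Rightarrow> nat \<Rightarrow> int \<Rightarrow> complex" where
  "coeff_j L n = (THE c. \<forall>\<tau>. Im \<tau> > 0 \<longrightarrow>
     ((\<lambda>l. if l > 0 then c l * ee \<tau> ^ nat l else c l * cnj (ee \<tau>) ^ nat (- l))
        has_sum (j_fun L n \<tau> - (inverse (ee \<tau>) ^ n - cnj (ee \<tau>) ^ n + c 0))) (- {0}))"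

definition J_fun :: "level \<Rightarrow> nat \<Rightarrow> complex \<Rightarrow> complex" where
  "J_fun L n \<tau> = (if n = 0 then 1 else j_fun L n \<tau> - coeff_j L n 0)"


section \<open>Operators\<close>

definition U_star :: "nat \<Rightarrow> (complex \<Rightarrow> complex) \<Rightarrow> complex \<Rightarrow> complex" where
  "U_star m f \<tau> = (\<Sum>i<m. f ((\<tau> + of_nat i) / of_nat m))"

definition T_prime_power :: "nat \<Rightarrow> nat \<Rightarrow> level \<Rightarrow> nat \<Rightarrow> complex \<Rightarrow> complex" where
  "T_prime_power p r L n \<tau> =
     (\<Sum>i\<le>r. U_star (p ^ (r - i)) (J_fun (plicate (p ^ i) L) n) (of_nat (p ^ i) * \<tau>))"

text \<open>\<open>J\<^bsub>L,n\<^esub> | T(p\<^sub>1^k\<^sub>1) | \<dots> | T(p\<^sub>r^k\<^sub>r)\<close>, for the list of pairs \<open>(p\<^sub>i, k\<^sub>i)\<close>. As the operators are defined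
  only on the functions \<open>J\<close>, the result of every operator except the last is first rewritten as a
  combination of such functions, on which the remaining operators act termwise.\<close>

fun T_list :: "(nat \<times> nat) list \<Rightarrow> level \<Rightarrow> nat \<Rightarrow> complex \<Rightarrow> complex" where
  "T_list [] L n \<tau> = J_fun L n \<tau>"
| "T_list [(p, k)] L n \<tau> = T_prime_power p k L n \<tau>"
| "T_list ((p, k) # pk # pks) L n \<tau> =
     (\<Sum>j | p ^ j dvd gcd n (p ^ k).
        of_nat (p ^ j) * T_list (pk # pks) (plicate (p ^ j) L) (p ^ k * n div p ^ (2 * j)) \<tau>)"

definition J_T :: "nat \<Rightarrow> level \<Rightarrow> nat \<Rightarrow> complex \<Rightarrow> complex" where
  "J_T m = T_list (map (\<lambda>p. (p, multiplicity p m)) (sorted_list_of_set (prime_factors m)))"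

end

theory Submission
  imports Defs "HOL-Number_Theory.Cong"
begin

text \<open>For \<open>Re s > 1\<close> both sides of the second identity, with \<open>j\<close> replaced by \<open>G(\<tau>, s)\<close>, are sums of the
  seed function over the \<open>\<Gamma>\<^sub>\<infinity>\<close>-classes of integral matrices of determinant \<open>m\<close> attached to \<open>\<Gamma>\<close>. Such a matrix is
  an element of \<open>\<Gamma>\<^sup>(\<^sup>d\<^sup>)\<close> times an upper triangular matrix, where \<open>d\<close> is the gcd of its first column, and also an
  upper triangular matrix times an element of \<open>\<Gamma>\<^sup>(\<^sup>e\<^sup>)\<close>, where \<open>e\<close> is the gcd of its last row. In the second
  factorisation the translates of the seed cancel unless \<open>e\<close> divides \<open>n\<close>.

  To reach \<open>s = 1\<close>, sum first over all matrices with a given lower left entry \<open>c\<close>. The phases of the terms are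
  twisted by inverses modulo \<open>c\<close>, and the elementary bound \<open>O(c powr (15/16))\<close> for Kloosterman sums, obtained from their
  fourth moment, makes the sum over \<open>c\<close> converge absolutely for \<open>Re s > 0.99\<close>. At \<open>s = 1\<close> the series
  becomes a principal part plus \<open>h(\<tau>) - h(cnj \<tau>)\<close> with \<open>h\<close> periodic and holomorphic off the real axis, which gives the Fourier expansion, and
  \<open>Im \<tau> \<rightarrow> \<infinity>\<close> gives the identity for the constant terms.\<close>

section \<open>Kloosterman sums\<close>

text \<open>The point \<open>s = 1\<close> lies on the edge of absolute convergence: estimated
  termwise, the row with lower left entry c has size about c powr (1 - 2 Re s), a harmonic series at
  1. Any fixed power of c saved in the Kloosterman sums repairs this and gives at once a half-plane
  reaching beyond 1. The fourth moment is used because it reduces to counting divisors: it yields c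
  powr (3/4) times the divisor number to the power 3/4, and a divisor bound with exponent 1/4 makes
  this 3/4 + 3/16 = 15/16. The later exponents spend the saved 1/16 = 0.0625: 0.01 on the logarithm
  that expansion in characters costs, 0.01 on each sum over a row, 0.02 on moving Re s from 1 to
  0.99. What is left is c powr (-1.0225). The matrices are handled as integer tuples
  \<open>(Q, a, b, c, d)\<close> instead of classes in \<open>PSL2R\<close>. In this form passing
  from a level to a plicate is a divisibility condition on c, and both factorisations of a matrix of
  determinant m are integer linear algebra.\<close>

definition ec :: "int \<Rightarrow> int \<Rightarrow> complex" where
  "ec c k = ee (of_int k / of_int c)"

lemma ee_add: "ee (x + y) = ee x * ee y"
  by (simp add: ee_def distrib_left exp_add)

lemma ee_0 [simp]: "ee 0 = 1"
  by (simp add: ee_def)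

lemma ee_minus: "ee (- x) = inverse (ee x)"
  by (simp add: ee_def exp_minus)

lemma ee_of_int [simp]: "ee (of_int k) = 1"
  using exp_integer_2pi[of "of_int k"] by (simp add: ee_def mult_ac)

lemma ee_add_of_int [simp]: "ee (x + of_int k) = ee x"
  by (simp add: ee_add)

lemma norm_ee: "norm (ee z) = exp (- 2 * pi * Im z)"
  by (simp add: ee_def)

lemma cnj_ee: "cnj (ee z) = ee (- cnj z)"
  by (simp add: ee_def exp_cnj)

lemma ec_add: "ec c (k + l) = ec c k * ec c l"
  by (simp add: ec_def add_divide_distrib ee_add)

lemma ec_0 [simp]: "ec c 0 = 1"
  by (simp add: ec_def)

lemma norm_ec [simp]: "norm (ec c k) = 1"
  by (simp add: ec_def norm_ee)

lemma cnj_ec: "cnj (ec c k) = ec c (- k)"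
  by (simp add: ec_def cnj_ee)

lemma ec_diff: "ec c (k - l) = ec c k * cnj (ec c l)"
  using ec_add[of c k "- l"] by (simp add: cnj_ec)

lemma ec_mult_self [simp]: "c \<noteq> 0 \<Longrightarrow> ec c (c * k) = 1"
  by (simp add: ec_def)

lemma ec_cong:
  assumes "c \<noteq> 0" "[k = l] (mod c)"
  shows "ec c k = ec c l"
proof -
  obtain t where "k = l + c * t"
    using assms(2) by (metis cong_iff_lin cong_sym)
  then show ?thesis using assms(1) by (simp add: ec_add)
qed

lemma ec_mult_of_nat: "ec c (int k * l) = ec c l ^ k"
  by (induction k) (simp_all add: distrib_right ec_add)

lemma ec_eq_1_iff:
  assumes "c \<noteq> 0"
  shows "ec c l = 1 \<longleftrightarrow> c dvd l"
proof
  assume "ec c l = 1"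
  then have "exp (2 * of_real pi * \<i> * (of_int l / of_int c)) = 1"
    by (simp add: ec_def ee_def)
  also have "2 * of_real pi * \<i> * (of_int l / of_int c) = complex_of_real (2 * pi * (real_of_int l / of_int c)) * \<i>"
    by simp
  finally obtain k :: int where "2 * pi * (real_of_int l / of_int c) = of_int (2 * k) * pi"
    by (auto simp: exp_eq_1 simp del: of_real_mult of_real_divide)
  then have "real_of_int l = of_int (c * k)"
    using assms by (simp add: field_simps)
  then show "c dvd l" by (metis dvd_triv_left of_int_eq_iff)
next
  assume "c dvd l"
  then show "ec c l = 1" using assms by (auto simp: dvd_def)
qed

lemma sum_int_lessThan:
  assumes "c \<ge> 0"
  shows "(\<Sum>k\<in>{0..<c}. f k) = (\<Sum>k<nat c. f (int k))"
  by (rule sum.reindex_bij_witness[of _ int nat]) (use assms in auto)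

lemma ec_orthogonality:
  assumes "c > 0"
  shows "(\<Sum>k\<in>{0..<c}. ec c (k * l)) = (if c dvd l then of_int c else 0)"
proof -
  have "(\<Sum>k\<in>{0..<c}. ec c (k * l)) = (\<Sum>k<nat c. ec c l ^ k)"
    using assms by (simp add: sum_int_lessThan ec_mult_of_nat)
  also have "\<dots> = (if c dvd l then of_int c else 0)"
  proof (cases "c dvd l")
    case True
    then have "ec c l = 1" using assms by (simp add: ec_eq_1_iff)
    then show ?thesis using True assms by simp
  next
    case False
    then have "ec c l \<noteq> 1" using assms by (simp add: ec_eq_1_iff)
    moreover have "ec c l ^ nat c = 1"
      using ec_mult_of_nat[of c "nat c" l] assms by simp
    ultimately show ?thesis using False by (simp add: sum_gp_strict)
  qed
  finally show ?thesis .
qed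

text \<open>Orthogonality in both frequencies keeps only the pairs that agree in both coordinates.
  Applied to the square of a Kloosterman sum, this converts the fourth moment into a count of
  quadruples.\<close>

lemma ec_parseval:
  fixes A B :: "'i \<Rightarrow> int"
  assumes "c > 0" "finite I"
  shows "(\<Sum>\<alpha>\<in>{0..<c}. \<Sum>\<beta>\<in>{0..<c}. (norm (\<Sum>i\<in>I. ec c (\<alpha> * A i + \<beta> * B i)))\<^sup>2) =
         of_int c ^ 2 * card {(i, j) \<in> I \<times> I. [A i = A j] (mod c) \<and> [B i = B j] (mod c)}"
proof -
  have "complex_of_real (\<Sum>\<alpha>\<in>{0..<c}. \<Sum>\<beta>\<in>{0..<c}. (norm (\<Sum>i\<in>I. ec c (\<alpha> * A i + \<beta> * B i)))\<^sup>2) =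
     (\<Sum>\<alpha>\<in>{0..<c}. \<Sum>\<beta>\<in>{0..<c}. \<Sum>i\<in>I. \<Sum>j\<in>I. ec c (\<alpha> * (A i - A j)) * ec c (\<beta> * (B i - B j)))"
    unfolding of_real_sum complex_norm_square
  proof (intro sum.cong refl)
    fix \<alpha> \<beta>
    have "(\<Sum>i\<in>I. ec c (\<alpha> * A i + \<beta> * B i)) * cnj (\<Sum>i\<in>I. ec c (\<alpha> * A i + \<beta> * B i)) =
      (\<Sum>i\<in>I. \<Sum>j\<in>I. ec c (\<alpha> * A i + \<beta> * B i) * cnj (ec c (\<alpha> * A j + \<beta> * B j)))"
      by (simp add: sum_product)
    also have "\<dots> = (\<Sum>i\<in>I. \<Sum>j\<in>I. ec c (\<alpha> * (A i - A j)) * ec c (\<beta> * (B i - B j)))"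
      by (intro sum.cong refl, simp only: ec_diff[symmetric] ec_add[symmetric], rule arg_cong[where f = "ec c"])
        (simp add: algebra_simps)
    finally show "(\<Sum>i\<in>I. ec c (\<alpha> * A i + \<beta> * B i)) * cnj (\<Sum>i\<in>I. ec c (\<alpha> * A i + \<beta> * B i)) = \<dots>" .
  qed
  also have "\<dots> = (\<Sum>\<alpha>\<in>{0..<c}. \<Sum>i\<in>I. \<Sum>\<beta>\<in>{0..<c}. \<Sum>j\<in>I. ec c (\<alpha> * (A i - A j)) * ec c (\<beta> * (B i - B j)))"
    by (intro sum.cong refl, rule sum.swap)
  also have "\<dots> = (\<Sum>i\<in>I. \<Sum>\<alpha>\<in>{0..<c}. \<Sum>\<beta>\<in>{0..<c}. \<Sum>j\<in>I. ec c (\<alpha> * (A i - A j)) * ec c (\<beta> * (B i - B j)))"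
    by (rule sum.swap)
  also have "\<dots> = (\<Sum>i\<in>I. \<Sum>\<alpha>\<in>{0..<c}. \<Sum>j\<in>I. \<Sum>\<beta>\<in>{0..<c}. ec c (\<alpha> * (A i - A j)) * ec c (\<beta> * (B i - B j)))"
    by (intro sum.cong refl, rule sum.swap)
  also have "\<dots> = (\<Sum>i\<in>I. \<Sum>j\<in>I. \<Sum>\<alpha>\<in>{0..<c}. \<Sum>\<beta>\<in>{0..<c}. ec c (\<alpha> * (A i - A j)) * ec c (\<beta> * (B i - B j)))"
    by (intro sum.cong refl, rule sum.swap)
  also have "\<dots> = (\<Sum>i\<in>I. \<Sum>j\<in>I. (\<Sum>\<alpha>\<in>{0..<c}. ec c (\<alpha> * (A i - A j))) * (\<Sum>\<beta>\<in>{0..<c}. ec c (\<beta> * (B i - B j))))"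
    by (simp add: sum_product)
  also have "\<dots> = (\<Sum>i\<in>I. \<Sum>j\<in>I. if [A i = A j] (mod c) \<and> [B i = B j] (mod c) then of_int c ^ 2 else 0)"
    by (intro sum.cong refl) (auto simp: ec_orthogonality[OF assms(1)] cong_iff_dvd_diff power2_eq_square)
  also have "\<dots> = (\<Sum>(i, j)\<in>I \<times> I. if [A i = A j] (mod c) \<and> [B i = B j] (mod c) then of_int c ^ 2 else 0)"
    by (simp add: sum.cartesian_product)
  also have "\<dots> = (\<Sum>(i, j)\<in>{(i, j) \<in> I \<times> I. [A i = A j] (mod c) \<and> [B i = B j] (mod c)}. of_int c ^ 2)"
    using assms(2) by (intro sum.mono_neutral_cong_right) (auto split: if_splits)
  also have "\<dots> = complex_of_real (of_int c ^ 2 * card {(i, j) \<in> I \<times> I. [A i = A j] (mod c) \<and> [B i = B j] (mod c)})"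
    by (simp add: case_prod_unfold)
  finally show ?thesis unfolding of_real_eq_iff .
qed

section \<open>Counting solutions of congruences modulo c\<close>

definition pos_divisors :: "int \<Rightarrow> int set" where
  "pos_divisors c = {d. d > 0 \<and> d dvd c}"

lemma finite_pos_divisors: "c > 0 \<Longrightarrow> finite (pos_divisors c)"
  by (rule finite_subset[of _ "{0..c}"]) (auto simp: pos_divisors_def intro: zdvd_imp_le)

text \<open>Solutions lie in one residue class modulo \<open>lcm e f\<close>, so the quotient by it
  tells them apart. The compatibility condition is kept as a second conclusion because in the counts
  below it is what bounds \<open>gcd e f\<close>, and with it the number of solutions.\<close>

lemma card_two_congruences_le:
  fixes e f c a b :: int
  assumes "c > 0" "e > 0" "f > 0" "e dvd c" "f dvd c"
  shows "card {y \<in> {0..<c}. e dvd y - a \<and> f dvd y - b} \<le> nat (c div lcm e f)"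
    and "{y \<in> {0..<c}. e dvd y - a \<and> f dvd y - b} \<noteq> {} \<Longrightarrow> gcd e f dvd a - b"
proof -
  let ?S = "{y \<in> {0..<c}. e dvd y - a \<and> f dvd y - b}"
  let ?L = "lcm e f"
  have L: "?L > 0" "?L dvd c" using assms by (auto simp: lcm_pos_int)
  have "inj_on (\<lambda>y. y div ?L) ?S"
  proof (rule inj_onI)
    fix y z assume yz: "y \<in> ?S" "z \<in> ?S" "y div ?L = z div ?L"
    have "e dvd (y - a) - (z - a)" by (rule dvd_diff) (use yz in blast)+
    moreover have "f dvd (y - b) - (z - b)" by (rule dvd_diff) (use yz in blast)+
    ultimately have "?L dvd y - z" by (simp add: lcm_least)
    then have mod: "y mod ?L = z mod ?L" by (simp add: mod_eq_dvd_iff)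
    have "y = y div ?L * ?L + y mod ?L" by (simp only: div_mult_mod_eq)
    also have "\<dots> = z div ?L * ?L + z mod ?L" by (simp only: yz(3) mod)
    also have "\<dots> = z" by (simp only: div_mult_mod_eq)
    finally show "y = z" .
  qed
  moreover have "(\<lambda>y. y div ?L) ` ?S \<subseteq> {0..<c div ?L}"
  proof
    fix v assume "v \<in> (\<lambda>y. y div ?L) ` ?S"
    then obtain y where y: "0 \<le> y" "y < c" "v = y div ?L" by auto
    have "y < (c div ?L) * ?L" using y L by simp
    moreover have "y div ?L * ?L \<le> y"
      using L(1) div_mult_mod_eq[of y ?L] pos_mod_sign[of ?L y] by linarith
    ultimately have "y div ?L * ?L < (c div ?L) * ?L" by linarith
    then have "y div ?L < c div ?L" using L(1) by (simp only: mult_less_cancel_right) 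
    then show "v \<in> {0..<c div ?L}" using y(1) y(3) L(1) by (simp only: atLeastLessThan_iff pos_imp_zdiv_nonneg_iff simp_thms)
  qed
  ultimately have "card ?S \<le> card {0..<c div ?L}"
    by (rule card_inj_on_le) simp
  then show "card ?S \<le> nat (c div ?L)" by (simp only: card_atLeastLessThan_int diff_zero)
  show "gcd e f dvd a - b" if ne: "?S \<noteq> {}"
  proof -
    obtain y where y: "e dvd y - a" "f dvd y - b" using ne by blast
    have "gcd e f dvd (y - b) - (y - a)" by (rule dvd_diff[OF dvd_trans[OF gcd_dvd2 y(2)] dvd_trans[OF gcd_dvd1 y(1)]])
    then show ?thesis by simp
  qed
qed

text \<open>Once the part \<open>g\<close> of c dividing x - k and the part e of the rest dividing y
  - k are removed, the third factor must absorb what remains. Each e thus leaves two congruences for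
  y. Their compatibility forces \<open>gcd e f\<close> to divide x + k, so the count c / lcm e f = g
  * gcd e f is at most \<open>g * gcd (x + k) c\<close>.\<close>

lemma card_triple_product_fixed_le:
  fixes c k x :: int
  assumes "c > 0"
  shows "card {y \<in> {0..<c}. c dvd (x - k) * (y - k) * (x + y)} \<le>
         card (pos_divisors c) * nat (gcd (x - k) c * gcd (x + k) c)"
proof -
  define g where "g = gcd (x - k) c"
  define c' where "c' = c div g"
  have g: "g > 0" "g dvd c" using assms by (auto simp: g_def)
  have c: "c = g * c'" "c' > 0"
    using g assms by (auto simp: c'_def pos_imp_zdiv_pos_iff zdvd_imp_le)
  let ?Y = "\<lambda>e. {y \<in> {0..<c}. e dvd y - k \<and> c' div e dvd y - (- x)}"
  have sub: "{y \<in> {0..<c}. c dvd (x - k) * (y - k) * (x + y)} \<subseteq> (\<Union>e\<in>pos_divisors c'. ?Y e)"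
  proof
    fix y assume y: "y \<in> {y \<in> {0..<c}. c dvd (x - k) * (y - k) * (x + y)}"
    define u where "u = (x - k) div g"
    have u: "x - k = g * u" by (simp add: u_def g_def)
    have "coprime u c'" unfolding u_def c'_def g_def
      using assms by (intro div_gcd_coprime) auto
    moreover have "c dvd g * (u * ((y - k) * (x + y)))"
      using y by (simp add: u mult_ac)
    then have "c' dvd u * ((y - k) * (x + y))" using g c(1)
      by (metis dvd_times_left_cancel_iff less_irrefl)
    ultimately have d: "c' dvd (y - k) * (x + y)"
      by (simp add: coprime_commute coprime_dvd_mult_right_iff)
    define e where "e = gcd (y - k) c'"
    have e: "e > 0" "e dvd c'" "e dvd y - k" using c by (auto simp: e_def)
    obtain f where f: "c' = e * f" using e by blast
    obtain v where v: "y - k = e * v" using e by blast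
    have "coprime ((y - k) div e) (c' div e)" unfolding e_def
      using c by (intro div_gcd_coprime) auto
    then have "coprime v f" using e v f by simp
    moreover have "e * f dvd e * (v * (x + y))" using d by (metis f v mult.assoc)
    then have "f dvd v * (x + y)" using e by (metis dvd_times_left_cancel_iff less_irrefl)
    ultimately have "f dvd x + y" by (simp add: coprime_commute coprime_dvd_mult_right_iff)
    then have "y \<in> ?Y e" using y e f by (simp add: add.commute)
    moreover have "e \<in> pos_divisors c'" using e by (simp add: pos_divisors_def)
    ultimately show "y \<in> (\<Union>e\<in>pos_divisors c'. ?Y e)" by blast
  qed
  have Y: "card (?Y e) \<le> nat (g * gcd (x + k) c)" if e: "e \<in> pos_divisors c'" for e
  proof (cases "?Y e = {}")
    case True
    then show ?thesis by (simp only: card.empty le0)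
  next
    case False
    define f where "f = c' div e"
    have ef: "c' = e * f" "e > 0" "f > 0"
      using e c by (auto simp: f_def pos_divisors_def pos_imp_zdiv_pos_iff zdvd_imp_le)
    have dv: "e dvd c" "f dvd c" using ef c by auto
    have "gcd e f dvd k - (- x)"
      using card_two_congruences_le(2)[OF assms ef(2,3) dv, of k "- x"] False by (simp add: f_def)
    then have "gcd e f dvd gcd (x + k) c" using dv(1)
      by (simp add: add.commute) (meson dvd_trans gcd_dvd1)
    then have le: "gcd e f \<le> gcd (x + k) c" using assms by (intro zdvd_imp_le) auto
    have "c = g * (gcd e f * lcm e f)" using ef c by (simp add: prod_gcd_lcm_int)
    then have "c div lcm e f = g * gcd e f" using ef
      by (metis lcm_pos_int less_irrefl mult.assoc nonzero_mult_div_cancel_right)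
    moreover have "card (?Y e) \<le> nat (c div lcm e f)"
      using card_two_congruences_le(1)[OF assms ef(2,3) dv, of k "- x"] by (simp add: f_def)
    ultimately show ?thesis using le g by (smt (verit) mult_left_mono nat_mono order_trans of_nat_le_iff)
  qed
  have fin: "finite (pos_divisors c')" using c finite_pos_divisors by blast
  have "card {y \<in> {0..<c}. c dvd (x - k) * (y - k) * (x + y)} \<le> card (\<Union>e\<in>pos_divisors c'. ?Y e)"
    using fin by (intro card_mono[OF _ sub] finite_UN_I) (auto intro: finite_subset[OF _ finite_atLeastLessThan_int[of 0 c]])
  also have "\<dots> \<le> (\<Sum>e\<in>pos_divisors c'. card (?Y e))" by (rule card_UN_le[OF fin])
  also have "\<dots> \<le> (\<Sum>e\<in>pos_divisors c'. nat (g * gcd (x + k) c))" by (intro sum_mono Y)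
  also have "\<dots> = card (pos_divisors c') * nat (g * gcd (x + k) c)" by simp
  also have "\<dots> \<le> card (pos_divisors c) * nat (g * gcd (x + k) c)"
    using c finite_pos_divisors[OF assms]
    by (intro mult_right_mono card_mono) (auto simp: pos_divisors_def)
  finally show ?thesis by (simp add: g_def)
qed

text \<open>A gcd with c is at most the sum of the divisors of c that divide the argument, which
  turns the product into pairs of congruences for x. Such a pair is solvable only if
  \<open>gcd e f\<close> divides 2k. As k is a unit modulo c, this gcd is at most 2, hence the
  factor 2.\<close>

lemma sum_gcd_product_le:
  fixes c k :: int
  assumes c: "c > 0" and k: "coprime k c"
  shows "(\<Sum>x\<in>{0..<c}. gcd (x - k) c * gcd (x + k) c) \<le> 2 * c * int (card (pos_divisors c)) ^ 2"
proof -
  let ?D = "pos_divisors c"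
  have fin: "finite ?D" using c finite_pos_divisors by blast
  have gcd_le: "gcd z c \<le> (\<Sum>e\<in>?D. if e dvd z then e else 0)" for z
  proof -
    have "gcd z c = (\<Sum>e\<in>{gcd z c}. if e dvd z then e else 0)" by simp
    also have "\<dots> \<le> (\<Sum>e\<in>?D. if e dvd z then e else 0)"
      using fin c by (intro sum_mono2) (auto simp: pos_divisors_def)
    finally show ?thesis .
  qed
  have pair: "(\<Sum>x\<in>{0..<c}. (if e dvd x - k then e else 0) * (if f dvd x + k then f else 0)) \<le> 2 * c"
    if "e \<in> ?D" "f \<in> ?D" for e f
  proof -
    let ?S = "{x \<in> {0..<c}. e dvd x - k \<and> f dvd x - (- k)}"
    have ef: "e > 0" "f > 0" "e dvd c" "f dvd c" using that by (auto simp: pos_divisors_def)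
    have "(\<Sum>x\<in>{0..<c}. (if e dvd x - k then e else 0) * (if f dvd x + k then f else 0)) = (\<Sum>x\<in>?S. e * f)"
      by (intro sum.mono_neutral_cong_right) auto
    also have "\<dots> = int (card ?S) * (e * f)" by simp
    also have "\<dots> \<le> 2 * c"
    proof (cases "?S = {}")
      case True
      then have "card ?S = 0" by (simp only: card.empty)
      then show ?thesis using c by simp
    next
      case False
      have "gcd e f dvd k - (- k)"
        using card_two_congruences_le(2)[OF c ef False] .
      then have "gcd e f dvd k * 2" by (simp add: mult_2_right)
      moreover have "coprime (gcd e f) k"
        using k ef(3) by (metis coprime_commute coprime_divisors dvd_refl dvd_trans gcd_dvd1)
      ultimately have "gcd e f dvd 2" by (simp add: coprime_dvd_mult_right_iff)
      then have g2: "gcd e f \<le> 2" by (intro zdvd_imp_le) auto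
      have L: "lcm e f > 0" "lcm e f dvd c" using ef by (auto simp: lcm_pos_int)
      have "int (card ?S) \<le> c div lcm e f"
        using card_two_congruences_le(1)[OF c ef, of k "- k"] c L
        by (simp add: le_nat_iff pos_imp_zdiv_nonneg_iff)
      then have "int (card ?S) * (e * f) \<le> (c div lcm e f) * (e * f)"
        using ef by (intro mult_right_mono) auto
      also have "\<dots> = (c div lcm e f) * (lcm e f * gcd e f)"
        using ef prod_gcd_lcm_int[of e f] by (simp add: mult.commute)
      also have "\<dots> = c * gcd e f"
        using L by (metis dvd_div_mult_self mult.assoc)
      also have "\<dots> \<le> c * 2" using g2 c by (intro mult_left_mono) auto
      finally show ?thesis by (simp only: mult.commute)
    qed
    finally show ?thesis .
  qed
  have "(\<Sum>x\<in>{0..<c}. gcd (x - k) c * gcd (x + k) c) \<le>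
        (\<Sum>x\<in>{0..<c}. (\<Sum>e\<in>?D. if e dvd x - k then e else 0) * (\<Sum>f\<in>?D. if f dvd x + k then f else 0))"
    by (intro sum_mono mult_mono gcd_le) (auto intro!: sum_nonneg simp: pos_divisors_def)
  also have "\<dots> = (\<Sum>x\<in>{0..<c}. \<Sum>e\<in>?D. \<Sum>f\<in>?D. (if e dvd x - k then e else 0) * (if f dvd x + k then f else 0))"
    by (simp only: sum_product)
  also have "\<dots> = (\<Sum>e\<in>?D. \<Sum>x\<in>{0..<c}. \<Sum>f\<in>?D. (if e dvd x - k then e else 0) * (if f dvd x + k then f else 0))"
    by (rule sum.swap)
  also have "\<dots> = (\<Sum>e\<in>?D. \<Sum>f\<in>?D. \<Sum>x\<in>{0..<c}. (if e dvd x - k then e else 0) * (if f dvd x + k then f else 0))"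
    by (rule sum.cong[OF refl], rule sum.swap)
  also have "\<dots> \<le> (\<Sum>e\<in>?D. \<Sum>f\<in>?D. 2 * c)" by (intro sum_mono pair)
  also have "\<dots> = 2 * c * int (card ?D) ^ 2" by (simp add: power2_eq_square mult_ac)
  finally show ?thesis .
qed

lemma card_triple_product_le:
  fixes c k :: int
  assumes c: "c > 0" and k: "coprime k c"
  shows "card {(x, y) \<in> {0..<c} \<times> {0..<c}. c dvd (x - k) * (y - k) * (x + y)} \<le>
         2 * nat c * card (pos_divisors c) ^ 3"
proof -
  have fin: "finite {y \<in> {0..<c}. P y}" for P by (rule finite_subset[of _ "{0..<c}"]) auto
  have eq: "{(x, y) \<in> {0..<c} \<times> {0..<c}. c dvd (x - k) * (y - k) * (x + y)} =
        (SIGMA x:{0..<c}. {y \<in> {0..<c}. c dvd (x - k) * (y - k) * (x + y)})" by auto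
  have "int (card {(x, y) \<in> {0..<c} \<times> {0..<c}. c dvd (x - k) * (y - k) * (x + y)}) =
        (\<Sum>x\<in>{0..<c}. int (card {y \<in> {0..<c}. c dvd (x - k) * (y - k) * (x + y)}))"
    unfolding eq using fin by (subst card_SigmaI) auto
  also have "\<dots> \<le> (\<Sum>x\<in>{0..<c}. int (card (pos_divisors c)) * (gcd (x - k) c * gcd (x + k) c))"
  proof (intro sum_mono)
    fix x
    show "int (card {y \<in> {0..<c}. c dvd (x - k) * (y - k) * (x + y)}) \<le>
      int (card (pos_divisors c)) * (gcd (x - k) c * gcd (x + k) c)"
      using card_triple_product_fixed_le[OF c, of x k]
      by (smt (verit) gcd_ge_0_int mult_nonneg_nonneg nat_0_le of_nat_le_iff of_nat_mult)
  qed
  also have "\<dots> = int (card (pos_divisors c)) * (\<Sum>x\<in>{0..<c}. gcd (x - k) c * gcd (x + k) c)"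
    by (simp add: sum_distrib_left)
  also have "\<dots> \<le> int (card (pos_divisors c)) * (2 * c * int (card (pos_divisors c)) ^ 2)"
    by (intro mult_left_mono sum_gcd_product_le c k) auto
  also have "\<dots> = int (2 * nat c * card (pos_divisors c) ^ 3)"
    using c by (simp add: power2_eq_square power3_eq_cube)
  finally show ?thesis by linarith
qed

text \<open>Pairs of mutually inverse residues serve instead of an inverse function modulo \<open>c\<close>.\<close>

definition unit_pairs :: "int \<Rightarrow> (int \<times> int) set" where
  "unit_pairs c = {(x, y). x \<in> {0..<c} \<and> y \<in> {0..<c} \<and> [x * y = 1] (mod c)}"

definition kloosterman :: "int \<Rightarrow> int \<Rightarrow> int \<Rightarrow> complex" where
  "kloosterman c \<alpha> \<beta> = (\<Sum>(x, y)\<in>unit_pairs c. ec c (\<alpha> * x + \<beta> * y))"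

lemma finite_unit_pairs [simp]: "finite (unit_pairs c)"
  by (rule finite_subset[of _ "{0..<c} \<times> {0..<c}"]) (auto simp: unit_pairs_def)

lemma unit_pairs_coprime: "(x, y) \<in> unit_pairs c \<Longrightarrow> coprime x c"
  by (auto simp: unit_pairs_def coprime_iff_invertible_int)

lemma cong_in_range_imp_eq:
  fixes x y c :: int
  shows "[x = y] (mod c) \<Longrightarrow> x \<in> {0..<c} \<Longrightarrow> y \<in> {0..<c} \<Longrightarrow> x = y"
  by (simp add: cong_def)

lemma unit_pairs_unique:
  assumes "(x, y) \<in> unit_pairs c" "(x', y') \<in> unit_pairs c"
  shows "x = x' \<longleftrightarrow> y = y'"
proof -
  have *: "b = b'" if "a * b mod c = 1 mod c" "a * b' mod c = 1 mod c" "b \<in> {0..<c}" "b' \<in> {0..<c}" for a b b' :: int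
  proof (rule cong_in_range_imp_eq)
    have 1: "[b * (a * b') = b * 1] (mod c)" by (rule cong_scalar_left) (use that in \<open>simp add: cong_def\<close>)
    have "[b' * (a * b) = b' * 1] (mod c)" by (rule cong_scalar_left) (use that in \<open>simp add: cong_def\<close>)
    moreover have "b' * (a * b) = b * (a * b')" by simp
    ultimately have 2: "[b * (a * b') = b' * 1] (mod c)" by (simp only:)
    show "[b = b'] (mod c)" using cong_trans[OF cong_sym[OF 1] 2] unfolding mult_1_right .
  qed (use that in auto)
  have 1: "x * y mod c = 1 mod c" "x' * y' mod c = 1 mod c" "y * x mod c = 1 mod c" "y' * x' mod c = 1 mod c"
    using assms by (auto simp: unit_pairs_def cong_def mult.commute[of y] mult.commute[of y'])
  have 2: "x \<in> {0..<c}" "y \<in> {0..<c}" "x' \<in> {0..<c}" "y' \<in> {0..<c}"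
    using assms by (auto simp: unit_pairs_def)
  show ?thesis
  proof
    assume "x = x'"
    then show "y = y'" using *[of x y y'] 1 2 by blast
  next
    assume "y = y'"
    then show "x = x'" using *[of y x x'] 1 2 by blast
  qed
qed

lemma one_in_unit_pairs: "c > 0 \<Longrightarrow> (1 mod c, 1 mod c) \<in> unit_pairs c"
  by (auto simp: unit_pairs_def cong_def mod_mult_eq)

lemma card_unit_pairs_pos: "c > 0 \<Longrightarrow> card (unit_pairs c) > 0"
  using one_in_unit_pairs[of c] by (auto simp: card_gt_0_iff)

text \<open>If \<open>x\<^sub>1 + x\<^sub>2 = x\<^sub>3 + x\<^sub>4\<close> and the same holds for the inverses, then
  \<open>(x\<^sub>1 + x\<^sub>2) (x\<^sub>3 x\<^sub>4 - x\<^sub>1 x\<^sub>2) = 0\<close>, and the second factor is \<open>- (x\<^sub>1 - x\<^sub>4) (x\<^sub>2 - x\<^sub>4)\<close>.\<close>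

lemma unit_quadruple_dvd:
  fixes c :: int
  assumes inv: "[x1 * y1 = 1] (mod c)" "[x2 * y2 = 1] (mod c)" "[x3 * y3 = 1] (mod c)" "[x4 * y4 = 1] (mod c)"
    and x: "[x1 + x2 = x3 + x4] (mod c)" and y: "[y1 + y2 = y3 + y4] (mod c)"
  shows "c dvd (x1 - x4) * (x2 - x4) * (x1 + x2)"
proof -
  obtain t1 t2 t3 t4 t5 t6 where t: "x1 * y1 = 1 + c * t1" "x2 * y2 = 1 + c * t2" "x3 * y3 = 1 + c * t3"
      "x4 * y4 = 1 + c * t4" "x3 = x1 + x2 - x4 + c * t5" "y1 + y2 = y3 + y4 + c * t6"
  proof -
    have ex: "\<exists>t. a = b + c * t" if "[a = b] (mod c)" for a b
      using that by (metis cong_iff_lin cong_sym)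
    have "[x3 = x1 + x2 - x4] (mod c)"
      using cong_diff[OF cong_sym[OF x] cong_refl[of x4]] by simp
    then show thesis using ex inv y that by meson
  qed
  \<comment> \<open>Multiplying the relation between the inverses by
    \<open>x1 * x2 * x3 * x4\<close> clears them; the four correction terms measure how far each
    product of a residue and its inverse is from 1.\<close>
  have "(x1 + x2) * x3 * x4 - (x3 + x4) * x1 * x2 =
     x1 * x2 * x3 * x4 * ((y1 + y2) - (y3 + y4)) - (x1 * y1 - 1) * x2 * x3 * x4 - (x2 * y2 - 1) * x1 * x3 * x4
      + (x3 * y3 - 1) * x1 * x2 * x4 + (x4 * y4 - 1) * x1 * x2 * x3"
    by (simp add: algebra_simps)
  also have "\<dots> = c * (x1 * x2 * x3 * x4 * t6 - t1 * x2 * x3 * x4 - t2 * x1 * x3 * x4 + t3 * x1 * x2 * x4 + t4 * x1 * x2 * x3)"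
    unfolding t(1-4,6) by (simp add: algebra_simps)
  finally have "c dvd (x1 + x2) * x3 * x4 - (x3 + x4) * x1 * x2" by simp
  moreover have "(x1 + x2) * x3 * x4 - (x3 + x4) * x1 * x2 =
     - ((x1 - x4) * (x2 - x4) * (x1 + x2)) + c * (t5 * (x1 + x2) * x4 - t5 * x1 * x2)"
    unfolding t(5) by (simp add: algebra_simps)
  ultimately have "c dvd - ((x1 - x4) * (x2 - x4) * (x1 + x2)) + c * (t5 * (x1 + x2) * x4 - t5 * x1 * x2)" by simp
  then have "c dvd - ((x1 - x4) * (x2 - x4) * (x1 + x2))"
    using dvd_add_left_iff dvd_triv_left by blast
  then show ?thesis by simp
qed

text \<open>A quadruple is recorded by its last unit pair and the residues x1, x2: the first
  congruence then determines x3, and residues determine their inverses. The record satisfies the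
  triple product congruence, whose count applies to each of the \<open>card V\<close> possible last
  pairs.\<close>

lemma card_unit_quadruples_le:
  assumes c: "c > 0"
  defines "V \<equiv> unit_pairs c"
  shows "card {(i, j) \<in> (V \<times> V) \<times> (V \<times> V).
      [fst (fst i) + fst (snd i) = fst (fst j) + fst (snd j)] (mod c) \<and>
      [snd (fst i) + snd (snd i) = snd (fst j) + snd (snd j)] (mod c)}
    \<le> card V * (2 * nat c * card (pos_divisors c) ^ 3)" (is "card ?T \<le> _")
proof -
  let ?Z = "\<lambda>p. {(x, y) \<in> {0..<c} \<times> {0..<c}. c dvd (x - fst p) * (y - fst p) * (x + y)}"
  let ?f = "\<lambda>(i, j). (snd j, (fst (fst i), fst (snd i)))"
  have V: "[x * y = 1] (mod c)" "x \<in> {0..<c}" "y \<in> {0..<c}" if "(x, y) \<in> V" for x y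
    using that by (auto simp: V_def unit_pairs_def)
  have "inj_on ?f ?T"
  proof (rule inj_onI)
    fix i j assume ij: "i \<in> ?T" "j \<in> ?T" "?f i = ?f j"
    obtain x1 y1 x2 y2 x3 y3 x4 y4 where i: "i = (((x1, y1), (x2, y2)), ((x3, y3), (x4, y4)))"
      by (metis surj_pair)
    obtain x1' y1' x2' y2' x3' y3' x4' y4' where j: "j = (((x1', y1'), (x2', y2')), ((x3', y3'), (x4', y4')))"
      by (metis surj_pair)
    have *: "(x1, y1) \<in> V" "(x2, y2) \<in> V" "(x3, y3) \<in> V" "(x4, y4) \<in> V"
      "(x1', y1') \<in> V" "(x2', y2') \<in> V" "(x3', y3') \<in> V" "(x4', y4') \<in> V"
      and cg: "[x1 + x2 = x3 + x4] (mod c)" "[x1' + x2' = x3' + x4'] (mod c)"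
      and e: "x4 = x4'" "y4 = y4'" "x1 = x1'" "x2 = x2'"
      using ij by (auto simp: i j)
    then have "[x3 + x4 = x3' + x4] (mod c)" using cg by (simp add: cong_def)
    then have "x3 = x3'"
      by (intro cong_in_range_imp_eq[OF _ V(2)[OF *(3)] V(2)[OF *(7)]]) (simp only: cong_add_rcancel)
    moreover have "y1 = y1'" using unit_pairs_unique[OF *(1)[unfolded V_def] *(5)[unfolded V_def]] e by blast
    moreover have "y2 = y2'" using unit_pairs_unique[OF *(2)[unfolded V_def] *(6)[unfolded V_def]] e by blast
    moreover have "y3 = y3'" using unit_pairs_unique[OF *(3)[unfolded V_def] *(7)[unfolded V_def]] \<open>x3 = x3'\<close> by blast
    ultimately show "i = j" using e \<open>x3 = x3'\<close> by (simp add: i j)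
  qed
  moreover have "?f ` ?T \<subseteq> (SIGMA p:V. ?Z p)"
  proof (rule image_subsetI)
    fix i assume T: "i \<in> ?T"
    obtain x1 y1 x2 y2 x3 y3 x4 y4 where i: "i = (((x1, y1), (x2, y2)), ((x3, y3), (x4, y4)))"
      by (metis surj_pair)
    have *: "(x1, y1) \<in> V" "(x2, y2) \<in> V" "(x3, y3) \<in> V" "(x4, y4) \<in> V"
      and cg: "[x1 + x2 = x3 + x4] (mod c)" "[y1 + y2 = y3 + y4] (mod c)"
      using T by (auto simp: i)
    have "c dvd (x1 - x4) * (x2 - x4) * (x1 + x2)"
      by (rule unit_quadruple_dvd[of x1 y1 c x2 y2 x3 y3 x4 y4]) (use cg V(1) * in auto)
    then show "?f i \<in> (SIGMA p:V. ?Z p)"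
      using * V by (auto simp: i)
  qed
  moreover have finZ: "finite (?Z p)" for p
    by (rule finite_subset[of _ "{0..<c} \<times> {0..<c}"]) auto
  ultimately have "card ?T \<le> card (SIGMA p:V. ?Z p)"
    by (intro card_inj_on_le finite_SigmaI) (auto simp: V_def)
  also have "\<dots> = (\<Sum>p\<in>V. card (?Z p))" using finZ by (subst card_SigmaI) (auto simp: V_def)
  also have "\<dots> \<le> (\<Sum>p\<in>V. 2 * nat c * card (pos_divisors c) ^ 3)"
    using unit_pairs_coprime unfolding V_def
    by (intro sum_mono card_triple_product_le[OF c]) (metis prod.collapse)
  finally show ?thesis by simp
qed

text \<open>The square of a Kloosterman sum is an exponential sum over pairs of unit pairs, so that
  \<open>ec_parseval\<close> computes the sum of the fourth powers exactly.\<close>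

lemma kloosterman_fourth_moment:
  assumes c: "c > 0"
  shows "(\<Sum>\<alpha>\<in>{0..<c}. \<Sum>\<beta>\<in>{0..<c}. norm (kloosterman c \<alpha> \<beta>) ^ 4) \<le>
     of_int c ^ 3 * real (card (unit_pairs c)) * 2 * real (card (pos_divisors c)) ^ 3"
proof -
  let ?V = "unit_pairs c"
  let ?A = "\<lambda>i :: (int \<times> int) \<times> (int \<times> int). fst (fst i) + fst (snd i)"
  let ?B = "\<lambda>i :: (int \<times> int) \<times> (int \<times> int). snd (fst i) + snd (snd i)"
  have sq: "kloosterman c \<alpha> \<beta> ^ 2 = (\<Sum>i\<in>?V \<times> ?V. ec c (\<alpha> * ?A i + \<beta> * ?B i))" for \<alpha> \<beta>
  proof -
    have "kloosterman c \<alpha> \<beta> ^ 2 = (\<Sum>p\<in>?V. \<Sum>q\<in>?V. ec c (\<alpha> * fst p + \<beta> * snd p) * ec c (\<alpha> * fst q + \<beta> * snd q))"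
      by (simp add: kloosterman_def power2_eq_square sum_product case_prod_unfold)
    also have "\<dots> = (\<Sum>(p, q)\<in>?V \<times> ?V. ec c (\<alpha> * fst p + \<beta> * snd p) * ec c (\<alpha> * fst q + \<beta> * snd q))"
      by (simp add: sum.cartesian_product)
    also have "\<dots> = (\<Sum>i\<in>?V \<times> ?V. ec c (\<alpha> * ?A i + \<beta> * ?B i))"
      by (intro sum.cong refl) (auto simp: ec_add[symmetric] algebra_simps)
    finally show ?thesis .
  qed
  have n4: "norm (z::complex) ^ 4 = (norm (z\<^sup>2))\<^sup>2" for z by (simp add: norm_power)
  have "(\<Sum>\<alpha>\<in>{0..<c}. \<Sum>\<beta>\<in>{0..<c}. norm (kloosterman c \<alpha> \<beta>) ^ 4) =
    of_int c ^ 2 * real (card {(i, j) \<in> (?V \<times> ?V) \<times> (?V \<times> ?V). [?A i = ?A j] (mod c) \<and> [?B i = ?B j] (mod c)})"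
    unfolding n4 sq using ec_parseval[OF c, where I = "?V \<times> ?V" and A = ?A and B = ?B] by simp
  also have "\<dots> \<le> of_int c ^ 2 * real (card ?V * (2 * nat c * card (pos_divisors c) ^ 3))"
    by (intro mult_left_mono of_nat_mono card_unit_quadruples_le[OF c]) auto
  finally show ?thesis using c by (simp add: power2_eq_square power3_eq_cube mult_ac)
qed

section \<open>From the fourth moment to individual Kloosterman sums\<close>

lemma kloosterman_cong:
  assumes "c > 0" "[\<alpha> = \<alpha>'] (mod c)" "[\<beta> = \<beta>'] (mod c)"
  shows "kloosterman c \<alpha> \<beta> = kloosterman c \<alpha>' \<beta>'"
  unfolding kloosterman_def
  by (intro sum.cong refl, clarify, intro ec_cong cong_add cong_mult)
    (use assms in auto)

text \<open>Scaling x by t and y by the inverse of t permutes the unit pairs. Hence the sum is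
  constant on the orbits over which the fourth power is averaged.\<close>

lemma kloosterman_unit_action:
  assumes c: "c > 0" and t: "(t, t') \<in> unit_pairs c"
  shows "kloosterman c (\<alpha> * t) (\<beta> * t') = kloosterman c \<alpha> \<beta>"
proof -
  have tt: "[t * t' = 1] (mod c)" using t by (simp add: unit_pairs_def)
  have map: "((u * x) mod c, (u' * y) mod c) \<in> unit_pairs c"
    if "(x, y) \<in> unit_pairs c" "[u * u' = 1] (mod c)" for u u' x y
  proof -
    have "[(u * x) mod c * ((u' * y) mod c) = (u * u') * (x * y)] (mod c)"
      by (simp add: cong_def mod_mult_eq mult_ac)
    also have "[(u * u') * (x * y) = 1 * 1] (mod c)"
      using that by (intro cong_mult) (auto simp: unit_pairs_def)
    finally show ?thesis using c by (auto simp: unit_pairs_def)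
  qed
  have bk: "(v * ((u * x) mod c)) mod c = x"
    if "x \<in> {0..<c}" "[u * v = 1] (mod c)" for u v x
  proof -
    have "[v * ((u * x) mod c) = (u * v) * x] (mod c)"
      by (simp add: cong_def mod_mult_right_eq mult_ac)
    also have "[(u * v) * x = 1 * x] (mod c)" using that by (intro cong_mult) auto
    finally show ?thesis using that by (simp add: cong_def)
  qed
  have tt': "[t' * t = 1] (mod c)" using tt by (simp add: mult.commute)
  show ?thesis unfolding kloosterman_def
  proof (rule sum.reindex_bij_witness[of _ "\<lambda>(x, y). ((t' * x) mod c, (t * y) mod c)" "\<lambda>(x, y). ((t * x) mod c, (t' * y) mod c)"], goal_cases)
    case (1 p) then show ?case using bk tt tt' by (auto simp: unit_pairs_def)
  next
    case (2 p) then show ?case using map tt by (cases p) auto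
  next
    case (3 p) then show ?case using bk tt tt' by (auto simp: unit_pairs_def)
  next
    case (4 p) then show ?case using map tt' by (cases p) auto
  next
    case (5 p)
    have "[\<alpha> * (t * x mod c) + \<beta> * (t' * y mod c) = \<alpha> * t * x + \<beta> * t' * y] (mod c)" for x y
      unfolding mult.assoc by (intro cong_add cong_scalar_left) (simp_all add: cong_def)
    then have "ec c (\<alpha> * (t * x mod c) + \<beta> * (t' * y mod c)) = ec c (\<alpha> * t * x + \<beta> * t' * y)" for x y
      using c by (intro ec_cong) auto
    then show ?case by (cases p) simp
  qed
qed

text \<open>Averaging the fourth power over the orbit of \<open>(n, l)\<close> under the units bounds one sum by the
  whole fourth moment, as the orbit map is at most \<open>n\<close> to one.\<close>

lemma kloosterman_bound_pow4:
  assumes c: "c > 0" and n: "n > 0"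
  shows "norm (kloosterman c n l) ^ 4 \<le> 2 * of_int n * of_int c ^ 3 * real (card (pos_divisors c)) ^ 3"
proof -
  let ?V = "unit_pairs c"
  let ?g = "\<lambda>(\<alpha>, \<beta>). norm (kloosterman c \<alpha> \<beta>) ^ 4"
  let ?h = "\<lambda>(t, t'). ((n * t) mod c, (l * t') mod c)"
  have fiber: "card {p \<in> ?V. ?h p = q} \<le> nat n" for q
  proof (cases "{p \<in> ?V. ?h p = q} = {}")
    case True
    then show ?thesis by (simp only: card.empty)
  next
    case False
    then obtain t0 t0' where t0: "(t0, t0') \<in> ?V" "?h (t0, t0') = q" by auto
    define g where "g = gcd n c"
    define e where "e = c div g"
    have g: "g > 0" "g dvd c" "g dvd n" using c by (auto simp: g_def)
    have ce: "c = g * e" "e > 0" using g c by (auto simp: e_def pos_imp_zdiv_pos_iff zdvd_imp_le)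
    have "inj_on fst {p \<in> ?V. ?h p = q}"
    proof (rule inj_onI)
      fix p p' assume "p \<in> {p \<in> ?V. ?h p = q}" "p' \<in> {p \<in> ?V. ?h p = q}" "fst p = fst p'"
      then have "p \<in> ?V" "p' \<in> ?V" "fst p = fst p'" by auto
      then show "p = p'"
        using unit_pairs_unique by (cases p; cases p'; fastforce)
    qed
    \<comment> \<open>The same congruence is listed twice so that the count for two congruences
      applies with both moduli equal to \<open>e\<close>. It yields c / e = gcd n c, which is at
      most n.\<close>
    moreover have "fst ` {p \<in> ?V. ?h p = q} \<subseteq> {y \<in> {0..<c}. e dvd y - t0 \<and> e dvd y - t0}"
    proof (rule image_subsetI)
      fix p assume p: "p \<in> {p \<in> ?V. ?h p = q}"
      obtain t t' where tt: "p = (t, t')" by (cases p)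
      have t: "(t, t') \<in> ?V" "(n * t mod c, l * t' mod c) = q" using p by (auto simp: tt)
      have "n * t mod c = n * t0 mod c" using t t0 by auto
      then have "c dvd n * t - n * t0" by (simp add: mod_eq_dvd_iff)
      then have "g * e dvd g * ((n div g) * (t - t0))"
        using g ce by (simp add: right_diff_distrib mult.assoc[symmetric])
      then have "e dvd (n div g) * (t - t0)" using g by (metis dvd_times_left_cancel_iff less_irrefl)
      moreover have "coprime (n div g) e" unfolding e_def g_def using c by (intro div_gcd_coprime) auto
      ultimately have "e dvd t - t0" by (simp add: coprime_commute coprime_dvd_mult_right_iff)
      then show "fst p \<in> {y \<in> {0..<c}. e dvd y - t0 \<and> e dvd y - t0}" using t by (auto simp: unit_pairs_def tt)
    qed
    ultimately have "card {p \<in> ?V. ?h p = q} \<le> card {y \<in> {0..<c}. e dvd y - t0 \<and> e dvd y - t0}"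
      by (rule card_inj_on_le) (auto intro: finite_subset[OF _ finite_atLeastLessThan_int[of 0 c]])
    also have "\<dots> \<le> nat (c div lcm e e)"
      by (rule card_two_congruences_le) (use c ce in auto)
    also have "\<dots> = nat g" using ce by simp
    also have "\<dots> \<le> nat n" using g n by (intro nat_mono zdvd_imp_le)
    finally show ?thesis .
  qed
  have "real (card ?V) * norm (kloosterman c n l) ^ 4 = (\<Sum>p\<in>?V. norm (kloosterman c n l) ^ 4)" by simp
  also have "\<dots> = (\<Sum>p\<in>?V. ?g (?h p))"
  proof (rule sum.cong[OF refl])
    fix p assume p: "p \<in> ?V"
    obtain t t' where tt: "p = (t, t')" by (cases p)
    have t: "(t, t') \<in> ?V" using p tt by simp
    have "kloosterman c n l = kloosterman c (n * t) (l * t')"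
      using kloosterman_unit_action[OF c t] by simp
    also have "\<dots> = kloosterman c ((n * t) mod c) ((l * t') mod c)"
      using c by (intro kloosterman_cong) (auto simp: cong_def)
    finally show "norm (kloosterman c n l) ^ 4 = ?g (?h p)"
      by (simp add: tt)
  qed
  also have "\<dots> = (\<Sum>q\<in>?h ` ?V. \<Sum>p\<in>{p \<in> ?V. ?h p = q}. ?g (?h p))"
    by (rule sum.image_gen) simp
  also have "\<dots> = (\<Sum>q\<in>?h ` ?V. real (card {p \<in> ?V. ?h p = q}) * ?g q)"
    by (intro sum.cong refl) simp
  also have "\<dots> \<le> (\<Sum>q\<in>?h ` ?V. real (nat n) * ?g q)"
    using fiber by (intro sum_mono mult_right_mono) auto
  also have "\<dots> \<le> (\<Sum>q\<in>{0..<c} \<times> {0..<c}. real (nat n) * ?g q)"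
    using c by (intro sum_mono2) (auto simp: pos_mod_sign)
  also have "\<dots> = of_int n * (\<Sum>\<alpha>\<in>{0..<c}. \<Sum>\<beta>\<in>{0..<c}. norm (kloosterman c \<alpha> \<beta>) ^ 4)"
    using n by (simp add: sum_distrib_left sum.cartesian_product case_prod_unfold)
  also have "\<dots> \<le> of_int n * (of_int c ^ 3 * real (card ?V) * 2 * real (card (pos_divisors c)) ^ 3)"
    using n kloosterman_fourth_moment[OF c] by (intro mult_left_mono) auto
  finally have "real (card ?V) * norm (kloosterman c n l) ^ 4 \<le>
     real (card ?V) * (2 * of_int n * of_int c ^ 3 * real (card (pos_divisors c)) ^ 3)"
    by (simp add: mult_ac)
  then show ?thesis using card_unit_pairs_pos[OF c] by simp
qed

section \<open>Divisor bound with exponent 1/4\<close>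

lemma card_divisors_prime_power_mult_le:
  fixes p m a :: nat
  assumes p: "prime p" and m: "m > 0"
  shows "card {d. d dvd p ^ a * m} \<le> (a + 1) * card {d. d dvd m}"
proof -
  have "{d. d dvd p ^ a * m} \<subseteq> (\<lambda>(i, e). p ^ i * e) ` ({..a} \<times> {d. d dvd m})"
  proof
    fix d assume "d \<in> {d. d dvd p ^ a * m}"
    then obtain x y where xy: "d = x * y" "x dvd p ^ a" "y dvd m"
      by (auto elim: dvd_productE)
    then obtain i where "i \<le> a" "x = p ^ i"
      using divides_primepow_nat[OF p] by blast
    then show "d \<in> (\<lambda>(i, e). p ^ i * e) ` ({..a} \<times> {d. d dvd m})"
      using xy by force
  qed
  moreover have "finite ({..a} \<times> {d. d dvd m})" using m by simp
  ultimately have "card {d. d dvd p ^ a * m} \<le> card ({..a} \<times> {d. d dvd m})"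
    by (meson surj_card_le)
  then show ?thesis by (simp add: card_cartesian_product)
qed

text \<open>The threshold 16 is where p powr (1/4) reaches 2, so that larger primes give at least 2
  ^ a, which is at least a + 1. For smaller primes 2 powr (a/4) is at least 1 + a/8, as ln 2 is at
  least 1/2; this explains the 8.\<close>

lemma Suc_le_prime_powr:
  fixes p a :: nat
  assumes "prime p"
  shows "real a + 1 \<le> (if p < 16 then 8 else 1) * real (p ^ a) powr (1/4)"
proof -
  have p2: "p \<ge> 2" using assms prime_ge_2_nat by blast
  have eq: "real (p ^ a) powr (1/4) = real p powr (real a / 4)"
    using p2 by (simp add: powr_realpow[symmetric] powr_powr)
  show ?thesis
  proof (cases "p < 16")
    case True
    have "1 / 2 \<le> ln (2::real)" using ln2_ge_two_thirds by simp
    then have "real a / 8 \<le> real a / 4 * ln 2"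
      using mult_left_mono[of "1/2" "ln 2" "real a / 4"] by simp
    also have "1 + \<dots> \<le> exp (real a / 4 * ln 2)" by (rule exp_ge_add_one_self)
    finally have "1 + real a / 8 \<le> 2 powr (real a / 4)" by (simp add: powr_def)
    also have "\<dots> \<le> real p powr (real a / 4)" using p2 by (intro powr_mono2) auto
    finally show ?thesis using True unfolding eq by simp
  next
    case False
    have "real a + 1 \<le> 2 ^ a" by (induction a) auto
    also have "\<dots> = 16 powr (real a / 4)"
      using powr_powr[of 2 4 "real a / 4"] by (simp add: powr_realpow[symmetric])
    also have "\<dots> \<le> real p powr (real a / 4)" using False by (intro powr_mono2) auto
    finally show ?thesis using False unfolding eq by simp
  qed
qed

text \<open>The full power of one prime is split off in each step. Only primes below 16 contribute a
  factor other than 1 to the constant, so it stays bounded in n.\<close>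

lemma card_divisors_le_aux:
  fixes n :: nat
  assumes "n > 0"
  shows "real (card {d. d dvd n}) \<le> (\<Prod>p\<in>prime_factors n. if p < 16 then 8 else 1) * real n powr (1/4)"
  using assms
proof (induction n rule: less_induct)
  case (less n)
  show ?case
  proof (cases "n = 1")
    case True
    then show ?thesis by simp
  next
    case False
    then obtain p where p: "prime p" "p dvd n" using prime_factor_nat by blast
    define a where "a = multiplicity p n"
    obtain m where m: "n = p ^ a * m" "\<not> p dvd m"
      using multiplicity_decompose'[where p = p and x = n] less.prems p unfolding a_def
      by (metis less_irrefl not_prime_unit)
    have a: "a > 0" using p less.prems by (simp add: a_def prime_multiplicity_gt_zero_iff)
    have m0: "m > 0" using less.prems m(1) by (intro gr0I) auto
    have "p ^ a > 1" using one_less_power[OF prime_gt_1_nat[OF p(1)] a] .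
    then have "m < n" using m m0 by simp
    have pf: "prime_factors n = insert p (prime_factors m)"
      using a p m0 m(1) by (auto simp: prime_factors_product prime_factorization_prime_power)
    have pm: "p \<notin> prime_factors m" using m(2) by auto
    let ?f = "\<lambda>p::nat. if p < 16 then 8 else (1::real)"
    have "real (card {d. d dvd n}) \<le> (real a + 1) * real (card {d. d dvd m})"
      using of_nat_mono[OF card_divisors_prime_power_mult_le[OF p(1) m0, of a]] unfolding m(1)
      by (simp add: algebra_simps)
    also have "\<dots> \<le> (?f p * real (p ^ a) powr (1/4)) * (prod ?f (prime_factors m) * real m powr (1/4))"
      using less.IH[OF \<open>m < n\<close> m0] Suc_le_prime_powr[OF p(1), of a] by (intro mult_mono) auto
    also have "\<dots> = prod ?f (prime_factors n) * real n powr (1/4)"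
      using pm unfolding pf by (simp add: m(1) powr_mult)
    finally show ?thesis .
  qed
qed

lemma card_pos_divisors_le:
  assumes "c > 0"
  shows "real (card (pos_divisors c)) \<le> 8 ^ 16 * of_int c powr (1/4)"
proof -
  have "pos_divisors c \<subseteq> int ` {d. d dvd nat c}"
  proof
    fix d assume "d \<in> pos_divisors c"
    then show "d \<in> int ` {d. d dvd nat c}"
      using assms by (intro image_eqI[of _ _ "nat d"]) (auto simp: pos_divisors_def nat_dvd_iff)
  qed
  then have "card (pos_divisors c) \<le> card {d. d dvd nat c}"
    using assms by (intro surj_card_le) auto
  then have "real (card (pos_divisors c)) \<le> real (card {d. d dvd nat c})" by simp
  also have "\<dots> \<le> (\<Prod>p\<in>prime_factors (nat c). if p < 16 then 8 else 1) * real (nat c) powr (1/4)"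
    using assms by (intro card_divisors_le_aux) auto
  also have "(\<Prod>p\<in>prime_factors (nat c). if p < 16 then 8 else (1::real)) =
     (\<Prod>p\<in>{p\<in>prime_factors (nat c). p < 16}. 8)"
    by (intro prod.mono_neutral_cong_right) auto
  also have "\<dots> = 8 ^ card {p\<in>prime_factors (nat c). p < 16}" by simp
  \<comment> \<open>Counting all numbers below 16 in place of the primes is crude, but only a
    constant is at stake.\<close>
  also have "card {p\<in>prime_factors (nat c). p < 16} \<le> card {..<16::nat}"
    by (intro card_mono) auto
  then have "(8::real) ^ card {p\<in>prime_factors (nat c). p < 16} \<le> 8 ^ 16"
    by (intro power_increasing) auto
  finally show ?thesis using assms by (simp add: mult_right_mono)
qed

lemma power4_powr_quarter:
  assumes "x \<ge> (0::real)"
  shows "(x ^ 4) powr (1/4) = x"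
proof (cases "x = 0")
  case False
  then have "x ^ 4 = x powr real 4" using assms by (subst powr_realpow) auto
  then show ?thesis using assms by (simp only: powr_powr) simp
qed simp

text \<open>With the divisor bound inserted, the fourth power is at most a constant times c powr (3
  + 3/4), whose fourth root has exponent 15/16. The constant depends on n but not on the second
  frequency l, as needed for the Fourier coefficients of the twist.\<close>

lemma kloosterman_bound:
  assumes n: "n > 0"
  obtains C where "C \<ge> 0" "\<And>c l. c > 0 \<Longrightarrow> norm (kloosterman c n l) \<le> C * of_int c powr (15/16)"
proof
  define B :: real where "B = 2 * of_int n * (8 ^ 16) ^ 3"
  have B: "B \<ge> 0" using n by (simp add: B_def)
  show "B powr (1/4) \<ge> 0" by simp
  fix c l :: int assume c: "c > 0"
  have "norm (kloosterman c n l) ^ 4 \<le> 2 * of_int n * of_int c ^ 3 * real (card (pos_divisors c)) ^ 3"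
    by (rule kloosterman_bound_pow4[OF c n])
  also have "\<dots> \<le> 2 * of_int n * of_int c ^ 3 * (8 ^ 16 * of_int c powr (1/4)) ^ 3"
    using n c by (intro mult_left_mono power_mono card_pos_divisors_le) auto
  also have "\<dots> = B * (of_int c powr 3 * of_int c powr (3/4))"
    using c by (simp add: B_def power_mult_distrib powr_power powr_numeral[symmetric] powr_powr del: powr_numeral)
  also have "\<dots> = B * of_int c powr (15/4)" by (simp add: powr_add[symmetric])
  finally have le: "norm (kloosterman c n l) ^ 4 \<le> B * of_int c powr (15/4)" .
  have "norm (kloosterman c n l) = (norm (kloosterman c n l) ^ 4) powr (1/4)"
    by (rule power4_powr_quarter[symmetric]) simp
  also have "\<dots> \<le> (B * of_int c powr (15/4)) powr (1/4)"
    using le by (intro powr_mono2) auto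
  also have "\<dots> = B powr (1/4) * of_int c powr (15/16)"
    using B by (simp add: powr_mult powr_powr)
  finally show "norm (kloosterman c n l) \<le> B powr (1/4) * of_int c powr (15/16)" .
qed

section \<open>Kloosterman twists of sums over the integers\<close>

text \<open>Halving the angle: sin x is 2 sin (x/2) cos (x/2), and sin (x/2) is x/2 times a cosine
  by the mean value theorem. Both cosines are taken at angles up to pi / 4, where they are at least
  \<open>sqrt 2 / 2\<close>.\<close>

lemma sin_ge_half:
  assumes "0 \<le> x" "x \<le> pi / 2"
  shows "x / 2 \<le> sin (x::real)"
proof (cases "x = 0")
  case False
  then have x: "0 < x / 2" using assms by simp
  have cos: "sqrt 2 / 2 \<le> cos t" if "0 \<le> t" "t \<le> x / 2" for t
    using that assms cos_monotone_0_pi_le[of t "pi / 4"] by (simp add: cos_45)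
  have "\<exists>z>0. z < x / 2 \<and> sin (x / 2) - sin 0 = (x / 2 - 0) * cos z"
    using x by (intro MVT2) (auto intro!: derivative_eq_intros)
  then obtain z where z: "z > 0" "z < x / 2" "sin (x / 2) = x / 2 * cos z" by auto
  have "x / 2 = 2 * (x / 2 * (sqrt 2 / 2)) * (sqrt 2 / 2)" by simp
  also have "\<dots> \<le> 2 * (x / 2 * cos z) * cos (x / 2)"
    using z x cos[of z] cos[of "x / 2"] order_trans[OF _ cos[of z], of 0] by (intro mult_mono) auto
  also have "\<dots> = sin x" using sin_double[of "x / 2"] z by simp
  finally show ?thesis .
qed simp

lemma one_over_antimono: "0 < a \<Longrightarrow> a \<le> b \<Longrightarrow> 1 / b \<le> 1 / (a::real)"
  by (simp add: frac_le)

text \<open>The norm is twice the sine of pi l / c, hence at least pi l / c for l up to c / 2; the 3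
  stands for pi. Conjugation reflects l to c - l in the other half. Adding both reciprocals covers
  the two cases in one formula that is easy to sum.\<close>

lemma norm_one_minus_ec:
  assumes "0 < l" "l < c"
  shows "1 / norm (1 - ec c l) \<le> of_int c / 3 * (1 / of_int l + 1 / of_int (c - l))"
proof -
  have *: "1 / norm (1 - ec c l) \<le> of_int c / 3 * (1 / of_int l)" if l: "0 < l" "2 * l \<le> c" for l
  proof -
    define x where "x = pi * (of_int l / of_int c)"
    have lc: "0 < real_of_int l" "2 * real_of_int l \<le> of_int c" using l by linarith+
    then have x: "0 \<le> x" "x \<le> pi / 2"
      using mult_left_mono[of "of_int l / of_int c" "1/2" pi] by (auto simp: x_def field_simps)
    have "norm (1 - ec c l) = norm (exp (\<i> * of_real (2 * x)) - 1)"
      by (simp add: ec_def ee_def x_def norm_minus_commute mult_ac)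
    also have "\<dots> = 2 * \<bar>sin x\<bar>" using dist_exp_i_1[of "2 * x"] by simp
    finally have eq: "norm (1 - ec c l) = 2 * \<bar>sin x\<bar>" .
    have "3 * (of_int l / of_int c) \<le> x" unfolding x_def
      using pi_gt3 lc by (intro mult_right_mono) auto
    also have "x \<le> 2 * \<bar>sin x\<bar>" using sin_ge_half[OF x] by simp
    finally have "3 * (of_int l / of_int c) \<le> norm (1 - ec c l)" using eq by simp
    moreover have "3 * (real_of_int l / of_int c) > 0" using lc by simp
    ultimately have "1 / norm (1 - ec c l) \<le> 1 / (3 * (of_int l / of_int c))"
      by (intro one_over_antimono)
    then show ?thesis by simp
  qed
  have pos: "of_int c / 3 * (1 / of_int l) \<ge> (0::real)" "of_int c / 3 * (1 / of_int (c - l)) \<ge> (0::real)"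
    using assms by auto
  show ?thesis
  proof (cases "2 * l \<le> c")
    case True
    show ?thesis using *[OF assms(1) True] pos unfolding distrib_left by linarith
  next
    case False
    have "ec c (c - l) = cnj (ec c l)" using assms by (simp add: ec_diff ec_eq_1_iff[THEN iffD2])
    then have "norm (1 - ec c (c - l)) = norm (1 - ec c l)"
      by (metis complex_cnj_diff complex_cnj_one complex_mod_cnj)
    moreover have "1 / norm (1 - ec c (c - l)) \<le> of_int c / 3 * (1 / of_int (c - l))"
      using False assms by (intro *) auto
    ultimately have "1 / norm (1 - ec c l) \<le> of_int c / 3 * (1 / of_int (c - l))" by (simp only:)
    then show ?thesis using pos unfolding distrib_left by linarith
  qed
qed

lemma sum_norm_one_minus_ec:
  assumes c: "c > 0"
  shows "(\<Sum>l\<in>{1..<c}. 1 / norm (1 - ec c l)) \<le> of_int c * (1 + ln (of_int c))"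
proof (cases "c = 1")
  case False
  then have c1: "c > 1" using c by simp
  have third: "a / 3 * (3 * b) = a * b" for a b :: real by simp
  have ln0: "0 \<le> ln (real_of_int c)" using c by (intro ln_ge_zero) auto
  have H: "(\<Sum>l\<in>{1..<c}. 1 / real_of_int l) \<le> 1 + ln (of_int c)"
  proof -
    have "(\<Sum>l\<in>{1..<c}. 1 / real_of_int l) = harm (nat c - 1)"
      unfolding harm_def by (rule sum.reindex_bij_witness[of _ int nat]) (use c1 in \<open>auto simp: field_simps\<close>)
    also have "\<dots> \<le> harm (nat c)" by (rule harm_mono) simp
    also have "\<dots> \<le> 1 + ln (real (nat c))"
      using decseqD[OF decseq_harm_diff_ln, of 0 "nat c - 1"] c by (simp add: harm_expand)
    finally show ?thesis using c by simp
  qed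
  have R: "(\<Sum>l\<in>{1..<c}. 1 / real_of_int (c - l)) = (\<Sum>l\<in>{1..<c}. 1 / real_of_int l)"
    by (rule sum.reindex_bij_witness[of _ "\<lambda>l. c - l" "\<lambda>l. c - l"]) auto
  have "(\<Sum>l\<in>{1..<c}. 1 / norm (1 - ec c l)) \<le> (\<Sum>l\<in>{1..<c}. of_int c / 3 * (1 / of_int l + 1 / of_int (c - l)))"
    by (intro sum_mono norm_one_minus_ec) auto
  also have "\<dots> = of_int c / 3 * (2 * (\<Sum>l\<in>{1..<c}. 1 / real_of_int l))"
    by (simp only: sum_distrib_left[symmetric] sum.distrib R mult_2)
  also have "\<dots> \<le> of_int c / 3 * (3 * (1 + ln (of_int c)))"
  proof (intro mult_left_mono)
    show "2 * (\<Sum>l\<in>{1..<c}. 1 / real_of_int l) \<le> 3 * (1 + ln (of_int c))"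
      using H ln0 unfolding distrib_left by linarith
  qed (use c in simp)
  also have "\<dots> = of_int c * (1 + ln (of_int c))"
    using third[of "of_int c" "1 + ln (of_int c)"] .
  finally show ?thesis .
qed auto

section \<open>Unordered sums over the integers\<close>

lemma infsum_minus:
  fixes f g :: "'a \<Rightarrow> 'b :: {topological_ab_group_add, t2_space}"
  assumes "f summable_on A" "g summable_on A"
  shows "(\<Sum>\<^sub>\<infinity>x\<in>A. f x - g x) = infsum f A - infsum g A"
  using infsum_add[OF assms(1), of "\<lambda>x. - g x"] assms(2)
  by (simp add: infsum_uminus summable_on_uminus)

lemma has_sum_finite_sum:
  fixes f :: "'i \<Rightarrow> 'a \<Rightarrow> 'b :: topological_comm_monoid_add"
  assumes "finite I" "\<And>i. i \<in> I \<Longrightarrow> (f i has_sum s i) A"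
  shows "((\<lambda>x. \<Sum>i\<in>I. f i x) has_sum (\<Sum>i\<in>I. s i)) A"
  using assms by (induction I rule: finite_induct) (auto intro: has_sum_add)

lemma infsum_finite_sum:
  fixes f :: "'i \<Rightarrow> 'a \<Rightarrow> 'b :: {topological_comm_monoid_add, t2_space}"
  assumes "finite I" "\<And>i. i \<in> I \<Longrightarrow> f i summable_on A"
  shows "(\<Sum>\<^sub>\<infinity>x\<in>A. \<Sum>i\<in>I. f i x) = (\<Sum>i\<in>I. infsum (f i) A)"
  by (intro infsumI has_sum_finite_sum has_sum_infsum assms)

lemma bij_int_shift: "bij_betw (\<lambda>w::int. w + k) UNIV UNIV"
  by (rule bij_betwI[of _ _ _ "\<lambda>w. w - k"]) auto

lemma infsum_int_shift: "(\<Sum>\<^sub>\<infinity>w. f (w + k :: int)) = infsum f UNIV"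
  by (rule infsum_reindex_bij_betw[OF bij_int_shift])

lemma summable_on_int_shift: "(\<lambda>w. f (w + k :: int)) summable_on UNIV \<longleftrightarrow> f summable_on UNIV"
  by (rule summable_on_reindex_bij_betw[OF bij_int_shift])

text \<open>Expand \<open>\<psi>\<close> in additive characters modulo \<open>c\<close>; for a nontrivial character, the sum against \<open>h\<close> is
  controlled by the variation of \<open>h\<close> through summation by parts.\<close>

lemma twisted_sum_bound:
  fixes \<psi> h :: "int \<Rightarrow> complex"
  assumes c: "c > 0"
    and per: "\<And>v w. [v = w] (mod c) \<Longrightarrow> \<psi> v = \<psi> w"
    and M: "\<And>l. norm (\<Sum>v\<in>{0..<c}. \<psi> v * ec c (l * v)) \<le> M"
    and sum: "(\<lambda>w. norm (h w)) summable_on UNIV"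
    and V0: "(\<Sum>\<^sub>\<infinity>w. norm (h w)) \<le> of_int c * V"
    and V1: "(\<Sum>\<^sub>\<infinity>w. norm (h (w + 1) - h w)) \<le> V"
  shows "norm (\<Sum>\<^sub>\<infinity>w. \<psi> w * h w) \<le> M * V * (2 + ln (of_int c))"
proof -
  define \<psi>' where "\<psi>' l = (\<Sum>v\<in>{0..<c}. \<psi> v * ec c (- l * v))" for l
  define E where "E l = (\<Sum>\<^sub>\<infinity>w. ec c (l * w) * h w)" for l
  have M0: "M \<ge> 0" using M[of 0] norm_ge_zero order_trans by blast
  have V: "V \<ge> 0" using order_trans[OF infsum_nonneg V1] by simp
  have hs: "(\<lambda>w. ec c (l * w) * h w) summable_on UNIV" for l
    by (rule abs_summable_summable) (simp add: norm_mult sum)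
  have expand: "\<psi> w = (\<Sum>l\<in>{0..<c}. \<psi>' l * ec c (l * w)) / of_int c" for w
  proof -
    have "(\<Sum>l\<in>{0..<c}. \<psi>' l * ec c (l * w)) = (\<Sum>l\<in>{0..<c}. \<Sum>v\<in>{0..<c}. \<psi> v * ec c (l * (w - v)))"
      unfolding \<psi>'_def sum_distrib_right
      by (intro sum.cong refl) (simp add: mult.assoc ec_add[symmetric] algebra_simps)
    also have "\<dots> = (\<Sum>v\<in>{0..<c}. \<psi> v * (\<Sum>l\<in>{0..<c}. ec c (l * (w - v))))"
      unfolding sum_distrib_left by (rule sum.swap)
    also have "\<dots> = (\<Sum>v\<in>{0..<c}. \<psi> v * (if c dvd w - v then of_int c else 0))"
      by (simp only: ec_orthogonality[OF c])
    also have "\<dots> = (\<Sum>v\<in>{w mod c}. \<psi> v * (if c dvd w - v then of_int c else 0))"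
    proof (rule sum.mono_neutral_right)
      show "\<forall>v\<in>{0..<c} - {w mod c}. \<psi> v * (if c dvd w - v then of_int c else 0) = 0"
        by (auto simp: mod_eq_dvd_iff[symmetric])
    qed (use c in auto)
    also have "\<dots> = \<psi> w * of_int c"
      using per[of "w mod c" w] by (simp add: cong_def mod_eq_dvd_iff[symmetric])
    finally show ?thesis using c by simp
  qed
  have E0: "norm (E 0) \<le> of_int c * V"
  proof -
    have "norm (E 0) \<le> (\<Sum>\<^sub>\<infinity>w. norm (ec c (0 * w) * h w))"
      unfolding E_def by (rule norm_infsum_bound) (simp add: sum)
    then show ?thesis using V0 by simp
  qed
  have El: "norm (E l) \<le> V * (1 / norm (1 - ec c l))" if l: "0 < l" "l < c" for l
  proof -
    have w1: "ec c l \<noteq> 1" using l c by (auto simp: ec_eq_1_iff dest: zdvd_imp_le)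
    have shs: "(\<lambda>w. norm (h (w + 1))) summable_on UNIV"
      using sum by (simp only: summable_on_int_shift[of "\<lambda>w. norm (h w)"])
    have ds: "(\<lambda>w. norm (h (w + 1) - h w)) summable_on UNIV"
      by (rule summable_on_comparison_test[OF summable_on_add[OF shs sum]])
        (auto intro: norm_triangle_ineq4)
    have sh2: "(\<lambda>w. ec c (l * w) * h (w + 1)) summable_on UNIV"
      by (rule abs_summable_summable) (simp add: norm_mult shs)
    \<comment> \<open>Summation by parts without boundary terms: translating w by one multiplies the
      character by \<open>ec c l\<close>, so that \<open>(1 - ec c l) * E l\<close> becomes a sum
      against the differences of h.\<close>
    have "E l = (\<Sum>\<^sub>\<infinity>w. ec c (l * (w + 1)) * h (w + 1))"
      unfolding E_def by (rule infsum_int_shift[symmetric])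
    also have "\<dots> = (\<Sum>\<^sub>\<infinity>w. ec c l * (ec c (l * w) * h (w + 1)))"
      by (simp add: distrib_left ec_add mult_ac)
    also have "\<dots> = ec c l * (\<Sum>\<^sub>\<infinity>w. ec c (l * w) * h (w + 1))"
      by (rule infsum_cmult_right) (use sh2 in simp)
    finally have 1: "E l = ec c l * (\<Sum>\<^sub>\<infinity>w. ec c (l * w) * h (w + 1))" .
    have "(\<Sum>\<^sub>\<infinity>w. ec c (l * w) * (h (w + 1) - h w)) =
        (\<Sum>\<^sub>\<infinity>w. ec c (l * w) * h (w + 1)) - E l"
      unfolding E_def right_diff_distrib by (rule infsum_minus[OF sh2 hs])
    then have "ec c l * (\<Sum>\<^sub>\<infinity>w. ec c (l * w) * (h (w + 1) - h w)) =
        ec c l * (\<Sum>\<^sub>\<infinity>w. ec c (l * w) * h (w + 1)) - ec c l * E l"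
      by (simp only: right_diff_distrib)
    also have "\<dots> = (1 - ec c l) * E l" by (simp only: 1[symmetric] left_diff_distrib mult_1_left)
    finally have "ec c l * (\<Sum>\<^sub>\<infinity>w. ec c (l * w) * (h (w + 1) - h w)) = (1 - ec c l) * E l" .
    from this[symmetric] have "norm (1 - ec c l) * norm (E l) = norm (\<Sum>\<^sub>\<infinity>w. ec c (l * w) * (h (w + 1) - h w))"
      by (simp only: norm_mult[symmetric]) (simp only: norm_mult norm_ec mult_1_left)
    also have "\<dots> \<le> (\<Sum>\<^sub>\<infinity>w. norm (ec c (l * w) * (h (w + 1) - h w)))"
      by (rule norm_infsum_bound) (simp add: norm_mult ds)
    also have "\<dots> \<le> V" using V1 by (simp add: norm_mult)
    finally show ?thesis using w1 by (simp add: field_simps)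
  qed
  have "(\<Sum>\<^sub>\<infinity>w. \<psi> w * h w) = (\<Sum>\<^sub>\<infinity>w. \<Sum>l\<in>{0..<c}. \<psi>' l / of_int c * (ec c (l * w) * h w))"
    by (intro infsum_cong, subst expand) (simp add: sum_divide_distrib sum_distrib_left mult_ac)
  also have "\<dots> = (\<Sum>l\<in>{0..<c}. \<Sum>\<^sub>\<infinity>w. \<psi>' l / of_int c * (ec c (l * w) * h w))"
    by (intro infsum_finite_sum summable_on_cmult_right hs) simp
  also have "\<dots> = (\<Sum>l\<in>{0..<c}. \<psi>' l / of_int c * E l)"
    unfolding E_def by (intro sum.cong refl infsum_cmult_right hs)
  also have "norm \<dots> \<le> (\<Sum>l\<in>{0..<c}. norm (\<psi>' l / of_int c * E l))" by (rule norm_sum)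
  also have "\<dots> \<le> (\<Sum>l\<in>{0..<c}. M / of_int c * norm (E l))"
  proof (rule sum_mono)
    fix l
    have "norm (\<psi>' l) \<le> M" unfolding \<psi>'_def by (rule M)
    then show "norm (\<psi>' l / of_int c * E l) \<le> M / of_int c * norm (E l)"
      using c by (simp add: norm_mult norm_divide divide_right_mono mult_right_mono)
  qed
  also have "\<dots> = M / of_int c * (norm (E 0) + (\<Sum>l\<in>{1..<c}. norm (E l)))"
  proof -
    have "{0..<c} = insert 0 {1..<c}" using c by auto
    then show ?thesis by (simp add: sum_distrib_left distrib_left)
  qed
  also have "\<dots> \<le> M / of_int c * (of_int c * V + (\<Sum>l\<in>{1..<c}. V * (1 / norm (1 - ec c l))))"
    using M0 c by (intro mult_left_mono add_mono E0 sum_mono El) auto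
  also have "\<dots> \<le> M / of_int c * (of_int c * V + V * (of_int c * (1 + ln (of_int c))))"
    unfolding sum_distrib_left[symmetric]
    using M0 c V by (intro mult_left_mono add_left_mono sum_norm_one_minus_ec) auto
  also have "\<dots> = M * V * (2 + ln (of_int c))" using c by (simp add: field_simps)
  finally show ?thesis .
qed

text \<open>Near each point the majorant makes the finite partial sums converge uniformly, and
  uniform limits of holomorphic functions are holomorphic. The majorant may change from point to
  point, which suits bounds whose constants depend on the norm of s or on the distance to the real
  axis.\<close>

lemma holomorphic_infsum:
  fixes f :: "'i \<Rightarrow> complex \<Rightarrow> complex"
  assumes U: "open U" and hol: "\<And>i. i \<in> I \<Longrightarrow> f i holomorphic_on U"
    and bd: "\<And>z. z \<in> U \<Longrightarrow> \<exists>e>0. \<exists>M. M summable_on I \<and> (\<forall>i\<in>I. \<forall>x\<in>ball z e \<inter> U. norm (f i x) \<le> M i)"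
  shows "(\<lambda>z. \<Sum>\<^sub>\<infinity>i\<in>I. f i z) holomorphic_on U"
proof (rule holomorphic_onI)
  fix z assume z: "z \<in> U"
  obtain e M where e: "e > 0" "M summable_on I" "\<And>i x. i \<in> I \<Longrightarrow> x \<in> ball z e \<inter> U \<Longrightarrow> norm (f i x) \<le> M i"
    using bd[OF z] by blast
  obtain r0 where r0: "r0 > 0" "cball z r0 \<subseteq> U" using U z open_contains_cball by blast
  define r where "r = min r0 (e / 2)"
  have r: "r > 0" "cball z r \<subseteq> U" "cball z r \<subseteq> ball z e" using r0 e by (auto simp: r_def)
  have "uniform_limit (cball z r) (\<lambda>X y. \<Sum>i\<in>X. f i y) (\<lambda>y. \<Sum>\<^sub>\<infinity>i\<in>I. f i y) (finite_subsets_at_top I)"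
    by (rule Weierstrass_m_test_general[OF _ e(2)]) (use e(3) r in blast)
  moreover have "\<forall>\<^sub>F X in finite_subsets_at_top I. continuous_on (cball z r) (\<lambda>y. \<Sum>i\<in>X. f i y) \<and>
      (\<lambda>y. \<Sum>i\<in>X. f i y) holomorphic_on ball z r"
  proof (rule eventually_finite_subsets_at_top_weakI)
    fix X assume X: "finite X" "X \<subseteq> I"
    have "(\<lambda>y. \<Sum>i\<in>X. f i y) holomorphic_on U"
      using X hol by (intro holomorphic_on_sum) blast
    then show "continuous_on (cball z r) (\<lambda>y. \<Sum>i\<in>X. f i y) \<and> (\<lambda>y. \<Sum>i\<in>X. f i y) holomorphic_on ball z r"
      using r ball_subset_cball
      by (meson holomorphic_on_imp_continuous_on holomorphic_on_subset)
  qed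
  ultimately have "(\<lambda>y. \<Sum>\<^sub>\<infinity>i\<in>I. f i y) holomorphic_on ball z r"
    by (elim holomorphic_uniform_limit[rotated]) auto
  then have "(\<lambda>y. \<Sum>\<^sub>\<infinity>i\<in>I. f i y) field_differentiable at z"
    using r by (metis centre_in_ball holomorphic_on_imp_differentiable_at open_ball)
  then show "(\<lambda>y. \<Sum>\<^sub>\<infinity>i\<in>I. f i y) field_differentiable at z within U"
    by (rule field_differentiable_at_within)
qed

lemma abs_summable_on_bounded_by:
  fixes f :: "'a \<Rightarrow> 'b :: banach"
  assumes "\<And>x. x \<in> A \<Longrightarrow> norm (f x) \<le> g x" "g summable_on A"
  shows "(\<lambda>x. norm (f x)) summable_on A" "f summable_on A" "norm (infsum f A) \<le> infsum g A"
proof -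
  show 1: "(\<lambda>x. norm (f x)) summable_on A"
    by (rule summable_on_comparison_test[OF assms(2)]) (use assms(1) in auto)
  then show "f summable_on A" by (rule abs_summable_summable)
  have "norm (infsum f A) \<le> (\<Sum>\<^sub>\<infinity>x\<in>A. norm (f x))" by (rule norm_infsum_bound[OF 1])
  also have "\<dots> \<le> infsum g A" by (rule infsum_mono[OF 1 assms(2) assms(1)])
  finally show "norm (infsum f A) \<le> infsum g A" .
qed

section \<open>Power sums and lattice estimates\<close>

lemma summable_on_nat_powr:
  assumes "a > 1"
  shows "(\<lambda>k::nat. (1 + real k) powr (- a)) summable_on UNIV"
proof (rule norm_summable_imp_summable_on)
  have "summable (\<lambda>k. real k powr (- a))" using assms by (simp add: summable_real_powr_iff)
  then have "summable (\<lambda>k. real (Suc k) powr (- a))" by (subst summable_Suc_iff)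
  then show "summable (\<lambda>k. norm ((1 + real k) powr (- a)))" by (simp add: add.commute)
qed

lemma summable_on_int_powr:
  assumes "a > 1"
  shows "(\<lambda>w::int. (1 + \<bar>real_of_int w\<bar>) powr (- a)) summable_on UNIV"
proof -
  let ?f = "\<lambda>w::int. (1 + \<bar>real_of_int w\<bar>) powr (- a)"
  have "?f summable_on (range int)"
    using summable_on_nat_powr[OF assms] by (subst summable_on_reindex) (auto simp: o_def)
  moreover have "?f summable_on (range (\<lambda>k. - int k))"
    using summable_on_nat_powr[OF assms] by (subst summable_on_reindex) (auto simp: o_def inj_on_def)
  ultimately have "?f summable_on (range int \<union> range (\<lambda>k. - int k))" by (rule summable_on_union)
  moreover have "range int \<union> range (\<lambda>k. - int k) = UNIV"
  proof -
    have "w \<in> range int \<union> range (\<lambda>k. - int k)" for w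
      by (cases w rule: int_cases2) auto
    then show ?thesis by blast
  qed
  ultimately show ?thesis by simp
qed

lemma summable_on_pos_int_powr:
  assumes "a > 1"
  shows "(\<lambda>c::int. real_of_int c powr (- a)) summable_on {0<..}"
proof -
  have "(\<lambda>c::int. real_of_int c powr (- a)) summable_on (\<lambda>k. int k + 1) ` UNIV"
    using summable_on_nat_powr[OF assms] by (subst summable_on_reindex) (auto simp: o_def inj_on_def add.commute)
  also have "(\<lambda>k. int k + 1) ` UNIV = {0<..}"
  proof -
    have "c \<in> range (\<lambda>k. int k + 1)" if "c > 0" for c :: int
      using that by (intro image_eqI[of _ _ "nat (c - 1)"]) auto
    then show ?thesis by auto
  qed
  finally show ?thesis .
qed

text \<open>The exponent 1.01 is an arbitrary choice above 1. With it a sum over w costs c powr 1.01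
  where an integral would cost c, with a constant independent of c.\<close>

definition row_const :: real where
  "row_const = (\<Sum>\<^sub>\<infinity>w::int. (1 + \<bar>real_of_int w\<bar>) powr (- 1.01))"

lemma row_const_nonneg: "row_const \<ge> 0"
  unfolding row_const_def by (rule infsum_nonneg) simp

text \<open>The exponent is split into 1.01 for convergence in w and the rest for decay in c, since
  c + |w| is at least 1 + |w| and at least c.\<close>

lemma row_sum:
  fixes c :: int
  assumes "c > 0" "\<rho> \<ge> 1.01"
  shows "(\<lambda>w::int. (of_int c + \<bar>of_int w\<bar>) powr (- \<rho>)) summable_on UNIV"
    and "(\<Sum>\<^sub>\<infinity>w::int. (of_int c + \<bar>of_int w\<bar>) powr (- \<rho>)) \<le> row_const * of_int c powr (1.01 - \<rho>)"
proof -
  have c: "real_of_int c \<ge> 1" using assms by simp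
  let ?g = "\<lambda>w::int. (1 + \<bar>real_of_int w\<bar>) powr (- 1.01) * of_int c powr (1.01 - \<rho>)"
  have le: "(of_int c + \<bar>of_int w\<bar>) powr (- \<rho>) \<le> ?g w" for w
  proof -
    have "(of_int c + \<bar>of_int w\<bar>) powr (- \<rho>) =
        (of_int c + \<bar>of_int w\<bar>) powr (- 1.01) * (of_int c + \<bar>of_int w\<bar>) powr (1.01 - \<rho>)"
      by (simp add: powr_add[symmetric])
    also have "\<dots> \<le> ?g w"
      using assms c by (intro mult_mono powr_mono2') auto
    finally show ?thesis .
  qed
  have g: "?g summable_on UNIV"
    by (intro summable_on_cmult_left summable_on_int_powr) simp
  show "(\<lambda>w::int. (of_int c + \<bar>of_int w\<bar>) powr (- \<rho>)) summable_on UNIV"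
    by (rule abs_summable_on_bounded_by(2)[OF _ g]) (use le in simp)
  have "norm (\<Sum>\<^sub>\<infinity>w::int. (of_int c + \<bar>of_int w\<bar>) powr (- \<rho>)) \<le> infsum ?g UNIV"
    by (rule abs_summable_on_bounded_by(3)[OF _ g]) (use le in simp)
  also have "infsum ?g UNIV = row_const * of_int c powr (1.01 - \<rho>)"
    unfolding row_const_def by (intro infsum_cmult_left summable_on_int_powr) simp
  finally show "(\<Sum>\<^sub>\<infinity>w::int. (of_int c + \<bar>of_int w\<bar>) powr (- \<rho>)) \<le> row_const * of_int c powr (1.01 - \<rho>)"
    by simp
qed

text \<open>102 = 2 + 100: ln x is 100 times the logarithm of x powr 0.01, and x powr 0.01 is at
  least 1 and at least its own logarithm.\<close>

lemma ln_le_powr: "1 \<le> x \<Longrightarrow> 2 + ln x \<le> 102 * x powr (0.01 :: real)"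
proof -
  assume x: "1 \<le> x"
  have "x powr 0 \<le> x powr 0.01" using x by (intro powr_mono) auto
  moreover have "ln (x powr 0.01) \<le> x powr 0.01" using x by (intro ln_bound) auto
  ultimately show ?thesis using x by (simp add: ln_powr)
qed

text \<open>Uniform comparability of |c \<tau> + t| with |c| + |t|. Points of both half-planes can
  satisfy it, since the value at 1 is later written through \<tau> and its conjugate. The cap at 1
  lets negative powers of \<kappa> be estimated by the one with the largest exponent in absolute
  value.\<close>

definition lattice_bound :: "real \<Rightarrow> complex \<Rightarrow> bool" where
  "lattice_bound \<kappa> \<tau> \<longleftrightarrow> 0 < \<kappa> \<and> \<kappa> \<le> 1 \<and> (\<forall>c t :: real. \<kappa> * (\<bar>c\<bar> + \<bar>t\<bar>) \<le> norm (of_real c * \<tau> + of_real t))"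

text \<open>The imaginary part controls |c|, and the triangle inequality then controls |t|; the
  factor 1 + 2 |\<tau>| is the cost of combining the two.\<close>

lemma lattice_boundI:
  assumes "Im \<tau> \<noteq> 0" "0 < \<kappa>" "\<kappa> * (1 + 2 * norm \<tau>) \<le> \<bar>Im \<tau>\<bar>"
  shows "lattice_bound \<kappa> \<tau>"
  unfolding lattice_bound_def
proof (intro conjI allI)
  have y: "\<bar>Im \<tau>\<bar> \<le> norm \<tau>" by (rule abs_Im_le_cmod)
  have "\<kappa> * (1 + 2 * norm \<tau>) \<le> 1 + 2 * norm \<tau>" using assms(3) y norm_ge_zero[of \<tau>] by linarith
  then show "\<kappa> \<le> 1" by (simp add: add_pos_nonneg)
  fix c t :: real
  let ?u = "of_real c * \<tau> + of_real t"
  have "\<bar>Im ?u\<bar> \<le> norm ?u" by (rule abs_Im_le_cmod)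
  then have 1: "\<bar>c\<bar> * \<bar>Im \<tau>\<bar> \<le> norm ?u" by (simp add: abs_mult)
  have "norm (of_real t :: complex) \<le> norm ?u + norm (of_real c * \<tau>)"
    by (metis add_diff_cancel_left' norm_triangle_ineq4)
  then have "\<bar>t\<bar> \<le> norm ?u + \<bar>c\<bar> * norm \<tau>" by (simp add: norm_mult)
  then have "\<bar>t\<bar> * \<bar>Im \<tau>\<bar> \<le> (norm ?u + \<bar>c\<bar> * norm \<tau>) * \<bar>Im \<tau>\<bar>" by (intro mult_right_mono) auto
  also have "\<dots> = norm ?u * \<bar>Im \<tau>\<bar> + norm \<tau> * (\<bar>c\<bar> * \<bar>Im \<tau>\<bar>)" by (simp add: algebra_simps)
  also have "\<dots> \<le> norm ?u * norm \<tau> + norm \<tau> * norm ?u"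
    using 1 y by (intro add_mono mult_left_mono) auto
  finally have "(\<bar>c\<bar> + \<bar>t\<bar>) * \<bar>Im \<tau>\<bar> \<le> norm ?u * (1 + 2 * norm \<tau>)"
    using 1 by (simp add: algebra_simps)
  moreover have "(\<bar>c\<bar> + \<bar>t\<bar>) * (\<kappa> * (1 + 2 * norm \<tau>)) \<le> (\<bar>c\<bar> + \<bar>t\<bar>) * \<bar>Im \<tau>\<bar>"
    using assms(3) by (intro mult_left_mono) auto
  ultimately have "\<kappa> * (\<bar>c\<bar> + \<bar>t\<bar>) * (1 + 2 * norm \<tau>) \<le> norm ?u * (1 + 2 * norm \<tau>)"
    by (simp add: mult_ac)
  moreover have "1 + 2 * norm \<tau> > 0" by (simp add: add_pos_nonneg)
  ultimately show "\<kappa> * (\<bar>c\<bar> + \<bar>t\<bar>) \<le> norm ?u" by (rule mult_right_le_imp_le)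
qed (use assms in auto)

lemma lattice_bound_exists:
  assumes "Im \<tau> \<noteq> 0"
  obtains \<kappa> where "lattice_bound \<kappa> \<tau>"
proof
  show "lattice_bound (\<bar>Im \<tau>\<bar> / (1 + 2 * norm \<tau>)) \<tau>"
    using assms by (intro lattice_boundI) (auto simp: add_pos_nonneg less_imp_neq[symmetric])
qed

text \<open>A single \<kappa> for a whole ball, as locally uniform majorants require. The radius |Im
  \<tau>| / 2 keeps the ball at least that far from the real axis.\<close>

lemma lattice_bound_locally:
  assumes "Im \<tau> \<noteq> 0"
  obtains e \<kappa> where "e > 0" "\<And>z. z \<in> ball \<tau> e \<Longrightarrow> lattice_bound \<kappa> z" "\<And>z. z \<in> ball \<tau> e \<Longrightarrow> norm z \<le> 1 + 2 * norm \<tau>"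
proof
  define e where "e = \<bar>Im \<tau>\<bar> / 2"
  show e: "e > 0" using assms by (simp add: e_def)
  fix z assume z: "z \<in> ball \<tau> e"
  have "\<bar>Im \<tau>\<bar> \<le> norm \<tau>" by (rule abs_Im_le_cmod)
  moreover have "norm z \<le> norm \<tau> + norm (z - \<tau>)" by (metis add.commute norm_triangle_sub)
  moreover have d: "norm (z - \<tau>) < e" using z by (simp add: dist_norm norm_minus_commute)
  ultimately have n: "norm z \<le> 2 * norm \<tau>" using norm_ge_zero[of \<tau>] by (simp add: e_def)
  then show "norm z \<le> 1 + 2 * norm \<tau>" by simp
  have "\<bar>Im z - Im \<tau>\<bar> < e" using d abs_Im_le_cmod[of "z - \<tau>"] by simp
  then have im: "\<bar>Im z\<bar> \<ge> e" unfolding e_def by linarith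
  show "lattice_bound (e / (1 + 4 * norm \<tau>)) z"
  proof (rule lattice_boundI)
    have p: "1 + 4 * norm \<tau> > 0" by (simp add: add_pos_nonneg)
    then show "0 < e / (1 + 4 * norm \<tau>)" using e by simp
    have "e / (1 + 4 * norm \<tau>) * (1 + 2 * norm z) \<le> e / (1 + 4 * norm \<tau>) * (1 + 4 * norm \<tau>)"
      using e p n by (intro mult_left_mono) auto
    also have "\<dots> = e" using p by simp
    finally show "e / (1 + 4 * norm \<tau>) * (1 + 2 * norm z) \<le> \<bar>Im z\<bar>" using im by simp
  qed (use im e in auto)
qed

text \<open>The second bound is meant for differences of consecutive terms: as c is at least 1,
  passing from w to w + 1 lowers c + |w| at most by a factor 2.\<close>

lemma lattice_bound_int:
  assumes "lattice_bound \<kappa> \<tau>" "c > 0"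
  shows "\<kappa> * (of_int c + \<bar>of_int w\<bar>) \<le> norm (of_int c * \<tau> + of_int w)"
    and "\<kappa> / 2 * (of_int c + \<bar>of_int w\<bar>) \<le> norm (of_int c * \<tau> + of_int (w + 1))"
    and "\<kappa> / 2 * (of_int c + \<bar>of_int w\<bar>) > 0"
proof -
  have *: "\<kappa> * (of_int c + \<bar>of_int w\<bar>) \<le> norm (of_int c * \<tau> + of_int w)" for w
    using assms unfolding lattice_bound_def
    by (metis abs_of_nonneg le_less of_int_0_le_iff of_real_of_int_eq)
  show "\<kappa> * (of_int c + \<bar>of_int w\<bar>) \<le> norm (of_int c * \<tau> + of_int w)" by (rule *)
  have k: "\<kappa> > 0" using assms by (simp add: lattice_bound_def)
  have half: "\<kappa> / 2 * (2 * x) = \<kappa> * x" for x by simp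
  have aux: "1 \<le> x \<Longrightarrow> y \<le> z + 1 \<Longrightarrow> 0 \<le> z \<Longrightarrow> x + y \<le> 2 * (x + z)" for x y z :: real by simp
  have "real_of_int c \<ge> 1" using assms by simp
  moreover have "\<bar>real_of_int w\<bar> \<le> \<bar>of_int (w + 1)\<bar> + 1"
    using abs_triangle_ineq[of "real_of_int w + 1" "- 1"] by simp
  ultimately have "real_of_int c + \<bar>real_of_int w\<bar> \<le> 2 * (of_int c + \<bar>of_int (w + 1)\<bar>)"
    using aux[of "of_int c" "\<bar>of_int w\<bar>" "\<bar>of_int (w + 1)\<bar>"] by simp
  then have "\<kappa> / 2 * (of_int c + \<bar>of_int w\<bar>) \<le> \<kappa> / 2 * (2 * (of_int c + \<bar>of_int (w + 1)\<bar>))"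
    using k by (intro mult_left_mono) auto
  also have "\<dots> = \<kappa> * (of_int c + \<bar>of_int (w + 1)\<bar>)" by (rule half)
  also have "\<dots> \<le> norm (of_int c * \<tau> + of_int (w + 1))" by (rule *)
  finally show "\<kappa> / 2 * (of_int c + \<bar>of_int w\<bar>) \<le> norm (of_int c * \<tau> + of_int (w + 1))" .
  show "\<kappa> / 2 * (of_int c + \<bar>of_int w\<bar>) > 0" using k assms by (simp add: add_pos_nonneg)
qed

lemma norm_exp_minus_one_le: "norm (exp z - 1 :: complex) \<le> norm z * exp (norm z)"
  using Taylor_exp_field[of z 0] by (simp add: mult.commute)

lemma norm_exp_minus_one_minus_le: "norm (exp z - 1 - z :: complex) \<le> norm z ^ 2 * exp (norm z)"
  using Taylor_exp_field[of z 1] by (simp add: mult.commute diff_diff_eq power2_eq_square)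

text \<open>The phase e(-n a / c) of the seed on matrices with bottom row (c, w), where a is the
  inverse of Q w modulo c; it is used for Q coprime to c. The value 0 at w not coprime to c lets row
  sums run over all integers.\<close>

definition twist :: "nat \<Rightarrow> nat \<Rightarrow> int \<Rightarrow> int \<Rightarrow> complex" where
  "twist n Q c w = (if coprime w c then ec c (- int n * (SOME x. [int Q * x * w = 1] (mod c))) else 0)"

section \<open>Fourier coefficients of the phases\<close>

lemma inverse_mod_exists:
  fixes a c :: int
  assumes "coprime a c"
  obtains x where "[a * x = 1] (mod c)"
  using assms by (meson coprime_iff_invertible_int)

lemma inverse_mod_unique:
  fixes a c x y :: int
  assumes "[a * x = 1] (mod c)" "[a * y = 1] (mod c)"
  shows "[x = y] (mod c)"
proof -
  have "[y * (a * x) = y * 1] (mod c)" using assms(1) by (rule cong_scalar_left)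
  moreover have "[x * (a * y) = x * 1] (mod c)" using assms(2) by (rule cong_scalar_left)
  moreover have "y * (a * x) = x * (a * y)" by simp
  ultimately show ?thesis by (metis cong_def mult.right_neutral)
qed

lemma twist_eq:
  assumes c: "c > 0" and x: "[int Q * x * w = 1] (mod c)"
  shows "twist n Q c w = ec c (- int n * x)"
proof -
  have "[w * (int Q * x) = 1] (mod c)" using x by (simp add: mult_ac)
  then have "coprime w c" using coprime_iff_invertible_int by blast
  moreover define y where "y = (SOME x. [int Q * x * w = 1] (mod c))"
  then have y: "[int Q * y * w = 1] (mod c)" using x by (metis someI)
  have "[int Q * w * x = 1] (mod c)" "[int Q * w * y = 1] (mod c)"
    using x y by (simp_all add: mult_ac)
  then have "[x = y] (mod c)" by (rule inverse_mod_unique)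
  then have "ec c (- int n * x) = ec c (- int n * y)"
    using c by (intro ec_cong cong_scalar_left) auto
  ultimately show ?thesis by (simp add: twist_def y_def)
qed

lemma twist_eq_0: "\<not> coprime w c \<Longrightarrow> twist n Q c w = 0"
  by (simp add: twist_def)

lemma norm_twist_le: "norm (twist n Q c w) \<le> 1"
  by (simp add: twist_def)

lemma twist_cong:
  assumes "[v = w] (mod c)"
  shows "twist n Q c v = twist n Q c w"
proof -
  have "coprime v c \<longleftrightarrow> coprime w c"
    using assms by (metis cong_imp_coprime cong_sym)
  moreover have "[int Q * x * v = 1] (mod c) \<longleftrightarrow> [int Q * x * w = 1] (mod c)" for x
    using assms by (metis cong_scalar_left cong_sym cong_trans)
  ultimately show ?thesis by (simp add: twist_def)
qed

lemma kloosterman_uminus: "kloosterman c (- \<alpha>) (- \<beta>) = cnj (kloosterman c \<alpha> \<beta>)"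
  by (simp add: kloosterman_def cnj_ec case_prod_unfold)

text \<open>Put y = Q v modulo c. The phase at v then involves the inverse of y, and l v equals l
  times the inverse of Q times y, so the finite Fourier coefficient is a Kloosterman sum.\<close>

lemma twist_fourier:
  assumes c: "c > 0" and Q: "coprime (int Q) c"
  obtains l' where "(\<Sum>v\<in>{0..<c}. twist n Q c v * ec c (l * v)) = kloosterman c (- int n) l'"
proof -
  obtain Q' where Q': "[int Q * Q' = 1] (mod c)" using inverse_mod_exists[OF Q] .
  have "(\<Sum>v\<in>{0..<c}. twist n Q c v * ec c (l * v)) = (\<Sum>v\<in>{v \<in> {0..<c}. coprime v c}. twist n Q c v * ec c (l * v))"
    by (rule sum.mono_neutral_right) (auto simp: twist_eq_0)
  also have "\<dots> = (\<Sum>(x, y)\<in>unit_pairs c. ec c (- int n * x + (l * Q') * y))"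
  proof (rule sum.reindex_bij_witness[symmetric, of _ "\<lambda>v. (SOME x. x \<in> {0..<c} \<and> [int Q * x * v = 1] (mod c), (int Q * v) mod c)"
        "\<lambda>(x, y). (Q' * y) mod c"], goal_cases)
    case (1 p)
    obtain x y where p: "p = (x, y)" by (cases p)
    have xy: "x \<in> {0..<c}" "y \<in> {0..<c}" "[x * y = 1] (mod c)" using 1 by (auto simp: p unit_pairs_def)
    let ?v = "(Q' * y) mod c"
    have "[int Q * ?v = (int Q * Q') * y] (mod c)" by (simp add: cong_def mod_mult_right_eq mult.assoc)
    also have "[(int Q * Q') * y = 1 * y] (mod c)" by (rule cong_scalar_right[OF Q'])
    finally have v: "[int Q * ?v = y] (mod c)" by simp
    then have "[x * (int Q * ?v) = x * y] (mod c)" by (rule cong_scalar_left)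
    then have xv: "[int Q * x * ?v = 1] (mod c)" using xy(3) by (metis cong_trans mult.assoc mult.commute)
    have "(SOME x. x \<in> {0..<c} \<and> [int Q * x * ?v = 1] (mod c)) = x"
    proof (rule some_equality)
      fix z assume z: "z \<in> {0..<c} \<and> [int Q * z * ?v = 1] (mod c)"
      have "[int Q * ?v * z = 1] (mod c)" "[int Q * ?v * x = 1] (mod c)" using z xv by (simp_all add: mult_ac)
      then show "z = x" using z xy by (intro cong_in_range_imp_eq[OF inverse_mod_unique]) auto
    qed (use xy xv in auto)
    moreover have "(int Q * ?v) mod c = y" using v xy by (simp add: cong_def)
    ultimately show ?case by (simp add: p)
  next
    case (2 p)
    obtain x y where p: "p = (x, y)" by (cases p)
    have "coprime y c"
      using 2 by (auto simp: p unit_pairs_def coprime_iff_invertible_int mult.commute)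
    moreover have "coprime Q' c" using Q' by (auto simp: coprime_iff_invertible_int mult.commute)
    ultimately show ?case using c by (auto simp: p)
  next
    case (3 v)
    have "[Q' * ((int Q * v) mod c) = (int Q * Q') * v] (mod c)"
      by (simp add: cong_def mod_mult_right_eq mult_ac)
    also have "[(int Q * Q') * v = 1 * v] (mod c)" by (rule cong_scalar_right[OF Q'])
    finally show ?case using 3 by (simp add: cong_def)
  next
    case (4 v)
    have "coprime (int Q * v) c" using 4 Q by simp
    then obtain z where z: "[int Q * v * z = 1] (mod c)" by (rule inverse_mod_exists)
    have "[int Q * v * (z mod c) = int Q * v * z] (mod c)" by (intro cong_scalar_left) (simp add: cong_def)
    then have "[int Q * (z mod c) * v = 1] (mod c)" using z by (metis cong_trans mult.assoc mult.commute)
    then have ex: "\<exists>x. x \<in> {0..<c} \<and> [int Q * x * v = 1] (mod c)" using c by (intro exI[of _ "z mod c"]) auto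
    define x where "x = (SOME x. x \<in> {0..<c} \<and> [int Q * x * v = 1] (mod c))"
    have x: "x \<in> {0..<c}" "[int Q * x * v = 1] (mod c)" using someI_ex[OF ex] by (simp_all only: x_def)
    have "[x * ((int Q * v) mod c) = x * (int Q * v)] (mod c)" by (intro cong_scalar_left) (simp add: cong_def)
    then have "[x * ((int Q * v) mod c) = 1] (mod c)" using x(2) by (metis cong_trans mult.assoc mult.commute)
    then have "(x, (int Q * v) mod c) \<in> unit_pairs c" using x c by (simp add: unit_pairs_def)
    then show ?case by (simp only: x_def)
  next
    case (5 p)
    obtain x y where p: "p = (x, y)" by (cases p)
    have xy: "x \<in> {0..<c}" "y \<in> {0..<c}" "[x * y = 1] (mod c)" using 5 by (auto simp: p unit_pairs_def)
    let ?v = "(Q' * y) mod c"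
    have "[int Q * x * ?v = int Q * x * (Q' * y)] (mod c)" by (intro cong_scalar_left) (simp add: cong_def)
    also have "int Q * x * (Q' * y) = (int Q * Q') * (x * y)" by simp
    also have "[(int Q * Q') * (x * y) = 1 * 1] (mod c)" by (intro cong_mult Q' xy)
    finally have 1: "twist n Q c ?v = ec c (- int n * x)" using c by (intro twist_eq) auto
    have 2: "ec c (l * ?v) = ec c (l * (Q' * y))"
      using c by (intro ec_cong cong_scalar_left) (auto simp: cong_def)
    show ?case by (simp only: p prod.case 1 2 ec_add mult.assoc)
  qed
  also have "\<dots> = kloosterman c (- int n) (l * Q')" by (simp add: kloosterman_def)
  finally show thesis by (rule that)
qed

text \<open>0.9475 is 15/16 plus the 0.01 spent on the logarithm. The constant is uniform in Q, c
  and the weight h, so one choice serves all rows of all cosets.\<close>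

lemma twist_sum_bound:
  assumes n: "n > 0"
  obtains C where "C \<ge> 0"
    "\<And>Q c h V. \<lbrakk>c > 0; coprime (int Q) c; (\<lambda>w. norm (h w)) summable_on UNIV;
        (\<Sum>\<^sub>\<infinity>w. norm (h w)) \<le> of_int c * V; (\<Sum>\<^sub>\<infinity>w. norm (h (w + 1) - h w)) \<le> V\<rbrakk> \<Longrightarrow>
      norm (\<Sum>\<^sub>\<infinity>w. twist n Q c w * h w) \<le> C * V * of_int c powr 0.9475"
proof -
  obtain C where C: "C \<ge> 0" "\<And>c l. c > 0 \<Longrightarrow> norm (kloosterman c (int n) l) \<le> C * of_int c powr (15/16)"
    using kloosterman_bound[of "int n"] n by auto
  show thesis
  proof (rule that[of "102 * C"])
    show "102 * C \<ge> 0" using C by simp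
    fix Q :: nat and c :: int and h :: "int \<Rightarrow> complex" and V :: real
    assume c: "c > 0" and Q: "coprime (int Q) c" and sum: "(\<lambda>w. norm (h w)) summable_on UNIV"
      and V0: "(\<Sum>\<^sub>\<infinity>w. norm (h w)) \<le> of_int c * V" and V1: "(\<Sum>\<^sub>\<infinity>w. norm (h (w + 1) - h w)) \<le> V"
    have V: "V \<ge> 0" using order_trans[OF infsum_nonneg V1] by simp
    have "norm (\<Sum>\<^sub>\<infinity>w. twist n Q c w * h w) \<le> (C * of_int c powr (15/16)) * V * (2 + ln (of_int c))"
    proof (rule twisted_sum_bound[OF c twist_cong _ sum V0 V1])
      fix l
      obtain l' where l': "(\<Sum>v\<in>{0..<c}. twist n Q c v * ec c (l * v)) = kloosterman c (- int n) l'"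
        by (rule twist_fourier[OF c Q])
      also have "\<dots> = cnj (kloosterman c (int n) (- l'))" using kloosterman_uminus[of c "int n" "- l'"] by simp
      finally show "norm (\<Sum>v\<in>{0..<c}. twist n Q c v * ec c (l * v)) \<le> C * of_int c powr (15/16)"
        using C(2)[OF c] by simp
    qed
    also have "\<dots> \<le> (C * of_int c powr (15/16)) * V * (102 * of_int c powr 0.01)"
      using c C V by (intro mult_left_mono ln_le_powr) auto
    also have "\<dots> = 102 * C * V * (of_int c powr (15/16) * of_int c powr 0.01)" by simp
    also have "of_int c powr (15/16) * of_int c powr 0.01 = of_int c powr (0.9475 :: real)"
      by (simp add: powr_add[symmetric])
    finally show "norm (\<Sum>\<^sub>\<infinity>w. twist n Q c w * h w) \<le> 102 * C * V * of_int c powr 0.9475" .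
  qed
qed

section \<open>Continuation of the Poincare series\<close>

lemma norm_pochhammer_ge_1:
  assumes "Re z \<ge> 1"
  shows "norm (pochhammer z k) \<ge> 1"
proof (induction k)
  case (Suc k)
  have "1 \<le> Re (z + of_nat k)" using assms by simp
  also have "\<dots> \<le> norm (z + of_nat k)" by (rule complex_Re_le_cmod)
  finally show ?case using mult_mono[OF Suc.IH, of 1 "norm (z + of_nat k)"] by (simp add: pochhammer_Suc norm_mult)
qed simp

text \<open>The quotient of the two values is a Pochhammer product whose factors have norm at least
  1. Consequently the Bessel series is dominated by its first coefficient times an exponential
  series.\<close>

lemma norm_rGamma_plus_le:
  fixes z :: complex
  assumes "Re z \<ge> 1"
  shows "norm (rGamma (z + of_nat k)) \<le> norm (rGamma z)"
proof -
  have "norm (rGamma z) = norm (pochhammer z k) * norm (rGamma (z + of_nat k))"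
    using pochhammer_rGamma[of z k] by (simp add: norm_mult)
  then show ?thesis
    using mult_right_mono[OF norm_pochhammer_ge_1[OF assms, of k], of "norm (rGamma (z + of_nat k))"] by simp
qed

text \<open>The power series that remains of the I-Bessel function of order s - 1/2 at 2 pi Y after
  division by (pi Y) powr (s - 1/2). Its constant term is \<open>rGamma (s + 1/2)\<close>.\<close>

definition Bessel_E :: "complex \<Rightarrow> real \<Rightarrow> complex" where
  "Bessel_E s Y = (\<Sum>k. rGamma (s + 1/2 + of_nat k) / fact k * of_real ((pi * Y)\<^sup>2) ^ k)"

lemma Bessel_E_term_le:
  assumes "Re s \<ge> 1/2"
  shows "norm (rGamma (s + 1/2 + of_nat k) / fact k * of_real X ^ k) \<le> norm (rGamma (s + 1/2)) * (\<bar>X\<bar> ^ k / fact k)"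
proof -
  have "norm (rGamma (s + 1/2 + of_nat k)) \<le> norm (rGamma (s + 1/2))"
    using assms by (intro norm_rGamma_plus_le) simp
  then have "norm (rGamma (s + 1/2 + of_nat k)) * (\<bar>X\<bar> ^ k / fact k) \<le> norm (rGamma (s + 1/2)) * (\<bar>X\<bar> ^ k / fact k)"
    by (intro mult_right_mono) auto
  then show ?thesis by (simp add: norm_mult norm_divide norm_power)
qed

lemma exp_sums: "(\<lambda>k. x ^ k / fact k) sums exp (x::real)"
  using exp_converges[of x] by (simp add: divide_inverse_commute)

lemma Bessel_E_summable:
  assumes "Re s \<ge> 1/2"
  shows "summable (\<lambda>k. norm (rGamma (s + 1/2 + of_nat k) / fact k * of_real X ^ k))"
proof (rule summable_comparison_test)
  show "summable (\<lambda>k. norm (rGamma (s + 1/2)) * (\<bar>X\<bar> ^ k / fact k))"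
    using exp_sums by (intro summable_mult) (rule sums_summable)
qed (use Bessel_E_term_le[OF assms] in auto)

text \<open>Coefficientwise comparison with the exponential series. The second bound drops the
  constant term and uses exp X - 1 \<le> X exp X, which gives the rate of convergence as Y tends to
  0.\<close>

lemma Bessel_E_bounds:
  fixes Y :: real
  assumes "Re s \<ge> 1/2"
  defines "X \<equiv> (pi * Y)\<^sup>2"
  shows "norm (Bessel_E s Y) \<le> norm (rGamma (s + 1/2)) * exp X"
    and "norm (Bessel_E s Y - rGamma (s + 1/2)) \<le> norm (rGamma (s + 1/2)) * (X * exp X)"
proof -
  let ?f = "\<lambda>k. rGamma (s + 1/2 + of_nat k) / fact k * of_real X ^ k"
  let ?G = "norm (rGamma (s + 1/2))"
  have X: "X \<ge> 0" by (simp add: X_def)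
  have sm: "summable (\<lambda>k. norm (?f k))" by (rule Bessel_E_summable[OF assms(1)])
  have g: "(\<lambda>k. ?G * (X ^ k / fact k)) sums (?G * exp X)" by (intro sums_mult exp_sums)
  have le: "norm (?f k) \<le> ?G * (X ^ k / fact k)" for k using Bessel_E_term_le[OF assms(1), of k X] X by simp
  have "norm (\<Sum>k. ?f k) \<le> (\<Sum>k. ?G * (X ^ k / fact k))"
    by (rule norm_suminf_le) (use le g sums_summable in auto)
  then show "norm (Bessel_E s Y) \<le> ?G * exp X"
    using sums_unique[OF g] by (simp add: Bessel_E_def X_def)
  have "norm (\<Sum>k. ?f (Suc k)) \<le> (\<Sum>k. ?G * (X ^ Suc k / fact (Suc k)))"
  proof (rule norm_suminf_le)
    show "summable (\<lambda>k. ?G * (X ^ Suc k / fact (Suc k)))"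
      using sums_summable[OF g] summable_Suc_iff[of "\<lambda>k. ?G * (X ^ k / fact k)"] by simp
  qed (rule le)
  also have "(\<Sum>k. ?G * (X ^ Suc k / fact (Suc k))) = ?G * exp X - ?G"
    using suminf_split_head[OF sums_summable[OF g]] sums_unique[OF g] by simp
  also have "\<dots> \<le> ?G * (X * exp X)"
  proof -
    have "1 - X \<le> exp (- X)" using exp_ge_add_one_self[of "- X"] by simp
    then have "(1 - X) * exp X \<le> exp (- X) * exp X" by (intro mult_right_mono) auto
    then have "exp X - 1 \<le> X * exp X" by (simp add: exp_minus algebra_simps)
    then have "?G * (exp X - 1) \<le> ?G * (X * exp X)" by (intro mult_left_mono) auto
    then show ?thesis by (simp add: right_diff_distrib)
  qed
  also have "(\<Sum>k. ?f (Suc k)) = Bessel_E s Y - rGamma (s + 1/2)"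
    using suminf_split_head[OF summable_norm_cancel[OF sm]] by (simp add: Bessel_E_def X_def)
  finally show "norm (Bessel_E s Y - rGamma (s + 1/2)) \<le> ?G * (X * exp X)" .
qed

lemma holomorphic_Bessel_E: "(\<lambda>s. Bessel_E s Y) holomorphic_on {s. Re s > 1/2}"
proof -
  let ?X = "(pi * Y)\<^sup>2"
  let ?f = "\<lambda>k s. rGamma (s + 1/2 + of_nat k) / fact k * of_real ?X ^ k"
  have "(\<lambda>s. \<Sum>\<^sub>\<infinity>k. ?f k s) holomorphic_on {s. Re s > 1/2}"
  proof (rule holomorphic_infsum)
    show "open {s. Re s > 1/2}" by (rule open_halfspace_Re_gt)
    show "?f k holomorphic_on {s. Re s > 1/2}" for k by (intro holomorphic_intros) auto
    fix z :: complex assume z: "z \<in> {s. Re s > 1/2}"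
    have "compact ((\<lambda>s. rGamma (s + 1/2)) ` cball z 1)"
      by (intro compact_continuous_image holomorphic_on_imp_continuous_on holomorphic_intros) auto
    then obtain B where B: "\<And>s. s \<in> cball z 1 \<Longrightarrow> norm (rGamma (s + 1/2)) \<le> B"
      by (meson bounded_iff compact_imp_bounded image_eqI)
    show "\<exists>e>0. \<exists>M. M summable_on UNIV \<and> (\<forall>i\<in>UNIV. \<forall>x\<in>ball z e \<inter> {s. Re s > 1/2}. norm (?f i x) \<le> M i)"
    proof (intro exI conjI ballI)
      show "(0::real) < 1" by simp
      show "(\<lambda>k. B * (\<bar>?X\<bar> ^ k / fact k)) summable_on UNIV"
        using sums_summable[OF exp_sums[of "\<bar>?X\<bar>"]]
        by (intro summable_on_cmult_right norm_summable_imp_summable_on) simp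
      fix k x assume x: "x \<in> ball z 1 \<inter> {s. Re s > 1/2}"
      have "norm (?f k x) \<le> norm (rGamma (x + 1/2)) * (\<bar>?X\<bar> ^ k / fact k)"
        using x by (intro Bessel_E_term_le) auto
      also have "\<dots> \<le> B * (\<bar>?X\<bar> ^ k / fact k)" using x B[of x] by (intro mult_right_mono) auto
      finally show "norm (?f k x) \<le> B * (\<bar>?X\<bar> ^ k / fact k)" .
    qed
  qed
  moreover have "(\<Sum>\<^sub>\<infinity>k. ?f k s) = Bessel_E s Y" if "s \<in> {s. Re s > 1/2}" for s
  proof -
    have "Re s \<ge> 1/2" using that by simp
    from Bessel_E_summable[OF this, of ?X] have sm: "summable (\<lambda>k. norm (?f k s))" .
    from norm_summable_imp_has_sum[OF sm summable_sums[OF summable_norm_cancel[OF sm]]]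
    have "((\<lambda>k. ?f k s) has_sum Bessel_E s Y) UNIV" unfolding Bessel_E_def .
    from infsumI[OF this] show ?thesis .
  qed
  ultimately show ?thesis by (rule holomorphic_transform)
qed

text \<open>The square root of Y in the seed raises the exponent s - 1/2 of the Bessel prefactor to
  s.\<close>

lemma seed_eq:
  assumes n: "n > 0" and \<zeta>: "Im \<zeta> > 0"
  defines "Y \<equiv> real n * Im \<zeta>"
  shows "seed n s \<zeta> = ee (of_real (- real n * Re \<zeta>)) * (of_real pi powr (s - 1/2) * of_real Y powr s * Bessel_E s Y)"
proof -
  have Y: "Y > 0" using n \<zeta> by (simp add: Y_def)
  have "Bessel_I (s - 1/2) (of_real (2 * pi * real n * Im \<zeta>)) = (of_real (pi * Y)) powr (s - 1/2) * Bessel_E s Y"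
  proof -
    have h: "of_real (2 * pi * real n * Im \<zeta>) / 2 = complex_of_real (pi * Y)" by (simp add: Y_def)
    have g: "s - 1/2 + of_nat k + 1 = s + 1/2 + of_nat k" for k by simp
    show ?thesis
      unfolding Bessel_I_def Bessel_E_def h g of_real_power[symmetric] power_mult ..
  qed
  also have "of_real (pi * Y) powr (s - 1/2) = of_real pi powr (s - 1/2) * of_real Y powr (s - 1/2)"
    using Y by (simp add: powr_times_real)
  finally have 1: "Bessel_I (s - 1/2) (of_real (2 * pi * real n * Im \<zeta>)) =
     of_real pi powr (s - 1/2) * of_real Y powr (s - 1/2) * Bessel_E s Y" .
  have "complex_of_real (sqrt Y) = of_real Y powr (1/2)"
    using Y powr_of_real[of Y "1/2"] by (simp add: powr_half_sqrt)
  then have 2: "complex_of_real (sqrt Y) * of_real Y powr (s - 1/2) = of_real Y powr s"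
    by (simp add: powr_add[symmetric])
  have "seed n s \<zeta> = ee (of_real (- real n * Re \<zeta>)) *
     (of_real pi powr (s - 1/2) * (complex_of_real (sqrt Y) * of_real Y powr (s - 1/2)) * Bessel_E s Y)"
    unfolding seed_def 1 Y_def[symmetric] by (simp add: mult_ac)
  then show ?thesis unfolding 2 .
qed

text \<open>The seed at the image of \<tau> under a matrix with bottom row (c, w), written without
  the top row. That image is a/c - 1/(Q c (c \<tau> + w)), where a/c enters only through
  \<open>twist\<close>, and its imaginary part is Im \<tau> divided by Q |c \<tau> + w|^2.\<close>

definition row_term :: "nat \<Rightarrow> nat \<Rightarrow> complex \<Rightarrow> int \<Rightarrow> int \<Rightarrow> complex \<Rightarrow> complex" where
  "row_term n Q \<tau> c w s =
     (let u = of_int c * \<tau> + of_int w; Y = real n * Im \<tau> / real Q / (norm u)\<^sup>2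
      in twist n Q c w * (ee (of_real (real n * Re (1 / (of_nat Q * of_int c * u)))) *
           (of_real pi powr (s - 1/2) * of_real Y powr s * Bessel_E s Y)))"

text \<open>Coefficient of the leading behaviour: for large c + |w| the exponential in
  \<open>row_term\<close> tends to 1 and \<open>Bessel_E\<close> to \<open>rGamma (s + 1/2)\<close>,
  leaving the twist and a power of |c \<tau> + w|.\<close>

definition row_main :: "nat \<Rightarrow> nat \<Rightarrow> complex \<Rightarrow> complex \<Rightarrow> complex" where
  "row_main n Q \<tau> s = of_real pi powr (s - 1/2) * of_real (real n * Im \<tau> / real Q) powr s * rGamma (s + 1/2)"

text \<open>The exponential and \<open>Bessel_E\<close> each differ from their limits by a multiple
  of 1 / (c + |w|). This extra power makes the remainder absolutely summable over all rows down to
  Re s = 0.99, so that cancellation has to be exploited only in the main term.\<close>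

lemma row_term_bounds:
  assumes n: "n > 0" and Q: "Q > 0" and \<tau>: "Im \<tau> > 0"
  obtains K where "K \<ge> 0"
    "\<And>c w s. \<lbrakk>c > 0; 0.99 \<le> Re s; norm s \<le> B\<rbrakk> \<Longrightarrow>
        norm (row_term n Q \<tau> c w s) \<le> K * (of_int c + \<bar>of_int w\<bar>) powr (- 2 * Re s)"
    "\<And>c w s. \<lbrakk>c > 0; 0.99 \<le> Re s; norm s \<le> B\<rbrakk> \<Longrightarrow>
        norm (row_term n Q \<tau> c w s - row_main n Q \<tau> s * (twist n Q c w * of_real (norm (of_int c * \<tau> + of_int w)) powr (- 2 * s)))
          \<le> K * (of_int c + \<bar>of_int w\<bar>) powr (- 2.98)"
    "\<And>s. \<lbrakk>0.99 \<le> Re s; norm s \<le> B\<rbrakk> \<Longrightarrow> norm (row_main n Q \<tau> s) \<le> K"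
proof -
  obtain \<kappa> where lb: "lattice_bound \<kappa> \<tau>" using lattice_bound_exists[of \<tau>] \<tau> by auto
  have \<kappa>: "\<kappa> > 0" using lb by (simp add: lattice_bound_def)
  define y0 where "y0 = real n * Im \<tau> / real Q"
  have y0: "y0 > 0" using n Q \<tau> by (simp add: y0_def)
  define d where "d = y0 / \<kappa>\<^sup>2"
  have d: "d > 0" using y0 \<kappa> by (simp add: d_def)
  have "compact ((\<lambda>s. rGamma (s + 1/2 :: complex)) ` cball 0 B)"
    by (intro compact_continuous_image holomorphic_on_imp_continuous_on holomorphic_intros) auto
  then have "bounded ((\<lambda>s. rGamma (s + 1/2 :: complex)) ` cball 0 B)" by (rule compact_imp_bounded)
  then obtain G where "\<forall>x \<in> (\<lambda>s. rGamma (s + 1/2 :: complex)) ` cball 0 B. norm x \<le> G"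
    unfolding bounded_iff by blast
  then have G: "\<And>s. s \<in> cball 0 B \<Longrightarrow> norm (rGamma (s + 1/2 :: complex)) \<le> G" by blast
  define G' where "G' = max 0 G"
  have G': "G' \<ge> 0" "\<And>s::complex. norm s \<le> B \<Longrightarrow> norm (rGamma (s + 1/2)) \<le> G'"
    using G by (fastforce simp: G'_def)+
  define P where "P = pi powr B"
  \<comment> \<open>One bound for both \<open>d powr Re s\<close> and \<open>y0 powr Re s\<close>;
    the base is raised to at least 1 so that the exponent may be enlarged to
    \<open>B\<close>.\<close>
  define m where "m = max 1 (max d y0) powr B"
  define X0 where "X0 = (pi * d)\<^sup>2"
  define T0 where "T0 = 2 * pi * n / \<kappa>"
  have nn: "P \<ge> 0" "m \<ge> 0" "X0 \<ge> 0" "T0 \<ge> 0" using \<kappa> by (auto simp: P_def m_def X0_def T0_def)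
  define K2 where "K2 = T0 * exp T0 * (G' * exp X0) + G' * (X0 * exp X0)"
  have K2: "K2 \<ge> 0" using nn G' by (simp add: K2_def)
  have pows: "norm (of_real pi powr (s - 1/2)) \<le> P" "\<And>t. 0 < t \<Longrightarrow> t \<le> max d y0 \<Longrightarrow> t powr Re s \<le> m"
    if s: "0.99 \<le> Re s" "norm s \<le> B" for s
  proof -
    have sB: "Re s \<le> B" using s complex_Re_le_cmod[of s] by linarith
    have "norm (of_real pi powr (s - 1/2)) = pi powr (Re s - 1/2)" by (simp add: norm_powr_real_powr)
    also have "\<dots> \<le> pi powr B" using sB pi_gt3 by (intro powr_mono) auto
    finally show "norm (of_real pi powr (s - 1/2)) \<le> P" by (simp add: P_def)
    fix t assume t: "0 < t" "t \<le> max d y0"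
    have "t powr Re s \<le> max 1 (max d y0) powr Re s" using t s by (intro powr_mono2) auto
    also have "\<dots> \<le> max 1 (max d y0) powr B" using sB by (intro powr_mono) auto
    finally show "t powr Re s \<le> m" by (simp add: m_def)
  qed
  have main: "norm (row_term n Q \<tau> c w s) \<le> P * m * (G' * exp X0) * (of_int c + \<bar>of_int w\<bar>) powr (- 2 * Re s) \<and>
     norm (row_term n Q \<tau> c w s - row_main n Q \<tau> s * (twist n Q c w * of_real (norm (of_int c * \<tau> + of_int w)) powr (- 2 * s)))
          \<le> P * m * K2 * (of_int c + \<bar>of_int w\<bar>) powr (- 2.98)"
    if c: "c > 0" and s: "0.99 \<le> Re s" "norm s \<le> B" for c w s
  proof -
    define L where "L = real_of_int c + \<bar>real_of_int w\<bar>"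
    have L: "L \<ge> 1" using c by (simp add: L_def)
    define u where "u = of_int c * \<tau> + of_int w"
    have uL: "\<kappa> * L \<le> norm u" using lattice_bound_int(1)[OF lb c, of w] by (simp add: L_def u_def)
    have \<kappa>L: "\<kappa> * L > 0" using \<kappa> L by simp
    have u: "norm u > 0" using uL \<kappa>L by linarith
    define Y where "Y = y0 / (norm u)\<^sup>2"
    have Y: "Y > 0" using y0 u by (simp add: Y_def)
    have "Y \<le> y0 / (\<kappa> * L)\<^sup>2"
      unfolding Y_def using y0 \<kappa>L uL u
      by (intro divide_left_mono power_mono mult_pos_pos[OF zero_less_power zero_less_power]) linarith+
    then have YL: "Y \<le> d / L\<^sup>2" by (simp add: d_def power_mult_distrib)
    have L2: "L\<^sup>2 \<ge> L" "L\<^sup>2 \<ge> 1" using L by (auto simp: power2_eq_square intro: mult_le_one order_trans[OF L] mult_left_le)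
    have Yd: "Y \<le> d" using order_trans[OF YL frac_le[of d d 1 "L\<^sup>2"]] L2 d by simp
    define X where "X = (pi * Y)\<^sup>2"
    have X0: "X \<le> X0" unfolding X_def X0_def using Y Yd by (intro power_mono mult_left_mono) auto
    have Xn: "X \<ge> 0" by (simp add: X_def)
    have XL: "X \<le> X0 / L"
    proof -
      have "Y \<le> d / L" using order_trans[OF YL, of "d / L"] L2 d L by (simp add: frac_le)
      then have "Y * Y \<le> d / L * d" using Y Yd d L by (intro mult_mono) auto
      then have "pi\<^sup>2 * (Y * Y) \<le> pi\<^sup>2 * (d / L * d)" by (intro mult_left_mono) auto
      then show ?thesis by (simp add: X_def X0_def power2_eq_square mult_ac)
    qed
    define v where "v = 1 / (of_nat Q * of_int c * u)"
    define t where "t = real n * Re v"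
    have "norm v \<le> 1 / (\<kappa> * L)"
    proof -
      have "1 * (\<kappa> * L) \<le> (real Q * of_int c) * norm u"
        using uL Q c \<kappa> L mult_mono[of 1 "real Q" 1 "of_int c"] by (intro mult_mono) auto
      then have "1 / ((real Q * of_int c) * norm u) \<le> 1 / (\<kappa> * L)"
        using \<kappa> L by (intro one_over_antimono) auto
      then show ?thesis using c by (simp add: v_def norm_divide norm_mult)
    qed
    then have "\<bar>Re v\<bar> \<le> 1 / (\<kappa> * L)" using abs_Re_le_cmod[of v] by linarith
    then have "2 * pi * (real n * \<bar>Re v\<bar>) \<le> 2 * pi * (real n * (1 / (\<kappa> * L)))"
      by (intro mult_left_mono) auto
    then have tL: "2 * pi * \<bar>t\<bar> \<le> T0 / L" using \<kappa> by (simp add: t_def T0_def abs_mult mult_ac)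
    have t0: "2 * pi * \<bar>t\<bar> \<le> T0" using order_trans[OF tL frac_le[of T0 T0 1 L]] L nn by simp
    have ee1: "norm (ee (of_real t) - 1) \<le> T0 * exp T0 / L"
    proof -
      have "norm (ee (of_real t) - 1) \<le> norm (2 * of_real pi * \<i> * of_real t) * exp (norm (2 * of_real pi * \<i> * of_real t))"
        unfolding ee_def by (rule norm_exp_minus_one_le)
      also have "norm (2 * of_real pi * \<i> * complex_of_real t) = 2 * pi * \<bar>t\<bar>" by (simp add: norm_mult)
      also have "2 * pi * \<bar>t\<bar> * exp (2 * pi * \<bar>t\<bar>) \<le> T0 / L * exp T0" using tL t0 nn L by (intro mult_mono) auto
      finally show ?thesis by simp
    qed
    have nee: "norm (ee (of_real t)) = 1" by (simp add: norm_ee)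
    have sh: "Re s \<ge> 1/2" using s by simp
    have gs: "norm (rGamma (s + 1/2)) \<le> G'" by (rule G'(2)[OF s(2)])
    have E1: "norm (Bessel_E s Y) \<le> G' * exp X0"
      using order_trans[OF Bessel_E_bounds(1)[OF sh, of Y] mult_mono[OF gs]] X0 G' by (simp add: X_def)
    have E2: "norm (Bessel_E s Y - rGamma (s + 1/2)) \<le> G' * (X0 / L * exp X0)"
    proof -
      have XE: "X * exp X \<le> X0 / L * exp X0" using XL X0 Xn nn L by (intro mult_mono) auto
      have "norm (rGamma (s + 1/2)) * (X * exp X) \<le> G' * (X0 / L * exp X0)"
        by (rule mult_mono[OF gs XE G'(1)]) (use Xn in simp)
      then show ?thesis using Bessel_E_bounds(2)[OF sh, of Y] by (simp add: X_def)
    qed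
    have Ypow: "norm (of_real Y powr s) \<le> m * L powr (- 2 * Re s)"
    proof -
      have "norm (of_real Y powr s) = Y powr Re s" using Y by (simp add: norm_powr_real_powr)
      also have "\<dots> \<le> (d / L\<^sup>2) powr Re s" using YL Y s by (intro powr_mono2) auto
      also have "\<dots> = d powr Re s * L powr (- 2 * Re s)"
      proof -
        have "L\<^sup>2 = L powr 2" using L by simp
        then have "(L\<^sup>2) powr Re s = L powr (2 * Re s)" by (simp only: powr_powr)
        moreover have "(d / L\<^sup>2) powr Re s = d powr Re s / (L\<^sup>2) powr Re s" using d L by (simp add: powr_divide)
        ultimately show ?thesis by (simp add: powr_minus divide_inverse)
      qed
      also have "\<dots> \<le> m * L powr (- 2 * Re s)" using pows(2)[OF s, of d] d by (intro mult_right_mono) auto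
      finally show ?thesis .
    qed
    have pre: "norm (twist n Q c w * (of_real pi powr (s - 1/2) * of_real Y powr s)) \<le> P * m * L powr (- 2 * Re s)"
    proof -
      have "norm (twist n Q c w * (of_real pi powr (s - 1/2) * of_real Y powr s)) \<le> 1 * (P * (m * L powr (- 2 * Re s)))"
        unfolding norm_mult using norm_twist_le[of n Q c w] pows(1)[OF s] Ypow nn
        by (intro mult_mono) auto
      then show ?thesis by (simp add: mult_ac)
    qed
    have rt: "row_term n Q \<tau> c w s = twist n Q c w * (of_real pi powr (s - 1/2) * of_real Y powr s) * (ee (of_real t) * Bessel_E s Y)"
      unfolding row_term_def Let_def u_def[symmetric] v_def[symmetric] y0_def[symmetric] Y_def[symmetric] t_def[symmetric]
      by (simp add: mult_ac)
    have up: "of_real (norm u) powr (- 2 * s) * of_real y0 powr s = complex_of_real Y powr s"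
    proof -
      have "complex_of_real Y powr s = exp (s * of_real (ln Y))" using Y by (simp add: powr_def Ln_of_real)
      also have "ln Y = ln y0 - 2 * ln (norm u)" using y0 u by (simp add: Y_def ln_div ln_realpow)
      also have "exp (s * of_real (ln y0 - 2 * ln (norm u))) = of_real (norm u) powr (- 2 * s) * of_real y0 powr s"
        using y0 u by (simp add: powr_def Ln_of_real exp_add[symmetric] algebra_simps)
      finally show ?thesis by simp
    qed
    have dif: "row_term n Q \<tau> c w s - row_main n Q \<tau> s * (twist n Q c w * of_real (norm u) powr (- 2 * s)) =
       twist n Q c w * (of_real pi powr (s - 1/2) * of_real Y powr s) * (ee (of_real t) * Bessel_E s Y - rGamma (s + 1/2))"
      unfolding rt row_main_def y0_def[symmetric] up[symmetric] by (simp add: algebra_simps)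
    \<comment> \<open>The two factors are replaced by their limits one after the other.\<close>
    have inner: "norm (ee (of_real t) * Bessel_E s Y - rGamma (s + 1/2)) \<le> K2 / L"
    proof -
      have "ee (of_real t) * Bessel_E s Y - rGamma (s + 1/2) =
          (ee (of_real t) - 1) * Bessel_E s Y + (Bessel_E s Y - rGamma (s + 1/2))" by (simp add: algebra_simps)
      also have "norm \<dots> \<le> norm (ee (of_real t) - 1) * norm (Bessel_E s Y) + norm (Bessel_E s Y - rGamma (s + 1/2))"
        using norm_triangle_ineq norm_mult by metis
      also have "\<dots> \<le> T0 * exp T0 / L * (G' * exp X0) + G' * (X0 / L * exp X0)"
        using ee1 E1 E2 nn L by (intro add_mono mult_mono) auto
      also have "\<dots> = K2 / L" by (simp add: K2_def add_divide_distrib)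
      finally show ?thesis .
    qed
    have "norm (row_term n Q \<tau> c w s) \<le> P * m * L powr (- 2 * Re s) * (1 * (G' * exp X0))"
      unfolding rt norm_mult[of _ "ee (of_real t) * Bessel_E s Y"] norm_mult[of "ee (of_real t)"] nee
      using pre E1 nn G' by (intro mult_mono) auto
    moreover have "norm (row_term n Q \<tau> c w s - row_main n Q \<tau> s * (twist n Q c w * of_real (norm u) powr (- 2 * s)))
       \<le> P * m * L powr (- 2 * Re s) * (K2 / L)"
      unfolding dif norm_mult[of _ "ee (of_real t) * Bessel_E s Y - rGamma (s + 1/2)"]
      using pre inner nn by (intro mult_mono) auto
    moreover have "P * m * L powr (- 2 * Re s) * (K2 / L) \<le> P * m * K2 * L powr (- 2.98)"
    proof -
      have "L powr (- 2 * Re s) / L = L powr (- 2 * Re s - 1)" using L by (simp add: powr_diff)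
      also have "\<dots> \<le> L powr (- 2.98)" using L s by (intro powr_mono) auto
      finally have "P * m * K2 * (L powr (- 2 * Re s) / L) \<le> P * m * K2 * L powr (- 2.98)"
        using nn K2 by (intro mult_left_mono) auto
      then show ?thesis by (simp add: mult_ac)
    qed
    ultimately show ?thesis by (simp add: L_def u_def mult_ac)
  qed
  define K where "K = P * m * (G' * exp X0) + P * m * K2 + P * m * G'"
  have Ks: "P * m * (G' * exp X0) \<le> K" "P * m * K2 \<le> K" "P * m * G' \<le> K" "K \<ge> 0"
    using nn K2 G' by (auto simp: K_def)
  show thesis
  proof (rule that[of K])
    show "K \<ge> 0" by (rule Ks)
    fix s assume s: "0.99 \<le> Re s" "norm s \<le> B"
    have "norm (row_main n Q \<tau> s) \<le> P * m * G'"
      unfolding row_main_def y0_def[symmetric] norm_mult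
      using pows(1)[OF s] pows(2)[OF s, of y0] y0 G'(1) G'(2)[OF s(2)] nn
      by (intro mult_mono) (auto simp: norm_powr_real_powr)
    then show "norm (row_main n Q \<tau> s) \<le> K" using Ks by linarith
    fix c w :: int assume c: "c > 0"
    note main[OF c s, of w]
    moreover have "P * m * (G' * exp X0) * (of_int c + \<bar>of_int w\<bar>) powr (- 2 * Re s) \<le> K * (of_int c + \<bar>of_int w\<bar>) powr (- 2 * Re s)"
      "P * m * K2 * (of_int c + \<bar>of_int w\<bar>) powr (- 2.98) \<le> K * (of_int c + \<bar>of_int w\<bar>) powr (- 2.98)"
      using Ks by (auto intro!: mult_right_mono)
    ultimately show "norm (row_term n Q \<tau> c w s) \<le> K * (of_int c + \<bar>of_int w\<bar>) powr (- 2 * Re s)"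
      "norm (row_term n Q \<tau> c w s - row_main n Q \<tau> s * (twist n Q c w * of_real (norm (of_int c * \<tau> + of_int w)) powr (- 2 * s)))
          \<le> K * (of_int c + \<bar>of_int w\<bar>) powr (- 2.98)"
      by (meson order_trans)+
  qed
qed

text \<open>Mean value estimate on the real segment between a and b. As Re z \<le> 1, the norm of
  the derivative there is bounded by its size at the lower end r.\<close>

lemma norm_powr_diff_le:
  fixes a b r :: real and z :: complex
  assumes "r > 0" "r \<le> a" "r \<le> b" "Re z \<le> 1"
  shows "norm (of_real a powr z - of_real b powr z) \<le> norm z * r powr (Re z - 1) * \<bar>a - b\<bar>"
proof -
  let ?S = "closed_segment (complex_of_real a) (of_real b)"
  have ab: "complex_of_real a \<in> ?S" "complex_of_real b \<in> ?S" "convex ?S"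
    by (rule ends_in_segment convex_closed_segment)+
  have pt: "\<exists>x. t = of_real x \<and> r \<le> x" if "t \<in> ?S" for t
  proof -
    have "t \<in> of_real ` closed_segment a b" using that unfolding closed_segment_of_real .
    then obtain x where x: "t = of_real x" "x \<in> closed_segment a b" ..
    then have "x \<ge> r" using assms(2,3) unfolding closed_segment_eq_real_ivl by (simp split: if_splits)
    then show ?thesis using x(1) by blast
  qed
  have deriv: "((\<lambda>t. t powr z) has_field_derivative z * t powr (z - 1)) (at t within ?S)" if "t \<in> ?S" for t
  proof -
    have "t \<notin> \<real>\<^sub>\<le>\<^sub>0" using assms pt[OF that] by (auto simp: complex_nonpos_Reals_iff)
    then show ?thesis by (rule has_field_derivative_at_within[OF has_field_derivative_powr])
  qed
  have bd: "norm (z * t powr (z - 1)) \<le> norm z * r powr (Re z - 1)" if t: "t \<in> ?S" for t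
  proof -
    obtain x where x: "t = of_real x" "r \<le> x" using pt[OF t] by blast
    have "norm (t powr (z - 1)) = x powr (Re z - 1)" unfolding x(1) using x assms(1) by (simp add: norm_powr_real_powr)
    also have "\<dots> \<le> r powr (Re z - 1)" using x assms by (intro powr_mono2') auto
    finally show ?thesis unfolding norm_mult by (rule mult_left_mono) simp
  qed
  have "norm (of_real a powr z - of_real b powr z) \<le> (norm z * r powr (Re z - 1)) * norm (complex_of_real a - of_real b)"
    by (rule field_differentiable_bound[OF ab(3) deriv bd ab(1,2)])
  also have "norm (complex_of_real a - of_real b) = \<bar>a - b\<bar>" by (metis norm_of_real of_real_diff)
  finally show ?thesis .
qed

text \<open>Supplies the hypotheses of \<open>twist_sum_bound\<close> for the main term. For Re s
  \<ge> 0.99 the weights sum to at most a multiple of c powr (1.01 - 1.98), which is c times c powr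
  (-1.97). Differences gain one more power, because |c \<tau> + w| changes by at most 1 from one w
  to the next.\<close>

lemma norm_power_row_variation:
  fixes \<tau> s :: complex
  assumes lb: "lattice_bound \<kappa> \<tau>" and c: "c > 0" and s: "0.99 \<le> Re s" "norm s \<le> B"
  defines "h \<equiv> (\<lambda>w::int. complex_of_real (norm (of_int c * \<tau> + of_int w)) powr (- 2 * s))"
  defines "V \<equiv> (1 + 2 * B) * (\<kappa> / 2) powr (- (2 * B + 1)) * row_const * of_int c powr (- 1.97)"
  shows "(\<lambda>w. norm (h w)) summable_on UNIV"
    and "(\<Sum>\<^sub>\<infinity>w. norm (h w)) \<le> of_int c * V"
    and "(\<Sum>\<^sub>\<infinity>w. norm (h (w + 1) - h w)) \<le> V"
proof -
  have \<kappa>: "0 < \<kappa> / 2" "\<kappa> / 2 \<le> 1" using lb by (auto simp: lattice_bound_def)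
  have sB: "Re s \<le> B" using s complex_Re_le_cmod[of s] by linarith
  have B: "B \<ge> 0" using s(2) norm_ge_zero[of s] by linarith
  define k where "k = (\<kappa> / 2) powr (- (2 * B + 1))"
  have k: "k \<ge> 0" by (simp add: k_def)
  have kp: "(\<kappa> / 2) powr a \<le> k" if "a \<ge> - (2 * B + 1)" for a
    unfolding k_def using \<kappa> that by (intro powr_mono') auto
  have c1: "real_of_int c \<ge> 1" using c by simp
  define L where "L w = real_of_int c + \<bar>real_of_int w\<bar>" for w
  have L: "L w \<ge> 1" for w using c1 by (simp add: L_def)
  have lo: "\<kappa> / 2 * L w \<le> norm (of_int c * \<tau> + of_int w)" "\<kappa> / 2 * L w \<le> norm (of_int c * \<tau> + of_int (w + 1))" "\<kappa> / 2 * L w > 0" for w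
  proof -
    have "\<kappa> / 2 * L w \<le> \<kappa> * L w" using \<kappa> L[of w] by (intro mult_right_mono) auto
    then show "\<kappa> / 2 * L w \<le> norm (of_int c * \<tau> + of_int w)"
      using lattice_bound_int(1)[OF lb c, of w, folded L_def] by linarith
    show "\<kappa> / 2 * L w \<le> norm (of_int c * \<tau> + of_int (w + 1))" "\<kappa> / 2 * L w > 0"
      by (rule lattice_bound_int(2,3)[OF lb c, of w, folded L_def])+
  qed
  have split: "(\<kappa> / 2 * L w) powr a = (\<kappa> / 2) powr a * L w powr a" for w a
    by (rule powr_mult)
  have h0: "norm (h w) \<le> k * L w powr (- 1.98)" for w
  proof -
    have "norm (h w) = norm (of_int c * \<tau> + of_int w) powr (- 2 * Re s)"
      using order_less_le_trans[OF lo(3) lo(1), of w] by (simp add: h_def norm_powr_real_powr)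
    also have "\<dots> \<le> (\<kappa> / 2 * L w) powr (- 2 * Re s)"
      using lo[of w] s by (intro powr_mono2') auto
    also have "\<dots> = (\<kappa> / 2) powr (- 2 * Re s) * L w powr (- 2 * Re s)" by (rule split)
    also have "\<dots> \<le> k * L w powr (- 1.98)"
      using sB s L[of w] k by (intro mult_mono kp powr_mono) auto
    finally show ?thesis .
  qed
  have h1: "norm (h (w + 1) - h w) \<le> 2 * B * k * L w powr (- 2.98)" for w
  proof -
    let ?a = "norm (of_int c * \<tau> + of_int (w + 1))" and ?b = "norm (of_int c * \<tau> + of_int w)"
    have "\<bar>?a - ?b\<bar> \<le> 1"
      using norm_triangle_ineq3[of "of_int c * \<tau> + of_int (w + 1)" "of_int c * \<tau> + of_int w"] by simp
    moreover have "norm (h (w + 1) - h w) \<le> norm (- 2 * s) * (\<kappa> / 2 * L w) powr (Re (- 2 * s) - 1) * \<bar>?a - ?b\<bar>"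
      unfolding h_def using lo[of w] s by (intro norm_powr_diff_le) auto
    ultimately have "norm (h (w + 1) - h w) \<le> norm (- 2 * s) * (\<kappa> / 2 * L w) powr (Re (- 2 * s) - 1)"
      by (elim order_trans) (rule mult_left_le, simp_all)
    also have "\<dots> = (2 * norm s) * ((\<kappa> / 2) powr (- 2 * Re s - 1) * L w powr (- 2 * Re s - 1))"
      unfolding split by (simp add: norm_mult)
    also have "\<dots> \<le> (2 * B) * (k * L w powr (- 2.98))"
      using sB s L[of w] k B by (intro mult_mono kp powr_mono) auto
    finally show ?thesis by (simp add: mult_ac)
  qed
  have sm0: "(\<lambda>w. k * L w powr (- 1.98)) summable_on UNIV"
    unfolding L_def by (intro summable_on_cmult_right row_sum(1) c) simp
  have sm1: "(\<lambda>w. 2 * B * k * L w powr (- 2.98)) summable_on UNIV"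
    unfolding L_def by (intro summable_on_cmult_right row_sum(1) c) simp
  show "(\<lambda>w. norm (h w)) summable_on UNIV" by (rule abs_summable_on_bounded_by(1)[OF h0 sm0])
  have "(\<Sum>\<^sub>\<infinity>w. norm (h w)) \<le> (\<Sum>\<^sub>\<infinity>w. k * L w powr (- 1.98))"
    by (rule infsum_mono[OF abs_summable_on_bounded_by(1)[OF h0 sm0] sm0 h0])
  also have "\<dots> = k * (\<Sum>\<^sub>\<infinity>w. L w powr (- 1.98))"
    unfolding L_def by (intro infsum_cmult_right row_sum(1) c) simp
  also have "\<dots> \<le> k * (row_const * of_int c powr (1.01 - 1.98))"
    unfolding L_def using k c by (intro mult_left_mono row_sum(2)) auto
  also have "of_int c powr (1.01 - 1.98) = of_int c * of_int c powr (- 1.97 :: real)"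
    using powr_add[of "of_int c" 1 "- 1.97 :: real"] c1 by simp
  also have "k * (row_const * (of_int c * of_int c powr (- 1.97))) \<le> of_int c * V"
  proof -
    have "1 * (k * row_const * of_int c powr (- 1.97)) \<le> (1 + 2 * B) * (k * row_const * of_int c powr (- 1.97))"
      using B k row_const_nonneg by (intro mult_right_mono) auto
    then have "k * row_const * of_int c powr (- 1.97) \<le> V" by (simp add: V_def k_def mult_ac)
    then have "of_int c * (k * row_const * of_int c powr (- 1.97)) \<le> of_int c * V" using c1 by (intro mult_left_mono) auto
    then show ?thesis by (simp add: mult_ac)
  qed
  finally show "(\<Sum>\<^sub>\<infinity>w. norm (h w)) \<le> of_int c * V" .
  have "(\<Sum>\<^sub>\<infinity>w. norm (h (w + 1) - h w)) \<le> (\<Sum>\<^sub>\<infinity>w. 2 * B * k * L w powr (- 2.98))"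
    by (rule infsum_mono[OF abs_summable_on_bounded_by(1)[OF h1 sm1] sm1 h1])
  also have "\<dots> = 2 * B * k * (\<Sum>\<^sub>\<infinity>w. L w powr (- 2.98))"
    unfolding L_def by (intro infsum_cmult_right row_sum(1) c) simp
  also have "\<dots> \<le> 2 * B * k * (row_const * of_int c powr (1.01 - 2.98))"
    unfolding L_def using k B c by (intro mult_left_mono row_sum(2)) auto
  also have "\<dots> = 2 * B * (k * row_const * of_int c powr (- 1.97))" by simp
  also have "\<dots> \<le> (1 + 2 * B) * (k * row_const * of_int c powr (- 1.97))"
    using k row_const_nonneg by (intro mult_right_mono) auto
  also have "\<dots> = V" by (simp add: V_def k_def mult_ac)
  finally show "(\<Sum>\<^sub>\<infinity>w. norm (h (w + 1) - h w)) \<le> V" .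
qed

definition row_sum :: "nat \<Rightarrow> nat \<Rightarrow> complex \<Rightarrow> int \<Rightarrow> complex \<Rightarrow> complex" where
  "row_sum n Q \<tau> c s = (\<Sum>\<^sub>\<infinity>w. row_term n Q \<tau> c w s)"

text \<open>The main term profits from the twist, -1.97 + 0.9475 = -1.0225, while the remainder is
  estimated termwise, 1.01 - 2.98 = -1.97. Both exponents lie below -1.02, uniformly for s in a
  bounded part of Re s \<ge> 0.99.\<close>

lemma row_sum_bound:
  assumes n: "n > 0" and Q: "Q > 0" and \<tau>: "Im \<tau> > 0"
  obtains K where "\<And>c s. \<lbrakk>c > 0; coprime (int Q) c; 0.99 \<le> Re s; norm s \<le> B\<rbrakk> \<Longrightarrow>
        norm (row_sum n Q \<tau> c s) \<le> K * of_int c powr (- 1.02)"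
proof -
  obtain K where K: "K \<ge> 0"
    "\<And>c w s. \<lbrakk>c > 0; 0.99 \<le> Re s; norm s \<le> B\<rbrakk> \<Longrightarrow>
        norm (row_term n Q \<tau> c w s - row_main n Q \<tau> s * (twist n Q c w * of_real (norm (of_int c * \<tau> + of_int w)) powr (- 2 * s)))
          \<le> K * (of_int c + \<bar>of_int w\<bar>) powr (- 2.98)"
    "\<And>s. \<lbrakk>0.99 \<le> Re s; norm s \<le> B\<rbrakk> \<Longrightarrow> norm (row_main n Q \<tau> s) \<le> K"
    by (rule row_term_bounds[OF n Q \<tau>, of B]) blast
  obtain C where C: "C \<ge> 0"
    "\<And>Q c h V. \<lbrakk>c > 0; coprime (int Q) c; (\<lambda>w. norm (h w)) summable_on UNIV;
        (\<Sum>\<^sub>\<infinity>w. norm (h w)) \<le> of_int c * V; (\<Sum>\<^sub>\<infinity>w. norm (h (w + 1) - h w)) \<le> V\<rbrakk> \<Longrightarrow>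
      norm (\<Sum>\<^sub>\<infinity>w. twist n Q c w * h w) \<le> C * V * of_int c powr 0.9475"
    by (rule twist_sum_bound[OF n]) blast
  obtain \<kappa> where lb: "lattice_bound \<kappa> \<tau>" using lattice_bound_exists[of \<tau>] \<tau> by auto
  define v where "v = (1 + 2 * B) * (\<kappa> / 2) powr (- (2 * B + 1)) * row_const"
  show thesis
  proof (rule that[of "K * (C * v) + K * row_const"])
    fix c s assume c: "c > 0" "coprime (int Q) c" and s: "0.99 \<le> Re s" "norm s \<le> B"
    have c1: "real_of_int c \<ge> 1" using c by simp
    have "B \<ge> 0" using order_trans[OF norm_ge_zero s(2)] .
    then have v: "v \<ge> 0" unfolding v_def using row_const_nonneg by simp
    define h where "h w = complex_of_real (norm (of_int c * \<tau> + of_int w)) powr (- 2 * s)" for w :: int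
    note var = norm_power_row_variation[OF lb c(1) s, folded h_def, folded v_def]
    define r where "r w = row_term n Q \<tau> c w s - row_main n Q \<tau> s * (twist n Q c w * h w)" for w
    have r: "norm (r w) \<le> K * (of_int c + \<bar>of_int w\<bar>) powr (- 2.98)" for w
      using K(2)[OF c(1) s, of w] by (simp add: r_def h_def)
    have sm: "(\<lambda>w::int. K * (of_int c + \<bar>of_int w\<bar>) powr (- 2.98)) summable_on UNIV"
      by (intro summable_on_cmult_right row_sum(1) c) simp
    note r' = abs_summable_on_bounded_by[OF r sm]
    have th: "(\<lambda>w. twist n Q c w * h w) summable_on UNIV"
    proof (rule abs_summable_on_bounded_by(2)[OF _ var(1)])
      show "norm (twist n Q c w * h w) \<le> norm (h w)" for w
        using mult_right_mono[OF norm_twist_le[of n Q c w], of "norm (h w)"] by (simp add: norm_mult)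
    qed
    have "row_sum n Q \<tau> c s = (\<Sum>\<^sub>\<infinity>w. row_main n Q \<tau> s * (twist n Q c w * h w) + r w)"
      unfolding row_sum_def r_def by simp
    also have "\<dots> = (\<Sum>\<^sub>\<infinity>w. row_main n Q \<tau> s * (twist n Q c w * h w)) + infsum r UNIV"
      by (intro infsum_add summable_on_cmult_right th r'(2))
    also have "\<dots> = row_main n Q \<tau> s * (\<Sum>\<^sub>\<infinity>w. twist n Q c w * h w) + infsum r UNIV"
      by (simp add: infsum_cmult_right th)
    finally have "norm (row_sum n Q \<tau> c s) \<le> norm (row_main n Q \<tau> s) * norm (\<Sum>\<^sub>\<infinity>w. twist n Q c w * h w) + norm (infsum r UNIV)"
      using norm_triangle_ineq norm_mult by metis
    also have "\<dots> \<le> K * (C * v * of_int c powr (- 1.02)) + K * row_const * of_int c powr (- 1.02)"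
    proof (intro add_mono mult_mono K(3) s)
      have "norm (\<Sum>\<^sub>\<infinity>w. twist n Q c w * h w) \<le> C * (v * of_int c powr (- 1.97)) * of_int c powr 0.9475"
        by (rule C(2)[OF c var])
      also have "\<dots> = C * v * (of_int c powr (- 1.97) * of_int c powr 0.9475)" by simp
      also have "of_int c powr (- 1.97) * of_int c powr 0.9475 = of_int c powr (- 1.0225 :: real)"
        by (simp add: powr_add[symmetric])
      also have "C * v * of_int c powr (- 1.0225) \<le> C * v * of_int c powr (- 1.02)"
        using C v c1 by (intro mult_left_mono powr_mono) auto
      finally show "norm (\<Sum>\<^sub>\<infinity>w. twist n Q c w * h w) \<le> C * v * of_int c powr (- 1.02)" .
      have "norm (infsum r UNIV) \<le> (\<Sum>\<^sub>\<infinity>w::int. K * (of_int c + \<bar>of_int w\<bar>) powr (- 2.98))" by (rule r'(3))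
      also have "\<dots> = K * (\<Sum>\<^sub>\<infinity>w::int. (of_int c + \<bar>of_int w\<bar>) powr (- 2.98))"
        by (intro infsum_cmult_right row_sum(1) c) simp
      also have "\<dots> \<le> K * (row_const * of_int c powr (1.01 - 2.98))"
        using K(1) c by (intro mult_left_mono row_sum(2)) auto
      also have "\<dots> \<le> K * (row_const * of_int c powr (- 1.02))"
        using K(1) c1 row_const_nonneg by (intro mult_left_mono powr_mono) auto
      finally show "norm (infsum r UNIV) \<le> K * row_const * of_int c powr (- 1.02)" by (simp add: mult_ac)
    qed (use K(1) in auto)
    finally show "norm (row_sum n Q \<tau> c s) \<le> (K * (C * v) + K * row_const) * of_int c powr (- 1.02)"
      by (simp add: algebra_simps)
  qed
qed

section \<open>Holomorphy in s and absolute convergence to the right of 1\<close>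

lemma holomorphic_row_term:
  assumes "n > 0" "Q > 0" "Im \<tau> > 0" "c > 0"
  shows "(\<lambda>s. row_term n Q \<tau> c w s) holomorphic_on {s. Re s > 0.99}"
proof -
  have "(\<lambda>s. Bessel_E s Y) holomorphic_on {s. Re s > 0.99}" for Y
    by (rule holomorphic_on_subset[OF holomorphic_Bessel_E]) auto
  then show ?thesis unfolding row_term_def Let_def by (intro holomorphic_intros)
qed

lemma row_term_summable:
  assumes "n > 0" "Q > 0" "Im \<tau> > 0" "c > 0" "0.99 \<le> Re s"
  shows "(\<lambda>w. norm (row_term n Q \<tau> c w s)) summable_on UNIV"
proof -
  obtain K where K: "\<And>c w s'. \<lbrakk>c > 0; 0.99 \<le> Re s'; norm s' \<le> norm s\<rbrakk> \<Longrightarrow>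
        norm (row_term n Q \<tau> c w s') \<le> K * (of_int c + \<bar>of_int w\<bar>) powr (- 2 * Re s')"
    by (rule row_term_bounds[OF assms(1-3), of "norm s"]) blast
  show ?thesis
  proof (rule abs_summable_on_bounded_by(1)[OF K])
    have "(\<lambda>w::int. K * (of_int c + \<bar>of_int w\<bar>) powr (- (2 * Re s))) summable_on UNIV"
      by (intro summable_on_cmult_right row_sum(1)) (use assms in auto)
    then show "(\<lambda>w::int. K * (of_int c + \<bar>of_int w\<bar>) powr (- 2 * Re s)) summable_on UNIV" by simp
  qed (use assms in auto)
qed

lemma holomorphic_row_sum:
  assumes nQ: "n > 0" "Q > 0" "Im \<tau> > 0" "c > 0"
  shows "(\<lambda>s. row_sum n Q \<tau> c s) holomorphic_on {s. Re s > 0.99}"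
  unfolding row_sum_def
proof (rule holomorphic_infsum)
  show "open {s. Re s > 0.99}" by (rule open_halfspace_Re_gt)
  show "(\<lambda>s. row_term n Q \<tau> c w s) holomorphic_on {s. Re s > 0.99}" for w
    by (rule holomorphic_row_term[OF nQ])
  fix z assume z: "z \<in> {s. Re s > 0.99}"
  obtain K where K: "K \<ge> 0" "\<And>c w s. \<lbrakk>c > 0; 0.99 \<le> Re s; norm s \<le> norm z + 1\<rbrakk> \<Longrightarrow>
        norm (row_term n Q \<tau> c w s) \<le> K * (of_int c + \<bar>of_int w\<bar>) powr (- 2 * Re s)"
    by (rule row_term_bounds[OF nQ(1-3), of "norm z + 1"]) blast
  show "\<exists>e>0. \<exists>M. M summable_on UNIV \<and> (\<forall>w\<in>UNIV. \<forall>s\<in>ball z e \<inter> {s. Re s > 0.99}. norm (row_term n Q \<tau> c w s) \<le> M w)"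
  proof (intro exI conjI ballI)
    show "(0::real) < 1" by simp
    show "(\<lambda>w::int. K * (of_int c + \<bar>of_int w\<bar>) powr (- 1.98)) summable_on UNIV"
      by (intro summable_on_cmult_right row_sum(1) nQ) simp
    fix w s assume s: "s \<in> ball z 1 \<inter> {s. Re s > 0.99}"
    have "norm s \<le> norm z + norm (s - z)" using norm_triangle_sub[of s z] by (simp add: add.commute)
    then have "norm s \<le> norm z + 1" using s by (simp add: dist_norm norm_minus_commute)
    then have "norm (row_term n Q \<tau> c w s) \<le> K * (of_int c + \<bar>of_int w\<bar>) powr (- 2 * Re s)"
      using s nQ by (intro K(2)) auto
    also have "\<dots> \<le> K * (of_int c + \<bar>of_int w\<bar>) powr (- 1.98)"
    proof (intro mult_left_mono powr_mono K(1))
      have "1 \<le> real_of_int c" using nQ by simp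
      then show "1 \<le> real_of_int c + \<bar>real_of_int w\<bar>" by (simp add: add_increasing2)
    qed (use s in simp)
    finally show "norm (row_term n Q \<tau> c w s) \<le> K * (of_int c + \<bar>of_int w\<bar>) powr (- 1.98)" .
  qed
qed

text \<open>This is the continuation past Re s = 1: the bound c powr (-1.02) for complete rows is
  summable, whereas absolute convergence of the double series over (c, w) is established for Re s >
  1 only. Hence the sum over w has to stay inside.\<close>

lemma holomorphic_row_sums:
  assumes nQ: "n > 0" "Q > 0" "Im \<tau> > 0" and C: "\<And>c. c \<in> C \<Longrightarrow> c > 0 \<and> coprime (int Q) c"
  shows "(\<lambda>s. \<Sum>\<^sub>\<infinity>c\<in>C. row_sum n Q \<tau> c s) holomorphic_on {s. Re s > 0.99}"
proof (rule holomorphic_infsum)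
  show "open {s. Re s > 0.99}" by (rule open_halfspace_Re_gt)
  show "(\<lambda>s. row_sum n Q \<tau> c s) holomorphic_on {s. Re s > 0.99}" if "c \<in> C" for c
    using C[OF that] by (intro holomorphic_row_sum nQ) auto
  fix z assume z: "z \<in> {s. Re s > 0.99}"
  obtain K where K: "\<And>c s. \<lbrakk>c > 0; coprime (int Q) c; 0.99 \<le> Re s; norm s \<le> norm z + 1\<rbrakk> \<Longrightarrow>
        norm (row_sum n Q \<tau> c s) \<le> K * of_int c powr (- 1.02)"
    using row_sum_bound[OF nQ, of "norm z + 1"] by metis
  show "\<exists>e>0. \<exists>M. M summable_on C \<and> (\<forall>c\<in>C. \<forall>s\<in>ball z e \<inter> {s. Re s > 0.99}. norm (row_sum n Q \<tau> c s) \<le> M c)"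
  proof (intro exI conjI ballI)
    show "(0::real) < 1" by simp
    have "(\<lambda>c::int. K * of_int c powr (- 1.02)) summable_on {0<..}"
      by (intro summable_on_cmult_right summable_on_pos_int_powr) simp
    then show "(\<lambda>c::int. K * of_int c powr (- 1.02)) summable_on C"
      by (rule summable_on_subset_banach) (use C in auto)
    fix c s assume s: "c \<in> C" "s \<in> ball z 1 \<inter> {s. Re s > 0.99}"
    have "norm s \<le> norm z + norm (s - z)" using norm_triangle_sub[of s z] by (simp add: add.commute)
    then have "norm s \<le> norm z + 1" using s by (simp add: dist_norm norm_minus_commute)
    then show "norm (row_sum n Q \<tau> c s) \<le> K * of_int c powr (- 1.02)"
      using s C by (intro K) auto
  qed
qed

text \<open>Since (c + |w|)^2 \<ge> c (1 + |w|), the bound separates into a power of c and a power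
  of 1 + |w|, both with exponent -Re s < -1.\<close>

lemma row_term_summable_pairs:
  assumes nQ: "n > 0" "Q > 0" "Im \<tau> > 0" and s: "Re s > 1"
    and C: "\<And>c. c \<in> C \<Longrightarrow> c > 0"
  shows "(\<lambda>(c, w). row_term n Q \<tau> c w s) summable_on C \<times> UNIV"
proof -
  obtain K where K: "K \<ge> 0" "\<And>c w s'. \<lbrakk>c > 0; 0.99 \<le> Re s'; norm s' \<le> norm s\<rbrakk> \<Longrightarrow>
        norm (row_term n Q \<tau> c w s') \<le> K * (of_int c + \<bar>of_int w\<bar>) powr (- 2 * Re s')"
    by (rule row_term_bounds[OF nQ, of "norm s"]) blast
  let ?R = "\<Sum>\<^sub>\<infinity>w::int. (1 + \<bar>real_of_int w\<bar>) powr (- Re s)"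
  let ?g = "\<lambda>(c::int, w::int). K * of_int c powr (- Re s) * (1 + \<bar>of_int w\<bar>) powr (- Re s)"
  have "?g summable_on C \<times> UNIV"
  proof (rule summable_on_SigmaI)
    fix c assume "c \<in> C"
    show "((\<lambda>w::int. ?g (c, w)) has_sum K * of_int c powr (- Re s) * ?R) UNIV"
      unfolding prod.case using s by (intro has_sum_cmult_right has_sum_infsum summable_on_int_powr) simp
  next
    have "(\<lambda>c::int. K * of_int c powr (- Re s) * ?R) summable_on {0<..}"
      using s by (intro summable_on_cmult_right summable_on_cmult_left summable_on_pos_int_powr) simp
    then show "(\<lambda>c::int. K * of_int c powr (- Re s) * ?R) summable_on C"
      by (rule summable_on_subset_banach) (use C in auto)
  qed (use K in auto)
  then show ?thesis
  proof (rule abs_summable_on_bounded_by(2)[rotated])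
    fix p assume "p \<in> C \<times> (UNIV :: int set)"
    then obtain c w where p: "p = (c, w)" "c \<in> C" by auto
    have c: "real_of_int c \<ge> 1" "c > 0" using C[OF p(2)] by auto
    define x where "x = \<bar>real_of_int w\<bar>"
    have x: "x \<ge> 0" by (simp add: x_def)
    have "of_int c * (1 + x) \<le> (of_int c + x) powr 2"
    proof -
      have "of_int c * 1 \<le> of_int c * real_of_int c" using c by (intro mult_left_mono) auto
      moreover have "0 \<le> of_int c * x" "0 \<le> x * x" using c x by auto
      moreover have "(of_int c + x)\<^sup>2 = of_int c * of_int c + (of_int c * x + (of_int c * x + x * x))"
        by (simp add: power2_eq_square algebra_simps)
      ultimately have "of_int c * (1 + x) \<le> (of_int c + x)\<^sup>2" unfolding distrib_left by linarith
      then show ?thesis using c x by simp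
    qed
    then have "((of_int c + x) powr 2) powr (- Re s) \<le> (of_int c * (1 + x)) powr (- Re s)"
      using c x s by (intro powr_mono2') auto
    then have le: "(of_int c + x) powr (- 2 * Re s) \<le> of_int c powr (- Re s) * (1 + x) powr (- Re s)"
      by (simp add: powr_powr powr_mult)
    have "norm (row_term n Q \<tau> c w s) \<le> K * (of_int c + \<bar>of_int w\<bar>) powr (- 2 * Re s)"
      using c s by (intro K(2)) auto
    also have "\<dots> \<le> K * (of_int c powr (- Re s) * (1 + x) powr (- Re s))"
      using le K(1) unfolding x_def by (intro mult_left_mono)
    finally show "norm ((\<lambda>(c, w). row_term n Q \<tau> c w s) p) \<le> ?g p" by (simp add: p x_def)
  qed
qed

section \<open>The value at 1\<close>

text \<open>Legendre's duplication formula at k + 1 merges k! and Gamma (k + 3/2) into (2k + 1)!,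
  which makes the Bessel coefficients at s = 1 those of the hyperbolic sine.\<close>

lemma rGamma_half_duplication:
  "rGamma (of_nat k + 3/2 :: complex) / fact k = of_real (2 ^ (2 * k + 1) / (sqrt pi * fact (2 * k + 1)))"
proof -
  have inv: "inverse (inverse a * b * d) = a / (b * d)" for a b d :: real by (simp add: divide_inverse)
  have z: "(of_nat k + 1 :: complex) \<notin> \<int>\<^sub>\<le>\<^sub>0" "(of_nat k + 1 + 1/2 :: complex) \<notin> \<int>\<^sub>\<le>\<^sub>0"
    by (auto simp: elim!: nonpos_Ints_cases dest!: arg_cong[where f = Re])
  have "Gamma (of_nat k + 1 :: complex) * Gamma (of_nat k + 1 + 1/2) =
      exp ((1 - 2 * (of_nat k + 1)) * of_real (ln 2)) * of_real (sqrt pi) * Gamma (2 * (of_nat k + 1))"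
    by (rule Gamma_legendre_duplication[OF z])
  also have "Gamma (of_nat k + 1 :: complex) = fact k" using Gamma_fact[of k, where ?'a = complex] by (simp add: add.commute)
  also have "Gamma (2 * (of_nat k + 1) :: complex) = fact (2 * k + 1)"
    using Gamma_fact[of "2 * k + 1", where ?'a = complex] by (simp add: algebra_simps)
  also have "exp ((1 - 2 * (of_nat k + 1)) * of_real (ln 2) :: complex) = of_real (exp (- (real (2 * k + 1) * ln 2)))"
    by (simp add: exp_of_real[symmetric] algebra_simps)
  also have "exp (- (real (2 * k + 1) * ln 2)) = inverse (2 ^ (2 * k + 1) :: real)"
    by (simp only: exp_minus exp_of_nat_mult exp_ln zero_less_numeral)
  also have "of_nat k + 1 + 1/2 = (of_nat k + 3/2 :: complex)" by simp
  finally have "fact k * Gamma (of_nat k + 3/2 :: complex) = of_real (inverse (2 ^ (2 * k + 1)) * sqrt pi * fact (2 * k + 1))"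
    by (simp del: power_Suc)
  then have "inverse (fact k * Gamma (of_nat k + 3/2 :: complex)) = of_real (inverse (inverse (2 ^ (2 * k + 1)) * sqrt pi * fact (2 * k + 1)))"
    by (simp only: of_real_inverse)
  also have "inverse (fact k * Gamma (of_nat k + 3/2 :: complex)) = rGamma (of_nat k + 3/2) / fact k"
    by (simp only: rGamma_inverse_Gamma divide_inverse inverse_mult_distrib mult.commute)
  also have "inverse (inverse (2 ^ (2 * k + 1)) * sqrt pi * fact (2 * k + 1)) = 2 ^ (2 * k + 1) / (sqrt pi * fact (2 * k + 1))"
    by (rule inv)
  finally show ?thesis .
qed

text \<open>The I-Bessel function of order 1/2 is elementary: its series consists of the odd terms
  of the exponential series, up to the prefactor.\<close>

lemma Bessel_E_one:
  assumes "Y > 0"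
  shows "of_real pi powr (1 - 1/2) * of_real Y powr 1 * Bessel_E 1 Y = of_real (sinh (2 * pi * Y) / pi)"
proof -
  have "(\<lambda>n. if even n then 0 else (2 * pi * Y) ^ n /\<^sub>R fact n) sums sinh (2 * pi * Y)"
    by (rule sinh_converges)
  then have "(\<lambda>k. (\<lambda>n. if even n then 0 else (2 * pi * Y) ^ n /\<^sub>R fact n) (2 * k + 1)) sums sinh (2 * pi * Y)"
    by (subst sums_mono_reindex) (auto simp: strict_mono_def elim!: oddE)
  then have "(\<lambda>k. (2 * pi * Y) ^ (2 * k + 1) / fact (2 * k + 1)) sums sinh (2 * pi * Y)"
    by (simp add: divide_inverse mult.commute)
  from sums_mult[OF this, of "1 / (sqrt pi * pi * Y)"]
  have "(\<lambda>k. 1 / (sqrt pi * pi * Y) * ((2 * pi * Y) ^ (2 * k + 1) / fact (2 * k + 1))) sums (1 / (sqrt pi * pi * Y) * sinh (2 * pi * Y))" .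
  also have "(\<lambda>k. 1 / (sqrt pi * pi * Y) * ((2 * pi * Y) ^ (2 * k + 1) / fact (2 * k + 1))) =
      (\<lambda>k. 2 ^ (2 * k + 1) / (sqrt pi * fact (2 * k + 1)) * ((pi * Y)\<^sup>2) ^ k)"
    using assms by (intro ext) (simp add: power_mult_distrib power_add power_mult[symmetric] field_simps)
  finally have "(\<lambda>k. complex_of_real (2 ^ (2 * k + 1) / (sqrt pi * fact (2 * k + 1)) * ((pi * Y)\<^sup>2) ^ k)) sums
      complex_of_real (1 / (sqrt pi * pi * Y) * sinh (2 * pi * Y))"
    by (rule sums_of_real)
  then have "(\<lambda>k. rGamma (1 + 1/2 + of_nat k :: complex) / fact k * of_real ((pi * Y)\<^sup>2) ^ k) sums
      complex_of_real (1 / (sqrt pi * pi * Y) * sinh (2 * pi * Y))"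
    using rGamma_half_duplication by (simp add: add.commute del: power_Suc)
  then have E: "Bessel_E 1 Y = complex_of_real (1 / (sqrt pi * pi * Y) * sinh (2 * pi * Y))"
    unfolding Bessel_E_def by (rule sums_unique[symmetric])
  have "complex_of_real pi powr (1 - 1/2) = of_real (pi powr (1/2))"
    using powr_of_real[of pi "1/2"] by simp
  also have "pi powr (1/2) = sqrt pi" by (simp add: powr_half_sqrt)
  finally show ?thesis using assms by (simp add: E)
qed

text \<open>With v = 1 / (Q c (c \<tau> + w)) this is e(n v), holomorphic off the real axis. At s =
  1 the two exponentials of the hyperbolic sine combine with the phase e(n Re v) to the values of
  this function at \<tau> and at its conjugate.\<close>

definition cusp_term :: "nat \<Rightarrow> nat \<Rightarrow> int \<Rightarrow> int \<Rightarrow> complex \<Rightarrow> complex" where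
  "cusp_term n Q c w \<tau> = ee (of_nat n / (of_nat Q * of_int c * (of_int c * \<tau> + of_int w)))"

lemma row_term_at_one:
  assumes "n > 0" "Q > 0" "Im \<tau> > 0" "c > 0"
  shows "2 * of_real pi * row_term n Q \<tau> c w 1 = twist n Q c w * (cusp_term n Q c w \<tau> - cusp_term n Q c w (cnj \<tau>))"
proof -
  define u where "u = of_int c * \<tau> + of_int w"
  define Y where "Y = real n * Im \<tau> / real Q / (norm u)\<^sup>2"
  define v where "v = 1 / (of_nat Q * of_int c * u)"
  have u: "u \<noteq> 0" using assms by (auto simp: u_def complex_eq_iff)
  then have Y: "Y > 0" using assms by (simp add: Y_def)
  have Imv: "real n * Im v = - Y"
  proof -
    have "v = inverse u / complex_of_real (real Q * of_int c)" by (simp add: v_def divide_inverse mult_ac)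
    then have "Im v = Im (inverse u) / (real Q * of_int c)" by (simp only: Im_divide_of_real)
    also have "Im (inverse u) = - (of_int c * Im \<tau>) / (norm u)\<^sup>2"
      by (simp add: u_def cmod_power2)
    finally show ?thesis using assms by (simp add: Y_def field_simps)
  qed
  have t: "cusp_term n Q c w \<tau> = ee (of_nat n * v)" by (simp add: cusp_term_def v_def u_def)
  have "cnj v = 1 / (of_nat Q * of_int c * (of_int c * cnj \<tau> + of_int w))" by (simp add: v_def u_def)
  then have t': "cusp_term n Q c w (cnj \<tau>) = ee (of_nat n * cnj v)" by (simp add: cusp_term_def)
  have ee_i: "ee (\<i> * of_real y) = of_real (exp (- (2 * pi * y)))" for y
  proof -
    have "2 * of_real pi * \<i> * (\<i> * of_real y) = complex_of_real (- (2 * pi * y))" by (simp add: complex_eq_iff)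
    then show ?thesis unfolding ee_def by (simp only: exp_of_real)
  qed
  have "of_nat n * v = of_real (real n * Re v) + \<i> * of_real (- Y)"
    using Imv by (simp add: complex_eq_iff)
  then have "ee (of_nat n * v) = ee (of_real (real n * Re v)) * ee (\<i> * of_real (- Y))" by (simp only: ee_add)
  also have "ee (\<i> * of_real (- Y)) = of_real (exp (2 * pi * Y))" unfolding ee_i by simp
  finally have e1: "ee (of_nat n * v) = ee (of_real (real n * Re v)) * of_real (exp (2 * pi * Y))" .
  have "of_nat n * cnj v = of_real (real n * Re v) + \<i> * of_real Y"
    using Imv by (simp add: complex_eq_iff)
  then have "ee (of_nat n * cnj v) = ee (of_real (real n * Re v)) * ee (\<i> * of_real Y)" by (simp only: ee_add)
  also have "ee (\<i> * of_real Y) = of_real (exp (- (2 * pi * Y)))" by (rule ee_i)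
  finally have e2: "ee (of_nat n * cnj v) = ee (of_real (real n * Re v)) * of_real (exp (- (2 * pi * Y)))" .
  have "row_term n Q \<tau> c w 1 = twist n Q c w * (ee (of_real (real n * Re v)) * of_real (sinh (2 * pi * Y) / pi))"
    unfolding row_term_def Let_def u_def[symmetric] v_def[symmetric] Y_def[symmetric] Bessel_E_one[OF Y] ..
  then have "2 * of_real pi * row_term n Q \<tau> c w 1 =
      twist n Q c w * (ee (of_real (real n * Re v)) * of_real (2 * sinh (2 * pi * Y)))"
    by (simp add: mult_ac)
  also have "2 * sinh (2 * pi * Y) = exp (2 * pi * Y) - exp (- (2 * pi * Y))" by (simp add: sinh_def)
  finally show ?thesis unfolding t t' e1 e2 by (simp add: algebra_simps)
qed

text \<open>A single exponential tends to 1 only like 1 / |w|. Subtracting the value at the base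
  point \<i> improves the decay to |w| powr (-2), and the subtraction cancels in the difference of
  the values at \<tau> and at its conjugate.\<close>

definition cusp_part :: "nat \<Rightarrow> nat \<Rightarrow> int \<Rightarrow> complex \<Rightarrow> complex" where
  "cusp_part n Q c \<tau> = (\<Sum>\<^sub>\<infinity>w. twist n Q c w * (cusp_term n Q c w \<tau> - cusp_term n Q c w \<i>))"

lemma ee_expansion: "norm (ee z - 1 - 2 * of_real pi * \<i> * z) \<le> (2 * pi * norm z)\<^sup>2 * exp (2 * pi * norm z)"
  using norm_exp_minus_one_minus_le[of "2 * of_real pi * \<i> * z"] by (simp add: ee_def norm_mult)

text \<open>The difference of two values of \<open>cusp_term\<close> is \<open>2 \<pi> \<i> n / (Q c)\<close> times
  \<open>1 / (c \<tau> + w) - 1 / (c \<i> + w)\<close> up to an absolutely summable error.\<close>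

lemma cusp_term_expansion:
  assumes lb: "lattice_bound \<kappa> \<tau>" and c: "c > 0" and Q: "Q > 0"
  shows "norm (cusp_term n Q c w \<tau> - 1 - 2 * of_real pi * \<i> * of_nat n / (of_nat Q * of_int c) * (1 / (of_int c * \<tau> + of_int w)))
     \<le> (2 * pi * n / \<kappa>)\<^sup>2 * exp (2 * pi * n / \<kappa>) * of_int c powr (- 1.02) * (of_int c + \<bar>of_int w\<bar>) powr (- 2)"
    and "norm (cusp_term n Q c w \<tau> - 1) \<le> 2 * pi * n / \<kappa> * exp (2 * pi * n / \<kappa>) / (of_int c + \<bar>of_int w\<bar>)"
proof -
  define u where "u = of_int c * \<tau> + of_int w"
  define L where "L = real_of_int c + \<bar>real_of_int w\<bar>"
  have \<kappa>: "\<kappa> > 0" using lb by (simp add: lattice_bound_def)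
  have c1: "real_of_int c \<ge> 1" using c by simp
  have L: "L \<ge> 1" using c1 by (simp add: L_def)
  have uL: "\<kappa> * L \<le> norm u" using lattice_bound_int(1)[OF lb c, of w] by (simp add: u_def L_def)
  have \<kappa>L: "\<kappa> * L > 0" using \<kappa> L by simp
  define z where "z = of_nat n / (of_nat Q * of_int c * u)"
  define D where "D = 2 * pi * n / \<kappa>"
  have D: "D \<ge> 0" using \<kappa> by (simp add: D_def)
  have "of_int c * (\<kappa> * L) \<le> (real Q * of_int c) * norm u"
    using uL \<kappa>L c1 Q mult_right_mono[of 1 "real Q" "of_int c"] by (intro mult_mono) auto
  then have "real n / ((real Q * of_int c) * norm u) \<le> real n / (of_int c * (\<kappa> * L))"
    using \<kappa>L c1 by (intro frac_le) auto
  then have "norm z \<le> real n / (of_int c * (\<kappa> * L))" using c by (simp add: z_def norm_divide norm_mult)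
  then have "2 * pi * norm z \<le> 2 * pi * (real n / (of_int c * (\<kappa> * L)))" by (intro mult_left_mono) auto
  then have z1: "2 * pi * norm z \<le> D / (of_int c * L)" by (simp add: D_def mult_ac)
  have "D / (of_int c * L) \<le> D / L" using D L c1 mult_right_mono[OF c1, of L] by (intro divide_left_mono) auto
  then have z2: "2 * pi * norm z \<le> D / L" using z1 by linarith
  have "D / L \<le> D / 1" using D L by (intro divide_left_mono) auto
  then have z3: "2 * pi * norm z \<le> D" using z2 by simp
  have ct: "cusp_term n Q c w \<tau> = ee z" by (simp add: cusp_term_def z_def u_def)
  have "norm (cusp_term n Q c w \<tau> - 1) \<le> norm (2 * of_real pi * \<i> * z) * exp (norm (2 * of_real pi * \<i> * z))"
    unfolding ct ee_def by (rule norm_exp_minus_one_le)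
  also have "\<dots> = (2 * pi * norm z) * exp (2 * pi * norm z)" by (simp add: norm_mult)
  also have "\<dots> \<le> D / L * exp D" using z2 z3 D L by (intro mult_mono) auto
  finally show "norm (cusp_term n Q c w \<tau> - 1) \<le> 2 * pi * n / \<kappa> * exp (2 * pi * n / \<kappa>) / (of_int c + \<bar>of_int w\<bar>)"
    by (simp add: D_def L_def)
  have "norm (cusp_term n Q c w \<tau> - 1 - 2 * of_real pi * \<i> * of_nat n / (of_nat Q * of_int c) * (1 / u)) =
      norm (ee z - 1 - 2 * of_real pi * \<i> * z)" unfolding ct by (simp add: z_def)
  also have "\<dots> \<le> (2 * pi * norm z)\<^sup>2 * exp (2 * pi * norm z)" by (rule ee_expansion)
  also have "\<dots> \<le> (D / (of_int c * L))\<^sup>2 * exp D" using z1 z3 by (intro mult_mono power_mono) auto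
  also have "\<dots> = D\<^sup>2 * exp D * of_int c powr (- 2) * L powr (- 2)"
    using c1 L by (simp add: power_divide power_mult_distrib powr_minus divide_inverse mult_ac power_inverse)
  \<comment> \<open>The decay in c is weakened from -2 to -1.02, the exponent in which the bounds
    for whole rows are stated.\<close>
  also have "\<dots> \<le> D\<^sup>2 * exp D * of_int c powr (- 1.02) * L powr (- 2)"
    using c1 D by (intro mult_left_mono mult_right_mono powr_mono) auto
  finally show "norm (cusp_term n Q c w \<tau> - 1 - 2 * of_real pi * \<i> * of_nat n / (of_nat Q * of_int c) * (1 / (of_int c * \<tau> + of_int w)))
     \<le> (2 * pi * n / \<kappa>)\<^sup>2 * exp (2 * pi * n / \<kappa>) * of_int c powr (- 1.02) * (of_int c + \<bar>of_int w\<bar>) powr (- 2)"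
    by (simp only: D_def L_def u_def)
qed

lemma norm_inverse_diff_le:
  fixes a b :: complex
  assumes "0 < r" "r \<le> norm a" "r \<le> norm b" "norm (a - b) \<le> d"
  shows "norm (1 / a - 1 / b) \<le> d / r\<^sup>2"
proof -
  have n: "a \<noteq> 0" "b \<noteq> 0" using assms by auto
  have "norm (1 / a - 1 / b) = norm (a - b) / (norm a * norm b)"
    using n by (simp add: divide_simps norm_divide norm_mult norm_minus_commute)
  also have "\<dots> \<le> d / (r * r)"
    using assms by (intro frac_le mult_mono mult_pos_pos) (auto intro: order_trans[OF norm_ge_zero])
  finally show ?thesis by (simp add: power2_eq_square)
qed

text \<open>The scheme of \<open>row_sum_bound\<close> at s = 1: the linear term, a multiple of 1 /
  (c \<tau> + w) - 1 / (c \<i> + w), carries the twist, and its factor 1 / c gives -1 - 0.99 +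
  0.9475 = -1.0425. Fixing \<kappa> beforehand makes K uniform in \<tau>; the factor 1 + |\<tau> -
  \<i>| later becomes linear growth at the cusp.\<close>

lemma cusp_part_bounds:
  assumes n: "n > 0" and Q: "Q > 0" and i: "lattice_bound \<kappa> \<i>"
  obtains K where "K \<ge> 0"
    "\<And>c \<tau> w. \<lbrakk>c > 0; lattice_bound \<kappa> \<tau>\<rbrakk> \<Longrightarrow>
       norm (twist n Q c w * (cusp_term n Q c w \<tau> - cusp_term n Q c w \<i>)) \<le> K * (1 + norm (\<tau> - \<i>)) * (of_int c + \<bar>of_int w\<bar>) powr (- 2)"
    "\<And>c \<tau>. \<lbrakk>c > 0; coprime (int Q) c; lattice_bound \<kappa> \<tau>\<rbrakk> \<Longrightarrow>
       norm (cusp_part n Q c \<tau>) \<le> K * (1 + norm (\<tau> - \<i>)) * of_int c powr (- 1.02)"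
proof -
  obtain C where C: "C \<ge> 0"
    "\<And>Q c h V. \<lbrakk>c > 0; coprime (int Q) c; (\<lambda>w. norm (h w)) summable_on UNIV;
        (\<Sum>\<^sub>\<infinity>w. norm (h w)) \<le> of_int c * V; (\<Sum>\<^sub>\<infinity>w. norm (h (w + 1) - h w)) \<le> V\<rbrakk> \<Longrightarrow>
      norm (\<Sum>\<^sub>\<infinity>w. twist n Q c w * h w) \<le> C * V * of_int c powr 0.9475"
    by (rule twist_sum_bound[OF n]) blast
  have \<kappa>: "\<kappa> > 0" using i by (simp add: lattice_bound_def)
  define E where "E = 2 * ((2 * pi * n / \<kappa>)\<^sup>2 * exp (2 * pi * n / \<kappa>))"
  define k where "k = 4 / \<kappa>\<^sup>2"
  have E: "E \<ge> 0" and k: "k \<ge> 0" by (auto simp: E_def k_def)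
  define K where "K = 2 * pi * n * (C * (2 * k * row_const)) + E * row_const + 2 * pi * n * k + E"
  have K: "K \<ge> 0" using C E k row_const_nonneg by (simp add: K_def)
  show thesis
  proof (rule that[OF K])
    fix c :: int and \<tau> assume c: "c > 0" and lb: "lattice_bound \<kappa> \<tau>"
    have c1: "real_of_int c \<ge> 1" using c by simp
    define T where "T = 1 + norm (\<tau> - \<i>)"
    have T: "T \<ge> 1" by (simp add: T_def)
    define L where "L w = real_of_int c + \<bar>real_of_int w\<bar>" for w
    have L: "L w \<ge> 1" for w using c1 by (simp add: L_def)
    define h where "h w = 1 / (of_int c * \<tau> + of_int w) - 1 / (of_int c * \<i> + of_int w)" for w
    define a where "a = 2 * of_real pi * \<i> * of_nat n / (of_nat Q * of_int c :: complex)"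
    have na: "norm a \<le> 2 * pi * n / of_int c"
    proof -
      have "of_int c \<le> real Q * of_int c" using Q c1 mult_right_mono[of 1 "real Q" "of_int c"] by simp
      then have "2 * pi * n / (real Q * of_int c) \<le> 2 * pi * n / of_int c"
        using c1 by (intro divide_left_mono) auto
      then show ?thesis using c by (simp add: a_def norm_divide norm_mult)
    qed
    define r where "r w = (cusp_term n Q c w \<tau> - cusp_term n Q c w \<i>) - a * h w" for w
    have r: "norm (r w) \<le> E * of_int c powr (- 1.02) * L w powr (- 2)" for w
    proof -
      have "r w = (cusp_term n Q c w \<tau> - 1 - a * (1 / (of_int c * \<tau> + of_int w))) -
          (cusp_term n Q c w \<i> - 1 - a * (1 / (of_int c * \<i> + of_int w)))"
        by (simp add: r_def h_def algebra_simps)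
      also have "norm \<dots> \<le> norm (cusp_term n Q c w \<tau> - 1 - a * (1 / (of_int c * \<tau> + of_int w))) +
          norm (cusp_term n Q c w \<i> - 1 - a * (1 / (of_int c * \<i> + of_int w)))" by (rule norm_triangle_ineq4)
      also have "\<dots> \<le> (2 * pi * n / \<kappa>)\<^sup>2 * exp (2 * pi * n / \<kappa>) * of_int c powr (- 1.02) * L w powr (- 2) +
         (2 * pi * n / \<kappa>)\<^sup>2 * exp (2 * pi * n / \<kappa>) * of_int c powr (- 1.02) * L w powr (- 2)"
        unfolding a_def L_def using cusp_term_expansion(1)[OF lb c Q] cusp_term_expansion(1)[OF i c Q]
        by (intro add_mono)
      also have "\<dots> = E * of_int c powr (- 1.02) * L w powr (- 2)" by (simp add: E_def)
      finally show ?thesis .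
    qed
    have low: "\<kappa> / 2 * L w > 0" "\<kappa> / 2 * L w \<le> norm (of_int c * z + of_int w)" "\<kappa> / 2 * L w \<le> norm (of_int c * z + of_int (w + 1))"
      if "lattice_bound \<kappa> z" for z w
    proof -
      have "\<kappa> / 2 * L w \<le> \<kappa> * L w" using \<kappa> L[of w] by (intro mult_right_mono) auto
      then show "\<kappa> / 2 * L w \<le> norm (of_int c * z + of_int w)"
        using lattice_bound_int(1)[OF that c, of w, folded L_def] by linarith
      show "\<kappa> / 2 * L w > 0" "\<kappa> / 2 * L w \<le> norm (of_int c * z + of_int (w + 1))"
        by (rule lattice_bound_int(2,3)[OF that c, of w, folded L_def])+
    qed
    have sq: "d / (\<kappa> / 2 * L w)\<^sup>2 = d * k * L w powr (- 2)" for d w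
    proof -
      have "L w powr (- 2) = 1 / (L w)\<^sup>2" using L[of w] by (simp add: powr_minus divide_inverse)
      then show ?thesis by (simp add: k_def power_mult_distrib power_divide)
    qed
    have h0: "norm (h w) \<le> of_int c * (T * k) * L w powr (- 2)" for w
    proof -
      have "norm ((of_int c * \<tau> + of_int w) - (of_int c * \<i> + of_int w)) = of_int c * norm (\<tau> - \<i>)"
        using c by (simp add: right_diff_distrib[symmetric] norm_mult)
      also have "\<dots> \<le> of_int c * T" using c1 by (intro mult_left_mono) (auto simp: T_def)
      finally have "norm (h w) \<le> of_int c * T / (\<kappa> / 2 * L w)\<^sup>2"
        unfolding h_def using low[OF lb] low[OF i] by (intro norm_inverse_diff_le)
      then show ?thesis unfolding sq by (simp add: mult_ac)
    qed
    have h1: "norm (h (w + 1) - h w) \<le> 2 * (T * k) * L w powr (- 2)" for w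
    proof -
      have "h (w + 1) - h w = (1 / (of_int c * \<tau> + of_int (w + 1)) - 1 / (of_int c * \<tau> + of_int w)) -
          (1 / (of_int c * \<i> + of_int (w + 1)) - 1 / (of_int c * \<i> + of_int w))" by (simp add: h_def)
      also have "norm \<dots> \<le> norm (1 / (of_int c * \<tau> + of_int (w + 1)) - 1 / (of_int c * \<tau> + of_int w)) +
          norm (1 / (of_int c * \<i> + of_int (w + 1)) - 1 / (of_int c * \<i> + of_int w))" by (rule norm_triangle_ineq4)
      also have "\<dots> \<le> 1 / (\<kappa> / 2 * L w)\<^sup>2 + 1 / (\<kappa> / 2 * L w)\<^sup>2"
        using low[OF lb, of w] low[OF i, of w] by (intro add_mono norm_inverse_diff_le) auto
      also have "\<dots> = 2 * (1 * (k * L w powr (- 2)))" unfolding sq by simp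
      also have "\<dots> \<le> 2 * (T * (k * L w powr (- 2)))" using T k by (intro mult_left_mono mult_right_mono) auto
      finally show ?thesis by (simp add: mult_ac)
    qed
    have sm: "(\<lambda>w. x * L w powr (- 2)) summable_on UNIV" for x
      unfolding L_def by (intro summable_on_cmult_right row_sum(1) c) simp
    have sml: "(\<Sum>\<^sub>\<infinity>w. x * L w powr (- 2)) \<le> x * row_const * of_int c powr (- 0.99)" if "x \<ge> 0" for x
    proof -
      have "(\<Sum>\<^sub>\<infinity>w. x * L w powr (- 2)) = x * (\<Sum>\<^sub>\<infinity>w. L w powr (- 2))"
        unfolding L_def by (intro infsum_cmult_right row_sum(1) c) simp
      also have "\<dots> \<le> x * (row_const * of_int c powr (1.01 - 2))"
        unfolding L_def using that c by (intro mult_left_mono row_sum(2)) auto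
      finally show ?thesis by simp
    qed
    have terms: "norm (twist n Q c w * (cusp_term n Q c w \<tau> - cusp_term n Q c w \<i>)) \<le> (2 * pi * n * k + E) * T * L w powr (- 2)" for w
    proof -
      have "norm (a * h w) \<le> 2 * pi * n / of_int c * (of_int c * (T * k) * L w powr (- 2))"
        unfolding norm_mult using na h0[of w] c1 by (intro mult_mono) auto
      also have "\<dots> = 2 * pi * n * k * T * L w powr (- 2)" using c by simp
      finally have 1: "norm (a * h w) \<le> 2 * pi * n * k * T * L w powr (- 2)" .
      have "of_int c powr (- 1.02) \<le> (1::real)" using c1 powr_mono[of "- 1.02" 0 "of_int c"] by simp
      then have "E * of_int c powr (- 1.02) * L w powr (- 2) \<le> E * T * L w powr (- 2)"
        using E T by (intro mult_right_mono mult_left_mono) auto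
      then have 2: "norm (r w) \<le> E * T * L w powr (- 2)" using r[of w] by linarith
      have "cusp_term n Q c w \<tau> - cusp_term n Q c w \<i> = a * h w + r w" by (simp add: r_def)
      then have "norm (cusp_term n Q c w \<tau> - cusp_term n Q c w \<i>) \<le> (2 * pi * n * k + E) * T * L w powr (- 2)"
        using norm_triangle_ineq[of "a * h w" "r w"] 1 2 by (simp add: algebra_simps)
      then show ?thesis
        using mult_mono[OF norm_twist_le[of n Q c w]] by (simp add: norm_mult)
    qed
    show "norm (twist n Q c w * (cusp_term n Q c w \<tau> - cusp_term n Q c w \<i>)) \<le> K * (1 + norm (\<tau> - \<i>)) * (of_int c + \<bar>of_int w\<bar>) powr (- 2)" for w
    proof -
      have "(2 * pi * n * k + E) * T * L w powr (- 2) \<le> K * T * L w powr (- 2)"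
        using T C E k row_const_nonneg by (intro mult_right_mono) (auto simp: K_def)
      then show ?thesis using terms[of w] by (simp add: T_def L_def)
    qed
    assume cop: "coprime (int Q) c"
    define V where "V = 2 * (T * k) * row_const * of_int c powr (- 0.99)"
    note hs = abs_summable_on_bounded_by[OF h0 sm] abs_summable_on_bounded_by[OF h1 sm]
    have V0: "(\<Sum>\<^sub>\<infinity>w. norm (h w)) \<le> of_int c * V"
    proof -
      have "(\<Sum>\<^sub>\<infinity>w. norm (h w)) \<le> (\<Sum>\<^sub>\<infinity>w. of_int c * (T * k) * L w powr (- 2))"
        by (rule infsum_mono[OF hs(1) sm h0])
      also have "\<dots> \<le> of_int c * (T * k) * row_const * of_int c powr (- 0.99)"
        using T k c1 by (intro sml) auto
      also have "\<dots> \<le> of_int c * V"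
        using T k c1 row_const_nonneg by (simp add: V_def mult_ac mult_left_mono)
      finally show ?thesis .
    qed
    have V1: "(\<Sum>\<^sub>\<infinity>w. norm (h (w + 1) - h w)) \<le> V"
    proof -
      have "(\<Sum>\<^sub>\<infinity>w. norm (h (w + 1) - h w)) \<le> (\<Sum>\<^sub>\<infinity>w. 2 * (T * k) * L w powr (- 2))"
        by (rule infsum_mono[OF hs(4) sm h1])
      also have "\<dots> \<le> V" unfolding V_def using T k by (intro sml) auto
      finally show ?thesis .
    qed
    have main: "norm (\<Sum>\<^sub>\<infinity>w. twist n Q c w * h w) \<le> C * V * of_int c powr 0.9475"
      by (rule C(2)[OF c cop hs(1) V0 V1])
    have th: "(\<lambda>w. twist n Q c w * h w) summable_on UNIV"
    proof (rule abs_summable_on_bounded_by(2)[OF _ hs(1)])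
      show "norm (twist n Q c w * h w) \<le> norm (h w)" for w
        using mult_right_mono[OF norm_twist_le[of n Q c w], of "norm (h w)"] by (simp add: norm_mult)
    qed
    have tr: "norm (twist n Q c w * r w) \<le> E * of_int c powr (- 1.02) * L w powr (- 2)" for w
      using mult_right_mono[OF norm_twist_le[of n Q c w], of "norm (r w)"] r[of w] by (simp add: norm_mult)
    note rs = abs_summable_on_bounded_by[OF tr sm]
    have "cusp_part n Q c \<tau> = (\<Sum>\<^sub>\<infinity>w. a * (twist n Q c w * h w) + twist n Q c w * r w)"
      unfolding cusp_part_def r_def by (simp add: algebra_simps)
    also have "\<dots> = (\<Sum>\<^sub>\<infinity>w. a * (twist n Q c w * h w)) + (\<Sum>\<^sub>\<infinity>w. twist n Q c w * r w)"
      by (intro infsum_add summable_on_cmult_right th rs(2))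
    also have "\<dots> = a * (\<Sum>\<^sub>\<infinity>w. twist n Q c w * h w) + (\<Sum>\<^sub>\<infinity>w. twist n Q c w * r w)"
      by (simp add: infsum_cmult_right th)
    finally have "norm (cusp_part n Q c \<tau>) \<le> norm a * norm (\<Sum>\<^sub>\<infinity>w. twist n Q c w * h w) + norm (\<Sum>\<^sub>\<infinity>w. twist n Q c w * r w)"
      using norm_triangle_ineq norm_mult by metis
    also have "\<dots> \<le> 2 * pi * n * (C * (2 * k * row_const)) * T * of_int c powr (- 1.02) + E * row_const * T * of_int c powr (- 1.02)"
    proof (intro add_mono)
      have "norm a * norm (\<Sum>\<^sub>\<infinity>w. twist n Q c w * h w) \<le> 2 * pi * n / of_int c * (C * V * of_int c powr 0.9475)"
        using na main c1 by (intro mult_mono) auto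
      also have "\<dots> = 2 * pi * n * (C * (2 * k * row_const)) * T * (of_int c powr (- 0.99) * of_int c powr 0.9475 / of_int c)"
        by (simp add: V_def)
      also have "of_int c powr (- 0.99) * of_int c powr 0.9475 / of_int c = (of_int c powr (- 1.0425) :: real)"
        using c1 powr_diff[of "of_int c" "- 0.0425" "1 :: real"] by (simp add: powr_add[symmetric])
      also have "2 * pi * n * (C * (2 * k * row_const)) * T * of_int c powr (- 1.0425) \<le>
          2 * pi * n * (C * (2 * k * row_const)) * T * of_int c powr (- 1.02)"
        using c1 T k C row_const_nonneg by (intro mult_left_mono powr_mono) auto
      finally show "norm a * norm (\<Sum>\<^sub>\<infinity>w. twist n Q c w * h w) \<le> 2 * pi * n * (C * (2 * k * row_const)) * T * of_int c powr (- 1.02)" .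
      have "norm (\<Sum>\<^sub>\<infinity>w. twist n Q c w * r w) \<le> (\<Sum>\<^sub>\<infinity>w. E * of_int c powr (- 1.02) * L w powr (- 2))" by (rule rs(3))
      also have "\<dots> \<le> E * of_int c powr (- 1.02) * row_const * of_int c powr (- 0.99)"
        using E by (intro sml) auto
      also have "\<dots> \<le> E * of_int c powr (- 1.02) * row_const * T"
        using E row_const_nonneg T c1 powr_mono[of "- 0.99" 0 "real_of_int c"] by (intro mult_left_mono) auto
      finally show "norm (\<Sum>\<^sub>\<infinity>w. twist n Q c w * r w) \<le> E * row_const * T * of_int c powr (- 1.02)" by (simp add: mult_ac)
    qed
    also have "\<dots> = (2 * pi * n * (C * (2 * k * row_const)) + E * row_const) * T * of_int c powr (- 1.02)" by (simp add: algebra_simps)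
    also have "\<dots> \<le> K * T * of_int c powr (- 1.02)"
      using T E k by (intro mult_right_mono) (auto simp: K_def)
    finally show "norm (cusp_part n Q c \<tau>) \<le> K * (1 + norm (\<tau> - \<i>)) * of_int c powr (- 1.02)" by (simp add: T_def)
  qed
qed

lemma lattice_bound_mono: "lattice_bound \<kappa> \<tau> \<Longrightarrow> 0 < \<kappa>' \<Longrightarrow> \<kappa>' \<le> \<kappa> \<Longrightarrow> lattice_bound \<kappa>' \<tau>"
  unfolding lattice_bound_def
  by (meson abs_ge_zero add_nonneg_nonneg mult_right_mono order_trans)

section \<open>Periodicity of the rows under translation\<close>

lemma has_sum_int_limit:
  fixes f :: "int \<Rightarrow> complex"
  assumes "(f has_sum S) UNIV"
  shows "(\<lambda>k. \<Sum>w\<in>{- int k..<int k}. f w) \<longlonglongrightarrow> S"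
proof -
  have "filterlim (\<lambda>k. {- int k..<int k}) (finite_subsets_at_top UNIV) sequentially"
    unfolding filterlim_finite_subsets_at_top
  proof (intro allI impI)
    fix X :: "int set" assume X: "finite X \<and> X \<subseteq> UNIV"
    have "\<forall>\<^sub>F k in sequentially. \<forall>x\<in>X. x \<in> {- int k..<int k}"
    proof (rule eventually_ball_finite)
      show "\<forall>x\<in>X. \<forall>\<^sub>F k in sequentially. x \<in> {- int k..<int k}"
      proof
        fix x
        show "\<forall>\<^sub>F k in sequentially. x \<in> {- int k..<int k}"
          by (rule eventually_mono[OF eventually_gt_at_top[of "nat \<bar>x\<bar>"]]) auto
      qed
    qed (use X in simp)
    then show "\<forall>\<^sub>F k in sequentially. finite {- int k..<int k} \<and> X \<subseteq> {- int k..<int k} \<and> {- int k..<int k} \<subseteq> UNIV"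
      by (rule eventually_mono) auto
  qed
  then show ?thesis using assms unfolding has_sum_def by (rule filterlim_compose[rotated])
qed

text \<open>As f decays only like 1 / |w|, the sum of the differences cannot be split into two. Over
  a symmetric interval it telescopes to two blocks of c terms at the ends, of total size at most 2 c
  K / k.\<close>

lemma infsum_shift_difference:
  fixes f :: "int \<Rightarrow> complex" and c :: int
  assumes c: "c > 0" and sm: "(\<lambda>w. f (w + c) - f w) summable_on UNIV"
    and f: "\<And>w. norm (f w) \<le> K / (of_int c + \<bar>of_int w\<bar>)"
  shows "(\<Sum>\<^sub>\<infinity>w. f (w + c) - f w) = 0"
proof -
  let ?S = "\<Sum>\<^sub>\<infinity>w. f (w + c) - f w"
  have K: "K \<ge> 0" using order_trans[OF norm_ge_zero f[of 0]] c by (simp add: zero_le_divide_iff)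
  have lim: "(\<lambda>k. \<Sum>w\<in>{- int k..<int k}. f (w + c) - f w) \<longlonglongrightarrow> ?S"
    by (rule has_sum_int_limit[OF has_sum_infsum[OF sm]])
  have "(\<lambda>k. \<Sum>w\<in>{- int k..<int k}. f (w + c) - f w) \<longlonglongrightarrow> 0"
  proof (rule Lim_null_comparison)
    show "\<forall>\<^sub>F k in sequentially. norm (\<Sum>w\<in>{- int k..<int k}. f (w + c) - f w) \<le> 2 * of_int c * K / real k"
      using eventually_ge_at_top[of "nat c"]
    proof eventually_elim
      case (elim k)
      have k: "int k \<ge> c" using elim by linarith
      have "(\<Sum>w\<in>{- int k..<int k}. f (w + c)) = (\<Sum>w\<in>{- int k + c..<int k + c}. f w)"
        by (rule sum.reindex_bij_witness[of _ "\<lambda>w. w - c" "\<lambda>w. w + c"]) auto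
      also have "{- int k + c..<int k + c} = {- int k + c..<int k} \<union> {int k..<int k + c}" using k c by auto
      also have "sum f \<dots> = sum f {- int k + c..<int k} + sum f {int k..<int k + c}"
        by (rule sum.union_disjoint) auto
      finally have 1: "(\<Sum>w\<in>{- int k..<int k}. f (w + c)) = sum f {- int k + c..<int k} + sum f {int k..<int k + c}" .
      have "{- int k..<int k} = {- int k..<- int k + c} \<union> {- int k + c..<int k}" using k c by auto
      then have "sum f {- int k..<int k} = sum f ({- int k..<- int k + c} \<union> {- int k + c..<int k})" by simp
      also have "\<dots> = sum f {- int k..<- int k + c} + sum f {- int k + c..<int k}"
        by (rule sum.union_disjoint) auto
      finally have 2: "sum f {- int k..<int k} = sum f {- int k..<- int k + c} + sum f {- int k + c..<int k}" .
      have "(\<Sum>w\<in>{- int k..<int k}. f (w + c) - f w) = sum f {int k..<int k + c} - sum f {- int k..<- int k + c}"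
        by (simp add: sum_subtractf 1 2)
      also have "norm \<dots> \<le> norm (sum f {int k..<int k + c}) + norm (sum f {- int k..<- int k + c})"
        by (rule norm_triangle_ineq4)
      also have "\<dots> \<le> of_int c * (K / real k) + of_int c * (K / real k)"
      proof (rule add_mono)
        have b: "norm (f w) \<le> K / real k" if "real k \<le> of_int c + \<bar>of_int w\<bar>" for w
          using order_trans[OF f[of w] frac_le[of K K "real k"]] that K k c by simp
        have "norm (sum f {int k..<int k + c}) \<le> (\<Sum>w\<in>{int k..<int k + c}. K / real k)"
          using c by (intro sum_norm_le b) auto
        then show "norm (sum f {int k..<int k + c}) \<le> of_int c * (K / real k)" using c by simp
        have "norm (sum f {- int k..<- int k + c}) \<le> (\<Sum>w\<in>{- int k..<- int k + c}. K / real k)"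
        proof (intro sum_norm_le b)
          fix w assume w: "w \<in> {- int k..<- int k + c}"
          then have "int k \<le> c + \<bar>w\<bar>" using k by auto
          then have "real_of_int (int k) \<le> real_of_int (c + \<bar>w\<bar>)" by (simp only: of_int_le_iff)
          then show "real k \<le> of_int c + \<bar>of_int w\<bar>" by simp
        qed
        then show "norm (sum f {- int k..<- int k + c}) \<le> of_int c * (K / real k)" using c by simp
      qed
      finally show ?case by (simp add: mult_ac)
    qed
    show "(\<lambda>k. 2 * of_int c * K / real k) \<longlonglongrightarrow> 0" by (rule lim_const_over_n)
  qed
  then show ?thesis using lim by (rule LIMSEQ_unique[rotated])
qed

lemma cusp_part_summable:
  assumes n: "n > 0" and Q: "Q > 0" and c: "c > 0" and \<tau>: "Im \<tau> \<noteq> 0"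
  shows "(\<lambda>w. twist n Q c w * (cusp_term n Q c w \<tau> - cusp_term n Q c w \<i>)) summable_on UNIV"
proof -
  obtain \<kappa>1 where 1: "lattice_bound \<kappa>1 \<tau>" using lattice_bound_exists[OF \<tau>] .
  obtain \<kappa>2 where 2: "lattice_bound \<kappa>2 \<i>" using lattice_bound_exists[of \<i>] by auto
  define \<kappa> where "\<kappa> = min \<kappa>1 \<kappa>2"
  have lb: "lattice_bound \<kappa> \<tau>" "lattice_bound \<kappa> \<i>"
    using lattice_bound_mono[OF 1, of \<kappa>] lattice_bound_mono[OF 2, of \<kappa>] 1 2
    by (auto simp: \<kappa>_def lattice_bound_def)
  obtain K where K: "K \<ge> 0"
    "\<And>c \<tau> w. \<lbrakk>c > 0; lattice_bound \<kappa> \<tau>\<rbrakk> \<Longrightarrow>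
       norm (twist n Q c w * (cusp_term n Q c w \<tau> - cusp_term n Q c w \<i>)) \<le> K * (1 + norm (\<tau> - \<i>)) * (of_int c + \<bar>of_int w\<bar>) powr (- 2)"
    by (rule cusp_part_bounds[OF n Q lb(2)]) blast
  show ?thesis
    by (rule abs_summable_on_bounded_by(2)[OF K(2)[OF c lb(1)]])
      (intro summable_on_cmult_right row_sum(1) c, simp)
qed

text \<open>Adding 1 to \<tau> moves w to w + c, which the twist does not notice. The subtracted
  values at the base point do not move along; the discrepancy is a sum of shift differences and
  vanishes.\<close>

lemma cusp_part_periodic:
  assumes n: "n > 0" and Q: "Q > 0" and c: "c > 0" and \<tau>: "Im \<tau> \<noteq> 0"
  shows "cusp_part n Q c (\<tau> + 1) = cusp_part n Q c \<tau>"
proof -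
  define g where "g w = twist n Q c w * (cusp_term n Q c w \<tau> - cusp_term n Q c w \<i>)" for w
  define f where "f w = twist n Q c w * (cusp_term n Q c w \<i> - 1)" for w
  have g: "g summable_on UNIV" unfolding g_def by (rule cusp_part_summable[OF assms])
  have shift: "twist n Q c w * (cusp_term n Q c w (\<tau> + 1) - cusp_term n Q c w \<i>) = g (w + c) + (f (w + c) - f w)" for w
  proof -
    have "twist n Q c (w + c) = twist n Q c w" by (rule twist_cong) (simp add: cong_def)
    moreover have "cusp_term n Q c w (\<tau> + 1) = cusp_term n Q c (w + c) \<tau>"
      by (simp add: cusp_term_def algebra_simps)
    ultimately show ?thesis by (simp add: g_def f_def algebra_simps)
  qed
  have gs: "(\<lambda>w. g (w + c)) summable_on UNIV" using g by (simp only: summable_on_int_shift)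
  have "(\<lambda>w. g (w + c) + (f (w + c) - f w)) summable_on UNIV"
    using cusp_part_summable[OF n Q c, of "\<tau> + 1"] \<tau> unfolding shift by simp
  from summable_on_add[OF this summable_on_uminus[THEN iffD2, OF gs]]
  have fs: "(\<lambda>w. f (w + c) - f w) summable_on UNIV" by simp
  obtain \<kappa> where lb: "lattice_bound \<kappa> \<i>" using lattice_bound_exists[of \<i>] by auto
  have "norm (f w) \<le> 2 * pi * n / \<kappa> * exp (2 * pi * n / \<kappa>) / (of_int c + \<bar>of_int w\<bar>)" for w
  proof -
    have "norm (f w) \<le> 1 * norm (cusp_term n Q c w \<i> - 1)"
      unfolding f_def norm_mult by (intro mult_right_mono norm_twist_le) simp
    then show ?thesis using cusp_term_expansion(2)[OF lb c Q, of n w] by simp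
  qed
  then have 0: "(\<Sum>\<^sub>\<infinity>w. f (w + c) - f w) = 0" by (rule infsum_shift_difference[OF c fs])
  have "cusp_part n Q c (\<tau> + 1) = (\<Sum>\<^sub>\<infinity>w. g (w + c) + (f (w + c) - f w))"
    unfolding cusp_part_def shift ..
  also have "\<dots> = (\<Sum>\<^sub>\<infinity>w. g (w + c)) + (\<Sum>\<^sub>\<infinity>w. f (w + c) - f w)" by (rule infsum_add[OF gs fs])
  also have "\<dots> = infsum g UNIV" using 0 by (simp add: infsum_int_shift)
  also have "\<dots> = cusp_part n Q c \<tau>"
    unfolding cusp_part_def by (rule infsum_cong) (simp add: g_def)
  finally show ?thesis .
qed

text \<open>Bounds with constants independent of the point of the ball, in the form that
  \<open>holomorphic_infsum\<close> consumes. The smaller of two \<kappa> serves the ball and the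
  base point at once.\<close>

lemma cusp_part_local_bounds:
  assumes n: "n > 0" and Q: "Q > 0" and z: "Im z \<noteq> 0"
  obtains e K where "e > 0" "K \<ge> 0"
    "\<And>c \<tau> w. \<lbrakk>c > 0; \<tau> \<in> ball z e\<rbrakk> \<Longrightarrow>
       norm (twist n Q c w * (cusp_term n Q c w \<tau> - cusp_term n Q c w \<i>)) \<le> K * (of_int c + \<bar>of_int w\<bar>) powr (- 2)"
    "\<And>c \<tau>. \<lbrakk>c > 0; coprime (int Q) c; \<tau> \<in> ball z e\<rbrakk> \<Longrightarrow> norm (cusp_part n Q c \<tau>) \<le> K * of_int c powr (- 1.02)"
proof -
  obtain e \<kappa>1 where 1: "e > 0" "\<And>\<tau>. \<tau> \<in> ball z e \<Longrightarrow> lattice_bound \<kappa>1 \<tau>"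
    "\<And>\<tau>. \<tau> \<in> ball z e \<Longrightarrow> norm \<tau> \<le> 1 + 2 * norm z"
    using lattice_bound_locally[OF z] by metis
  obtain \<kappa>2 where 2: "lattice_bound \<kappa>2 \<i>" using lattice_bound_exists[of \<i>] by auto
  define \<kappa> where "\<kappa> = min \<kappa>1 \<kappa>2"
  have "\<kappa>1 > 0" using 1(1) 1(2)[of z] by (simp add: lattice_bound_def)
  then have \<kappa>: "0 < \<kappa>" "\<kappa> \<le> \<kappa>1" "\<kappa> \<le> \<kappa>2" using 2 by (auto simp: \<kappa>_def lattice_bound_def)
  have i: "lattice_bound \<kappa> \<i>" by (rule lattice_bound_mono[OF 2 \<kappa>(1,3)])
  have lb: "lattice_bound \<kappa> \<tau>" if "\<tau> \<in> ball z e" for \<tau> by (rule lattice_bound_mono[OF 1(2)[OF that] \<kappa>(1,2)])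
  obtain K where K: "K \<ge> 0"
    "\<And>c \<tau> w. \<lbrakk>c > 0; lattice_bound \<kappa> \<tau>\<rbrakk> \<Longrightarrow>
       norm (twist n Q c w * (cusp_term n Q c w \<tau> - cusp_term n Q c w \<i>)) \<le> K * (1 + norm (\<tau> - \<i>)) * (of_int c + \<bar>of_int w\<bar>) powr (- 2)"
    "\<And>c \<tau>. \<lbrakk>c > 0; coprime (int Q) c; lattice_bound \<kappa> \<tau>\<rbrakk> \<Longrightarrow>
       norm (cusp_part n Q c \<tau>) \<le> K * (1 + norm (\<tau> - \<i>)) * of_int c powr (- 1.02)"
    by (rule cusp_part_bounds[OF n Q i]) blast
  have T: "K * (1 + norm (\<tau> - \<i>)) * x \<le> K * (3 + 2 * norm z) * x" if "\<tau> \<in> ball z e" "x \<ge> 0" for \<tau> x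
  proof -
    have "norm (\<tau> - \<i>) \<le> norm \<tau> + 1" using norm_triangle_ineq4[of \<tau> \<i>] by simp
    then show ?thesis using 1(3)[OF that(1)] that(2) K(1) by (intro mult_right_mono mult_left_mono) auto
  qed
  show thesis
  proof (rule that[OF 1(1), of "K * (3 + 2 * norm z)"])
    show "K * (3 + 2 * norm z) \<ge> 0" using K(1) by simp
    show "norm (twist n Q c w * (cusp_term n Q c w \<tau> - cusp_term n Q c w \<i>)) \<le> K * (3 + 2 * norm z) * (of_int c + \<bar>of_int w\<bar>) powr (- 2)"
      if "c > 0" "\<tau> \<in> ball z e" for c \<tau> w
      using K(2)[OF that(1) lb[OF that(2)], of w] T[OF that(2), of "(of_int c + \<bar>of_int w\<bar>) powr (- 2)"] by (meson order_trans powr_ge_zero)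
    show "norm (cusp_part n Q c \<tau>) \<le> K * (3 + 2 * norm z) * of_int c powr (- 1.02)"
      if "c > 0" "coprime (int Q) c" "\<tau> \<in> ball z e" for c \<tau>
      using K(3)[OF that(1,2) lb[OF that(3)]] T[OF that(3), of "of_int c powr (- 1.02)"] by (meson order_trans powr_ge_zero)
  qed
qed

section \<open>Holomorphy and growth in the upper and lower half-plane\<close>

lemma open_Im_nonzero: "open {z. Im z \<noteq> 0}"
proof -
  have "{z. Im z \<noteq> 0} = {z. Im z < 0} \<union> {z. Im z > 0}" by auto
  then show ?thesis by (metis open_Un open_halfspace_Im_lt open_halfspace_Im_gt)
qed

lemma holomorphic_cusp_part:
  assumes n: "n > 0" and Q: "Q > 0" and c: "c > 0"
  shows "cusp_part n Q c holomorphic_on {z. Im z \<noteq> 0}"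
proof -
  have "(\<lambda>z. \<Sum>\<^sub>\<infinity>w. twist n Q c w * (cusp_term n Q c w z - cusp_term n Q c w \<i>)) holomorphic_on {z. Im z \<noteq> 0}"
  proof (rule holomorphic_infsum[OF open_Im_nonzero])
    fix w
    have "of_int c * z + of_int w \<noteq> 0" if "Im z \<noteq> 0" for z :: complex
      using that c by (auto simp: complex_eq_iff)
    then show "(\<lambda>z. twist n Q c w * (cusp_term n Q c w z - cusp_term n Q c w \<i>)) holomorphic_on {z. Im z \<noteq> 0}"
      unfolding cusp_term_def ee_def using Q c by (intro holomorphic_intros) auto
  next
    fix z assume "z \<in> {z. Im z \<noteq> 0}"
    then obtain e K where eK: "e > 0" "K \<ge> 0"
      "\<And>c \<tau> w. \<lbrakk>c > 0; \<tau> \<in> ball z e\<rbrakk> \<Longrightarrow>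
       norm (twist n Q c w * (cusp_term n Q c w \<tau> - cusp_term n Q c w \<i>)) \<le> K * (of_int c + \<bar>of_int w\<bar>) powr (- 2)"
      using cusp_part_local_bounds[OF n Q, of z] by (smt (verit) mem_Collect_eq)
    have "(\<lambda>w. K * (of_int c + \<bar>of_int w\<bar>) powr (- 2)) summable_on UNIV"
      by (intro summable_on_cmult_right row_sum(1) c) simp
    then show "\<exists>e>0. \<exists>M. M summable_on UNIV \<and> (\<forall>w\<in>UNIV. \<forall>x\<in>ball z e \<inter> {z. Im z \<noteq> 0}.
        norm (twist n Q c w * (cusp_term n Q c w x - cusp_term n Q c w \<i>)) \<le> M w)"
      using eK c by blast
  qed
  then show ?thesis unfolding cusp_part_def .
qed

definition cusp_sum :: "nat \<Rightarrow> nat \<Rightarrow> int set \<Rightarrow> complex \<Rightarrow> complex" where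
  "cusp_sum n Q C \<tau> = (\<Sum>\<^sub>\<infinity>c\<in>C. cusp_part n Q c \<tau>)"

lemma summable_on_positive_subset:
  assumes "\<And>c. c \<in> C \<Longrightarrow> c > 0 \<and> coprime (int Q) c"
  shows "(\<lambda>c. K * real_of_int c powr (- 1.02)) summable_on C"
proof -
  have "(\<lambda>c::int. K * of_int c powr (- 1.02)) summable_on {0<..}"
    by (intro summable_on_cmult_right summable_on_pos_int_powr) simp
  then show ?thesis by (rule summable_on_subset_banach) (use assms in auto)
qed

lemma cusp_sum_summable:
  assumes n: "n > 0" and Q: "Q > 0" and \<tau>: "Im \<tau> \<noteq> 0" and C: "\<And>c. c \<in> C \<Longrightarrow> c > 0 \<and> coprime (int Q) c"
  shows "(\<lambda>c. cusp_part n Q c \<tau>) summable_on C"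
proof -
  obtain e K where eK: "e > 0" "\<And>c z. \<lbrakk>c > 0; coprime (int Q) c; z \<in> ball \<tau> e\<rbrakk> \<Longrightarrow> norm (cusp_part n Q c z) \<le> K * of_int c powr (- 1.02)"
    using cusp_part_local_bounds[OF n Q \<tau>] by metis
  show ?thesis
  proof (rule abs_summable_on_bounded_by(2))
    show "norm (cusp_part n Q c \<tau>) \<le> K * real_of_int c powr (- 1.02)" if "c \<in> C" for c
      using eK C[OF that] by auto
  qed (rule summable_on_positive_subset[OF C])
qed

lemma holomorphic_cusp_sum:
  assumes n: "n > 0" and Q: "Q > 0" and C: "\<And>c. c \<in> C \<Longrightarrow> c > 0 \<and> coprime (int Q) c"
  shows "cusp_sum n Q C holomorphic_on {z. Im z \<noteq> 0}"
proof -
  have "(\<lambda>z. \<Sum>\<^sub>\<infinity>c\<in>C. cusp_part n Q c z) holomorphic_on {z. Im z \<noteq> 0}"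
  proof (rule holomorphic_infsum[OF open_Im_nonzero])
    show "cusp_part n Q c holomorphic_on {z. Im z \<noteq> 0}" if "c \<in> C" for c
      using C[OF that] by (intro holomorphic_cusp_part n Q) auto
    fix z assume "z \<in> {z. Im z \<noteq> 0}"
    then have "Im z \<noteq> 0" by simp
    then obtain e K where eK: "e > 0" "\<And>c \<tau>. \<lbrakk>c > 0; coprime (int Q) c; \<tau> \<in> ball z e\<rbrakk> \<Longrightarrow> norm (cusp_part n Q c \<tau>) \<le> K * of_int c powr (- 1.02)"
      using cusp_part_local_bounds[OF n Q] by metis
    show "\<exists>e>0. \<exists>M. M summable_on C \<and> (\<forall>c\<in>C. \<forall>x\<in>ball z e \<inter> {z. Im z \<noteq> 0}. norm (cusp_part n Q c x) \<le> M c)"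
      by (intro exI[of _ e] exI[of _ "\<lambda>c. K * of_int c powr (- 1.02)"] conjI summable_on_positive_subset[OF C])
        (use eK C in auto)
  qed
  then show ?thesis unfolding cusp_sum_def .
qed

lemma cusp_sum_periodic:
  assumes n: "n > 0" and Q: "Q > 0" and C: "\<And>c. c \<in> C \<Longrightarrow> c > 0 \<and> coprime (int Q) c" and \<tau>: "Im \<tau> \<noteq> 0"
  shows "cusp_sum n Q C (\<tau> + 1) = cusp_sum n Q C \<tau>"
  unfolding cusp_sum_def using C by (intro infsum_cong cusp_part_periodic n Q \<tau>) auto

lemma cusp_sum_growth:
  assumes n: "n > 0" and Q: "Q > 0" and C: "\<And>c. c \<in> C \<Longrightarrow> c > 0 \<and> coprime (int Q) c"
  obtains K where "\<And>\<tau>. \<bar>Re \<tau>\<bar> \<le> 1 \<Longrightarrow> 1 \<le> \<bar>Im \<tau>\<bar> \<Longrightarrow> norm (cusp_sum n Q C \<tau>) \<le> K * \<bar>Im \<tau>\<bar>"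
proof -
  have i: "lattice_bound (1/5) \<i>" by (rule lattice_boundI) auto
  obtain K where K: "K \<ge> 0"
    "\<And>c \<tau>. \<lbrakk>c > 0; coprime (int Q) c; lattice_bound (1/5) \<tau>\<rbrakk> \<Longrightarrow>
       norm (cusp_part n Q c \<tau>) \<le> K * (1 + norm (\<tau> - \<i>)) * of_int c powr (- 1.02)"
    by (rule cusp_part_bounds[OF n Q i]) blast
  define Z where "Z = (\<Sum>\<^sub>\<infinity>c\<in>C. 1 * real_of_int c powr (- 1.02))"
  have Z: "Z \<ge> 0" unfolding Z_def by (rule infsum_nonneg) simp
  show thesis
  proof (rule that[of "4 * K * Z"])
    fix \<tau> assume \<tau>: "\<bar>Re \<tau>\<bar> \<le> 1" "1 \<le> \<bar>Im \<tau>\<bar>"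
    have nt: "norm \<tau> \<le> 1 + \<bar>Im \<tau>\<bar>" using cmod_le[of \<tau>] \<tau> by linarith
    \<comment> \<open>1/5 works because 1 + 2 |\<tau>| \<le> 3 + 2 |Im \<tau>| \<le> 5 |Im \<tau>|
      in this region.\<close>
    have lb: "lattice_bound (1/5) \<tau>" by (rule lattice_boundI) (use \<tau> nt in auto)
    define T where "T = 1 + norm (\<tau> - \<i>)"
    have T: "T \<le> 4 * \<bar>Im \<tau>\<bar>" using norm_triangle_ineq4[of \<tau> \<i>] nt \<tau> by (simp add: T_def)
    have "norm (cusp_sum n Q C \<tau>) \<le> (\<Sum>\<^sub>\<infinity>c\<in>C. K * T * of_int c powr (- 1.02))"
      unfolding cusp_sum_def
      by (rule abs_summable_on_bounded_by(3)[OF _ summable_on_positive_subset[OF C]]) (use K(2)[OF _ _ lb] C in \<open>auto simp: T_def\<close>)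
    also have "\<dots> = (\<Sum>\<^sub>\<infinity>c\<in>C. (K * T) * (1 * of_int c powr (- 1.02)))" by simp
    also have "\<dots> = K * T * Z" unfolding Z_def by (intro infsum_cmult_right summable_on_positive_subset[OF C])
    also have "\<dots> \<le> K * (4 * \<bar>Im \<tau>\<bar>) * Z" using T K(1) Z by (intro mult_right_mono mult_left_mono)
    finally show "norm (cusp_sum n Q C \<tau>) \<le> 4 * K * Z * \<bar>Im \<tau>\<bar>" by (simp add: mult_ac)
  qed
qed

lemma row_sums_at_one:
  assumes n: "n > 0" and Q: "Q > 0" and \<tau>: "Im \<tau> > 0" and C: "\<And>c. c \<in> C \<Longrightarrow> c > 0 \<and> coprime (int Q) c"
  shows "2 * of_real pi * (\<Sum>\<^sub>\<infinity>c\<in>C. row_sum n Q \<tau> c 1) = cusp_sum n Q C \<tau> - cusp_sum n Q C (cnj \<tau>)"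
proof -
  have t: "Im \<tau> \<noteq> 0" "Im (cnj \<tau>) \<noteq> 0" using \<tau> by auto
  have "2 * of_real pi * row_sum n Q \<tau> c 1 = cusp_part n Q c \<tau> - cusp_part n Q c (cnj \<tau>)" if c: "c > 0" for c
  proof -
    have "2 * of_real pi * row_sum n Q \<tau> c 1 = (\<Sum>\<^sub>\<infinity>w. 2 * of_real pi * row_term n Q \<tau> c w 1)"
      unfolding row_sum_def
      using abs_summable_summable[OF row_term_summable[OF n Q \<tau> c, of 1]] by (simp add: infsum_cmult_right)
    also have "\<dots> = (\<Sum>\<^sub>\<infinity>w. twist n Q c w * (cusp_term n Q c w \<tau> - cusp_term n Q c w \<i>) -
        twist n Q c w * (cusp_term n Q c w (cnj \<tau>) - cusp_term n Q c w \<i>))"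
      unfolding row_term_at_one[OF n Q \<tau> c] by (simp add: algebra_simps)
    also have "\<dots> = cusp_part n Q c \<tau> - cusp_part n Q c (cnj \<tau>)"
      unfolding cusp_part_def by (rule infsum_minus) (intro cusp_part_summable n Q c t)+
    finally show ?thesis .
  qed
  then have eq: "(\<Sum>\<^sub>\<infinity>c\<in>C. 2 * of_real pi * row_sum n Q \<tau> c 1) = (\<Sum>\<^sub>\<infinity>c\<in>C. cusp_part n Q c \<tau> - cusp_part n Q c (cnj \<tau>))"
    using C by (intro infsum_cong) auto
  have "2 * of_real pi * (\<Sum>\<^sub>\<infinity>c\<in>C. row_sum n Q \<tau> c 1) = (\<Sum>\<^sub>\<infinity>c\<in>C. 2 * of_real pi * row_sum n Q \<tau> c 1)"
    by (rule infsum_cmult_right'[symmetric])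
  also have "\<dots> = cusp_sum n Q C \<tau> - cusp_sum n Q C (cnj \<tau>)"
    unfolding eq cusp_sum_def by (intro infsum_minus cusp_sum_summable n Q t C)
  finally show ?thesis .
qed

section \<open>Fourier expansion\<close>

lemma periodic_int:
  fixes f :: "complex \<Rightarrow> complex"
  assumes "\<And>\<tau>. Im \<tau> > 0 \<Longrightarrow> f (\<tau> + 1) = f \<tau>" "Im \<tau> > 0"
  shows "f (\<tau> + of_int k) = f \<tau>"
proof (induction k rule: int_induct[where k = 0])
  case (step1 i)
  then show ?case using assms(1)[of "\<tau> + of_int i"] assms(2) by (simp add: add_ac)
next
  case (step2 i)
  then show ?case using assms(1)[of "\<tau> + of_int (i - 1)"] assms(2) by (simp add: add_ac)
qed simp

lemma norm_ee_less_1_iff: "norm (ee \<tau>) < 1 \<longleftrightarrow> Im \<tau> > 0"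
  by (simp add: norm_ee zero_less_mult_iff)

lemma ee_Ln: "q \<noteq> 0 \<Longrightarrow> ee (Ln q / (2 * of_real pi * \<i>)) = q"
  by (simp add: ee_def)

lemma ee_eq_imp_shift:
  assumes "ee a = ee b"
  obtains k :: int where "a = b + of_int k"
proof -
  have "exp (2 * of_real pi * \<i> * a) = exp (2 * of_real pi * \<i> * b)" using assms by (simp add: ee_def)
  then obtain k :: int where "2 * of_real pi * \<i> * a = 2 * of_real pi * \<i> * b + (of_int (2 * k) * pi) * \<i>"
    unfolding exp_eq by blast
  then have "2 * of_real pi * \<i> * a = 2 * of_real pi * \<i> * (b + of_int k)" by (simp add: algebra_simps)
  then have "a = b + of_int k" by (simp only: mult_cancel_left) simp
  then show thesis by (rule that)
qed

lemma mult_ln_bound: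
  assumes "0 < (x::real)"
  shows "x * (- ln x) \<le> 2 * sqrt x"
proof -
  have "ln (1 / sqrt x) \<le> 1 / sqrt x" using assms by (intro ln_bound) simp
  then have "- ln x \<le> 2 * (1 / sqrt x)" using assms by (simp add: ln_div ln_sqrt)
  then have "x * (- ln x) \<le> x * (2 * (1 / sqrt x))" using assms by (intro mult_left_mono) auto
  also have "\<dots> = 2 * sqrt x" using assms by (simp add: field_simps flip: power2_eq_square)
  finally show ?thesis .
qed

text \<open>The function induced on the punctured disc is \<open>o(1 / q)\<close> at the cusp, so that its singularity is removable.\<close>

lemma fourier_expansion:
  fixes f :: "complex \<Rightarrow> complex"
  assumes hol: "f holomorphic_on {z. Im z > 0}"
    and per: "\<And>\<tau>. Im \<tau> > 0 \<Longrightarrow> f (\<tau> + 1) = f \<tau>"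
    and growth: "\<And>\<tau>. \<bar>Re \<tau>\<bar> \<le> 1 \<Longrightarrow> 1 \<le> Im \<tau> \<Longrightarrow> norm (f \<tau>) \<le> K * Im \<tau>"
  obtains a :: "nat \<Rightarrow> complex" where "\<And>\<tau>. Im \<tau> > 0 \<Longrightarrow> ((\<lambda>l. a l * ee \<tau> ^ l) has_sum f \<tau>) UNIV"
proof -
  define F where "F q = f (Ln q / (2 * of_real pi * \<i>))" for q
  have F: "F (ee \<tau>) = f \<tau>" if \<tau>: "Im \<tau> > 0" for \<tau>
  proof -
    have "ee (Ln (ee \<tau>) / (2 * of_real pi * \<i>)) = ee \<tau>" by (rule ee_Ln) (simp add: ee_def)
    then obtain k :: int where "Ln (ee \<tau>) / (2 * of_real pi * \<i>) = \<tau> + of_int k" by (rule ee_eq_imp_shift)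
    then show ?thesis unfolding F_def using periodic_int[of f, OF per \<tau>] by simp
  qed
  have holF: "F holomorphic_on ball 0 1 - {0}"
  proof (rule holomorphic_onI)
    fix q0 :: complex assume q0: "q0 \<in> ball 0 1 - {0}"
    define \<tau>0 where "\<tau>0 = Ln q0 / (2 * of_real pi * \<i>)"
    \<comment> \<open>A local inverse of \<open>ee\<close> around \<open>q0\<close>: the logarithm
      is taken of q / q0, which is near 1, so its branch cut is avoided wherever q0 lies.\<close>
    define h where "h q = \<tau>0 + Ln (q / q0) / (2 * of_real pi * \<i>)" for q
    have e0: "ee \<tau>0 = q0" using q0 by (simp add: \<tau>0_def ee_Ln)
    then have \<tau>0: "Im \<tau>0 > 0" using q0 by (simp add: norm_ee_less_1_iff[symmetric])
    have eq: "f (h q) = F q" if q: "q \<in> ball 0 1 - {0}" for q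
    proof -
      have "ee (h q) = q0 * (q / q0)" unfolding h_def ee_add e0 using q q0 by (subst ee_Ln) auto
      then have eh: "ee (h q) = q" using q0 by simp
      then have "Im (h q) > 0" using q by (simp add: norm_ee_less_1_iff[symmetric])
      then show ?thesis using F[of "h q"] eh by simp
    qed
    have "h q0 = \<tau>0" using q0 by (simp add: h_def)
    moreover have "f field_differentiable at \<tau>0"
      by (rule holomorphic_on_imp_differentiable_at[OF hol open_halfspace_Im_gt]) (use \<tau>0 in simp)
    moreover have "h field_differentiable at q0"
    proof -
      have "((\<lambda>q. Ln (q / q0)) has_field_derivative inverse (q0 / q0) * (1 / q0)) (at q0)"
        by (rule DERIV_chain2[OF has_field_derivative_Ln]) (use q0 in \<open>auto intro!: derivative_eq_intros simp: complex_nonpos_Reals_iff\<close>)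
      then have "(\<lambda>q. Ln (q / q0)) field_differentiable at q0" by (auto simp: field_differentiable_def)
      then show ?thesis unfolding h_def by (intro field_differentiable_add field_differentiable_divide field_differentiable_const) auto
    qed
    ultimately have "(f \<circ> h) field_differentiable at q0" by (intro field_differentiable_compose) auto
    then obtain D where "((f \<circ> h) has_field_derivative D) (at q0)" by (auto simp: field_differentiable_def)
    then have "(F has_field_derivative D) (at q0)"
      by (rule has_field_derivative_transform_within_open[of _ _ _ "ball 0 1 - {0}"]) (use q0 eq in auto)
    then show "F field_differentiable at q0 within ball 0 1 - {0}"
      by (auto simp: field_differentiable_def intro: has_field_derivative_at_within)
  qed
  have "((\<lambda>q. (q - 0) * F q) \<longlongrightarrow> 0) (at 0)"
  proof (rule Lim_null_comparison)
    \<comment> \<open>This radius places the preimage under \<open>ee\<close> at height at least 1,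
      where the growth hypothesis applies.\<close>
    have small: "\<forall>\<^sub>F q in at (0::complex). q \<in> ball 0 (exp (- 2 * pi)) - {0}"
      using eventually_at_in_open[of "ball 0 (exp (- 2 * pi))" "0::complex"] by auto
    show "\<forall>\<^sub>F q in at 0. norm ((q - 0) * F q) \<le> \<bar>K\<bar> * (2 * sqrt (norm q))"
      using small
    proof eventually_elim
      case (elim q)
      define \<tau> where "\<tau> = Ln q / (2 * of_real pi * \<i>)"
      have q: "q \<noteq> 0" "norm q < exp (- 2 * pi)" using elim by auto
      have t: "Re \<tau> = Im (Ln q) / (2 * pi)" "Im \<tau> = - ln (norm q) / (2 * pi)"
        using q by (simp_all add: \<tau>_def Re_divide Im_divide power2_eq_square)
      have "\<bar>Im (Ln q)\<bar> \<le> pi" using q Im_Ln_le_pi[of q] mpi_less_Im_Ln[of q] by auto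
      then have re: "\<bar>Re \<tau>\<bar> \<le> 1" unfolding t by (simp add: abs_divide divide_le_eq)
      have "ln (norm q) < - 2 * pi" using q by (metis ln_exp ln_less_cancel_iff exp_gt_zero zero_less_norm_iff)
      then have im: "1 \<le> Im \<tau>" unfolding t by (simp add: field_simps)
      have "norm (F q) \<le> K * Im \<tau>" unfolding F_def \<tau>_def[symmetric] by (rule growth[OF re im])
      also have "\<dots> \<le> \<bar>K\<bar> * Im \<tau>" using im by (intro mult_right_mono) auto
      also have "\<dots> \<le> \<bar>K\<bar> * (- ln (norm q))"
      proof (intro mult_left_mono)
        have "0 \<le> - ln (norm q)" using \<open>ln (norm q) < - 2 * pi\<close> pi_gt_zero by linarith
        then show "Im \<tau> \<le> - ln (norm q)" unfolding t using pi_gt3 frac_le[of "- ln (norm q)" "- ln (norm q)" 1 "2 * pi"] by simp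
      qed simp
      finally have "norm q * norm (F q) \<le> norm q * (\<bar>K\<bar> * (- ln (norm q)))" by (intro mult_left_mono) auto
      also have "\<dots> = \<bar>K\<bar> * (norm q * (- ln (norm q)))" by simp
      also have "\<dots> \<le> \<bar>K\<bar> * (2 * sqrt (norm q))" using q by (intro mult_left_mono mult_ln_bound) auto
      finally show ?case by (simp add: norm_mult)
    qed
    have "((\<lambda>q::complex. \<bar>K\<bar> * (2 * sqrt (norm q))) \<longlongrightarrow> \<bar>K\<bar> * (2 * sqrt (norm (0::complex)))) (at 0)"
      by (intro tendsto_intros)
    then show "((\<lambda>q::complex. \<bar>K\<bar> * (2 * sqrt (norm q))) \<longlongrightarrow> 0) (at 0)" by simp
  qed
  then obtain g where g: "g holomorphic_on ball 0 1" "\<And>q. q \<in> ball 0 1 - {0} \<Longrightarrow> g q = F q"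
    using holomorphic_on_extend_lim[OF holF] by auto
  define a where "a l = (deriv ^^ l) g 0 / fact l" for l
  have pw: "(\<lambda>l. a l * q ^ l) sums g q" if "norm q < 1" for q
    using holomorphic_power_series[OF g(1), of q] that by (simp add: a_def)
  show thesis
  proof (rule that[of a])
    fix \<tau> assume \<tau>: "Im \<tau> > 0"
    then have q: "norm (ee \<tau>) < 1" by (simp add: norm_ee_less_1_iff)
    then obtain r where r: "norm (ee \<tau>) < r" "r < 1" using dense by blast
    then have r0: "r > 0" using norm_ge_zero[of "ee \<tau>"] by linarith
    have "summable (\<lambda>l. norm (a l * ee \<tau> ^ l))"
      by (rule powser_insidea[of a "of_real r"]) (use sums_summable[OF pw[of "of_real r"]] r r0 in auto)
    moreover have "(\<lambda>l. a l * ee \<tau> ^ l) sums f \<tau>"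
      using pw[OF q] g(2)[of "ee \<tau>"] F[OF \<tau>] q by (simp add: ee_def)
    ultimately show "((\<lambda>l. a l * ee \<tau> ^ l) has_sum f \<tau>) UNIV" by (rule norm_summable_imp_has_sum)
  qed
qed

text \<open>The condition inside \<open>coeff_j\<close> with the principal part absorbed into R, so
  that existence and uniqueness of coefficients can be treated for functions of this shape in
  general.\<close>

definition harmonic_expansion :: "(complex \<Rightarrow> complex) \<Rightarrow> (int \<Rightarrow> complex) \<Rightarrow> bool" where
  "harmonic_expansion R c \<longleftrightarrow> (\<forall>\<tau>. Im \<tau> > 0 \<longrightarrow>
     ((\<lambda>l. if l > 0 then c l * ee \<tau> ^ nat l else c l * cnj (ee \<tau>) ^ nat (- l)) has_sum (R \<tau> - c 0)) (- {0}))"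

lemma has_sum_minus:
  fixes f g :: "'a \<Rightarrow> complex"
  assumes "(f has_sum S) A" "(g has_sum T) A"
  shows "((\<lambda>x. f x - g x) has_sum (S - T)) A"
  using has_sum_add[OF assms(1) has_sum_uminusI[OF assms(2)]] by simp

lemma has_sum_nonzero_ints:
  fixes f :: "int \<Rightarrow> complex"
  assumes "((\<lambda>k. f (int k)) has_sum S) {1..}" "((\<lambda>k. f (- int k)) has_sum T) {1..}"
  shows "(f has_sum (S + T)) (- {0})"
proof -
  have "(f has_sum S) (int ` {1..})" using assms(1) by (subst has_sum_reindex) (auto simp: o_def)
  moreover have "(f has_sum T) ((\<lambda>k. - int k) ` {1..})"
    using assms(2) by (subst has_sum_reindex) (auto simp: o_def inj_on_def)
  ultimately have "(f has_sum (S + T)) (int ` {1..} \<union> (\<lambda>k. - int k) ` {1..})"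
    by (rule has_sum_Un_disjoint) auto
  also have "int ` {1..} \<union> (\<lambda>k. - int k) ` {1..} = - {0}"
  proof -
    have "l \<in> int ` {1..} \<union> (\<lambda>k. - int k) ` {1..}" if "l \<noteq> 0" for l
      using that by (cases l rule: int_cases2) (auto intro!: image_eqI)
    then show ?thesis by auto
  qed
  finally show ?thesis .
qed

text \<open>Conjugating both the argument and the value of A turns its restriction to the lower
  half-plane into another periodic holomorphic function on the upper one. The conjugate of its
  q-series provides the coefficients with negative index.\<close>

lemma harmonic_expansion_exists:
  fixes A :: "complex \<Rightarrow> complex"
  assumes hol: "A holomorphic_on {z. Im z \<noteq> 0}"
    and per: "\<And>\<tau>. Im \<tau> \<noteq> 0 \<Longrightarrow> A (\<tau> + 1) = A \<tau>"
    and growth: "\<And>\<tau>. \<bar>Re \<tau>\<bar> \<le> 1 \<Longrightarrow> 1 \<le> \<bar>Im \<tau>\<bar> \<Longrightarrow> norm (A \<tau>) \<le> K * \<bar>Im \<tau>\<bar>"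
  obtains c where "harmonic_expansion (\<lambda>\<tau>. A \<tau> - A (cnj \<tau>)) c"
proof -
  obtain a where a: "\<And>\<tau>. Im \<tau> > 0 \<Longrightarrow> ((\<lambda>l. a l * ee \<tau> ^ l) has_sum A \<tau>) UNIV"
  proof (rule fourier_expansion[of A K])
    show "A holomorphic_on {z. Im z > 0}" by (rule holomorphic_on_subset[OF hol]) auto
    show "A (\<tau> + 1) = A \<tau>" if "Im \<tau> > 0" for \<tau> using per that by simp
    show "norm (A \<tau>) \<le> K * Im \<tau>" if "\<bar>Re \<tau>\<bar> \<le> 1" "1 \<le> Im \<tau>" for \<tau> using growth[of \<tau>] that by simp
  qed blast
  define B where "B = cnj \<circ> A \<circ> cnj"
  obtain b where b: "\<And>\<tau>. Im \<tau> > 0 \<Longrightarrow> ((\<lambda>l. b l * ee \<tau> ^ l) has_sum B \<tau>) UNIV"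
  proof (rule fourier_expansion[of B K])
    show "B holomorphic_on {z. Im z > 0}" unfolding B_def
      by (intro holomorphic_on_compose_cnj_cnj holomorphic_on_subset[OF hol] open_halfspace_Im_gt) auto
    show "B (\<tau> + 1) = B \<tau>" if "Im \<tau> > 0" for \<tau> using per[of "cnj \<tau>"] that by (simp add: B_def)
    show "norm (B \<tau>) \<le> K * Im \<tau>" if "\<bar>Re \<tau>\<bar> \<le> 1" "1 \<le> Im \<tau>" for \<tau>
      using growth[of "cnj \<tau>"] that by (simp add: B_def)
  qed blast
  define c where "c l = (if l > 0 then a (nat l) else if l < 0 then - cnj (b (nat (- l))) else a 0 - cnj (b 0))" for l
  have tail: "((\<lambda>k. f k) has_sum (S - f 0)) {1..}" if "(f has_sum S) UNIV" for f :: "nat \<Rightarrow> complex" and S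
  proof -
    have U: "insert 0 {1::nat..} = UNIV" by auto
    have T: "(f has_sum infsum f {1..}) {1..}"
      using summable_on_subset_banach[OF has_sum_imp_summable[OF that]] by simp
    have "(f has_sum (f 0 + infsum f {1..})) (insert 0 {1..})" by (rule has_sum_insert[OF _ T]) simp
    then have "S = f 0 + infsum f {1..}" unfolding U using that has_sum_unique by blast
    then show ?thesis using T by simp
  qed
  have "harmonic_expansion (\<lambda>\<tau>. A \<tau> - A (cnj \<tau>)) c"
    unfolding harmonic_expansion_def
  proof (intro allI impI)
    fix \<tau> assume \<tau>: "Im \<tau> > 0"
    let ?g = "\<lambda>l. if l > 0 then c l * ee \<tau> ^ nat l else c l * cnj (ee \<tau>) ^ nat (- l)"
    have "((\<lambda>k. a k * ee \<tau> ^ k) has_sum (A \<tau> - a 0)) {1..}" using tail[OF a[OF \<tau>]] by simp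
    then have 1: "((\<lambda>k. ?g (int k)) has_sum (A \<tau> - a 0)) {1..}"
      by (rule has_sum_cong[THEN iffD1, rotated]) (auto simp: c_def)
    have "((\<lambda>l. cnj (b l * ee \<tau> ^ l)) has_sum cnj (B \<tau>)) UNIV" using b[OF \<tau>] by (subst has_sum_cnj_iff)
    from tail[OF this] have "((\<lambda>l. - cnj (b l * ee \<tau> ^ l)) has_sum - (cnj (B \<tau>) - cnj (b 0))) {1..}"
      by (intro has_sum_uminusI) simp
    then have 2: "((\<lambda>k. ?g (- int k)) has_sum - (cnj (B \<tau>) - cnj (b 0))) {1..}"
      by (rule has_sum_cong[THEN iffD1, rotated]) (auto simp: c_def)
    show "(?g has_sum (A \<tau> - A (cnj \<tau>) - c 0)) (- {0})"
      using has_sum_nonzero_ints[OF 1 2] by (simp add: c_def B_def algebra_simps)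
  qed
  then show thesis by (rule that)
qed

text \<open>Evaluation at the point of the imaginary axis where \<open>ee \<tau>\<close> equals r;
  for complex terms unordered summability is absolute.\<close>

lemma harmonic_expansion_summable:
  assumes "harmonic_expansion R c" "0 < r" "r < 1"
  shows "(\<lambda>l. norm (c l) * r ^ nat \<bar>l\<bar>) summable_on (- {0})"
proof -
  define \<tau> where "\<tau> = \<i> * of_real (- ln r / (2 * pi))"
  have e: "ee \<tau> = of_real r"
  proof -
    have "2 * of_real pi * \<i> * \<tau> = of_real (ln r)" by (simp add: \<tau>_def complex_eq_iff)
    then show ?thesis using assms by (simp add: ee_def exp_of_real)
  qed
  have "Im \<tau> > 0" using assms by (simp add: \<tau>_def divide_neg_pos)
  then have "((\<lambda>l. if l > 0 then c l * ee \<tau> ^ nat l else c l * cnj (ee \<tau>) ^ nat (- l)) has_sum (R \<tau> - c 0)) (- {0})"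
    using assms(1) by (simp add: harmonic_expansion_def)
  then have "(\<lambda>l. norm (if l > 0 then c l * ee \<tau> ^ nat l else c l * cnj (ee \<tau>) ^ nat (- l))) summable_on (- {0})"
    by (simp only: has_sum_imp_summable flip: summable_on_iff_abs_summable_on_complex)
  then show ?thesis
    by (rule summable_on_cong[THEN iffD1, rotated]) (use assms in \<open>auto simp: e norm_mult norm_power\<close>)
qed

lemma filterlim_Im_at_top: "filterlim Im at_top (filtercomap Im at_top)"
  by (rule filterlim_filtercomap)

text \<open>Every term apart from the constant contains at least one factor q or its conjugate. This
  pulls exp (-2 pi Im \<tau>) out in front of a fixed series that converges at r = exp (-2 pi), the
  value of |q| at height 1.\<close>

lemma harmonic_expansion_limit:
  assumes E: "harmonic_expansion R c"
  shows "(R \<longlongrightarrow> c 0) (filtercomap Im at_top)"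
proof -
  define r where "r = exp (- 2 * pi)"
  have r: "0 < r" "r < 1" by (auto simp: r_def)
  define M where "M = (\<Sum>\<^sub>\<infinity>l\<in>- {0}. norm (c l) * r ^ nat \<bar>l\<bar>)"
  note sm = harmonic_expansion_summable[OF E r]
  have ev: "\<forall>\<^sub>F \<tau> in filtercomap Im at_top. Im \<tau> \<ge> 1"
    using filterlim_Im_at_top eventually_ge_at_top[of "1::real"] by (simp add: filterlim_iff)
  have "((\<lambda>\<tau>. R \<tau> - c 0) \<longlongrightarrow> 0) (filtercomap Im at_top)"
  proof (rule Lim_null_comparison)
    show "\<forall>\<^sub>F \<tau> in filtercomap Im at_top. norm (R \<tau> - c 0) \<le> exp (- 2 * pi * Im \<tau>) / r * M"
      using ev
    proof eventually_elim
      case (elim \<tau>)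
      define x where "x = norm (ee \<tau>)"
      have x: "x = exp (- 2 * pi * Im \<tau>)" by (simp add: x_def norm_ee)
      have xr: "0 \<le> x" "x \<le> r" using elim by (auto simp: x r_def)
      let ?g = "\<lambda>l. if l > 0 then c l * ee \<tau> ^ nat l else c l * cnj (ee \<tau>) ^ nat (- l)"
      have hs: "(?g has_sum (R \<tau> - c 0)) (- {0})" using E elim by (simp add: harmonic_expansion_def)
      have le: "norm (?g l) \<le> x / r * (norm (c l) * r ^ nat \<bar>l\<bar>)" if l: "l \<in> - {0}" for l
      proof -
        obtain k where k: "nat \<bar>l\<bar> = Suc k" using l by (metis ComplD insertI1 not0_implies_Suc nat_0_iff zero_less_abs_iff not_le)
        have "norm (?g l) = norm (c l) * x ^ nat \<bar>l\<bar>" by (auto simp: x_def norm_mult norm_power)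
        also have "\<dots> \<le> norm (c l) * (x * r ^ k)"
          unfolding k using xr by (intro mult_left_mono) (simp_all add: mult_left_mono power_mono)
        also have "\<dots> = x / r * (norm (c l) * r ^ nat \<bar>l\<bar>)" unfolding k using r by simp
        finally show ?thesis .
      qed
      have "norm (infsum ?g (- {0})) \<le> (\<Sum>\<^sub>\<infinity>l\<in>- {0}. x / r * (norm (c l) * r ^ nat \<bar>l\<bar>))"
        by (rule abs_summable_on_bounded_by(3)[OF le summable_on_cmult_right[OF sm]])
      also have "\<dots> = x / r * M" unfolding M_def by (rule infsum_cmult_right) (rule sm)
      finally show ?case using infsumI[OF hs] x by simp
    qed
    have "((\<lambda>\<tau>. exp (- 2 * pi * Im \<tau>)) \<longlongrightarrow> 0) (filtercomap Im at_top)"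
    proof (rule filterlim_compose[OF exp_at_bot])
      have "filterlim (\<lambda>\<tau>. 2 * pi * Im \<tau>) at_top (filtercomap Im at_top)"
        by (rule filterlim_tendsto_pos_mult_at_top[OF tendsto_const _ filterlim_Im_at_top]) simp
      then show "filterlim (\<lambda>\<tau>. - 2 * pi * Im \<tau>) at_bot (filtercomap Im at_top)"
        by (simp add: filterlim_uminus_at_top)
    qed
    then have "((\<lambda>\<tau>. exp (- 2 * pi * Im \<tau>) / r * M) \<longlongrightarrow> 0 / r * M) (filtercomap Im at_top)"
      by (intro tendsto_intros) (use r in auto)
    then show "((\<lambda>\<tau>. exp (- 2 * pi * Im \<tau>) / r * M) \<longlongrightarrow> 0) (filtercomap Im at_top)" by simp
  qed
  then show ?thesis by (rule LIM_zero_cancel)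
qed

text \<open>Isolation of zeros. The series is first multiplied by z, since
  \<open>powser_0_nonzero\<close> isolates a zero at the centre.\<close>

lemma power_series_eq_0_on_reals:
  fixes d :: "nat \<Rightarrow> complex"
  assumes sm: "\<And>r. 0 < r \<Longrightarrow> r < 1 \<Longrightarrow> summable (\<lambda>k. norm (d k) * r ^ k)"
    and zero: "\<And>r. 0 < r \<Longrightarrow> r < 1 \<Longrightarrow> (\<lambda>k. d k * of_real r ^ k) sums 0"
  shows "d m = 0"
proof (rule ccontr)
  assume m: "d m \<noteq> 0"
  define a where "a k = (if k = 0 then 0 else d (k - 1))" for k
  define f where "f z = z * (\<Sum>k. d k * z ^ k)" for z
  have sums: "(\<lambda>k. a k * (z - 0) ^ k) sums f z" if z: "norm (z - 0) < 1" for z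
  proof -
    obtain r where r: "norm z < r" "r < 1" using z dense by auto
    then have r0: "r > 0" using norm_ge_zero[of z] by linarith
    have "summable (\<lambda>k. norm (d k * z ^ k))"
      by (rule summable_comparison_test[OF _ sm[OF r0 r(2)]])
        (use r in \<open>auto simp: norm_mult norm_power intro!: mult_left_mono power_mono\<close>)
    then have "(\<lambda>k. d k * z ^ k) sums (\<Sum>k. d k * z ^ k)" by (rule summable_sums[OF summable_norm_cancel])
    then have "(\<lambda>k. z * (d k * z ^ k)) sums f z" unfolding f_def by (rule sums_mult)
    then have "(\<lambda>k. a (Suc k) * z ^ Suc k) sums f z" by (simp add: a_def mult_ac)
    then show ?thesis using sums_Suc_iff[of "\<lambda>k. a k * z ^ k" "f z"] by (simp add: a_def)
  qed
  obtain s where s: "0 < s" "\<And>z. z \<in> cball 0 s - {0} \<Longrightarrow> f z \<noteq> 0"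
    by (rule powser_0_nonzero[OF zero_less_one sums, of "Suc m"]) (use m in \<open>auto simp: a_def f_def\<close>)
  define r where "r = min s (1/2)"
  have r: "0 < r" "r < 1" "r \<le> s" using s by (auto simp: r_def)
  have "f (of_real r) = 0" using sums_unique[OF zero[OF r(1,2)]] by (simp add: f_def)
  moreover have "f (of_real r) \<noteq> 0" by (rule s(2)) (use r in auto)
  ultimately show False by simp
qed

text \<open>On the ray q = \<omega> r the difference of two expansions is a power series in r, so
  for each m the coefficients of index m and -m satisfy a linear relation with weights \<omega> ^ m
  and its conjugate. The directions with \<omega> = 1 and \<omega> ^ m = \<i> separate the
  two.\<close>

lemma harmonic_expansion_unique:
  assumes E: "harmonic_expansion R c" "harmonic_expansion R c'"
  shows "c = c'"
proof -
  define \<delta> where "\<delta> l = c l - c' l" for l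
  have sym: "\<delta> 0 = 0 \<and> (m \<ge> 1 \<longrightarrow> \<delta> (int m) * \<omega> ^ m + \<delta> (- int m) * cnj \<omega> ^ m = 0)" if \<omega>: "norm \<omega> = 1" for \<omega> m
  proof -
    define d where "d k = (if k = 0 then \<delta> 0 else \<delta> (int k) * \<omega> ^ k + \<delta> (- int k) * cnj \<omega> ^ k)" for k :: nat
    define f where "f r l = (if l > 0 then \<delta> l * \<omega> ^ nat l else \<delta> l * cnj \<omega> ^ nat (- l)) * of_real r ^ nat \<bar>l\<bar>" for l and r :: real
    have smr: "(\<lambda>l. norm (f r l)) summable_on (- {0})" and hs: "(f r has_sum (- \<delta> 0)) (- {0})" if r: "0 < r" "r < 1" for r
    proof -
      have "(\<lambda>l. norm (c l) * r ^ nat \<bar>l\<bar> + norm (c' l) * r ^ nat \<bar>l\<bar>) summable_on (- {0})"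
        by (intro summable_on_add harmonic_expansion_summable[OF E(1) r] harmonic_expansion_summable[OF E(2) r])
      then show "(\<lambda>l. norm (f r l)) summable_on (- {0})"
      proof (rule abs_summable_on_bounded_by(1)[rotated])
        fix l
        have "norm (f r l) = norm (\<delta> l) * r ^ nat \<bar>l\<bar>" using \<omega> r by (auto simp: f_def norm_mult norm_power)
        also have "\<dots> \<le> (norm (c l) + norm (c' l)) * r ^ nat \<bar>l\<bar>"
          unfolding \<delta>_def using r by (intro mult_right_mono norm_triangle_ineq4) auto
        finally show "norm (f r l) \<le> norm (c l) * r ^ nat \<bar>l\<bar> + norm (c' l) * r ^ nat \<bar>l\<bar>" by (simp add: distrib_right)
      qed
      define \<tau> where "\<tau> = Ln (\<omega> * of_real r) / (2 * of_real pi * \<i>)"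
      have nz: "\<omega> * of_real r \<noteq> 0" using \<omega> r by auto
      have e: "ee \<tau> = \<omega> * of_real r" unfolding \<tau>_def by (rule ee_Ln[OF nz])
      have "Im \<tau> > 0" using r \<omega> by (simp add: norm_ee_less_1_iff[symmetric] e norm_mult)
      then have "((\<lambda>l. (if l > 0 then c l * ee \<tau> ^ nat l else c l * cnj (ee \<tau>) ^ nat (- l)) -
           (if l > 0 then c' l * ee \<tau> ^ nat l else c' l * cnj (ee \<tau>) ^ nat (- l))) has_sum ((R \<tau> - c 0) - (R \<tau> - c' 0))) (- {0})"
        using E by (intro has_sum_minus) (auto simp: harmonic_expansion_def)
      also have "(R \<tau> - c 0) - (R \<tau> - c' 0) = - \<delta> 0" by (simp add: \<delta>_def)
      finally show "(f r has_sum (- \<delta> 0)) (- {0})"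
        by (rule has_sum_cong[THEN iffD1, rotated]) (auto simp: f_def \<delta>_def e power_mult_distrib algebra_simps)
    qed
    have ser: "(\<lambda>k. d k * of_real r ^ k) sums 0 \<and> summable (\<lambda>k. norm (d k * of_real r ^ k))" if r: "0 < r" "r < 1" for r
    proof -
      have f1: "f r summable_on (int ` {1..})" "f r summable_on ((\<lambda>k. - int k) ` {1..})"
        by (rule summable_on_subset_banach[OF has_sum_imp_summable[OF hs[OF r]]]; auto)+
      then have s1: "(\<lambda>k. f r (int k)) summable_on {1..}" "(\<lambda>k. f r (- int k)) summable_on {1..}"
        by (subst (asm) summable_on_reindex; simp add: o_def inj_on_def)+
      have "infsum (\<lambda>k. f r (int k)) {1..} + infsum (\<lambda>k. f r (- int k)) {1..} = - \<delta> 0"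
        by (rule has_sum_unique[OF has_sum_nonzero_ints[OF has_sum_infsum[OF s1(1)] has_sum_infsum[OF s1(2)]] hs[OF r]])
      then have "((\<lambda>k. f r (int k) + f r (- int k)) has_sum (- \<delta> 0)) {1..}"
        using has_sum_add[OF has_sum_infsum[OF s1(1)] has_sum_infsum[OF s1(2)]] by simp
      then have "((\<lambda>k. d k * of_real r ^ k) has_sum (- \<delta> 0)) {1..}"
        by (rule has_sum_cong[THEN iffD1, rotated]) (auto simp: f_def d_def algebra_simps)
      then have "((\<lambda>k. d k * of_real r ^ k) has_sum (d 0 * of_real r ^ 0 + (- \<delta> 0))) (insert 0 {1..})"
        by (intro has_sum_insert) auto
      also have "insert 0 {1..} = (UNIV :: nat set)" by auto
      finally have "((\<lambda>k. d k * of_real r ^ k) has_sum 0) UNIV" by (simp add: d_def)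
      then have "(\<lambda>k. d k * of_real r ^ k) sums 0" "(\<lambda>k. d k * of_real r ^ k) summable_on UNIV"
        by (simp_all only: has_sum_imp_sums has_sum_imp_summable)
      moreover from this(2) have "summable (\<lambda>k. norm (d k * of_real r ^ k))"
        by (intro summable_on_imp_summable) (simp only: flip: summable_on_iff_abs_summable_on_complex)
      ultimately show ?thesis by blast
    qed
    have "d k = 0" for k
    proof (rule power_series_eq_0_on_reals)
      fix r :: real assume r: "0 < r" "r < 1"
      show "summable (\<lambda>k. norm (d k) * r ^ k)" using ser[OF r] r by (simp add: norm_mult norm_power)
      show "(\<lambda>k. d k * of_real r ^ k) sums 0" using ser[OF r] by blast
    qed
    from this[of 0] this[of m] show ?thesis by (auto simp: d_def)
  qed
  show "c = c'"
  proof
    fix l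
    have "\<delta> l = 0"
    proof (cases "l = 0")
      case True
      then show ?thesis using sym[of 1] by simp
    next
      case False
      define m where "m = nat \<bar>l\<bar>"
      have m: "m \<ge> 1" using False by (simp add: m_def)
      have 1: "\<delta> (int m) + \<delta> (- int m) = 0" using sym[of 1 m] m by simp
      define \<omega> where "\<omega> = ee (of_real (1 / (4 * real m)))"
      have "\<omega> ^ m = exp (of_nat m * (2 * of_real pi * \<i> * of_real (1 / (4 * real m))))"
        unfolding \<omega>_def ee_def by (rule exp_of_nat_mult[symmetric])
      also have "of_nat m * (2 * of_real pi * \<i> * of_real (1 / (4 * real m))) = of_real (pi / 2) * \<i>"
        using m by (simp add: field_simps)
      also have "exp (of_real (pi / 2) * \<i>) = \<i>" by (metis cis_conv_exp cis_pi_half mult.commute)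
      finally have \<omega>m: "\<omega> ^ m = \<i>" .
      then have "cnj \<omega> ^ m = - \<i>" by (metis complex_cnj_i complex_cnj_power)
      moreover have "norm \<omega> = 1" by (simp add: \<omega>_def norm_ee)
      ultimately have "\<delta> (int m) * \<i> - \<delta> (- int m) * \<i> = 0" using sym[of \<omega> m] m \<omega>m by simp
      then have "\<delta> (int m) = \<delta> (- int m)" by (simp add: left_diff_distrib[symmetric])
      then have "\<delta> (int m) = 0" "\<delta> (- int m) = 0" using 1 by auto
      moreover have "l = int m \<or> l = - int m" by (auto simp: m_def)
      ultimately show ?thesis by auto
    qed
    then show "c l = c' l" by (simp add: \<delta>_def)
  qed
qed

section \<open>The groups and their cosets\<close>

lemma mat2_nth [simp]:
  "vec_nth (vec_nth (mat2 a b c d) 1) 1 = a" "vec_nth (vec_nth (mat2 a b c d) 1) 2 = b"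
  "vec_nth (vec_nth (mat2 a b c d) 2) 1 = c" "vec_nth (vec_nth (mat2 a b c d) 2) 2 = d"
  by (simp_all add: mat2_def)

lemma mat2_eqI:
  fixes A B :: "real^2^2"
  assumes "vec_nth (vec_nth A 1) 1 = vec_nth (vec_nth B 1) 1" "vec_nth (vec_nth A 1) 2 = vec_nth (vec_nth B 1) 2"
    "vec_nth (vec_nth A 2) 1 = vec_nth (vec_nth B 2) 1" "vec_nth (vec_nth A 2) 2 = vec_nth (vec_nth B 2) 2"
  shows "A = B"
  using assms by (simp add: vec_eq_iff forall_2)

lemma mat2_cases:
  fixes A :: "real^2^2"
  obtains a b c d where "A = mat2 a b c d"
  using mat2_eqI[of A "mat2 (vec_nth (vec_nth A 1) 1) (vec_nth (vec_nth A 1) 2) (vec_nth (vec_nth A 2) 1) (vec_nth (vec_nth A 2) 2)"]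
  by auto

lemma mat2_eq_iff: "mat2 a b c d = mat2 a' b' c' d' \<longleftrightarrow> a = a' \<and> b = b' \<and> c = c' \<and> d = d'"
  by (metis mat2_nth)

lemma mat2_mult: "mat2 a b c d ** mat2 a' b' c' d' = mat2 (a * a' + b * c') (a * b' + b * d') (c * a' + d * c') (c * b' + d * d')"
  by (rule mat2_eqI) (simp_all add: matrix_matrix_mult_def sum_2)

lemma det_mat2: "det (mat2 a b c d) = a * d - b * c"
  by (simp add: det_2)

lemma mat_1_eq: "mat 1 = mat2 1 0 0 1"
  by (rule mat2_eqI) (simp_all add: mat_def)

lemma uminus_mat2: "- mat2 a b c d = mat2 (- a) (- b) (- c) (- d)"
  by (rule mat2_eqI) simp_all

lemma scaleR_mat2: "r *\<^sub>R mat2 a b c d = mat2 (r * a) (r * b) (r * c) (r * d)"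
  by (rule mat2_eqI) simp_all

lemma mat2_minus_mult: "- (A :: real^2^2) ** (B :: real^2^2) = - (A ** B)" "A ** - B = - (A ** B)"
  by (cases A rule: mat2_cases; cases B rule: mat2_cases; simp add: mat2_mult uminus_mat2)+

definition adj2 :: "real^2^2 \<Rightarrow> real^2^2" where
  "adj2 A = mat2 (vec_nth (vec_nth A 2) 2) (- vec_nth (vec_nth A 1) 2) (- vec_nth (vec_nth A 2) 1) (vec_nth (vec_nth A 1) 1)"

lemma adj2_mat2: "adj2 (mat2 a b c d) = mat2 d (- b) (- c) a"
  by (simp add: adj2_def)

lemma adj2_mult: "det A = 1 \<Longrightarrow> adj2 A ** A = mat 1" "det A = 1 \<Longrightarrow> A ** adj2 A = mat 1"
  by (cases A rule: mat2_cases; simp add: adj2_mat2 mat2_mult det_mat2 mat_1_eq mat2_eq_iff algebra_simps)+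

lemma det_adj2: "det (adj2 A) = det A"
  by (cases A rule: mat2_cases) (simp add: adj2_mat2 det_mat2)

lemma SL2R_simps [simp]: "carrier SL2R = {A. det A = 1}" "monoid.mult SL2R = (**)" "one SL2R = mat 1"
  by (simp_all add: SL2R_def)

lemma group_SL2R: "group SL2R"
proof (rule groupI)
  fix A assume "A \<in> carrier SL2R"
  then show "\<exists>B\<in>carrier SL2R. B \<otimes>\<^bsub>SL2R\<^esub> A = \<one>\<^bsub>SL2R\<^esub>"
    by (intro bexI[of _ "adj2 A"]) (auto simp: adj2_mult det_adj2)
qed (auto simp: det_mul matrix_mul_assoc)

lemma det_uminus_mat2: "det (- (A :: real^2^2)) = det A"
  by (cases A rule: mat2_cases) (simp add: uminus_mat2 det_mat2)

lemma psl_class_eq: "psl_class A = {A, - A}"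
  by (auto simp: psl_class_def r_coset_def mat2_minus_mult)

lemma normal_pm_one: "{mat 1, - mat 1} \<lhd> SL2R"
proof -
  interpret group SL2R by (rule group_SL2R)
  have "subgroup {mat 1, - mat 1} SL2R"
  proof (rule subgroupI)
    fix A assume A: "A \<in> {mat 1, - mat 1 :: real^2^2}"
    then have "inv\<^bsub>SL2R\<^esub> A = A"
      by (intro inv_equality) (auto simp: mat2_minus_mult det_uminus_mat2)
    then show "inv\<^bsub>SL2R\<^esub> A \<in> {mat 1, - mat 1}" using A by simp
  qed (auto simp: det_uminus_mat2 mat2_minus_mult)
  then show ?thesis
    by (rule normalI) (auto simp: r_coset_def l_coset_def mat2_minus_mult)
qed

lemma group_PSL2R: "group PSL2R"
  unfolding PSL2R_def by (rule normal.factorgroup_is_group[OF normal_pm_one])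

lemma carrier_PSL2R: "carrier PSL2R = psl_class ` {A. det A = 1}"
  by (auto simp: PSL2R_def FactGroup_def RCOSETS_def psl_class_def)

lemma one_PSL2R: "\<one>\<^bsub>PSL2R\<^esub> = psl_class (mat 1)"
  by (simp add: PSL2R_def FactGroup_def psl_class_eq)

lemma mult_PSL2R: "psl_class A \<otimes>\<^bsub>PSL2R\<^esub> psl_class B = psl_class (A ** B)"
  by (auto simp: PSL2R_def FactGroup_def set_mult_def psl_class_eq mat2_minus_mult)

lemma inv_PSL2R:
  assumes "det A = 1"
  shows "inv\<^bsub>PSL2R\<^esub> psl_class A = psl_class (adj2 A)"
  by (rule group.inv_equality[OF group_PSL2R])
    (use assms in \<open>auto simp: mult_PSL2R adj2_mult one_PSL2R carrier_PSL2R det_adj2\<close>)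

lemma psl_class_eq_iff: "psl_class A = psl_class B \<longleftrightarrow> A = B \<or> A = - B"
  by (auto simp: psl_class_eq doubleton_eq_iff)

lemma moebius_uminus: "moebius (- A) z = moebius A z"
proof -
  have "moebius (- A) z = (- (of_real (vec_nth (vec_nth A 1) 1) * z + of_real (vec_nth (vec_nth A 1) 2))) /
      (- (of_real (vec_nth (vec_nth A 2) 1) * z + of_real (vec_nth (vec_nth A 2) 2)))"
    by (simp add: moebius_def)
  then show ?thesis by (simp only: minus_divide_divide moebius_def)
qed

lemma psl_act_class: "psl_act (psl_class A) z = moebius A z"
  by (simp add: psl_act_def psl_class_eq moebius_uminus)

text \<open>The matrix of \<open>Atkin_Lehner\<close> after division by the root of Q, with the
  lower left entry N z written as Q c. For \<open>Q = 1\<close> it is an integral matrix, so that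
  \<open>Gamma0\<close> is treated along with the other cosets.\<close>

definition al_mat :: "nat \<Rightarrow> int \<Rightarrow> int \<Rightarrow> int \<Rightarrow> int \<Rightarrow> real^2^2" where
  "al_mat Q x y c w = mat2 (sqrt (real Q) * of_int x) (of_int y / sqrt (real Q)) (sqrt (real Q) * of_int c) (sqrt (real Q) * of_int w)"

lemma det_al_mat: "Q > 0 \<Longrightarrow> det (al_mat Q x y c w) = of_int (int Q * x * w - y * c)"
  by (simp add: al_mat_def det_mat2 algebra_simps)

section \<open>Products of Atkin-Lehner cosets\<close>

lemma Atkin_Lehner_eq:
  assumes "N > 0" "Q dvd N"
  shows "Atkin_Lehner Q N = {psl_class (al_mat Q x y c w) | x y c w. int Q * x * w - y * c = 1 \<and> int (N div Q) dvd c}"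
proof -
  have Q: "Q > 0" using assms by (auto intro: Nat.gr0I)
  obtain N' where N: "N = Q * N'" using assms by blast
  have s: "sqrt (real Q) * sqrt (real Q) = real Q" "sqrt (real Q) > 0" using Q by auto
  have mat: "(1 / sqrt (real Q)) *\<^sub>R mat2 (of_int (int Q * x)) (of_int y) (of_int (int N * z)) (of_int (int Q * w)) =
      al_mat Q x y (int N' * z) w" for x y z w
  proof -
    have h: "1 / sqrt (real Q) * (real Q * r) = sqrt (real Q) * r" for r :: real using s by (simp add: field_simps)
    show ?thesis unfolding al_mat_def scaleR_mat2 mat2_eq_iff N
      by (simp only: of_int_mult of_int_of_nat_eq of_nat_mult h mult.assoc) simp
  qed
  have det: "(int Q * x) * (int Q * w) - y * (int N * z) = int Q \<longleftrightarrow> int Q * x * w - y * (int N' * z) = 1" for x y z w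
  proof -
    have "(int Q * x) * (int Q * w) - y * (int N * z) = int Q * (int Q * x * w - y * (int N' * z))"
      by (simp add: N algebra_simps)
    then show ?thesis using Q by simp
  qed
  have "N div Q = N'" using Q N by simp
  then show ?thesis unfolding Atkin_Lehner_def mat det by (auto simp: dvd_def) metis
qed

lemma Gamma0_eq: "Gamma0 N = Atkin_Lehner 1 N"
proof -
  have m: "(1 / sqrt (real 1)) *\<^sub>R mat2 (of_int (int 1 * x)) (of_int y) (of_int (int N * z)) (of_int (int 1 * w)) =
      mat2 (of_int x) (of_int y) (of_int (int N * z)) (of_int w)" for x y z w
    by (simp add: scaleR_mat2)
  show ?thesis
  proof (intro equalityI subsetI)
    fix A assume "A \<in> Gamma0 N"
    then obtain a b c d where A: "A = psl_class (mat2 (of_int a) (of_int b) (of_int c) (of_int d))"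
        "a * d - b * c = 1" "int N dvd c" unfolding Gamma0_def by blast
    obtain k where k: "c = int N * k" using A(3) by blast
    have "(int 1 * a) * (int 1 * d) - b * (int N * k) = int 1" using A(2) by (simp add: k)
    then show "A \<in> Atkin_Lehner 1 N" unfolding A(1) k Atkin_Lehner_def m by blast
  next
    fix A assume "A \<in> Atkin_Lehner 1 N"
    then obtain x y z w where A: "A = psl_class (mat2 (of_int x) (of_int y) (of_int (int N * z)) (of_int w))"
        "(int 1 * x) * (int 1 * w) - y * (int N * z) = int 1" unfolding Atkin_Lehner_def m by blast
    have "x * w - y * (int N * z) = 1" "int N dvd int N * z" using A(2) by simp_all
    then show "A \<in> Gamma0 N" unfolding A(1) Gamma0_def by blast
  qed
qed

text \<open>Q Q' divided by the square of their gcd: the index of the coset that contains the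
  products of elements from the cosets of Q and Q'.\<close>

definition star :: "nat \<Rightarrow> nat \<Rightarrow> nat" where
  "star Q Q' = (Q div gcd Q Q') * (Q' div gcd Q Q')"

text \<open>Here g is the gcd of the two divisors, and q, q' are the cofactors. The product of the
  two square roots is g times the root of q q', so g joins the integral entries and the product has
  the same shape for q q'.\<close>

lemma al_mat_mult:
  fixes g q q' :: nat and k :: int
  assumes "g > 0" "q > 0" "q' > 0"
  shows "al_mat (g * q) x y (int q' * k * z) w ** al_mat (g * q') x' y' (int q * k * z') w' =
    al_mat (q * q') (int g * x * x' + k * y * z') (int q * x * y' + int q' * y * w')
      (int g * k * (int q' * z * x' + int q * w * z')) (k * z * y' + int g * w * w')"
proof -
  define a b e where "a = sqrt (real g)" "b = sqrt (real q)" "e = sqrt (real q')"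
  have p: "a > 0" "b > 0" "e > 0" using assms by (auto simp: a_b_e_def)
  have sq: "real g = a * a" "real q = b * b" "real q' = e * e" by (auto simp: a_b_e_def)
  have rt: "sqrt (real (g * q)) = a * b" "sqrt (real (g * q')) = a * e" "sqrt (real (q * q')) = b * e"
    by (auto simp: a_b_e_def real_sqrt_mult)
  show ?thesis unfolding al_mat_def mat2_mult rt mat2_eq_iff of_int_add of_int_mult of_int_of_nat_eq sq
    using p by (auto simp: field_simps)
qed

lemma mult_dvd_if_coprime:
  fixes g q q' N :: nat
  assumes "coprime q q'" "g * q dvd N" "g * q' dvd N" "g > 0"
  shows "g * q * q' dvd N"
proof -
  obtain t where t: "N = g * q * t" using assms(2) by blast
  then have "g * q' dvd g * (q * t)" using assms(3) by (simp add: mult.assoc)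
  then have "q' dvd q * t" using assms(4) by simp
  then have "q' dvd t" using assms(1) by (simp add: coprime_commute coprime_dvd_mult_right_iff)
  then show ?thesis unfolding t by (rule mult_dvd_mono[OF dvd_refl])
qed

lemma Atkin_Lehner_mult:
  assumes N: "N > 0" and Q: "Q dvd N" "Q' dvd N"
    and A: "A \<in> Atkin_Lehner Q N" and B: "B \<in> Atkin_Lehner Q' N"
  shows "star Q Q' dvd N" "A \<otimes>\<^bsub>PSL2R\<^esub> B \<in> Atkin_Lehner (star Q Q') N"
proof -
  have pos: "Q > 0" "Q' > 0" using N Q by (auto intro: Nat.gr0I)
  define g q q' where "g = gcd Q Q'" "q = Q div g" "q' = Q' div g"
  have g: "g > 0" using pos by (simp add: g_q_q'_def)
  have QQ: "Q = g * q" "Q' = g * q'" by (simp_all add: g_q_q'_def)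
  have qp: "q > 0" "q' > 0" using pos QQ by (auto intro: Nat.gr0I)
  have st: "star Q Q' = q * q'" by (simp add: star_def g_q_q'_def)
  have "coprime q q'" unfolding g_q_q'_def using pos by (intro div_gcd_coprime) auto
  then have "g * q * q' dvd N" using Q g unfolding QQ by (intro mult_dvd_if_coprime)
  then obtain k where k: "N = g * q * q' * k" by blast
  show dv: "star Q Q' dvd N" unfolding st k by (simp add: mult_ac)
  have d1: "N div Q = q' * k" using g qp unfolding k QQ by (simp add: mult.assoc)
  have d2: "N div Q' = q * k" using g qp unfolding k QQ by (simp add: mult.assoc mult.left_commute[of q])
  have d3: "N div star Q Q' = g * k" using g qp unfolding k st by (simp add: mult.assoc mult.left_commute[of g] div_mult2_eq)
  obtain x y c w where A': "A = psl_class (al_mat Q x y c w)" "int Q * x * w - y * c = 1" "int (q' * k) dvd c"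
    using A unfolding Atkin_Lehner_eq[OF N Q(1)] d1 by blast
  obtain x' y' c' w' where B': "B = psl_class (al_mat Q' x' y' c' w')" "int Q' * x' * w' - y' * c' = 1" "int (q * k) dvd c'"
    using B unfolding Atkin_Lehner_eq[OF N Q(2)] d2 by blast
  obtain z where z: "c = int q' * int k * z" using A'(3) by (auto simp: dvd_def)
  obtain z' where z': "c' = int q * int k * z'" using B'(3) by (auto simp: dvd_def)
  let ?X = "int g * x * x' + int k * y * z'" and ?Y = "int q * x * y' + int q' * y * w'"
    and ?C = "int g * int k * (int q' * z * x' + int q * w * z')" and ?W = "int k * z * y' + int g * w * w'"
  have "A \<otimes>\<^bsub>PSL2R\<^esub> B = psl_class (al_mat (star Q Q') ?X ?Y ?C ?W)"
    unfolding A'(1) B'(1) mult_PSL2R z z' st unfolding QQ by (simp only: al_mat_mult[OF g qp])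
  moreover have "int (star Q Q') * ?X * ?W - ?Y * ?C =
      (int Q * x * w - y * c) * (int Q' * x' * w' - y' * c')"
    unfolding st z z' unfolding QQ by (simp add: algebra_simps)
  then have "int (star Q Q') * ?X * ?W - ?Y * ?C = 1" by (simp only: A'(2) B'(2) mult_1_left)
  moreover have "int (N div star Q Q') dvd ?C" unfolding d3 by simp
  ultimately show "A \<otimes>\<^bsub>PSL2R\<^esub> B \<in> Atkin_Lehner (star Q Q') N"
    unfolding Atkin_Lehner_eq[OF N dv] by blast
qed

lemma Atkin_Lehner_carrier:
  assumes "N > 0" "Q dvd N"
  shows "Atkin_Lehner Q N \<subseteq> carrier PSL2R"
proof -
  have "Q > 0" using assms by (auto intro: Nat.gr0I)
  then show ?thesis
    unfolding Atkin_Lehner_eq[OF assms] carrier_PSL2R by (auto simp: det_al_mat)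
qed

lemma Atkin_Lehner_inv:
  assumes "N > 0" "Q dvd N" "A \<in> Atkin_Lehner Q N"
  shows "inv\<^bsub>PSL2R\<^esub> A \<in> Atkin_Lehner Q N"
proof -
  have Q: "Q > 0" using assms by (auto intro: Nat.gr0I)
  obtain x y c w where A: "A = psl_class (al_mat Q x y c w)" "int Q * x * w - y * c = 1" "int (N div Q) dvd c"
    using assms(3) unfolding Atkin_Lehner_eq[OF assms(1,2)] by blast
  have "inv\<^bsub>PSL2R\<^esub> A = psl_class (al_mat Q w (- y) (- c) x)"
  proof -
    have "det (al_mat Q x y c w) = 1" unfolding det_al_mat[OF Q] A(2) by simp
    then show ?thesis unfolding A(1) by (subst inv_PSL2R) (simp_all add: al_mat_def adj2_mat2)
  qed
  moreover have "int Q * w * x - (- y) * (- c) = 1" using A(2) by (simp add: mult_ac)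
  moreover have "int (N div Q) dvd - c" using A(3) by simp
  ultimately show ?thesis unfolding Atkin_Lehner_eq[OF assms(1,2)] by blast
qed

lemma Atkin_Lehner_nonempty:
  assumes "N > 0" "exact_divisor Q N"
  shows "Atkin_Lehner Q N \<noteq> {}"
proof -
  have Q: "Q dvd N" "coprime Q (N div Q)" using assms by (auto simp: exact_divisor_def coprime_iff_gcd_eq_1)
  then have "coprime (int Q) (int (N div Q))" by simp
  then obtain u v where "u * int Q + v * int (N div Q) = 1" using bezout_int[of "int Q" "int (N div Q)"] by auto
  then have e: "int Q * u * 1 - (- v) * int (N div Q) = 1" by (simp add: mult_ac)
  have "psl_class (al_mat Q u (- v) (int (N div Q)) 1) \<in> Atkin_Lehner Q N"
    unfolding Atkin_Lehner_eq[OF assms(1) Q(1)] by (rule CollectI, intro exI conjI, rule refl, rule e, rule dvd_refl)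
  then show ?thesis by blast
qed

text \<open>On exact divisors \<open>star\<close> is the symmetric difference of the sets of primes.
  This explains the identity for the double star, which recovers one factor from a product.\<close>

lemma star_exact_divisor:
  assumes "N > 0" "exact_divisor Q N" "exact_divisor Q' N"
  shows "exact_divisor (star Q Q') N" "star (star Q Q') Q = Q'" "star Q Q' > 0"
proof -
  have Q: "Q dvd N" "coprime Q (N div Q)" "Q' dvd N" "coprime Q' (N div Q')"
    using assms by (auto simp: exact_divisor_def coprime_iff_gcd_eq_1)
  have pos: "Q > 0" "Q' > 0" using assms(1) Q by (auto intro: Nat.gr0I)
  define g q q' where "g = gcd Q Q'" "q = Q div g" "q' = Q' div g"
  have g: "g > 0" using pos by (simp add: g_q_q'_def)
  have QQ: "Q = g * q" "Q' = g * q'" by (simp_all add: g_q_q'_def)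
  have qp: "q > 0" "q' > 0" using pos QQ by (auto intro: Nat.gr0I)
  have st: "star Q Q' = q * q'" by (simp add: star_def g_q_q'_def)
  have cop: "coprime q q'" unfolding g_q_q'_def using pos by (intro div_gcd_coprime) auto
  then have "g * q * q' dvd N" using Q g unfolding QQ by (intro mult_dvd_if_coprime)
  then obtain k where k: "N = g * q * q' * k" by blast
  have d1: "N div Q = q' * k" using g qp unfolding k QQ by (simp add: mult.assoc)
  have d2: "N div Q' = q * k" using g qp unfolding k QQ by (simp add: mult.assoc mult.left_commute[of q])
  have d3: "N div star Q Q' = g * k" using g qp unfolding k st by (simp add: mult.assoc mult.left_commute[of g] div_mult2_eq)
  have c: "coprime (g * q) (q' * k)" "coprime (g * q') (q * k)" using Q d1 d2 QQ by auto
  show "star Q Q' > 0" using qp by (simp add: st)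
  have "coprime (q * q') (g * k)" using c by (auto simp: coprime_commute)
  then show "exact_divisor (star Q Q') N"
    unfolding exact_divisor_def d3 by (auto simp: st k coprime_iff_gcd_eq_1 mult_ac)
  have "coprime q' g" using c by (auto simp: coprime_commute)
  then have "gcd (q * q') (g * q) = q" by (simp add: mult.commute[of g] gcd_mult_distrib_nat[symmetric])
  then show "star (star Q Q') Q = Q'" unfolding st unfolding star_def QQ using qp by (simp add: mult.commute)
qed

text \<open>The form in which \<open>is_level\<close> is used: the maximality of S appears as
  closure of \<open>insert 1 S\<close> under \<open>star\<close>, a property that is readily
  inherited by plicates.\<close>

fun good_level :: "level \<Rightarrow> bool" where
  "good_level (N, S) \<longleftrightarrow> N > 0 \<and> (\<forall>Q\<in>S. exact_divisor Q N \<and> Q > 1) \<and>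
     (\<forall>Q\<in>insert 1 S. \<forall>Q'\<in>insert 1 S. star Q Q' \<in> insert 1 S)"

lemma exact_divisor_1: "exact_divisor 1 N"
  by (simp add: exact_divisor_def)

text \<open>Closure under \<open>star\<close> makes the union of the cosets a subgroup, so it
  already equals the generated group.\<close>

lemma level_group_good:
  assumes "good_level (N, S)"
  shows "level_group (N, S) = (\<Union>Q\<in>insert 1 S. Atkin_Lehner Q N)"
proof -
  have N: "N > 0" and S: "\<And>Q. Q \<in> insert 1 S \<Longrightarrow> exact_divisor Q N"
    and cl: "\<And>Q Q'. Q \<in> insert 1 S \<Longrightarrow> Q' \<in> insert 1 S \<Longrightarrow> star Q Q' \<in> insert 1 S"
    using assms exact_divisor_1 by auto
  have dv: "Q dvd N" if "Q \<in> insert 1 S" for Q using S[OF that] by (simp add: exact_divisor_def)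
  let ?U = "\<Union>Q\<in>insert 1 S. Atkin_Lehner Q N"
  have "?U = generate PSL2R ?U"
  proof (rule group.generateI[OF group_PSL2R])
    show "subgroup ?U PSL2R"
    proof (rule group.subgroupI[OF group_PSL2R])
      show "?U \<subseteq> carrier PSL2R" using Atkin_Lehner_carrier[OF N dv] by blast
      show "?U \<noteq> {}" using Atkin_Lehner_nonempty[OF N exact_divisor_1] by blast
      show "inv\<^bsub>PSL2R\<^esub> A \<in> ?U" if "A \<in> ?U" for A using that Atkin_Lehner_inv[OF N dv] by blast
      show "A \<otimes>\<^bsub>PSL2R\<^esub> B \<in> ?U" if AB: "A \<in> ?U" "B \<in> ?U" for A B
      proof -
        obtain Q Q' where *: "Q \<in> insert 1 S" "A \<in> Atkin_Lehner Q N" "Q' \<in> insert 1 S" "B \<in> Atkin_Lehner Q' N"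
          using AB by blast
        show ?thesis using Atkin_Lehner_mult(2)[OF N dv[OF *(1)] dv[OF *(3)] *(2,4)] cl[OF *(1,3)] by blast
      qed
    qed
  qed auto
  then show ?thesis by (simp add: Gamma0_eq)
qed

text \<open>Suppose that R = \<open>star Q Q'\<close> is missing from S. An element of the coset of
  R times one of the coset of Q lies in the coset of Q', so adjoining R would not enlarge the group,
  against maximality.\<close>

lemma is_level_imp_good:
  assumes "is_level (N, S)"
  shows "good_level (N, S)"
proof -
  have N: "N > 0" and S: "S \<subseteq> {Q. exact_divisor Q N \<and> Q > 1}"
    and max: "\<And>S'. S' \<subseteq> {Q. exact_divisor Q N \<and> Q > 1} \<Longrightarrow> level_group (N, S') = level_group (N, S) \<Longrightarrow> S' \<subseteq> S"
    using assms by auto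
  have ex: "exact_divisor Q N" if "Q \<in> insert 1 S" for Q using that S exact_divisor_1 by auto
  have dv: "Q dvd N" if "Q \<in> insert 1 S" for Q using ex[OF that] by (simp add: exact_divisor_def)
  have gen: "Atkin_Lehner Q N \<subseteq> level_group (N, S)" if "Q \<in> insert 1 S" for Q
    using that by (auto simp: Gamma0_eq intro: generate.incl)
  have gen_car: "Gamma0 N \<union> (\<Union>Q\<in>S. Atkin_Lehner Q N) \<subseteq> carrier PSL2R"
    using Atkin_Lehner_carrier[OF N dv] by (auto simp: Gamma0_eq)
  have sub: "subgroup (level_group (N, S)) PSL2R"
    using group.generate_is_subgroup[OF group_PSL2R gen_car] by simp
  have "star Q Q' \<in> insert 1 S" if QQ: "Q \<in> insert 1 S" "Q' \<in> insert 1 S" for Q Q'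
  proof (rule ccontr)
    assume no: "star Q Q' \<notin> insert 1 S"
    define R where "R = star Q Q'"
    note R = star_exact_divisor[OF N ex[OF QQ(1)] ex[OF QQ(2)], folded R_def]
    have R1: "R > 1" using R(3) no by (auto simp: R_def)
    have Rdv: "R dvd N" using R(1) by (simp add: exact_divisor_def)
    have "Atkin_Lehner R N \<subseteq> level_group (N, S)"
    proof
      fix A assume A: "A \<in> Atkin_Lehner R N"
      obtain B where B: "B \<in> Atkin_Lehner Q N" using Atkin_Lehner_nonempty[OF N ex[OF QQ(1)]] by blast
      have AB: "A \<otimes>\<^bsub>PSL2R\<^esub> B \<in> Atkin_Lehner Q' N"
        using Atkin_Lehner_mult(2)[OF N Rdv dv[OF QQ(1)] A B] R(2) by simp
      have lg: "A \<otimes>\<^bsub>PSL2R\<^esub> B \<in> level_group (N, S)" "B \<in> level_group (N, S)"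
        using gen[OF QQ(1)] gen[OF QQ(2)] AB B by blast+
      have car: "A \<in> carrier PSL2R" "B \<in> carrier PSL2R"
        using A B Atkin_Lehner_carrier[OF N Rdv] Atkin_Lehner_carrier[OF N dv[OF QQ(1)]] by auto
      interpret group PSL2R by (rule group_PSL2R)
      have "A = (A \<otimes>\<^bsub>PSL2R\<^esub> B) \<otimes>\<^bsub>PSL2R\<^esub> inv\<^bsub>PSL2R\<^esub> B" using car by (simp add: m_assoc)
      also have "\<dots> \<in> level_group (N, S)"
        by (rule subgroup.m_closed[OF sub lg(1) subgroup.m_inv_closed[OF sub lg(2)]])
      finally show "A \<in> level_group (N, S)" .
    qed
    then have "Gamma0 N \<union> (\<Union>Q\<in>insert R S. Atkin_Lehner Q N) \<subseteq> level_group (N, S)"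
      using gen by (auto simp: Gamma0_eq)
    then have "level_group (N, insert R S) \<subseteq> level_group (N, S)"
      using group.generate_subgroup_incl[OF group_PSL2R _ sub] by (simp only: level_group.simps)
    moreover have "level_group (N, S) \<subseteq> level_group (N, insert R S)"
      unfolding level_group.simps by (rule group.mono_generate[OF group_PSL2R]) auto
    ultimately have "insert R S \<subseteq> S" using S R R1 by (intro max) auto
    then show False using no by (simp add: R_def)
  qed
  then show ?thesis using N S by auto
qed

section \<open>Plicates of a level\<close>

lemma div_gcd_dvd: "n div gcd m n dvd (n :: nat)"
  by (metis dvd_div_mult_self dvd_triv_left gcd_dvd2)

text \<open>After division by g = gcd a N the cofactor a / g is coprime to N / g and drops out of
  the next gcd. Hence iterated plication depends only on the product of the primes, not on their
  order.\<close>

lemma div_gcd_div_gcd: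
  fixes a b N :: nat
  assumes "N > 0"
  shows "(N div gcd a N) div gcd b (N div gcd a N) = N div gcd (a * b) N"
proof -
  define g where "g = gcd a N"
  have g: "g > 0" using assms by (simp add: g_def)
  obtain a' where a: "a = g * a'" by (metis dvdE g_def gcd_dvd1)
  obtain M where M: "N = g * M" by (metis dvdE g_def gcd_dvd2)
  have "coprime (a div g) (N div g)" unfolding g_def using assms by (intro div_gcd_coprime) auto
  then have cop: "coprime a' M" using a M g by simp
  have "gcd (a * b) N = g * gcd (a' * b) M" unfolding a M by (simp add: gcd_mult_distrib_nat[symmetric] mult.assoc)
  also have "gcd (a' * b) M = gcd b M" using cop gcd_mult_left_left_cancel[of M a' b] by (simp add: coprime_commute)
  finally have "N div gcd (a * b) N = M div gcd b M" using g by (simp add: M)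
  moreover have "N div g = M" using M g by simp
  ultimately show ?thesis unfolding g_def[symmetric] by simp
qed

lemma fold_plicate_prime:
  assumes "N > 0" "\<forall>Q\<in>S. Q dvd N"
  shows "fold plicate_prime ps (N, S) = (N div gcd (prod_list ps) N, {Q \<in> S. Q dvd N div gcd (prod_list ps) N})"
  using assms
proof (induction ps arbitrary: N S)
  case (Cons p ps)
  let ?N = "N div gcd p N" and ?S = "{Q \<in> S. Q dvd N div gcd p N}"
  have N1: "?N > 0" using Cons.prems by (simp add: pos_imp_zdiv_pos_iff dvd_imp_le div_greater_zero_iff)
  have eq: "?N div gcd (prod_list ps) ?N = N div gcd (p * prod_list ps) N"
    using div_gcd_div_gcd[OF Cons.prems(1)] .
  have "fold plicate_prime (p # ps) (N, S) = fold plicate_prime ps (?N, ?S)" by simp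
  also have "\<dots> = (?N div gcd (prod_list ps) ?N, {Q \<in> ?S. Q dvd ?N div gcd (prod_list ps) ?N})"
    by (rule Cons.IH[OF N1]) simp
  also have "{Q \<in> ?S. Q dvd ?N div gcd (prod_list ps) ?N} = {Q \<in> S. Q dvd ?N div gcd (prod_list ps) ?N}"
    by (auto intro: dvd_trans[OF _ div_gcd_dvd])
  finally show ?case unfolding eq by simp
qed auto

lemma plicate_eq:
  assumes "m > 0" "N > 0" "\<forall>Q\<in>S. Q dvd N"
  shows "plicate m (N, S) = (N div gcd m N, {Q \<in> S. Q dvd N div gcd m N})"
proof -
  have "prod_list (sorted_list_of_multiset (prime_factorization m)) = prod_mset (prime_factorization m)"
    by (metis mset_sorted_list_of_multiset prod_mset_prod_list)
  also have "\<dots> = m" using assms by (simp add: prod_mset_prime_factorization_nat)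
  finally show ?thesis unfolding plicate_def using fold_plicate_prime[OF assms(2,3)] by simp
qed

text \<open>Q and N / Q are coprime. If Q is coprime to m, the gcd with m is taken entirely from N /
  Q and Q survives as an exact divisor; a prime common to Q and m is lost from the Q-part of
  N.\<close>

lemma exact_divisor_plicate:
  assumes N: "N > 0" and m: "m > 0" and Q: "exact_divisor Q N"
  shows "Q dvd N div gcd m N \<longleftrightarrow> coprime Q m"
    and "coprime Q m \<Longrightarrow> exact_divisor Q (N div gcd m N)"
    and "coprime Q m \<Longrightarrow> (N div gcd m N) div Q = (N div Q) div gcd m (N div Q)"
proof -
  have "Q dvd N" using Q by (simp add: exact_divisor_def)
  then obtain M where M: "N = Q * M" by blast
  have Qp: "Q > 0" "M > 0" using N M by auto
  have cop: "coprime Q M" using Q Qp by (simp add: exact_divisor_def M coprime_iff_gcd_eq_1)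
  have eq: "N div gcd m N = Q * (M div gcd m M)" if "coprime Q m"
  proof -
    have "gcd m N = gcd m M" unfolding M using that by (simp add: gcd_mult_right_left_cancel coprime_commute)
    then show ?thesis by (simp add: M div_mult_swap)
  qed
  show "Q dvd N div gcd m N \<longleftrightarrow> coprime Q m"
  proof
    assume "Q dvd N div gcd m N"
    then obtain t where t: "N div gcd m N = Q * t" by blast
    then have "N = Q * t * gcd m N" by (metis dvd_div_mult_self gcd_dvd2)
    then have Mt: "M = t * gcd m N" using M Qp by (metis mult.assoc mult_cancel1 less_irrefl)
    show "coprime Q m"
    proof (rule coprimeI)
      fix d assume d: "d dvd Q" "d dvd m"
      then have "d dvd gcd m N" using \<open>Q dvd N\<close> by (meson dvd_trans gcd_greatest)
      then have "d dvd M" using Mt by (metis dvd_mult)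
      then show "is_unit d" using cop d(1) by (meson coprime_common_divisor)
    qed
  qed (use eq in auto)
  assume c: "coprime Q m"
  show "(N div gcd m N) div Q = (N div Q) div gcd m (N div Q)" using eq[OF c] Qp by (simp add: M)
  have "M div gcd m M dvd M" by (rule div_gcd_dvd)
  then have "coprime Q (M div gcd m M)" using cop by (meson coprime_divisors dvd_refl)
  moreover have q: "Q * (M div gcd m M) div Q = M div gcd m M" using Qp by simp
  ultimately show "exact_divisor Q (N div gcd m N)"
    unfolding exact_divisor_def eq[OF c] q coprime_iff_gcd_eq_1 by (simp only: dvd_triv_left simp_thms)
qed

lemma good_level_plicate_eq:
  assumes "good_level (N, S)" "m > 0"
  shows "plicate m (N, S) = (N div gcd m N, {Q \<in> S. coprime Q m})"
proof -
  have N: "N > 0" and S: "\<forall>Q\<in>S. exact_divisor Q N" using assms by auto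
  have "\<forall>Q\<in>S. Q dvd N" using S by (auto simp: exact_divisor_def)
  then have "plicate m (N, S) = (N div gcd m N, {Q \<in> S. Q dvd N div gcd m N})"
    by (rule plicate_eq[OF assms(2) N])
  also have "{Q \<in> S. Q dvd N div gcd m N} = {Q \<in> S. coprime Q m}"
    using exact_divisor_plicate(1)[OF N assms(2)] S by auto
  finally show ?thesis .
qed

lemma good_level_plicate:
  assumes "good_level L" "m > 0"
  shows "good_level (plicate m L)"
proof -
  obtain N S where L: "L = (N, S)" by (cases L)
  have g: "good_level (N, S)" using assms L by simp
  then have N: "N > 0" and S: "\<forall>Q\<in>S. exact_divisor Q N \<and> Q > 1"
    and cl: "\<And>Q Q'. Q \<in> insert 1 S \<Longrightarrow> Q' \<in> insert 1 S \<Longrightarrow> star Q Q' \<in> insert 1 S" by auto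
  have cop: "coprime (star Q Q') m" if "coprime Q m" "coprime Q' m" for Q Q'
  proof -
    have "Q div gcd Q Q' dvd Q" "Q' div gcd Q Q' dvd Q'" by (metis dvd_div_mult_self dvd_triv_left gcd_dvd1 gcd_dvd2)+
    then have "coprime (Q div gcd Q Q') m" "coprime (Q' div gcd Q Q') m"
      using that by (meson coprime_divisors dvd_refl)+
    then show ?thesis by (simp add: star_def)
  qed
  have "star Q Q' \<in> insert 1 {Q \<in> S. coprime Q m}"
    if "Q \<in> insert 1 {Q \<in> S. coprime Q m}" "Q' \<in> insert 1 {Q \<in> S. coprime Q m}" for Q Q'
  proof -
    have "Q \<in> insert 1 S" "Q' \<in> insert 1 S" "coprime Q m" "coprime Q' m" using that by auto
    then show ?thesis using cl[of Q Q'] cop[of Q Q'] by blast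
  qed
  moreover have "N div gcd m N > 0" using N by (simp add: div_greater_zero_iff dvd_imp_le)
  moreover have "\<forall>Q\<in>{Q \<in> S. coprime Q m}. exact_divisor Q (N div gcd m N) \<and> Q > 1"
    using S exact_divisor_plicate(2)[OF N assms(2)] by blast
  ultimately show ?thesis unfolding L good_level_plicate_eq[OF g assms(2)] good_level.simps by blast
qed

lemma plicate_plicate:
  assumes "good_level L" "a > 0" "b > 0"
  shows "plicate b (plicate a L) = plicate (a * b) L"
proof -
  obtain N S where L: "L = (N, S)" by (cases L)
  have g: "good_level (N, S)" using assms L by simp
  have N: "N > 0" using g by simp
  have "plicate b (plicate a L) = plicate b (N div gcd a N, {Q \<in> S. coprime Q a})"
    unfolding L good_level_plicate_eq[OF g assms(2)] ..
  also have "\<dots> = ((N div gcd a N) div gcd b (N div gcd a N), {Q \<in> {Q \<in> S. coprime Q a}. coprime Q b})"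
    using good_level_plicate[OF g assms(2)] assms(3)
    unfolding good_level_plicate_eq[OF g assms(2)] by (rule good_level_plicate_eq)
  also have "\<dots> = plicate (a * b) L"
    unfolding L using good_level_plicate_eq[OF g, of "a * b"] assms div_gcd_div_gcd[OF N] by auto
  finally show ?thesis .
qed

lemma plicate_1: "good_level L \<Longrightarrow> plicate 1 L = L"
  by (cases L) (simp add: plicate_def)

type_synonym al_data = "nat \<times> int \<times> int \<times> int \<times> int"

text \<open>\<open>(Q, a, b, c, d)\<close> stands for the integral matrix with rows \<open>(Q a, b)\<close> and \<open>(Q c, Q d)\<close>, of
  determinant \<open>Q m\<close>; the last condition selects one of the two matrices \<open>\<plusminus>A\<close>.\<close>

fun al_set :: "level \<Rightarrow> int \<Rightarrow> al_data set" where
  "al_set (N, S) m = {(Q, a, b, c, d). Q \<in> insert 1 S \<and> int Q * a * d - b * c = m \<and> int (N div Q) dvd c \<and>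
      coprime c (int Q) \<and> (c > 0 \<or> c = 0 \<and> d > 0)}"

fun al_act :: "al_data \<Rightarrow> complex \<Rightarrow> complex" where
  "al_act (Q, a, b, c, d) \<tau> = (of_nat Q * of_int a * \<tau> + of_int b) / (of_nat Q * (of_int c * \<tau> + of_int d))"

fun al_shift :: "int \<Rightarrow> al_data \<Rightarrow> al_data" where
  "al_shift t (Q, a, b, c, d) = (Q, a + t * c, b + t * (int Q * d), c, d)"

text \<open>Picks one representative from each coset of translations by the real part of the image
  of \<tau>, so that sums over cosets become sums over integer tuples. The choice depends on \<tau>,
  but the seed is invariant under translations.\<close>

definition al_strip :: "level \<Rightarrow> int \<Rightarrow> complex \<Rightarrow> al_data set" where
  "al_strip L m \<tau> = {\<delta> \<in> al_set L m. 0 \<le> Re (al_act \<delta> \<tau>) \<and> Re (al_act \<delta> \<tau>) < 1}"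

fun al_class :: "al_data \<Rightarrow> (real^2^2) set" where
  "al_class (Q, a, b, c, d) = psl_class (al_mat Q a b c d)"

section \<open>Representatives of the translation cosets\<close>

lemma good_level_pos: "good_level (N, S) \<Longrightarrow> Q \<in> insert 1 S \<Longrightarrow> Q > 0"
  by auto

lemma al_denominator_nonzero:
  assumes "c > 0 \<or> c = 0 \<and> d > (0::int)" "Im \<tau> > 0"
  shows "of_int c * \<tau> + of_int d \<noteq> 0"
  using assms by (auto simp: complex_eq_iff)

lemma al_act_shift:
  assumes "good_level L" "\<delta> \<in> al_set L m" "Im \<tau> > 0"
  shows "al_act (al_shift t \<delta>) \<tau> = al_act \<delta> \<tau> + of_int t"
proof -
  obtain N S where L: "L = (N, S)" by (cases L)
  obtain Q a b c d where \<delta>: "\<delta> = (Q, a, b, c, d)" by (cases \<delta>)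
  have "Q > 0" using good_level_pos[of N S Q] assms by (simp add: L \<delta>)
  moreover have "of_int c * \<tau> + of_int d \<noteq> 0"
    using assms by (intro al_denominator_nonzero) (auto simp: L \<delta>)
  ultimately have nz: "of_nat Q * (of_int c * \<tau> + of_int d) \<noteq> 0" by simp
  have "of_nat Q * of_int (a + t * c) * \<tau> + of_int (b + t * (int Q * d)) =
      (of_nat Q * of_int a * \<tau> + of_int b) + of_int t * (of_nat Q * (of_int c * \<tau> + of_int d))"
    by (simp add: algebra_simps)
  then show ?thesis
    by (simp only: \<delta> al_shift.simps al_act.simps add_divide_distrib nonzero_mult_div_cancel_right[OF nz])
qed

lemma al_shift_in_set: "\<delta> \<in> al_set L m \<Longrightarrow> al_shift t \<delta> \<in> al_set L m"
  by (cases L; cases \<delta>) (auto simp: algebra_simps)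

lemma al_shift_shift: "al_shift t (al_shift u \<delta>) = al_shift (t + u) \<delta>"
  by (cases \<delta>) (auto simp: algebra_simps)

lemma al_shift_0: "al_shift 0 \<delta> = \<delta>"
  by (cases \<delta>) simp

lemma Im_al_act:
  assumes "Q > 0" "int Q * a * d - b * c = m" "of_int c * \<tau> + of_int d \<noteq> 0"
  shows "Im (al_act (Q, a, b, c, d) \<tau>) = of_int m * Im \<tau> / (real Q * (norm (of_int c * \<tau> + of_int d))\<^sup>2)"
proof -
  let ?u = "of_int c * \<tau> + of_int d"
  have cu: "cnj ?u \<noteq> 0" using assms(3) by (simp only: complex_cnj_zero_iff not_False_eq_True)
  have "al_act (Q, a, b, c, d) \<tau> = (of_nat Q * of_int a * \<tau> + of_int b) * cnj ?u / (of_nat Q * ?u * cnj ?u)"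
    unfolding al_act.simps by (rule mult_divide_mult_cancel_right[OF cu, symmetric])
  also have "of_nat Q * ?u * cnj ?u = of_nat Q * (?u * cnj ?u)" by (rule mult.assoc)
  also have "?u * cnj ?u = of_real ((norm ?u)\<^sup>2)" by (metis complex_norm_square of_real_power)
  also have "of_nat Q * of_real ((norm ?u)\<^sup>2) = complex_of_real (real Q * (norm ?u)\<^sup>2)" by simp
  finally have "Im (al_act (Q, a, b, c, d) \<tau>) = Im ((of_nat Q * of_int a * \<tau> + of_int b) * cnj ?u) / (real Q * (norm ?u)\<^sup>2)"
    by (simp only: Im_divide_of_real)
  also have "Im ((of_nat Q * of_int a * \<tau> + of_int b) * cnj ?u) = (real Q * of_int a * of_int d - of_int b * of_int c) * Im \<tau>"
    by (simp add: algebra_simps)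
  also have "real Q * of_int a * of_int d - of_int b * of_int c = of_int m"
    unfolding assms(2)[symmetric] by simp
  finally show ?thesis .
qed

lemma seed_shift: "seed n s (\<zeta> + of_int t) = seed n s \<zeta>"
proof -
  have "ee (- of_nat n * of_real (Re (\<zeta> + of_int t))) = ee (- of_nat n * of_real (Re \<zeta>) + of_int (- int n * t))"
    by (simp add: algebra_simps)
  then show ?thesis unfolding seed_def by (simp only: ee_add_of_int) simp
qed

lemma moebius_al_mat:
  assumes "Q > 0"
  shows "moebius (al_mat Q a b c d) \<tau> = al_act (Q, a, b, c, d) \<tau>"
proof -
  define r where "r = complex_of_real (sqrt (real Q))"
  have "real Q = sqrt (real Q) * sqrt (real Q)" by simp
  then have rr: "of_nat Q = r * r" unfolding r_def by (metis of_real_mult of_real_of_nat_eq)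
  have r0: "r \<noteq> 0" using assms by (simp add: r_def)
  have "moebius (al_mat Q a b c d) \<tau> = (r * of_int a * \<tau> + of_int b / r) / (r * of_int c * \<tau> + r * of_int d)"
    by (simp add: moebius_def al_mat_def r_def)
  also have "\<dots> = (r * (r * of_int a * \<tau> + of_int b / r)) / (r * (r * of_int c * \<tau> + r * of_int d))"
    by (rule mult_divide_mult_cancel_left[OF r0, symmetric])
  also have "r * (r * of_int a * \<tau> + of_int b / r) = r * r * of_int a * \<tau> + of_int b"
    using r0 by (simp add: distrib_left)
  also have "r * (r * of_int c * \<tau> + r * of_int d) = r * r * (of_int c * \<tau> + of_int d)"
    by (simp add: algebra_simps)
  finally show ?thesis by (simp add: rr)
qed

lemma shift_al_mat:
  assumes "Q > 0"
  shows "mat2 1 (of_int t) 0 1 ** al_mat Q a b c d = al_mat Q (a + t * c) (b + t * (int Q * d)) c d"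
proof -
  define r where "r = sqrt (real Q)"
  have "real Q = r * r" "r \<noteq> 0" using assms by (simp_all add: r_def)
  then show ?thesis
    unfolding al_mat_def mat2_mult mat2_eq_iff r_def[symmetric] by (simp add: field_simps)
qed

text \<open>Bezout for the squares of a coprime row expresses Q' as a combination of Q' c'^2 and Q'
  d'^2, which are both multiples of Q. It recovers Q from matrices whose entries carry a square
  root.\<close>

lemma scaled_squares_dvd:
  fixes Q Q' :: nat and c d c' d' :: int
  assumes "int Q * c\<^sup>2 = int Q' * c'\<^sup>2" "int Q * d\<^sup>2 = int Q' * d'\<^sup>2" "coprime c' d'"
  shows "Q dvd Q'"
proof -
  have "coprime (c'\<^sup>2) (d'\<^sup>2)" using assms(3) by simp
  then obtain u v where uv: "u * c'\<^sup>2 + v * d'\<^sup>2 = 1" using bezout_int[of "c'\<^sup>2" "d'\<^sup>2"] by auto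
  have "int Q' = u * (int Q' * c'\<^sup>2) + v * (int Q' * d'\<^sup>2)"
  proof -
    have "int Q' = int Q' * (u * c'\<^sup>2 + v * d'\<^sup>2)" by (simp only: uv mult_1_right)
    then show ?thesis by (simp add: algebra_simps)
  qed
  also have "\<dots> = int Q * (u * c\<^sup>2 + v * d\<^sup>2)" unfolding assms(1,2)[symmetric] by (simp add: algebra_simps)
  finally have "int Q dvd int Q'" by simp
  then show ?thesis by simp
qed

text \<open>Squaring the entries removes sign and square roots, and the coprime bottom row then
  determines Q. The remaining sign is fixed by the normalisation of (c, d) in
  \<open>al_set\<close>.\<close>

lemma al_class_inj:
  assumes g: "good_level L" and \<delta>: "\<delta> \<in> al_set L 1" "\<delta>' \<in> al_set L 1" and eq: "al_class \<delta> = al_class \<delta>'"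
  shows "\<delta> = \<delta>'"
proof -
  obtain N S where L: "L = (N, S)" by (cases L)
  obtain Q a b c d where d1: "\<delta> = (Q, a, b, c, d)" by (cases \<delta>)
  obtain Q' a' b' c' d' where d2: "\<delta>' = (Q', a', b', c', d')" by (cases \<delta>')
  have Q: "Q > 0" "Q' > 0" using good_level_pos[of N S] g \<delta> by (auto simp: L d1 d2)
  have det: "int Q * a * d - b * c = 1" "int Q' * a' * d' - b' * c' = 1" using \<delta> by (auto simp: L d1 d2)
  have cop: "coprime c d" "coprime c' d'"
  proof -
    have *: "coprime c d" if "int Q * a * d - b * c = 1" for Q a b c d
    proof (rule coprimeI)
      fix x assume "x dvd c" "x dvd d"
      then have "x dvd int Q * a * d - b * c" by simp
      then show "is_unit x" using that by simp
    qed
    show "coprime c d" "coprime c' d'" using *[OF det(1)] *[OF det(2)] by auto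
  qed
  have "al_mat Q a b c d = al_mat Q' a' b' c' d' \<or> al_mat Q a b c d = - al_mat Q' a' b' c' d'"
    using eq by (simp add: d1 d2 psl_class_eq_iff)
  then obtain \<epsilon> :: int where \<epsilon>: "\<epsilon> = 1 \<or> \<epsilon> = -1" and m: "al_mat Q a b c d = al_mat Q' (\<epsilon> * a') (\<epsilon> * b') (\<epsilon> * c') (\<epsilon> * d')"
  proof
    assume "al_mat Q a b c d = al_mat Q' a' b' c' d'"
    then show thesis using that[of 1] by simp
  next
    assume "al_mat Q a b c d = - al_mat Q' a' b' c' d'"
    then show thesis using that[of "- 1"] by (simp add: al_mat_def uminus_mat2)
  qed
  have e: "sqrt (real Q) * of_int a = sqrt (real Q') * of_int (\<epsilon> * a')"
    "of_int b / sqrt (real Q) = of_int (\<epsilon> * b') / sqrt (real Q')"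
    "sqrt (real Q) * of_int c = sqrt (real Q') * of_int (\<epsilon> * c')"
    "sqrt (real Q) * of_int d = sqrt (real Q') * of_int (\<epsilon> * d')"
    using m unfolding al_mat_def mat2_eq_iff by auto
  have \<epsilon>2: "\<epsilon>\<^sup>2 = 1" using \<epsilon> by auto
  have sq: "int Q * x\<^sup>2 = int Q' * y\<^sup>2" if "sqrt (real Q) * of_int x = sqrt (real Q') * of_int (\<epsilon> * y)" for x y
  proof -
    have "(sqrt (real Q) * of_int x)\<^sup>2 = (sqrt (real Q') * of_int (\<epsilon> * y))\<^sup>2" using that by simp
    then have "real_of_int (int Q * x\<^sup>2) = real_of_int (int Q' * (\<epsilon> * y)\<^sup>2)" by (simp add: power_mult_distrib)
    then have "int Q * x\<^sup>2 = int Q' * (\<epsilon> * y)\<^sup>2" by (simp only: of_int_eq_iff)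
    then show ?thesis by (simp add: power_mult_distrib \<epsilon>2)
  qed
  have "Q dvd Q'" by (rule scaled_squares_dvd[OF sq[OF e(3)] sq[OF e(4)] cop(2)])
  moreover have "Q' dvd Q" by (rule scaled_squares_dvd[OF sq[OF e(3), symmetric] sq[OF e(4), symmetric] cop(1)])
  ultimately have QQ: "Q = Q'" by (rule dvd_antisym)
  have "of_int a = real_of_int (\<epsilon> * a')" "of_int b = real_of_int (\<epsilon> * b')" "of_int c = real_of_int (\<epsilon> * c')" "of_int d = real_of_int (\<epsilon> * d')"
    using e Q unfolding QQ by auto
  then have abcd: "a = \<epsilon> * a'" "b = \<epsilon> * b'" "c = \<epsilon> * c'" "d = \<epsilon> * d'" by (simp_all only: of_int_eq_iff)
  have "c > 0 \<or> c = 0 \<and> d > 0" "c' > 0 \<or> c' = 0 \<and> d' > 0" using \<delta> by (auto simp: L d1 d2)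
  then have "\<epsilon> = 1" using \<epsilon> abcd by auto
  then show ?thesis using abcd QQ by (simp add: d1 d2)
qed

lemma Gamma_inf_coset:
  assumes g: "good_level L" and \<delta>: "\<delta> \<in> al_set L m"
  shows "Gamma_inf #>\<^bsub>PSL2R\<lparr>carrier := level_group L\<rparr>\<^esub> al_class \<delta> = range (\<lambda>t. al_class (al_shift t \<delta>))"
proof -
  obtain N S where L: "L = (N, S)" by (cases L)
  obtain Q a b c d where d1: "\<delta> = (Q, a, b, c, d)" by (cases \<delta>)
  have Q: "Q > 0" using good_level_pos[of N S] g \<delta> by (auto simp: L d1)
  have "Gamma_inf #>\<^bsub>PSL2R\<lparr>carrier := level_group L\<rparr>\<^esub> al_class \<delta> =
      {psl_class (mat2 1 (of_int t) 0 1) \<otimes>\<^bsub>PSL2R\<^esub> al_class \<delta> | t :: int. True}"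
    by (auto simp: r_coset_def Gamma_inf_def)
  also have "\<dots> = range (\<lambda>t. al_class (al_shift t \<delta>))"
    by (auto simp: d1 mult_PSL2R shift_al_mat[OF Q] simp del: of_int_mult of_int_add)
  finally show ?thesis .
qed

lemma al_class_in_level_group:
  assumes g: "good_level L" and \<delta>: "\<delta> \<in> al_set L 1"
  shows "al_class \<delta> \<in> level_group L"
proof -
  obtain N S where L: "L = (N, S)" by (cases L)
  obtain Q a b c d where d1: "\<delta> = (Q, a, b, c, d)" by (cases \<delta>)
  have S: "Q \<in> insert 1 S" "int Q * a * d - b * c = 1" "int (N div Q) dvd c" using \<delta> by (auto simp: L d1)
  have N: "N > 0" "Q dvd N" using g S by (auto simp: L exact_divisor_def)
  have "al_class \<delta> \<in> Atkin_Lehner Q N" unfolding Atkin_Lehner_eq[OF N] using S by (auto simp: d1)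
  then show ?thesis unfolding L level_group_good[OF g[unfolded L]] using S(1) by blast
qed

lemma level_group_al_class:
  assumes g: "good_level L" and A: "A \<in> level_group L"
  obtains \<delta> where "\<delta> \<in> al_set L 1" "A = al_class \<delta>"
proof -
  obtain N S where L: "L = (N, S)" by (cases L)
  have g': "good_level (N, S)" using g L by simp
  obtain Q where Q: "Q \<in> insert 1 S" "A \<in> Atkin_Lehner Q N" using A unfolding L level_group_good[OF g'] by blast
  have N: "N > 0" "Q dvd N" using g' Q by (auto simp: exact_divisor_def)
  obtain x y c w where *: "A = psl_class (al_mat Q x y c w)" "int Q * x * w - y * c = 1" "int (N div Q) dvd c"
    using Q(2) unfolding Atkin_Lehner_eq[OF N] by blast
  have cop: "coprime c (int Q)"
  proof (rule coprimeI)
    fix z assume "z dvd c" "z dvd int Q"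
    then have "z dvd int Q * x * w - y * c" by (simp add: mult.assoc)
    then show "is_unit z" using *(2) by simp
  qed
  have nz: "c \<noteq> 0 \<or> w \<noteq> 0" using *(2) by auto
  show thesis
  proof (cases "c > 0 \<or> c = 0 \<and> w > 0")
    case True
    then show thesis using that[of "(Q, x, y, c, w)"] * Q(1) cop by (simp add: L)
  next
    case False
    have "al_mat Q (- x) (- y) (- c) (- w) = - al_mat Q x y c w" by (simp add: al_mat_def uminus_mat2)
    then have "A = psl_class (al_mat Q (- x) (- y) (- c) (- w))" using *(1) by (simp add: psl_class_eq_iff)
    moreover have "- c > 0 \<or> - c = 0 \<and> - w > 0" using False nz by auto
    ultimately show thesis using that[of "(Q, - x, - y, - c, - w)"] * Q(1) cop by (simp add: L)
  qed
qed

lemma al_shift_to_strip: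
  assumes "good_level L" "\<delta> \<in> al_set L m" "Im \<tau> > 0"
  shows "al_shift t \<delta> \<in> al_strip L m \<tau> \<longleftrightarrow> t = - \<lfloor>Re (al_act \<delta> \<tau>)\<rfloor>"
proof -
  have "al_shift t \<delta> \<in> al_strip L m \<tau> \<longleftrightarrow> 0 \<le> Re (al_act \<delta> \<tau>) + of_int t \<and> Re (al_act \<delta> \<tau>) + of_int t < 1"
    using al_shift_in_set[OF assms(2)] by (simp add: al_strip_def al_act_shift[OF assms])
  also have "\<dots> \<longleftrightarrow> \<lfloor>Re (al_act \<delta> \<tau>)\<rfloor> = - t"
    unfolding floor_eq_iff by (simp add: algebra_simps) linarith
  finally show ?thesis by linarith
qed

lemma al_strip_imp: "\<delta> \<in> al_strip L m \<tau> \<Longrightarrow> \<delta> \<in> al_set L m"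
  by (simp add: al_strip_def)

lemma al_strip_shift_eq:
  assumes "good_level L" "\<delta> \<in> al_strip L m \<tau>" "al_shift t \<delta> \<in> al_strip L m \<tau>" "Im \<tau> > 0"
  shows "t = 0"
  using al_shift_to_strip[OF assms(1) al_strip_imp[OF assms(2)] assms(4), of t]
    al_shift_to_strip[OF assms(1) al_strip_imp[OF assms(2)] assms(4), of 0] assms(2,3)
  by (simp add: al_shift_0)

lemma bij_betw_strip_cosets:
  assumes g: "good_level L" and \<tau>: "Im \<tau> > 0"
  shows "bij_betw (\<lambda>\<delta>. Gamma_inf #>\<^bsub>PSL2R\<lparr>carrier := level_group L\<rparr>\<^esub> al_class \<delta>) (al_strip L 1 \<tau>)
      (rcosets\<^bsub>PSL2R\<lparr>carrier := level_group L\<rparr>\<^esub> Gamma_inf)"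
proof (rule bij_betw_imageI)
  let ?h = "\<lambda>\<delta>. Gamma_inf #>\<^bsub>PSL2R\<lparr>carrier := level_group L\<rparr>\<^esub> al_class \<delta>"
  show "inj_on ?h (al_strip L 1 \<tau>)"
  proof (rule inj_onI)
    fix \<delta> \<delta>' assume *: "\<delta> \<in> al_strip L 1 \<tau>" "\<delta>' \<in> al_strip L 1 \<tau>" "?h \<delta> = ?h \<delta>'"
    have "al_class \<delta> \<in> range (\<lambda>t. al_class (al_shift t \<delta>))" by (rule range_eqI[of _ _ 0]) (simp add: al_shift_0)
    then have "al_class \<delta> \<in> range (\<lambda>t. al_class (al_shift t \<delta>'))"
      using *(3) unfolding Gamma_inf_coset[OF g al_strip_imp[OF *(1)]] Gamma_inf_coset[OF g al_strip_imp[OF *(2)]] by simp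
    then obtain t where "al_class \<delta> = al_class (al_shift t \<delta>')" by blast
    then have eq: "\<delta> = al_shift t \<delta>'"
      by (rule al_class_inj[OF g al_strip_imp[OF *(1)] al_shift_in_set[OF al_strip_imp[OF *(2)]]])
    then have "t = 0" using al_strip_shift_eq[OF g *(2) _ \<tau>] *(1) by simp
    then show "\<delta> = \<delta>'" using eq by (simp add: al_shift_0)
  qed
  show "?h ` al_strip L 1 \<tau> = rcosets\<^bsub>PSL2R\<lparr>carrier := level_group L\<rparr>\<^esub> Gamma_inf"
  proof (intro equalityI subsetI)
    fix C assume "C \<in> ?h ` al_strip L 1 \<tau>"
    then obtain \<delta> where \<delta>: "\<delta> \<in> al_strip L 1 \<tau>" "C = ?h \<delta>" by blast
    then have "al_class \<delta> \<in> level_group L" using al_class_in_level_group[OF g al_strip_imp] by blast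
    then show "C \<in> rcosets\<^bsub>PSL2R\<lparr>carrier := level_group L\<rparr>\<^esub> Gamma_inf"
      using \<delta>(2) unfolding RCOSETS_def by auto
  next
    fix C assume "C \<in> rcosets\<^bsub>PSL2R\<lparr>carrier := level_group L\<rparr>\<^esub> Gamma_inf"
    then obtain A where A: "A \<in> level_group L" "C = Gamma_inf #>\<^bsub>PSL2R\<lparr>carrier := level_group L\<rparr>\<^esub> A"
      unfolding RCOSETS_def by auto
    obtain \<delta> where \<delta>: "\<delta> \<in> al_set L 1" "A = al_class \<delta>" by (rule level_group_al_class[OF g A(1)])
    define t where "t = - \<lfloor>Re (al_act \<delta> \<tau>)\<rfloor>"
    have st: "al_shift t \<delta> \<in> al_strip L 1 \<tau>" using al_shift_to_strip[OF g \<delta>(1) \<tau>, of t] t_def by simp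
    have "?h (al_shift t \<delta>) = range (\<lambda>u. al_class (al_shift (u + t) \<delta>))"
      unfolding Gamma_inf_coset[OF g al_strip_imp[OF st]] al_shift_shift ..
    also have "\<dots> = range (\<lambda>u. al_class (al_shift u \<delta>))"
    proof (intro equalityI subsetI)
      fix X assume "X \<in> range (\<lambda>u. al_class (al_shift u \<delta>))"
      then obtain u where "X = al_class (al_shift u \<delta>)" by blast
      then show "X \<in> range (\<lambda>u. al_class (al_shift (u + t) \<delta>))" by (intro range_eqI[of _ _ "u - t"]) simp
    qed auto
    finally have "C = ?h (al_shift t \<delta>)" using A(2) \<delta>(2) Gamma_inf_coset[OF g \<delta>(1)] by simp
    then show "C \<in> ?h ` al_strip L 1 \<tau>" using st by blast
  qed
qed

lemma Niebur_G_strip: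
  assumes g: "good_level L" and \<tau>: "Im \<tau> > 0"
  shows "Niebur_G L n \<tau> s = 2 * of_real pi * (\<Sum>\<^sub>\<infinity>\<delta>\<in>al_strip L 1 \<tau>. seed n s (al_act \<delta> \<tau>))"
proof -
  let ?h = "\<lambda>\<delta>. Gamma_inf #>\<^bsub>PSL2R\<lparr>carrier := level_group L\<rparr>\<^esub> al_class \<delta>"
  have "the_elem ((\<lambda>\<gamma>. seed n s (psl_act \<gamma> \<tau>)) ` ?h \<delta>) = seed n s (al_act \<delta> \<tau>)" if \<delta>: "\<delta> \<in> al_strip L 1 \<tau>" for \<delta>
  proof -
    have act: "psl_act (al_class \<delta>') \<tau> = al_act \<delta>' \<tau>" if "\<delta>' \<in> al_set L 1" for \<delta>'
    proof -
      obtain N S where L: "L = (N, S)" by (cases L)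
      obtain Q a b c d where d1: "\<delta>' = (Q, a, b, c, d)" by (cases \<delta>')
      have Q: "Q > 0" using good_level_pos[of N S] g that by (auto simp: L d1)
      show ?thesis by (simp add: d1 psl_act_class moebius_al_mat[OF Q] del: al_act.simps)
    qed
    have "(\<lambda>\<gamma>. seed n s (psl_act \<gamma> \<tau>)) ` ?h \<delta> = range (\<lambda>t. seed n s (psl_act (al_class (al_shift t \<delta>)) \<tau>))"
      unfolding Gamma_inf_coset[OF g al_strip_imp[OF \<delta>]] by (simp add: image_image)
    also have "\<dots> = range (\<lambda>t :: int. seed n s (al_act \<delta> \<tau>))"
      unfolding act[OF al_shift_in_set[OF al_strip_imp[OF \<delta>]]] al_act_shift[OF g al_strip_imp[OF \<delta>] \<tau>] seed_shift ..
    also have "\<dots> = {seed n s (al_act \<delta> \<tau>)}" by auto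
    finally show ?thesis by simp
  qed
  then have "(\<Sum>\<^sub>\<infinity>\<delta>\<in>al_strip L 1 \<tau>. seed n s (al_act \<delta> \<tau>)) =
      (\<Sum>\<^sub>\<infinity>\<delta>\<in>al_strip L 1 \<tau>. the_elem ((\<lambda>\<gamma>. seed n s (psl_act \<gamma> \<tau>)) ` ?h \<delta>))"
    by (intro infsum_cong) simp
  also have "\<dots> = (\<Sum>\<^sub>\<infinity>C \<in> rcosets\<^bsub>PSL2R\<lparr>carrier := level_group L\<rparr>\<^esub> Gamma_inf. the_elem ((\<lambda>\<gamma>. seed n s (psl_act \<gamma> \<tau>)) ` C))"
    by (rule infsum_reindex_bij_betw[OF bij_betw_strip_cosets[OF g \<tau>]])
  finally show ?thesis by (simp add: Niebur_G_def)
qed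

section \<open>The Poincare series as a sum over bottom rows\<close>

fun bottom_rows :: "level \<Rightarrow> nat \<Rightarrow> int set" where
  "bottom_rows (N, S) Q = {c. c > 0 \<and> int (N div Q) dvd c \<and> coprime (int Q) c}"

lemma bottom_rows_pos: "c \<in> bottom_rows L Q \<Longrightarrow> c > 0 \<and> coprime (int Q) c"
  by (cases L) auto

text \<open>The determinant is used twice: it gives the decomposition a/c - 1/(Q c (c \<tau> + d))
  of the image point, and it says that a is inverse to Q d modulo c, as \<open>twist\<close>
  requires.\<close>

lemma seed_al_act:
  assumes n: "n > 0" and Q: "Q > 0" and c: "c > 0" and \<tau>: "Im \<tau> > 0" and det: "int Q * a * d - b * c = 1"
  shows "seed n s (al_act (Q, a, b, c, d) \<tau>) = row_term n Q \<tau> c d s"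
proof -
  define u where "u = of_int c * \<tau> + of_int d"
  define v where "v = 1 / (of_nat Q * of_int c * u)"
  define \<zeta> where "\<zeta> = al_act (Q, a, b, c, d) \<tau>"
  have u: "u \<noteq> 0" unfolding u_def using c \<tau> by (intro al_denominator_nonzero) auto
  have Im: "Im \<zeta> = Im \<tau> / (real Q * (norm u)\<^sup>2)"
    using Im_al_act[OF Q det u[unfolded u_def]] by (simp add: \<zeta>_def u_def)
  then have Imp: "Im \<zeta> > 0" using \<tau> Q u by simp
  have Y: "real n * Im \<zeta> = real n * Im \<tau> / real Q / (norm u)\<^sup>2" by (simp add: Im)
  have \<zeta>v: "\<zeta> = of_real (of_int a / of_int c) - v"
  proof -
    have "of_int (int Q * a * d - b * c) = (1 :: complex)" using det by simp
    then have "of_nat Q * of_int a * of_int d = of_int b * of_int c + (1 :: complex)" by (simp add: algebra_simps)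
    then have "of_nat Q * of_int a * u - 1 = of_int c * (of_nat Q * of_int a * \<tau> + of_int b)"
      by (simp add: u_def algebra_simps)
    moreover have "of_real (of_int a / of_int c) - v = (of_nat Q * of_int a * u - 1) / (of_nat Q * of_int c * u)"
      using Q c u by (simp add: v_def diff_divide_distrib)
    ultimately have "of_real (of_int a / of_int c) - v = of_int c * (of_nat Q * of_int a * \<tau> + of_int b) / (of_int c * (of_nat Q * u))"
      by (simp add: mult_ac)
    also have "\<dots> = \<zeta>" unfolding \<zeta>_def al_act.simps u_def using c by (intro mult_divide_mult_cancel_left) simp
    finally show ?thesis by simp
  qed
  have "complex_of_real (- real n * Re \<zeta>) = of_int (- int n * a) / of_int c + of_real (real n * Re v)"
    by (simp add: \<zeta>v algebra_simps)
  then have "ee (of_real (- real n * Re \<zeta>)) = ec c (- int n * a) * ee (of_real (real n * Re v))"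
    by (simp only: ee_add ec_def)
  also have "ec c (- int n * a) = twist n Q c d"
  proof (rule twist_eq[OF c, symmetric])
    have "int Q * a * d - 1 = b * c" using det by simp
    then show "[int Q * a * d = 1] (mod c)" by (simp add: cong_iff_dvd_diff)
  qed
  finally have e: "ee (of_real (- real n * Re \<zeta>)) = twist n Q c d * ee (of_real (real n * Re v))" .
  show ?thesis
    unfolding \<zeta>_def[symmetric] seed_eq[OF n Imp] e Y row_term_def Let_def u_def[symmetric] v_def[symmetric] by (simp only: mult.assoc)
qed

lemma has_sum_Sigma_finite:
  fixes f :: "'a \<times> 'b \<Rightarrow> complex"
  assumes "finite I" "\<And>i. i \<in> I \<Longrightarrow> ((\<lambda>x. f (i, x)) has_sum s i) (A i)"
  shows "(f has_sum (\<Sum>i\<in>I. s i)) (Sigma I A)"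
  using assms
proof (induction I rule: finite_induct)
  case (insert i I)
  have "(f has_sum s i) (Pair i ` A i)"
    using insert.prems[of i] by (subst has_sum_reindex) (auto simp: inj_on_def o_def)
  moreover have "(f has_sum (\<Sum>i\<in>I. s i)) (Sigma I A)" using insert by auto
  ultimately have "(f has_sum (s i + (\<Sum>i\<in>I. s i))) (Pair i ` A i \<union> Sigma I A)"
    by (rule has_sum_Un_disjoint) (use insert in auto)
  also have "Pair i ` A i \<union> Sigma I A = Sigma (insert i I) A" by auto
  finally show ?case using insert by simp
qed simp

lemma row_det_unique:
  fixes Q :: nat and a b c d a' b' :: int
  assumes "int Q * a * d - b * c = 1" "int Q * a' * d - b' * c = 1"
  obtains t where "a' = a + t * c" "b' = b + t * (int Q * d)"
proof -
  have bc: "b * c = int Q * a * d - 1" "b' * c = int Q * a' * d - 1" using assms(1,2) by simp_all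
  have ad: "int Q * a * d = 1 + b * c" "int Q * a' * d = 1 + b' * c" using assms(1,2) by simp_all
  have "(a * b' - a' * b) * c = a * (b' * c) - a' * (b * c)" by (simp add: algebra_simps)
  also have "\<dots> = a' - a" unfolding bc by (simp add: algebra_simps)
  finally have 1: "a' = a + (a * b' - a' * b) * c" by simp
  have "(a * b' - a' * b) * (int Q * d) = b' * (int Q * a * d) - b * (int Q * a' * d)" by (simp add: algebra_simps)
  also have "\<dots> = b' - b" unfolding ad by (simp add: algebra_simps)
  finally have 2: "b' = b + (a * b' - a' * b) * (int Q * d)" by simp
  show thesis using 1 2 by (rule that)
qed

lemma row_completion:
  fixes Q :: nat and c d :: int
  assumes "coprime (int Q * d) c"
  obtains a b where "int Q * a * d - b * c = 1"
proof -
  obtain u v where "u * (int Q * d) + v * c = 1" using bezout_int[of "int Q * d" c] assms by auto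
  then have "int Q * u * d - (- v) * c = 1" by (simp add: mult_ac)
  then show thesis by (rule that)
qed

text \<open>A bottom row with c > 0 is completed by Bezout to a matrix of determinant 1, uniquely up
  to translation, and the strip selects one of the translates.\<close>

lemma al_strip_positive_bij:
  assumes g: "good_level (N, S)" and \<tau>: "Im \<tau> > 0"
  shows "bij_betw (\<lambda>(Q, a, b, c, d). (Q, c, d)) {\<delta> \<in> al_strip (N, S) 1 \<tau>. fst (snd (snd (snd \<delta>))) > 0}
     (SIGMA Q:insert 1 S. {(c, w). c \<in> bottom_rows (N, S) Q \<and> coprime w c})"
proof (rule bij_betw_imageI)
  let ?P = "{\<delta> \<in> al_strip (N, S) 1 \<tau>. fst (snd (snd (snd \<delta>))) > 0}"
  let ?f = "\<lambda>(Q :: nat, a :: int, b :: int, c :: int, d :: int). (Q, c, d)"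
  show "inj_on ?f ?P"
  proof (rule inj_onI)
    fix \<delta> \<delta>' assume *: "\<delta> \<in> ?P" "\<delta>' \<in> ?P" "?f \<delta> = ?f \<delta>'"
    obtain Q a b c d where d1: "\<delta> = (Q, a, b, c, d)" by (cases \<delta>)
    obtain a' b' where d2: "\<delta>' = (Q, a', b', c, d)" using *(3) by (cases \<delta>') (auto simp: d1)
    have st: "\<delta> \<in> al_strip (N, S) 1 \<tau>" "\<delta>' \<in> al_strip (N, S) 1 \<tau>" and c: "c > 0" using * by (auto simp: d1)
    have "int Q * a * d - b * c = 1" "int Q * a' * d - b' * c = 1"
      using al_strip_imp[OF st(1)] al_strip_imp[OF st(2)] by (auto simp: d1 d2)
    then obtain t where "a' = a + t * c" "b' = b + t * (int Q * d)"
      by (rule row_det_unique)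
    then have eq: "\<delta>' = al_shift t \<delta>" by (simp add: d1 d2)
    then have "t = 0" using al_strip_shift_eq[OF g st(1) _ \<tau>, of t] st(2) by simp
    then show "\<delta> = \<delta>'" using eq by (simp add: al_shift_0)
  qed
  show "?f ` ?P = (SIGMA Q:insert 1 S. {(c, w). c \<in> bottom_rows (N, S) Q \<and> coprime w c})"
  proof (intro equalityI subsetI)
    fix x assume "x \<in> ?f ` ?P"
    then obtain Q a b c d where x: "x = (Q, c, d)" and \<delta>: "(Q, a, b, c, d) \<in> al_set (N, S) 1" "c > 0"
      by (auto simp: al_strip_def)
    have "coprime d c"
    proof (rule coprimeI)
      fix z assume "z dvd d" "z dvd c"
      then have "z dvd int Q * a * d - b * c" by simp
      then show "is_unit z" using \<delta> by simp
    qed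
    then show "x \<in> (SIGMA Q:insert 1 S. {(c, w). c \<in> bottom_rows (N, S) Q \<and> coprime w c})"
      using \<delta> by (auto simp: x coprime_commute)
  next
    fix x assume "x \<in> (SIGMA Q:insert 1 S. {(c, w). c \<in> bottom_rows (N, S) Q \<and> coprime w c})"
    then obtain Q c w where x: "x = (Q, c, w)" "Q \<in> insert 1 S" "c \<in> bottom_rows (N, S) Q" "coprime w c" by auto
    have "coprime (int Q * w) c" using x by simp
    then obtain a b where "int Q * a * w - b * c = 1" by (rule row_completion)
    then have \<delta>: "(Q, a, b, c, w) \<in> al_set (N, S) 1" using x by (auto simp: coprime_commute)
    define \<delta>' where "\<delta>' = al_shift (- \<lfloor>Re (al_act (Q, a, b, c, w) \<tau>)\<rfloor>) (Q, a, b, c, w)"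
    have "\<delta>' \<in> al_strip (N, S) 1 \<tau>" unfolding \<delta>'_def using al_shift_to_strip[OF g \<delta> \<tau>] by blast
    moreover have "?f \<delta>' = x" "fst (snd (snd (snd \<delta>'))) = c" by (simp_all add: \<delta>'_def x)
    ultimately show "x \<in> ?f ` ?P" using x(3) by (intro image_eqI[of _ _ \<delta>']) auto
  qed
qed

text \<open>For c = 0 coprimality of c and Q forces Q = 1, leaving only the class of the identity.
  It contributes the seed at \<tau> itself, the source of the principal part.\<close>

lemma al_strip_zero:
  assumes g: "good_level (N, S)" and \<tau>: "Im \<tau> > 0"
  shows "{\<delta> \<in> al_strip (N, S) 1 \<tau>. \<not> fst (snd (snd (snd \<delta>))) > 0} = {(1, 1, - \<lfloor>Re \<tau>\<rfloor>, 0, 1)}"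
proof -
  have one: "(1, 1, 0, 0, 1) \<in> al_set (N, S) 1" by simp
  have sh: "al_shift t (1, 1, 0, 0, 1) = (1, 1, t, 0, 1)" for t by simp
  have act: "al_act (1, 1, 0, 0, 1) \<tau> = \<tau>" by simp
  have mem: "(1, 1, t, 0, 1) \<in> al_strip (N, S) 1 \<tau> \<longleftrightarrow> t = - \<lfloor>Re \<tau>\<rfloor>" for t
    using al_shift_to_strip[OF g one \<tau>, of t] unfolding sh act .
  have "\<delta> = (1, 1, - \<lfloor>Re \<tau>\<rfloor>, 0, 1)"
    if \<delta>: "\<delta> \<in> al_strip (N, S) 1 \<tau>" "\<not> fst (snd (snd (snd \<delta>))) > 0" for \<delta>
  proof -
    obtain Q a b c d where d1: "\<delta> = (Q, a, b, c, d)" by (cases \<delta>)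
    have *: "int Q * a * d - b * c = 1" "coprime c (int Q)" "c = 0" "d > 0"
      using al_strip_imp[OF \<delta>(1)] \<delta>(2) by (auto simp: d1)
    then have Q: "Q = 1" by simp
    then have "a * d = 1" using * by simp
    then have "a = 1" "d = 1" using *(4) by (auto simp: zmult_eq_1_iff)
    then show ?thesis using \<delta>(1) mem[of b] by (simp add: d1 Q *)
  qed
  moreover have "(1, 1, - \<lfloor>Re \<tau>\<rfloor>, 0, 1) \<in> al_strip (N, S) 1 \<tau>" using mem by blast
  then have "\<delta> \<in> {\<delta> \<in> al_strip (N, S) 1 \<tau>. \<not> fst (snd (snd (snd \<delta>))) > 0}" if "\<delta> \<in> {(1, 1, - \<lfloor>Re \<tau>\<rfloor>, 0, 1)}" for \<delta>
    unfolding singletonD[OF that] mem_Collect_eq fst_conv snd_conv by (intro conjI) simp_all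
  ultimately show ?thesis by (intro equalityI subsetI) blast+
qed

lemma finite_level:
  assumes "good_level (N, S)"
  shows "finite (insert 1 S)"
proof -
  have "S \<subseteq> {..N}" using assms by (auto simp: exact_divisor_def dest: dvd_imp_le)
  then show ?thesis using finite_subset by auto
qed

fun poincare_rows :: "level \<Rightarrow> nat \<Rightarrow> complex \<Rightarrow> complex \<Rightarrow> complex" where
  "poincare_rows (N, S) n \<tau> s = (\<Sum>Q\<in>insert 1 S. \<Sum>\<^sub>\<infinity>c\<in>bottom_rows (N, S) Q. row_sum n Q \<tau> c s)"

text \<open>The rows are extended from coprime w to all integers, as \<open>twist\<close> vanishes
  elsewhere; for Re s > 1 absolute convergence allows summing row by row.\<close>

lemma seed_has_sum_strip:
  assumes g: "good_level L" and \<tau>: "Im \<tau> > 0" and n: "n > 0" and s: "Re s > 1"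
  shows "((\<lambda>\<delta>. seed n s (al_act \<delta> \<tau>)) has_sum (seed n s \<tau> + poincare_rows L n \<tau> s)) (al_strip L 1 \<tau>)"
proof -
  obtain N S where L: "L = (N, S)" by (cases L)
  have g': "good_level (N, S)" using g L by simp
  let ?Pos = "{\<delta> \<in> al_strip (N, S) 1 \<tau>. fst (snd (snd (snd \<delta>))) > 0}"
  let ?Zero = "{\<delta> \<in> al_strip (N, S) 1 \<tau>. \<not> fst (snd (snd (snd \<delta>))) > 0}"
  let ?T = "\<lambda>Q. {(c, w). c \<in> bottom_rows (N, S) Q \<and> coprime w c}"
  let ?f = "\<lambda>(Q :: nat, a :: int, b :: int, c :: int, d :: int). (Q, c, d)"
  have "((\<lambda>(Q, c, w). row_term n Q \<tau> c w s) has_sum poincare_rows (N, S) n \<tau> s) (SIGMA Q:insert 1 S. ?T Q)"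
    unfolding poincare_rows.simps
  proof (rule has_sum_Sigma_finite[OF finite_level[OF g']])
    fix Q assume Q: "Q \<in> insert 1 S"
    have Qp: "Q > 0" by (rule good_level_pos[OF g' Q])
    have sm: "(\<lambda>(c, w). row_term n Q \<tau> c w s) summable_on bottom_rows (N, S) Q \<times> UNIV"
      by (rule row_term_summable_pairs[OF n Qp \<tau> s]) (use bottom_rows_pos in blast)
    have "infsum (\<lambda>(c, w). row_term n Q \<tau> c w s) (bottom_rows (N, S) Q \<times> UNIV) =
        (\<Sum>\<^sub>\<infinity>c\<in>bottom_rows (N, S) Q. row_sum n Q \<tau> c s)"
      unfolding row_sum_def by (rule infsum_Sigma'_banach[OF sm, symmetric])
    then have "((\<lambda>(c, w). row_term n Q \<tau> c w s) has_sum (\<Sum>\<^sub>\<infinity>c\<in>bottom_rows (N, S) Q. row_sum n Q \<tau> c s)) (bottom_rows (N, S) Q \<times> UNIV)"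
      using has_sum_infsum[OF sm] by simp
    moreover have "(\<lambda>(c, w). row_term n Q \<tau> c w s) x = 0" if "x \<in> bottom_rows (N, S) Q \<times> UNIV - ?T Q" for x
    proof -
      obtain c w where x: "x = (c, w)" by (cases x)
      have "\<not> coprime w c" using that by (auto simp: x simp del: bottom_rows.simps)
      then show ?thesis by (simp add: x row_term_def Let_def twist_eq_0)
    qed
    moreover have "?T Q - bottom_rows (N, S) Q \<times> UNIV = {}" by blast
    ultimately have "((\<lambda>(c, w). row_term n Q \<tau> c w s) has_sum (\<Sum>\<^sub>\<infinity>c\<in>bottom_rows (N, S) Q. row_sum n Q \<tau> c s)) (?T Q)"
      by (subst has_sum_cong_neutral[where T = "bottom_rows (N, S) Q \<times> UNIV" and g = "\<lambda>(c, w). row_term n Q \<tau> c w s"]) auto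
    then show "((\<lambda>x. case (Q, x) of (Q, c, w) \<Rightarrow> row_term n Q \<tau> c w s) has_sum (\<Sum>\<^sub>\<infinity>c\<in>bottom_rows (N, S) Q. row_sum n Q \<tau> c s)) (?T Q)"
      by simp
  qed
  then have "((\<lambda>\<delta>. (\<lambda>(Q, c, w). row_term n Q \<tau> c w s) (?f \<delta>)) has_sum poincare_rows (N, S) n \<tau> s) ?Pos"
    by (simp only: has_sum_reindex_bij_betw[OF al_strip_positive_bij[OF g' \<tau>]])
  then have 1: "((\<lambda>\<delta>. seed n s (al_act \<delta> \<tau>)) has_sum poincare_rows (N, S) n \<tau> s) ?Pos"
  proof (rule has_sum_cong[THEN iffD1, rotated])
    fix \<delta> assume \<delta>: "\<delta> \<in> ?Pos"
    obtain Q a b c d where d1: "\<delta> = (Q, a, b, c, d)" by (cases \<delta>)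
    have "\<delta> \<in> al_set (N, S) 1" "c > 0" using \<delta> by (auto simp: d1 al_strip_def)
    moreover from this have "Q > 0" using good_level_pos[OF g', of Q] by (simp add: d1)
    ultimately have "seed n s (al_act \<delta> \<tau>) = row_term n Q \<tau> c d s"
      unfolding d1 by (intro seed_al_act n \<tau>) auto
    then show "(\<lambda>(Q, c, w). row_term n Q \<tau> c w s) (?f \<delta>) = seed n s (al_act \<delta> \<tau>)" by (simp add: d1)
  qed
  have "seed n s (al_act (1, 1, - \<lfloor>Re \<tau>\<rfloor>, 0, 1) \<tau>) = seed n s \<tau>"
    using seed_shift[of n s \<tau> "- \<lfloor>Re \<tau>\<rfloor>"] by simp
  then have 0: "((\<lambda>\<delta>. seed n s (al_act \<delta> \<tau>)) has_sum seed n s \<tau>) ?Zero"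
    unfolding al_strip_zero[OF g' \<tau>] by (intro has_sum_finiteI) (simp_all del: al_act.simps)
  have "((\<lambda>\<delta>. seed n s (al_act \<delta> \<tau>)) has_sum (seed n s \<tau> + poincare_rows (N, S) n \<tau> s)) (?Zero \<union> ?Pos)"
    by (rule has_sum_Un_disjoint[OF 0 1]) auto
  also have "?Zero \<union> ?Pos = al_strip L 1 \<tau>" unfolding L by blast
  finally show ?thesis unfolding L .
qed

lemma Niebur_G_eq:
  assumes "good_level L" "Im \<tau> > 0" "n > 0" "Re s > 1"
  shows "Niebur_G L n \<tau> s = 2 * of_real pi * (seed n s \<tau> + poincare_rows L n \<tau> s)"
  unfolding Niebur_G_strip[OF assms(1,2)] infsumI[OF seed_has_sum_strip[OF assms]] ..

lemma holomorphic_poincare_rows: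
  assumes "good_level L" "Im \<tau> > 0" "n > 0"
  shows "(\<lambda>s. 2 * of_real pi * (seed n s \<tau> + poincare_rows L n \<tau> s)) holomorphic_on {s. Re s > 0.99}"
proof -
  obtain N S where L: "L = (N, S)" by (cases L)
  have "(\<lambda>s. Bessel_E s Y) holomorphic_on {s. Re s > 0.99}" for Y
    by (rule holomorphic_on_subset[OF holomorphic_Bessel_E]) auto
  then have "(\<lambda>s. seed n s \<tau>) holomorphic_on {s. Re s > 0.99}"
    unfolding seed_eq[OF assms(3,2)] by (intro holomorphic_intros)
  moreover have "(\<lambda>s. poincare_rows L n \<tau> s) holomorphic_on {s. Re s > 0.99}"
    unfolding L poincare_rows.simps
  proof (rule holomorphic_on_sum)
    fix Q assume Q: "Q \<in> insert 1 S"
    have "Q > 0" using good_level_pos[of N S, OF _ Q] assms L by simp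
    then show "(\<lambda>s. \<Sum>\<^sub>\<infinity>c\<in>bottom_rows (N, S) Q. row_sum n Q \<tau> c s) holomorphic_on {s. Re s > 0.99}"
      by (intro holomorphic_row_sums assms bottom_rows_pos)
  qed
  ultimately show ?thesis by (intro holomorphic_intros)
qed

section \<open>The value of the continuation and its constant term\<close>

lemma at_1_within_right_halfplane: "at (1::complex) within {s. Re s > 1} \<noteq> bot"
proof -
  have "\<exists>x\<in>{s. Re s > 1}. x \<noteq> 1 \<and> dist x 1 < e" if "e > 0" for e
    by (rule bexI[of _ "1 + of_real (e / 2)"]) (use that in \<open>auto simp: dist_norm\<close>)
  then have "(1::complex) islimpt {s. Re s > 1}" unfolding islimpt_approachable by blast
  then show ?thesis by (simp add: trivial_limit_within)
qed

text \<open>Every admissible continuation is continuous at 1, so its value there is the limit of the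
  series from Re s > 1. This settles uniqueness across different domains, and it is the form in
  which identities are carried over to s = 1.\<close>

lemma j_fun_eq:
  assumes "good_level L" "Im \<tau> > 0" "n > 0"
  shows "j_fun L n \<tau> = 2 * of_real pi * (seed n 1 \<tau> + poincare_rows L n \<tau> 1)"
    and "((\<lambda>s. Niebur_G L n \<tau> s) \<longlongrightarrow> j_fun L n \<tau>) (at 1 within {s. Re s > 1})"
proof -
  define g where "g s = 2 * of_real pi * (seed n s \<tau> + poincare_rows L n \<tau> s)" for s
  let ?H = "{s :: complex. Re s > 1}"
  have gN: "g s = Niebur_G L n \<tau> s" if "Re s > 1" for s
    unfolding g_def using Niebur_G_eq[OF assms that] by simp
  have hol: "g holomorphic_on {s. Re s > 0.99}"
    unfolding g_def by (rule holomorphic_poincare_rows[OF assms])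
  have lim: "((\<lambda>s. Niebur_G L n \<tau> s) \<longlongrightarrow> h 1) (at 1 within ?H)"
    if "open U" "?H \<subseteq> U" "1 \<in> U" "h holomorphic_on U" "\<forall>s. Re s > 1 \<longrightarrow> h s = Niebur_G L n \<tau> s" for U h
  proof -
    have "continuous_on U h" by (rule holomorphic_on_imp_continuous_on[OF that(4)])
    then have "(h \<longlongrightarrow> h 1) (at 1 within U)" using that(3) by (simp add: continuous_on_def)
    then have "(h \<longlongrightarrow> h 1) (at 1 within ?H)" by (rule tendsto_within_subset[OF _ that(2)])
    then show ?thesis
      by (rule Lim_transform_eventually) (use that(5) in \<open>auto simp: eventually_at_filter\<close>)
  qed
  have U: "open {s :: complex. Re s > 0.99}" "connected {s :: complex. Re s > 0.99}"
    by (rule open_halfspace_Re_gt, rule convex_connected[OF convex_halfspace_Re_gt])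
  have "j_fun L n \<tau> = g 1"
    unfolding j_fun_def
  proof (rule the_equality)
    show "\<exists>U h. open U \<and> connected U \<and> ?H \<subseteq> U \<and> 1 \<in> U \<and> h holomorphic_on U \<and> (\<forall>s. Re s > 1 \<longrightarrow> h s = Niebur_G L n \<tau> s) \<and> g 1 = h 1"
      by (rule exI[of _ "{s. Re s > 0.99}"], rule exI[of _ g]) (use U hol gN in auto)
    fix v assume "\<exists>U h. open U \<and> connected U \<and> ?H \<subseteq> U \<and> 1 \<in> U \<and> h holomorphic_on U \<and> (\<forall>s. Re s > 1 \<longrightarrow> h s = Niebur_G L n \<tau> s) \<and> v = h 1"
    then obtain U h where h: "open U" "?H \<subseteq> U" "1 \<in> U" "h holomorphic_on U" "\<forall>s. Re s > 1 \<longrightarrow> h s = Niebur_G L n \<tau> s" "v = h 1"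
      by blast
    have "((\<lambda>s. Niebur_G L n \<tau> s) \<longlongrightarrow> g 1) (at 1 within ?H)"
      by (rule lim[OF U(1) _ _ hol]) (use gN in auto)
    then show "v = g 1" using lim[OF h(1-5)] h(6) tendsto_unique[OF at_1_within_right_halfplane] by blast
  qed
  then show "j_fun L n \<tau> = 2 * of_real pi * (seed n 1 \<tau> + poincare_rows L n \<tau> 1)" by (simp add: g_def)
  show "((\<lambda>s. Niebur_G L n \<tau> s) \<longlongrightarrow> j_fun L n \<tau>) (at 1 within ?H)"
    unfolding \<open>j_fun L n \<tau> = g 1\<close> by (rule lim[OF U(1) _ _ hol]) (use gN in auto)
qed

lemma seed_at_one:
  assumes "n > 0" "Im \<tau> > 0"
  shows "2 * of_real pi * seed n 1 \<tau> = inverse (ee \<tau>) ^ n - cnj (ee \<tau>) ^ n"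
proof -
  define Y where "Y = real n * Im \<tau>"
  have Y: "Y > 0" using assms by (simp add: Y_def)
  define e where "e = ee (of_real (- real n * Re \<tau>))"
  have ee_i: "ee (\<i> * of_real y) = of_real (exp (- (2 * pi * y)))" for y
  proof -
    have "2 * of_real pi * \<i> * (\<i> * of_real y) = complex_of_real (- (2 * pi * y))" by (simp add: complex_eq_iff)
    then show ?thesis unfolding ee_def by (simp only: exp_of_real)
  qed
  have pw: "ee z ^ n = ee (of_nat n * z)" for z
    unfolding ee_def exp_of_nat_mult[symmetric] by (rule arg_cong[where f = exp]) (simp add: mult_ac)
  have "inverse (ee \<tau>) ^ n = ee (of_nat n * (- \<tau>))" unfolding ee_minus[symmetric] pw ..
  also have "of_nat n * (- \<tau>) = of_real (- real n * Re \<tau>) + \<i> * of_real (- Y)"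
    by (simp add: complex_eq_iff Y_def)
  finally have 1: "inverse (ee \<tau>) ^ n = e * of_real (exp (2 * pi * Y))" unfolding ee_add ee_i e_def by simp
  have "cnj (ee \<tau>) ^ n = ee (of_nat n * (- cnj \<tau>))" unfolding cnj_ee pw ..
  also have "of_nat n * (- cnj \<tau>) = of_real (- real n * Re \<tau>) + \<i> * of_real Y"
    by (simp add: complex_eq_iff Y_def)
  finally have 2: "cnj (ee \<tau>) ^ n = e * of_real (exp (- (2 * pi * Y)))" unfolding ee_add ee_i e_def .
  have "seed n 1 \<tau> = e * of_real (sinh (2 * pi * Y) / pi)"
    unfolding seed_eq[OF assms] Y_def[symmetric] e_def Bessel_E_one[OF Y] ..
  then have "2 * of_real pi * seed n 1 \<tau> = e * of_real (2 * sinh (2 * pi * Y))" by simp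
  also have "2 * sinh (2 * pi * Y) = exp (2 * pi * Y) - exp (- (2 * pi * Y))" by (simp add: sinh_def)
  finally show ?thesis unfolding 1 2 by (simp add: right_diff_distrib)
qed

fun cusp_fun :: "level \<Rightarrow> nat \<Rightarrow> complex \<Rightarrow> complex" where
  "cusp_fun (N, S) n \<tau> = (\<Sum>Q\<in>insert 1 S. cusp_sum n Q (bottom_rows (N, S) Q) \<tau>)"

lemma j_fun_cusp:
  assumes "good_level L" "Im \<tau> > 0" "n > 0"
  shows "j_fun L n \<tau> - (inverse (ee \<tau>) ^ n - cnj (ee \<tau>) ^ n) = cusp_fun L n \<tau> - cusp_fun L n (cnj \<tau>)"
proof -
  obtain N S where L: "L = (N, S)" by (cases L)
  have "2 * of_real pi * poincare_rows L n \<tau> 1 =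
      (\<Sum>Q\<in>insert 1 S. 2 * of_real pi * (\<Sum>\<^sub>\<infinity>c\<in>bottom_rows (N, S) Q. row_sum n Q \<tau> c 1))"
    unfolding L poincare_rows.simps by (rule sum_distrib_left)
  also have "\<dots> = (\<Sum>Q\<in>insert 1 S. cusp_sum n Q (bottom_rows (N, S) Q) \<tau> - cusp_sum n Q (bottom_rows (N, S) Q) (cnj \<tau>))"
  proof (rule sum.cong[OF refl])
    fix Q assume Q: "Q \<in> insert 1 S"
    have "Q > 0" using good_level_pos[of N S, OF _ Q] assms L by simp
    then show "2 * of_real pi * (\<Sum>\<^sub>\<infinity>c\<in>bottom_rows (N, S) Q. row_sum n Q \<tau> c 1) =
        cusp_sum n Q (bottom_rows (N, S) Q) \<tau> - cusp_sum n Q (bottom_rows (N, S) Q) (cnj \<tau>)"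
      by (intro row_sums_at_one assms bottom_rows_pos)
  qed
  also have "\<dots> = cusp_fun L n \<tau> - cusp_fun L n (cnj \<tau>)" unfolding L cusp_fun.simps by (rule sum_subtractf)
  finally have "2 * of_real pi * poincare_rows L n \<tau> 1 = cusp_fun L n \<tau> - cusp_fun L n (cnj \<tau>)" .
  then show ?thesis
    unfolding j_fun_eq(1)[OF assms] distrib_left seed_at_one[OF assms(3,2)] by simp
qed

text \<open>What remains after the principal part is \<open>cusp_fun\<close> at \<tau> minus its
  value at the conjugate; holomorphy, periodicity and linear growth give it an expansion. By
  uniqueness this is the one described by \<open>coeff_j\<close>, and its constant term is a limit
  at the cusp.\<close>

lemma coeff_j_limit:
  assumes g: "good_level L" and n: "n > 0"
  shows "((\<lambda>\<tau>. j_fun L n \<tau> - (inverse (ee \<tau>) ^ n - cnj (ee \<tau>) ^ n)) \<longlongrightarrow> coeff_j L n 0) (filtercomap Im at_top)"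
proof -
  obtain N S where L: "L = (N, S)" by (cases L)
  have Q: "Q > 0" if "Q \<in> insert 1 S" for Q using good_level_pos[of N S, OF _ that] g L by simp
  let ?R = "\<lambda>\<tau>. j_fun L n \<tau> - (inverse (ee \<tau>) ^ n - cnj (ee \<tau>) ^ n)"
  have hol: "cusp_fun L n holomorphic_on {z. Im z \<noteq> 0}"
  proof -
    have "(\<lambda>\<tau>. \<Sum>Q\<in>insert 1 S. cusp_sum n Q (bottom_rows (N, S) Q) \<tau>) holomorphic_on {z. Im z \<noteq> 0}"
      by (rule holomorphic_on_sum) (intro holomorphic_cusp_sum n Q bottom_rows_pos)
    then show ?thesis by (simp add: L cusp_fun.simps[abs_def])
  qed
  have per: "cusp_fun L n (\<tau> + 1) = cusp_fun L n \<tau>" if "Im \<tau> \<noteq> 0" for \<tau>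
    unfolding L cusp_fun.simps by (intro sum.cong refl cusp_sum_periodic n Q bottom_rows_pos that)
  have "\<forall>Q\<in>insert 1 S. \<exists>K. \<forall>\<tau>. \<bar>Re \<tau>\<bar> \<le> 1 \<longrightarrow> 1 \<le> \<bar>Im \<tau>\<bar> \<longrightarrow> norm (cusp_sum n Q (bottom_rows (N, S) Q) \<tau>) \<le> K * \<bar>Im \<tau>\<bar>"
  proof
    fix Q' assume Q': "Q' \<in> insert 1 S"
    obtain K where "\<And>\<tau>. \<bar>Re \<tau>\<bar> \<le> 1 \<Longrightarrow> 1 \<le> \<bar>Im \<tau>\<bar> \<Longrightarrow> norm (cusp_sum n Q' (bottom_rows (N, S) Q') \<tau>) \<le> K * \<bar>Im \<tau>\<bar>"
      using cusp_sum_growth[OF n Q[OF Q'], of "bottom_rows (N, S) Q'"] bottom_rows_pos by metis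
    then show "\<exists>K. \<forall>\<tau>. \<bar>Re \<tau>\<bar> \<le> 1 \<longrightarrow> 1 \<le> \<bar>Im \<tau>\<bar> \<longrightarrow> norm (cusp_sum n Q' (bottom_rows (N, S) Q') \<tau>) \<le> K * \<bar>Im \<tau>\<bar>"
      by blast
  qed
  then obtain K where K: "\<forall>Q\<in>insert 1 S. \<forall>\<tau>. \<bar>Re \<tau>\<bar> \<le> 1 \<longrightarrow> 1 \<le> \<bar>Im \<tau>\<bar> \<longrightarrow> norm (cusp_sum n Q (bottom_rows (N, S) Q) \<tau>) \<le> K Q * \<bar>Im \<tau>\<bar>"
    by (rule bchoice[THEN exE]) 
  have growth: "norm (cusp_fun L n \<tau>) \<le> (\<Sum>Q\<in>insert 1 S. K Q) * \<bar>Im \<tau>\<bar>" if "\<bar>Re \<tau>\<bar> \<le> 1" "1 \<le> \<bar>Im \<tau>\<bar>" for \<tau>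
    unfolding L cusp_fun.simps sum_distrib_right by (rule sum_norm_le) (use K that in blast)
  obtain c where "harmonic_expansion (\<lambda>\<tau>. cusp_fun L n \<tau> - cusp_fun L n (cnj \<tau>)) c"
    by (rule harmonic_expansion_exists[OF hol per growth])
  then have E: "harmonic_expansion ?R c"
    unfolding harmonic_expansion_def using j_fun_cusp[OF g _ n] by simp
  have "coeff_j L n = c"
    unfolding coeff_j_def
  proof (rule the_equality)
    have eq: "j - (a + x) = j - a - x" for j a x :: complex by simp
    show "\<forall>\<tau>. Im \<tau> > 0 \<longrightarrow> ((\<lambda>l. if l > 0 then c l * ee \<tau> ^ nat l else c l * cnj (ee \<tau>) ^ nat (- l))
        has_sum (j_fun L n \<tau> - (inverse (ee \<tau>) ^ n - cnj (ee \<tau>) ^ n + c 0))) (- {0})"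
      using E unfolding harmonic_expansion_def eq .
    fix c' assume "\<forall>\<tau>. Im \<tau> > 0 \<longrightarrow> ((\<lambda>l. if l > 0 then c' l * ee \<tau> ^ nat l else c' l * cnj (ee \<tau>) ^ nat (- l))
        has_sum (j_fun L n \<tau> - (inverse (ee \<tau>) ^ n - cnj (ee \<tau>) ^ n + c' 0))) (- {0})"
    then have "harmonic_expansion ?R c'" unfolding harmonic_expansion_def eq .
    then show "c' = c" by (rule harmonic_expansion_unique[OF _ E])
  qed
  then show ?thesis using harmonic_expansion_limit[OF E] by simp
qed

section \<open>Hecke operators\<close>

text \<open>Translates the level of a plicate into a condition on c m, the lower left entry after
  scaling by m.\<close>

lemma div_gcd_dvd_iff: "n > 0 \<Longrightarrow> int (n div gcd m n) dvd c \<longleftrightarrow> int n dvd c * int m"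
proof -
  assume n: "n > 0"
  define g where "g = gcd m n"
  have g: "g > 0" using n by (simp add: g_def)
  obtain m' n' where mn: "m = m' * g" "n = n' * g" "coprime m' n'"
    using gcd_coprime_exists[of m n] g unfolding g_def by auto
  have "int n dvd c * int m \<longleftrightarrow> int g * int n' dvd int g * (c * int m')"
    unfolding mn(1,2) by (simp add: mult_ac)
  also have "\<dots> \<longleftrightarrow> int n' dvd c * int m'" using g by (intro dvd_mult_cancel_left[THEN trans]) simp
  also have "\<dots> \<longleftrightarrow> int n' dvd c" using mn(3) by (intro coprime_dvd_mult_left_iff) (simp add: coprime_commute)
  also have "int n' = int (n div gcd m n)" using g mn(2) unfolding g_def[symmetric] by simp
  finally show ?thesis ..
qed

text \<open>All conditions of the plicate are those of the original level with c m in place of c.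
  Therefore scaling the first column, as in \<open>al_up\<close>, or the bottom row, as in
  \<open>al_down\<close>, leads back to tuples of the original level.\<close>

lemma al_set_plicate_iff:
  assumes g: "good_level (N, S)" and m: "m > 0"
  shows "(Q, a, b, c, d) \<in> al_set (plicate m (N, S)) t \<longleftrightarrow> Q \<in> insert 1 S \<and> int Q * a * d - b * c = t \<and>
    int (N div Q) dvd c * int m \<and> coprime (c * int m) (int Q) \<and> (c > 0 \<or> c = 0 \<and> d > 0)"
proof -
  have N: "N > 0" and S: "\<And>Q. Q \<in> insert 1 S \<Longrightarrow> exact_divisor Q N" using g exact_divisor_1 by auto
  have *: "Q \<in> insert 1 {Q \<in> S. coprime Q m} \<and> int ((N div gcd m N) div Q) dvd c \<and> coprime c (int Q) \<longleftrightarrow>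
      Q \<in> insert 1 S \<and> int (N div Q) dvd c * int m \<and> coprime (c * int m) (int Q)"
  proof (cases "Q \<in> insert 1 S \<and> coprime Q m")
    case True
    then have e: "exact_divisor Q N" using S by blast
    then have "Q dvd N" by (simp add: exact_divisor_def)
    then have "N div Q > 0" using N by (simp add: div_greater_zero_iff dvd_imp_le dvd_pos_nat)
    then show ?thesis
      using True exact_divisor_plicate(3)[OF N m e] div_gcd_dvd_iff[of "N div Q" m c] by (auto simp: coprime_commute)
  qed (auto simp: coprime_commute)
  show ?thesis
    unfolding good_level_plicate_eq[OF g m] al_set.simps mem_Collect_eq case_prod_conv using * by blast
qed

lemma unit_det_imp_coprime:
  assumes "int Q * a * d - b * c = 1"
  shows "coprime a c" "coprime c d"
proof -
  have "is_unit z" if "z dvd int Q * a * d - b * c" for z using that assms by simp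
  then show "coprime a c" "coprime c d" by (auto intro!: coprimeI)
qed

text \<open>The scale is the gcd of the scaled pair. In both factorisations this makes the divisor
  recoverable from the product.\<close>

lemma coprime_scale_unique:
  fixes a c a' c' :: int and d d' :: nat
  assumes "coprime a c" "coprime a' c'" "a * int d = a' * int d'" "c * int d = c' * int d'"
  shows "d = d'"
proof -
  have "gcd (x * int k) (y * int k) = int k" if "coprime x y" for x y k
    using that gcd_mult_right[of x "int k" y] by (simp add: mult.commute gcd.commute coprime_iff_gcd_eq_1)
  from this[OF assms(1), of d] this[OF assms(2), of d'] show ?thesis using assms(3,4) by simp
qed

text \<open>Right multiplication by the matrix with rows \<open>(d, i)\<close> and \<open>(0, k)\<close>, respectively left
  multiplication by the matrix with rows \<open>(k, i)\<close> and \<open>(0, e)\<close>.\<close>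

fun al_up :: "nat \<Rightarrow> nat \<Rightarrow> nat \<Rightarrow> al_data \<Rightarrow> al_data" where
  "al_up d k i (Q, a, b, c, e) =
     (Q, a * int d, a * int Q * int i + b * int k, c * int d, c * int i + e * int k)"

fun al_down :: "nat \<Rightarrow> nat \<Rightarrow> nat \<Rightarrow> al_data \<Rightarrow> al_data" where
  "al_down e k i (Q, a, b, c, d) =
     (Q, int k * a + int i * c, int k * b + int i * (int Q * d), c * int e, d * int e)"

lemma al_up:
  assumes g: "good_level L" and \<delta>: "\<delta> \<in> al_set (plicate d L) 1" and k: "d > 0" "k > 0"
  shows "al_up d k i \<delta> \<in> al_set L (int (d * k))"
    and "al_act (al_up d k i \<delta>) \<tau> = al_act \<delta> ((of_nat d * \<tau> + of_nat i) / of_nat k)"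
proof -
  obtain N S where L: "L = (N, S)" by (cases L)
  obtain Q a b c e where d1: "\<delta> = (Q, a, b, c, e)" by (cases \<delta>)
  have *: "Q \<in> insert 1 S" "int Q * a * e - b * c = 1" "int (N div Q) dvd c * int d" "coprime (c * int d) (int Q)"
    "c > 0 \<or> c = 0 \<and> e > 0"
    using \<delta> al_set_plicate_iff[of N S d Q a b c e 1] g k unfolding L d1 by auto
  have "int Q * (a * int d) * (c * int i + e * int k) - (a * int Q * int i + b * int k) * (c * int d) =
      int d * int k * (int Q * a * e - b * c)" by (simp add: algebra_simps)
  also have "\<dots> = int (d * k)" unfolding *(2) by simp
  finally have det: "int Q * (a * int d) * (c * int i + e * int k) - (a * int Q * int i + b * int k) * (c * int d) = int (d * k)" .
  have "c * int d > 0 \<or> c * int d = 0 \<and> c * int i + e * int k > 0" using *(5) k by auto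
  then show "al_up d k i \<delta> \<in> al_set L (int (d * k))"
    unfolding L d1 al_up.simps al_set.simps mem_Collect_eq case_prod_conv using * det by blast
  have kc: "of_nat k \<noteq> (0 :: complex)" using k by simp
  have "al_act \<delta> ((of_nat d * \<tau> + of_nat i) / of_nat k) =
      (of_nat k * (of_nat Q * of_int a * ((of_nat d * \<tau> + of_nat i) / of_nat k) + of_int b)) /
      (of_nat k * (of_nat Q * (of_int c * ((of_nat d * \<tau> + of_nat i) / of_nat k) + of_int e)))"
    unfolding d1 al_act.simps by (rule mult_divide_mult_cancel_left[OF kc, symmetric])
  also have "of_nat k * (of_nat Q * of_int a * ((of_nat d * \<tau> + of_nat i) / of_nat k) + of_int b) =
      of_nat Q * of_int (a * int d) * \<tau> + of_int (a * int Q * int i + b * int k)"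
    using k by (simp add: field_simps)
  also have "of_nat k * (of_nat Q * (of_int c * ((of_nat d * \<tau> + of_nat i) / of_nat k) + of_int e)) =
      of_nat Q * (of_int (c * int d) * \<tau> + of_int (c * int i + e * int k))"
    using k by (simp add: field_simps)
  finally show "al_act (al_up d k i \<delta>) \<tau> = al_act \<delta> ((of_nat d * \<tau> + of_nat i) / of_nat k)"
    by (simp only: d1 al_up.simps al_act.simps)
qed

lemma al_down:
  assumes g: "good_level L" and \<delta>: "\<delta> \<in> al_set (plicate e L) 1" and k: "e > 0" "k > 0" and \<tau>: "Im \<tau> > 0"
  shows "al_down e k i \<delta> \<in> al_set L (int (e * k))"
    and "al_act (al_down e k i \<delta>) \<tau> = (of_nat k * al_act \<delta> \<tau> + of_nat i) / of_nat e"
proof -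
  obtain N S where L: "L = (N, S)" by (cases L)
  obtain Q a b c d where d1: "\<delta> = (Q, a, b, c, d)" by (cases \<delta>)
  have *: "Q \<in> insert 1 S" "int Q * a * d - b * c = 1" "int (N div Q) dvd c * int e" "coprime (c * int e) (int Q)"
    "c > 0 \<or> c = 0 \<and> d > 0"
    using \<delta> al_set_plicate_iff[of N S e Q a b c d 1] g k unfolding L d1 by auto
  have "int Q * (int k * a + int i * c) * (d * int e) - (int k * b + int i * (int Q * d)) * (c * int e) =
      int e * int k * (int Q * a * d - b * c)" by (simp add: algebra_simps)
  also have "\<dots> = int (e * k)" unfolding *(2) by simp
  finally have det: "int Q * (int k * a + int i * c) * (d * int e) - (int k * b + int i * (int Q * d)) * (c * int e) = int (e * k)" .
  have "c * int e > 0 \<or> c * int e = 0 \<and> d * int e > 0" using *(5) k by auto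
  then show "al_down e k i \<delta> \<in> al_set L (int (e * k))"
    unfolding L d1 al_down.simps al_set.simps mem_Collect_eq case_prod_conv using * det by blast
  have Q: "Q > 0" using good_level_pos[of N S Q] *(1) g L by simp
  define u where "u = of_nat Q * (of_int c * \<tau> + of_int d)"
  have u: "u \<noteq> 0" unfolding u_def using Q al_denominator_nonzero[OF *(5) \<tau>] by simp
  have "al_act (al_down e k i \<delta>) \<tau> = (of_nat k * (of_nat Q * of_int a * \<tau> + of_int b) + of_nat i * u) / (of_nat e * u)"
    unfolding d1 al_down.simps al_act.simps by (rule arg_cong2[where f = "(/)"]) (simp_all add: u_def algebra_simps)
  also have "\<dots> = (of_nat k * ((of_nat Q * of_int a * \<tau> + of_int b) / u) + of_nat i) / of_nat e"
    using u k by (simp add: field_simps)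
  finally show "al_act (al_down e k i \<delta>) \<tau> = (of_nat k * al_act \<delta> \<tau> + of_nat i) / of_nat e"
    by (simp only: d1 al_act.simps u_def)
qed

section \<open>The two factorisations of tuples of determinant m\<close>

lemma index_cases:
  fixes x :: "(nat \<times> nat) \<times> al_data"
  obtains d i Q a b c e where "x = ((d, i), (Q, a, b, c, e))"
  by (cases x; cases "fst x"; cases "snd x") auto

lemma al_set_gcd:
  assumes "int Q * A * D - B * C = int m" "m > 0" "g = gcd A C \<or> g = gcd C D"
  shows "int (nat g) = g" "nat g > 0" "nat g dvd m"
proof -
  have "g dvd int Q * A * D - B * C" using assms(3) by (elim disjE) (auto simp: mult.assoc)
  then have d: "g dvd int m" using assms(1) by simp
  have "g \<noteq> 0" using d assms(2) by auto
  moreover have "g \<ge> 0" using assms(3) by auto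
  ultimately show "int (nat g) = g" "nat g > 0" "nat g dvd m" using d by (auto simp: nat_dvd_iff)
qed

text \<open>The gcd d of the first column is split off, the primitive column is completed by Bezout
  to determinant 1, and i is reduced modulo m / d by changing the completion. The strip condition
  carries over unchanged, since \<open>al_up\<close> acts on \<tau> as the original tuple acts on
  the transformed point.\<close>

lemma al_up_bij:
  assumes g: "good_level L" and m: "m > 0"
  shows "bij_betw (\<lambda>((d, i), \<delta>). al_up d (m div d) i \<delta>)
     (SIGMA (d, i):(SIGMA d:{d. d dvd m}. {..<m div d}). al_strip (plicate d L) 1 ((of_nat d * \<tau> + of_nat i) / of_nat (m div d)))
     (al_strip L (int m) \<tau>)"
proof (rule bij_betw_imageI)
  let ?f = "\<lambda>((d, i), \<delta>). al_up d (m div d) i \<delta>"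
  let ?X = "SIGMA (d, i):(SIGMA d:{d. d dvd m}. {..<m div d}). al_strip (plicate d L) 1 ((of_nat d * \<tau> + of_nat i) / of_nat (m div d))"
  obtain N S where L: "L = (N, S)" by (cases L)
  have g': "good_level (N, S)" using g L by simp
  have pos: "d > 0" "m div d > 0" "d * (m div d) = m" if "d dvd m" for d
    using that m by (auto simp: div_greater_zero_iff dvd_imp_le dvd_pos_nat)
  show "inj_on ?f ?X"
  proof (rule inj_onI)
    fix x y assume *: "x \<in> ?X" "y \<in> ?X" "?f x = ?f y"
    obtain d i Q a b c e where x: "x = ((d, i), (Q, a, b, c, e))" by (rule index_cases)
    obtain d' i' Q' a' b' c' e' where y: "y = ((d', i'), (Q', a', b', c', e'))" by (rule index_cases)
    have dm: "d dvd m" "d' dvd m" and i: "i < m div d" "i' < m div d'"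
      and \<delta>: "(Q, a, b, c, e) \<in> al_set (plicate d L) 1" "(Q', a', b', c', e') \<in> al_set (plicate d' L) 1"
      using *(1,2) by (auto simp: x y al_strip_def)
    have det: "int Q * a * e - b * c = 1" "int Q' * a' * e' - b' * c' = 1"
      using \<delta> al_set_plicate_iff[OF g' pos(1)[OF dm(1)]] al_set_plicate_iff[OF g' pos(1)[OF dm(2)]] unfolding L by auto
    define k where "k = m div d"
    have eq: "Q = Q'" "a * int d = a' * int d'" "c * int d = c' * int d'"
      "a * int Q * int i + b * int k = a' * int Q' * int i' + b' * int (m div d')"
      "c * int i + e * int k = c' * int i' + e' * int (m div d')"
      using *(3) by (auto simp: x y k_def)
    have dd: "d = d'" by (rule coprime_scale_unique[OF unit_det_imp_coprime(1)[OF det(1)] unit_det_imp_coprime(1)[OF det(2)] eq(2,3)])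
    have ac: "a = a'" "c = c'" using eq(2,3) pos(1)[OF dm(1)] by (auto simp: dd)
    have k: "k > 0" using pos(2)[OF dm(1)] by (simp add: k_def)
    \<comment> \<open>Cramer's rule expresses i through the product; evaluated for the other
      preimage, the same combination gives i' up to a multiple of k.\<close>
    have i1: "int i = e * (a * int Q * int i + b * int k) - b * (c * int i + e * int k)"
    proof -
      have "e * (a * int Q * int i + b * int k) - b * (c * int i + e * int k) = (int Q * a * e - b * c) * int i"
        by (simp add: algebra_simps)
      then show ?thesis using det(1) by simp
    qed
    also have "\<dots> = e * (a * int Q * int i' + b' * int k) - b * (c * int i' + e' * int k)"
      using eq(4,5) by (simp add: ac eq(1)[symmetric] dd k_def)
    also have "\<dots> = (int Q * a * e - b * c) * int i' + int k * (e * b' - b * e')" by (simp add: algebra_simps)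
    finally have "int i = int i' + int k * (e * b' - b * e')" using det(1) by simp
    then have "int i mod int k = int i' mod int k" by simp
    then have ii: "i = i'" using i by (simp add: k_def dd)
    then have "b * int k = b' * int k" "e * int k = e' * int k" using eq(4,5) by (auto simp: ac eq(1)[symmetric] dd k_def)
    then show "x = y" using k by (simp add: x y dd ac ii eq(1))
  qed
  show "?f ` ?X = al_strip L (int m) \<tau>"
  proof (intro equalityI subsetI)
    fix z assume "z \<in> ?f ` ?X"
    then obtain d i \<delta> where z: "z = al_up d (m div d) i \<delta>" "d dvd m"
      and \<delta>: "\<delta> \<in> al_strip (plicate d L) 1 ((of_nat d * \<tau> + of_nat i) / of_nat (m div d))" by auto
    show "z \<in> al_strip L (int m) \<tau>"
      using al_up(1)[OF g al_strip_imp[OF \<delta>] pos(1,2)[OF z(2)], of i]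
        al_up(2)[OF g al_strip_imp[OF \<delta>] pos(1,2)[OF z(2)], of i \<tau>] \<delta> unfolding pos(3)[OF z(2)] z(1) al_strip_def by simp
  next
    fix z assume z: "z \<in> al_strip L (int m) \<tau>"
    obtain Q A B C D where z1: "z = (Q, A, B, C, D)" by (cases z)
    have *: "Q \<in> insert 1 S" "int Q * A * D - B * C = int m" "int (N div Q) dvd C" "coprime C (int Q)" "C > 0 \<or> C = 0 \<and> D > 0"
      using al_strip_imp[OF z] by (auto simp: z1 L)
    define d where "d = nat (gcd A C)"
    have d: "int d = gcd A C" "d > 0" "d dvd m" unfolding d_def using al_set_gcd[OF *(2) m, of "gcd A C"] by blast+
    define k where "k = m div d"
    have k: "k > 0" "int d * int k = int m" using pos[OF d(3)] by (simp_all only: k_def of_nat_mult[symmetric])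
    have "gcd A C \<noteq> 0" using d(1,2) by linarith
    then obtain a c where ac: "A = a * int d" "C = c * int d" "coprime a c"
      using gcd_coprime_exists[of A C] unfolding d(1)[symmetric] by blast
    have "int d * (int Q * a * D - B * c) = int d * int k" using *(2) by (simp add: ac k(2) algebra_simps)
    then have kk: "int Q * a * D - B * c = int k" using d(2) by simp
    have "coprime (int Q * a) c" using *(4) ac by (simp add: coprime_commute)
    then obtain e1 b1 where b1: "int Q * e1 * a - b1 * c = 1" by (rule row_completion)
    then have det1: "int Q * a * e1 = 1 + b1 * c" by (simp add: mult_ac)
    \<comment> \<open>Cramer's rule: the coordinate of the second column (B, Q D) along the first
      column of the completed matrix.\<close>
    define i1 where "i1 = e1 * B - b1 * D"
    have D: "D = c * i1 + e1 * int k"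
    proof -
      have "c * i1 + e1 * int k = (int Q * a * e1) * D - b1 * c * D" unfolding i1_def kk[symmetric] by (simp add: algebra_simps)
      then show ?thesis unfolding det1 by (simp add: algebra_simps)
    qed
    have B: "B = a * int Q * i1 + b1 * int k"
    proof -
      have "a * int Q * i1 + b1 * int k = (int Q * a * e1) * B - b1 * c * B" unfolding i1_def kk[symmetric] by (simp add: algebra_simps)
      then show ?thesis unfolding det1 by (simp add: algebra_simps)
    qed
    define i u where "i = nat (i1 mod int k)" and "u = i1 div int k"
    have i: "int i = i1 mod int k" "i < k" using k(1) by (auto simp: i_def nat_less_iff)
    have i1: "i1 = int i + int k * u" unfolding i(1) u_def by simp
    define \<delta> where "\<delta> = (Q, a, b1 + int Q * a * u, c, e1 + c * u)"
    have up: "z = al_up d k i \<delta>"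
      unfolding z1 \<delta>_def al_up.simps using ac B D by (simp add: i1 algebra_simps)
    have "int Q * a * (e1 + c * u) - (b1 + int Q * a * u) * c = 1" using det1 by (simp add: algebra_simps)
    moreover have "c > 0 \<or> c = 0 \<and> e1 + c * u > 0"
    proof (cases "C > 0")
      case True
      then show ?thesis using ac d(2) by (simp add: zero_less_mult_iff)
    next
      case False
      then have "C = 0" "D > 0" using *(5) by auto
      then have "c = 0" using ac d(2) by simp
      then show ?thesis using D \<open>D > 0\<close> k(1) by (simp add: zero_less_mult_iff)
    qed
    ultimately have \<delta>: "\<delta> \<in> al_set (plicate d L) 1"
      unfolding \<delta>_def L al_set_plicate_iff[OF g' d(2)] using * ac(2) by simp
    have "\<delta> \<in> al_strip (plicate d L) 1 ((of_nat d * \<tau> + of_nat i) / of_nat k)"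
      using z \<delta> unfolding al_strip_def up mem_Collect_eq al_up(2)[OF g \<delta> d(2) k(1)] by blast
    then show "z \<in> ?f ` ?X"
      using up d(3) i(2) by (intro image_eqI[of _ _ "((d, i), \<delta>)"]) (auto simp: k_def)
  qed
qed

text \<open>Here the gcd e of the bottom row is split off, and i runs modulo e because a translation
  of the product absorbs multiples of e. Left multiplication moves the real part, so the product
  must be translated back into the strip; hence the floor in the map.\<close>

lemma al_down_bij:
  assumes g: "good_level L" and m: "m > 0" and \<tau>: "Im \<tau> > 0"
  shows "bij_betw (\<lambda>((e, i), \<delta>). let \<rho> = al_down e (m div e) i \<delta> in al_shift (- \<lfloor>Re (al_act \<rho> \<tau>)\<rfloor>) \<rho>)
     (SIGMA (e, i):(SIGMA e:{e. e dvd m}. {..<e}). al_strip (plicate e L) 1 \<tau>) (al_strip L (int m) \<tau>)"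
proof (rule bij_betw_imageI)
  let ?f = "\<lambda>((e, i), \<delta>). let \<rho> = al_down e (m div e) i \<delta> in al_shift (- \<lfloor>Re (al_act \<rho> \<tau>)\<rfloor>) \<rho>"
  let ?X = "SIGMA (e, i):(SIGMA e:{e. e dvd m}. {..<e}). al_strip (plicate e L) 1 \<tau>"
  obtain N S where L: "L = (N, S)" by (cases L)
  have g': "good_level (N, S)" using g L by simp
  have pos: "d > 0" "m div d > 0" "d * (m div d) = m" if "d dvd m" for d
    using that m by (auto simp: div_greater_zero_iff dvd_imp_le dvd_pos_nat)
  show "inj_on ?f ?X"
  proof (rule inj_onI)
    fix x y assume *: "x \<in> ?X" "y \<in> ?X" "?f x = ?f y"
    obtain e i Q a b c d where x: "x = ((e, i), (Q, a, b, c, d))" by (rule index_cases)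
    obtain e' i' Q' a' b' c' d' where y: "y = ((e', i'), (Q', a', b', c', d'))" by (rule index_cases)
    have em: "e dvd m" "e' dvd m" and i: "i < e" "i' < e'"
      and st: "(Q, a, b, c, d) \<in> al_strip (plicate e L) 1 \<tau>" "(Q', a', b', c', d') \<in> al_strip (plicate e' L) 1 \<tau>"
      using *(1,2) by (auto simp: x y)
    have det: "int Q * a * d - b * c = 1" "int Q' * a' * d' - b' * c' = 1" and cd: "c > 0 \<or> c = 0 \<and> d > 0" and Qi: "Q \<in> insert 1 S"
      using al_strip_imp[OF st(1)] al_strip_imp[OF st(2)] al_set_plicate_iff[OF g' pos(1)[OF em(1)]] al_set_plicate_iff[OF g' pos(1)[OF em(2)]]
      unfolding L by auto
    have Q: "Q > 0" by (rule good_level_pos[OF g' Qi])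
    define k where "k = m div e"
    define u u' where "u = - \<lfloor>Re (al_act (al_down e k i (Q, a, b, c, d)) \<tau>)\<rfloor>"
      and "u' = - \<lfloor>Re (al_act (al_down e' (m div e') i' (Q', a', b', c', d')) \<tau>)\<rfloor>"
    have "al_shift u (al_down e k i (Q, a, b, c, d)) = al_shift u' (al_down e' (m div e') i' (Q', a', b', c', d'))"
      using *(3) unfolding x y Let_def case_prod_conv u_def u'_def k_def .
    then have eq: "Q = Q'" "c * int e = c' * int e'" "d * int e = d' * int e'"
      "int k * a + int i * c + u * (c * int e) = int (m div e') * a' + int i' * c' + u' * (c' * int e')"
      "int k * b + int i * (int Q * d) + u * (int Q * (d * int e)) = int (m div e') * b' + int i' * (int Q' * d') + u' * (int Q' * (d' * int e'))"
      unfolding al_down.simps al_shift.simps prod.inject by blast+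
    have ee: "e = e'" by (rule coprime_scale_unique[OF unit_det_imp_coprime(2)[OF det(1)] unit_det_imp_coprime(2)[OF det(2)] eq(2,3)])
    have ac: "c = c'" "d = d'" using eq(2,3) pos(1)[OF em(1)] by (auto simp: ee)
    obtain t where t: "a' = a + t * c" "b' = b + t * (int Q * d)"
      using row_det_unique[OF det(1) det(2)[folded ac eq(1)]] .
    have "(Q', a', b', c', d') = al_shift t (Q, a, b, c, d)" by (simp add: t ac eq(1))
    then have "t = 0" using al_strip_shift_eq[OF good_level_plicate[OF g pos(1)[OF em(1)]] st(1) _ \<tau>, of t] st(2) by (simp add: ee)
    then have ab: "a = a'" "b = b'" using t by auto
    have "(int i + u * int e) * c = (int i' + u' * int e) * c" "(int i + u * int e) * (int Q * d) = (int i' + u' * int e) * (int Q * d)"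
      using eq(4,5) by (simp_all add: ab ac ee eq(1) k_def algebra_simps)
    then have "int i + u * int e = int i' + u' * int e" using cd Q by auto
    then have "(int i + u * int e) mod int e = (int i' + u' * int e) mod int e" by simp
    then have "i = i'" using i by (simp add: ee)
    then show "x = y" by (simp add: x y ab ac ee eq(1))
  qed
  show "?f ` ?X = al_strip L (int m) \<tau>"
  proof (intro equalityI subsetI)
    fix z assume "z \<in> ?f ` ?X"
    then obtain e i \<delta> where z: "z = (let \<rho> = al_down e (m div e) i \<delta> in al_shift (- \<lfloor>Re (al_act \<rho> \<tau>)\<rfloor>) \<rho>)" "e dvd m"
      and \<delta>: "\<delta> \<in> al_strip (plicate e L) 1 \<tau>" by auto
    show "z \<in> al_strip L (int m) \<tau>"
      using al_down(1)[OF g al_strip_imp[OF \<delta>] pos(1,2)[OF z(2)] \<tau>, of i] al_shift_to_strip[OF g _ \<tau>]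
      unfolding pos(3)[OF z(2)] z(1) Let_def by blast
  next
    fix z assume z: "z \<in> al_strip L (int m) \<tau>"
    obtain Q A B C D where z1: "z = (Q, A, B, C, D)" by (cases z)
    have *: "Q \<in> insert 1 S" "int Q * A * D - B * C = int m" "int (N div Q) dvd C" "coprime C (int Q)" "C > 0 \<or> C = 0 \<and> D > 0"
      using al_strip_imp[OF z] by (auto simp: z1 L)
    define e where "e = nat (gcd C D)"
    have e: "int e = gcd C D" "e > 0" "e dvd m" unfolding e_def using al_set_gcd[OF *(2) m, of "gcd C D"] by blast+
    define k where "k = m div e"
    have k: "k > 0" "int e * int k = int m" "e * k = m" using pos[OF e(3)] by (simp_all only: k_def of_nat_mult[symmetric])
    have "gcd C D \<noteq> 0" using e(1,2) by linarith
    then obtain c d where cd: "C = c * int e" "D = d * int e" "coprime c d"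
      using gcd_coprime_exists[of C D] unfolding e(1)[symmetric] by blast
    have "int e * (int Q * A * d - B * c) = int e * int k" using *(2) by (simp add: cd k(2) algebra_simps)
    then have kk: "int Q * A * d - B * c = int k" using e(2) by simp
    have "coprime (int Q * d) c" using *(4) cd by (simp add: coprime_commute)
    then obtain a1 b1 where det1: "int Q * a1 * d - b1 * c = 1" by (rule row_completion)
    have "c > 0 \<or> c = 0 \<and> d > 0" using *(5) e(2) by (auto simp: cd zero_less_mult_iff)
    then have \<delta>1: "(Q, a1, b1, c, d) \<in> al_set (plicate e L) 1"
      unfolding L al_set_plicate_iff[OF g' e(2)] using * cd det1 by simp
    define t where "t = - \<lfloor>Re (al_act (Q, a1, b1, c, d) \<tau>)\<rfloor>"
    define a b where "a = a1 + t * c" and "b = b1 + t * (int Q * d)"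
    define \<delta> where "\<delta> = (Q, a, b, c, d)"
    have "al_shift t (Q, a1, b1, c, d) = \<delta>" by (simp add: \<delta>_def a_def b_def)
    then have \<delta>: "\<delta> \<in> al_strip (plicate e L) 1 \<tau>"
      using al_shift_to_strip[OF good_level_plicate[OF g e(2)] \<delta>1 \<tau>, of t] t_def by simp
    have det: "int Q * a * d = 1 + b * c" using det1 by (simp add: a_def b_def algebra_simps)
    \<comment> \<open>Cramer's rule again: the top row is k times (a, b) plus \<beta> times (c, Q
      d). The residue of \<beta> modulo e becomes i, its quotient the translation u.\<close>
    define \<beta> where "\<beta> = a * B - b * A"
    have A: "A = int k * a + \<beta> * c"
    proof -
      have "int k * a + \<beta> * c = A * (int Q * a * d) - A * (b * c)" unfolding \<beta>_def kk[symmetric] by (simp add: algebra_simps)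
      then show ?thesis unfolding det by (simp add: algebra_simps)
    qed
    have B: "B = int k * b + \<beta> * (int Q * d)"
    proof -
      have "int k * b + \<beta> * (int Q * d) = B * (int Q * a * d) - B * (b * c)" unfolding \<beta>_def kk[symmetric] by (simp add: algebra_simps)
      then show ?thesis unfolding det by (simp add: algebra_simps)
    qed
    define i u where "i = nat (\<beta> mod int e)" and "u = \<beta> div int e"
    have i: "int i = \<beta> mod int e" "i < e" using e(2) by (auto simp: i_def nat_less_iff)
    have \<beta>: "\<beta> = int i + u * int e" unfolding i(1) u_def by simp
    have zs: "z = al_shift u (al_down e k i \<delta>)"
      unfolding z1 \<delta>_def al_down.simps al_shift.simps using cd A B by (simp add: \<beta> algebra_simps)
    have "al_down e k i \<delta> \<in> al_set L (int m)"
      using al_down(1)[OF g al_strip_imp[OF \<delta>] e(2) k(1) \<tau>, of i] unfolding k(3) .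
    then have "u = - \<lfloor>Re (al_act (al_down e k i \<delta>) \<tau>)\<rfloor>"
      using al_shift_to_strip[OF g _ \<tau>, of _ "int m" u] z unfolding zs by blast
    then have "z = ?f ((e, i), \<delta>)" using zs by (simp add: Let_def k_def)
    then show "z \<in> ?f ` ?X"
      using \<delta> e(3) i(2) by (intro image_eqI[of _ _ "((e, i), \<delta>)"]) auto
  qed
qed

lemma infsum_Sigma_finite:
  fixes f :: "'a \<times> 'b \<Rightarrow> complex"
  assumes "finite I" "f summable_on Sigma I A"
  shows "i \<in> I \<Longrightarrow> (\<lambda>x. f (i, x)) summable_on A i" "infsum f (Sigma I A) = (\<Sum>i\<in>I. \<Sum>\<^sub>\<infinity>x\<in>A i. f (i, x))"
proof -
  have sm: "(\<lambda>x. f (i, x)) summable_on A i" if i: "i \<in> I" for i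
  proof -
    have "f summable_on Pair i ` A i" by (rule summable_on_subset_banach[OF assms(2)]) (use i in auto)
    then show ?thesis by (subst (asm) summable_on_reindex) (auto simp: inj_on_def o_def)
  qed
  then show "i \<in> I \<Longrightarrow> (\<lambda>x. f (i, x)) summable_on A i" .
  show "infsum f (Sigma I A) = (\<Sum>i\<in>I. \<Sum>\<^sub>\<infinity>x\<in>A i. f (i, x))"
    by (intro infsumI has_sum_Sigma_finite assms(1) has_sum_infsum sm)
qed

text \<open>The translates differ only by e-th roots of unity, which cancel unless e divides n. If
  it does, the factor k / e moves from the argument into the index, since the seed depends on its
  index and argument only through the products of n with real and imaginary part.\<close>

lemma sum_seed_translates:
  assumes e: "e > 0"
  shows "(\<Sum>i<e. seed n s ((of_nat k * \<zeta> + of_nat i) / of_nat e)) =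
    (if e dvd n then of_nat e * seed ((n div e) * k) s \<zeta> else 0)"
proof -
  define r where "r = real n * real k / real e"
  define X where "X = ee (of_real (- r * Re \<zeta>)) * of_real (sqrt (r * Im \<zeta>)) * Bessel_I (s - 1 / 2) (of_real (2 * pi * (r * Im \<zeta>)))"
  have "seed n s ((of_nat k * \<zeta> + of_nat i) / of_nat e) = ec (int e) (int i * (- int n)) * X" for i
  proof -
    have Re: "Re ((of_nat k * \<zeta> + of_nat i) / of_nat e) = (real k * Re \<zeta> + real i) / real e"
      and Im: "Im ((of_nat k * \<zeta> + of_nat i) / of_nat e) = real k * Im \<zeta> / real e"
      using Re_divide_of_real[of "of_nat k * \<zeta> + of_nat i" "real e"] Im_divide_of_real[of "of_nat k * \<zeta> + of_nat i" "real e"] by simp_all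
    have "- of_nat n * complex_of_real ((real k * Re \<zeta> + real i) / real e) =
        of_int (int i * (- int n)) / of_int (int e) + of_real (- r * Re \<zeta>)"
      using e by (simp add: r_def field_simps)
    then have "ee (- of_nat n * complex_of_real ((real k * Re \<zeta> + real i) / real e)) = ec (int e) (int i * (- int n)) * ee (of_real (- r * Re \<zeta>))"
      by (simp only: ee_add ec_def)
    moreover have "real n * (real k * Im \<zeta> / real e) = r * Im \<zeta>" "2 * pi * real n * (real k * Im \<zeta> / real e) = 2 * pi * (r * Im \<zeta>)"
      by (simp_all add: r_def)
    ultimately show ?thesis unfolding seed_def Re Im X_def by (simp only: mult.assoc)
  qed
  then have "(\<Sum>i<e. seed n s ((of_nat k * \<zeta> + of_nat i) / of_nat e)) = (\<Sum>i<e. ec (int e) (int i * (- int n))) * X"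
    by (simp add: sum_distrib_right)
  also have "(\<Sum>i<e. ec (int e) (int i * (- int n))) = (\<Sum>i\<in>{0..<int e}. ec (int e) (i * (- int n)))"
    by (simp add: sum_int_lessThan)
  also have "\<dots> = (if e dvd n then of_nat e else 0)" using e by (subst ec_orthogonality) auto
  also have "(if e dvd n then of_nat e else 0) * X = (if e dvd n then of_nat e * seed ((n div e) * k) s \<zeta> else 0)"
  proof (cases "e dvd n")
    case True
    then have r: "r = real ((n div e) * k)" using e by (auto simp: r_def)
    have "X = seed ((n div e) * k) s \<zeta>" unfolding X_def seed_def r by (simp add: mult.assoc)
    then show ?thesis using True by simp
  qed simp
  finally show ?thesis .
qed

text \<open>For Re s > 1 the series are unordered sums, so both bijections act as reindexings, with
  the strip of determinant m as the common index set.\<close>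

lemma Niebur_G_hecke:
  assumes g: "good_level L" and m: "m > 0" and n: "n > 0" and \<tau>: "Im \<tau> > 0" and s: "Re s > 1"
  shows "(\<Sum>d | d dvd m. \<Sum>i<m div d. Niebur_G (plicate d L) n ((of_nat d * \<tau> + of_nat i) / of_nat (m div d)) s) =
    (\<Sum>e | e dvd gcd n m. of_nat e * Niebur_G (plicate e L) (m * n div e\<^sup>2) \<tau> s)"
proof -
  have pos: "d > 0" "m div d > 0" "d * (m div d) = m" if "d dvd m" for d
    using that m by (auto simp: div_greater_zero_iff dvd_imp_le dvd_pos_nat)
  have fin: "finite {d. d dvd m}" using m by simp
  have gd: "good_level (plicate d L)" if "d dvd m" for d by (rule good_level_plicate[OF g pos(1)[OF that]])
  let ?h = "\<lambda>\<delta>. seed n s (al_act \<delta> \<tau>)"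
  let ?z = "\<lambda>d i. (of_nat d * \<tau> + of_nat i) / of_nat (m div d)"
  let ?T = "SIGMA d:{d. d dvd m}. {..<m div d}" and ?T' = "SIGMA e:{e. e dvd m}. {..<e}"
  let ?A = "\<lambda>(d, i). al_strip (plicate d L) 1 (?z d i)" and ?B = "\<lambda>(e, i :: nat). al_strip (plicate e L) 1 \<tau>"
  let ?w = "\<lambda>((d, i), \<delta>). seed n s (al_act \<delta> (?z d i))"
  let ?total = "\<Sum>x\<in>?T. \<Sum>\<^sub>\<infinity>\<delta>\<in>?A x. ?w (x, \<delta>)"
  have zpos: "Im (?z d i) > 0" if "d dvd m" for d i
    using pos[OF that] \<tau> Im_divide_of_real[of "of_nat d * \<tau> + of_nat i" "real (m div d)"] by simp
  have finT: "finite ?T" "finite ?T'" using fin by (auto simp: dvd_imp_le m finite_subset)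
  have "(?w has_sum ?total) (Sigma ?T ?A)"
  proof (rule has_sum_Sigma_finite[OF finT(1)])
    fix x assume x: "x \<in> ?T"
    then obtain d i where di: "x = (d, i)" "d dvd m" by auto
    show "((\<lambda>\<delta>. ?w (x, \<delta>)) has_sum (\<Sum>\<^sub>\<infinity>\<delta>\<in>?A x. ?w (x, \<delta>))) (?A x)"
      using has_sum_imp_summable[OF seed_has_sum_strip[OF gd[OF di(2)] zpos[OF di(2)] n s]] by (simp add: di(1) has_sum_infsum)
  qed
  then have "((\<lambda>x. ?h ((\<lambda>((d, i), \<delta>). al_up d (m div d) i \<delta>) x)) has_sum ?total) (Sigma ?T ?A)"
  proof (rule has_sum_cong[THEN iffD1, rotated])
    fix x assume "x \<in> Sigma ?T ?A"
    then obtain d i \<delta> where x: "x = ((d, i), \<delta>)" "d dvd m" "\<delta> \<in> al_strip (plicate d L) 1 (?z d i)" by auto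
    show "?w x = ?h ((\<lambda>((d, i), \<delta>). al_up d (m div d) i \<delta>) x)"
      using al_up(2)[OF g al_strip_imp[OF x(3)] pos(1,2)[OF x(2)], of i] by (simp add: x(1))
  qed
  then have mid: "(?h has_sum ?total) (al_strip L (int m) \<tau>)"
    by (rule has_sum_reindex_bij_betw[OF al_up_bij[OF g m], THEN iffD1])
  let ?f = "\<lambda>((e, i), \<delta>). let \<rho> = al_down e (m div e) i \<delta> in al_shift (- \<lfloor>Re (al_act \<rho> \<tau>)\<rfloor>) \<rho>"
  let ?g = "\<lambda>((e, i), \<delta>). seed n s ((of_nat (m div e) * al_act \<delta> \<tau> + of_nat i) / of_nat e)"
  have "((\<lambda>x. ?h (?f x)) has_sum ?total) (Sigma ?T' ?B)"
    by (rule has_sum_reindex_bij_betw[OF al_down_bij[OF g m \<tau>], THEN iffD2, OF mid])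
  then have R: "(?g has_sum ?total) (Sigma ?T' ?B)"
  proof (rule has_sum_cong[THEN iffD1, rotated])
    fix x assume "x \<in> Sigma ?T' ?B"
    then obtain e i \<delta> where x: "x = ((e, i), \<delta>)" "e dvd m" "\<delta> \<in> al_strip (plicate e L) 1 \<tau>" by auto
    note D = al_down[OF g al_strip_imp[OF x(3)] pos(1,2)[OF x(2)] \<tau>, of i, unfolded pos(3)[OF x(2)]]
    have "?h (?f x) = seed n s (al_act (al_down e (m div e) i \<delta>) \<tau>)"
      unfolding x(1) Let_def case_prod_conv al_act_shift[OF g D(1) \<tau>] by (rule seed_shift)
    then show "?h (?f x) = ?g x" unfolding D(2) by (simp add: x(1))
  qed
  \<comment> \<open>Summability of each inner series is inherited from the total, which was obtained
    through the first factorisation.\<close>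
  note S = infsum_Sigma_finite[OF finT(2) has_sum_imp_summable[OF R]]
  have "?total = infsum ?g (Sigma ?T' ?B)" using infsumI[OF R] by simp
  also have "\<dots> = (\<Sum>(e, i)\<in>?T'. \<Sum>\<^sub>\<infinity>\<delta>\<in>al_strip (plicate e L) 1 \<tau>. ?g ((e, i), \<delta>))"
    unfolding S(2) by (rule sum.cong) auto
  also have "\<dots> = (\<Sum>e | e dvd m. \<Sum>i<e. \<Sum>\<^sub>\<infinity>\<delta>\<in>al_strip (plicate e L) 1 \<tau>. ?g ((e, i), \<delta>))"
    by (rule sum.Sigma[symmetric]) (use fin in auto)
  also have "\<dots> = (\<Sum>e | e dvd m. if e dvd n then of_nat e * (\<Sum>\<^sub>\<infinity>\<delta>\<in>al_strip (plicate e L) 1 \<tau>. seed ((n div e) * (m div e)) s (al_act \<delta> \<tau>)) else 0)"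
  proof (rule sum.cong[OF refl])
    fix e assume "e \<in> {e. e dvd m}"
    then have e: "e dvd m" by simp
    have "(\<Sum>i<e. \<Sum>\<^sub>\<infinity>\<delta>\<in>al_strip (plicate e L) 1 \<tau>. ?g ((e, i), \<delta>)) = (\<Sum>\<^sub>\<infinity>\<delta>\<in>al_strip (plicate e L) 1 \<tau>. \<Sum>i<e. ?g ((e, i), \<delta>))"
    proof (rule infsum_finite_sum[symmetric])
      fix i assume "i \<in> {..<e}"
      then show "(\<lambda>\<delta>. ?g ((e, i), \<delta>)) summable_on al_strip (plicate e L) 1 \<tau>" using S(1)[of "(e, i)"] e by simp
    qed simp
    also have "\<dots> = (\<Sum>\<^sub>\<infinity>\<delta>\<in>al_strip (plicate e L) 1 \<tau>. if e dvd n then of_nat e * seed ((n div e) * (m div e)) s (al_act \<delta> \<tau>) else 0)"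
      by (simp only: case_prod_conv sum_seed_translates[OF pos(1)[OF e]])
    also have "\<dots> = (if e dvd n then of_nat e * (\<Sum>\<^sub>\<infinity>\<delta>\<in>al_strip (plicate e L) 1 \<tau>. seed ((n div e) * (m div e)) s (al_act \<delta> \<tau>)) else 0)"
      by (simp add: infsum_cmult_right')
    finally show "(\<Sum>i<e. \<Sum>\<^sub>\<infinity>\<delta>\<in>al_strip (plicate e L) 1 \<tau>. ?g ((e, i), \<delta>)) =
      (if e dvd n then of_nat e * (\<Sum>\<^sub>\<infinity>\<delta>\<in>al_strip (plicate e L) 1 \<tau>. seed ((n div e) * (m div e)) s (al_act \<delta> \<tau>)) else 0)" .
  qed
  also have "\<dots> = (\<Sum>e | e dvd gcd n m. of_nat e * (\<Sum>\<^sub>\<infinity>\<delta>\<in>al_strip (plicate e L) 1 \<tau>. seed ((n div e) * (m div e)) s (al_act \<delta> \<tau>)))"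
    by (rule sum.mono_neutral_cong_right) (use fin in auto)
  finally have main: "?total = (\<Sum>e | e dvd gcd n m. of_nat e * (\<Sum>\<^sub>\<infinity>\<delta>\<in>al_strip (plicate e L) 1 \<tau>. seed ((n div e) * (m div e)) s (al_act \<delta> \<tau>)))" .
  have "(\<Sum>d | d dvd m. \<Sum>i<m div d. Niebur_G (plicate d L) n (?z d i) s) = (\<Sum>(d, i)\<in>?T. Niebur_G (plicate d L) n (?z d i) s)"
    by (rule sum.Sigma) (use fin in auto)
  also have "\<dots> = 2 * of_real pi * ?total"
    unfolding sum_distrib_left by (rule sum.cong) (auto simp: Niebur_G_strip[OF gd zpos])
  also have "\<dots> = (\<Sum>e | e dvd gcd n m. of_nat e * Niebur_G (plicate e L) (m * n div e\<^sup>2) \<tau> s)"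
    unfolding main sum_distrib_left
  proof (rule sum.cong[OF refl])
    fix e assume "e \<in> {e. e dvd gcd n m}"
    then have e: "e dvd n" "e dvd m" by auto
    have "m * n div e\<^sup>2 = (n div e) * (m div e)" using e by (simp add: power2_eq_square div_mult_div_if_dvd mult.commute)
    then show "2 * of_real pi * (of_nat e * (\<Sum>\<^sub>\<infinity>\<delta>\<in>al_strip (plicate e L) 1 \<tau>. seed ((n div e) * (m div e)) s (al_act \<delta> \<tau>))) =
        of_nat e * Niebur_G (plicate e L) (m * n div e\<^sup>2) \<tau> s"
      by (simp add: Niebur_G_strip[OF gd[OF e(2)] \<tau>])
  qed
  finally show ?thesis .
qed

section \<open>Passage to s = 1 and comparison of constant terms\<close>

lemma dvd_pos_cofactor:
  fixes d m :: nat
  assumes "m > 0" "d dvd m"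
  shows "d > 0" "m div d > 0" "d * (m div d) = m"
  using assms by (auto simp: div_greater_zero_iff dvd_imp_le dvd_pos_nat)

lemma hecke_index_pos:
  fixes e m n :: nat
  assumes "m > 0" "n > 0" "e dvd gcd n m"
  shows "m * n div e\<^sup>2 > 0" "m * n div e\<^sup>2 = (n div e) * (m div e)"
proof -
  have e: "e dvd n" "e dvd m" using assms(3) by auto
  show *: "m * n div e\<^sup>2 = (n div e) * (m div e)"
    using e by (simp add: power2_eq_square div_mult_div_if_dvd mult.commute)
  show "m * n div e\<^sup>2 > 0"
    unfolding * using dvd_pos_cofactor(2)[OF assms(1) e(2)] dvd_pos_cofactor(2)[OF assms(2) e(1)] by simp
qed

lemma Im_hecke_point:
  assumes "m > 0" "d dvd m"
  shows "Im ((of_nat d * \<tau> + of_nat i) / of_nat (m div d)) = real d / real (m div d) * Im \<tau>"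
  using Im_divide_of_real[of "of_nat d * \<tau> + of_nat i" "real (m div d)"] by simp

lemma Im_hecke_point_pos:
  assumes "m > 0" "d dvd m" "Im \<tau> > 0"
  shows "Im ((of_nat d * \<tau> + of_nat i) / of_nat (m div d)) > 0"
  unfolding Im_hecke_point[OF assms(1,2)] using dvd_pos_cofactor[OF assms(1,2)] assms(3) by simp

text \<open>Both sides are finite sums, so the identity for Re s > 1 passes to the limits furnished
  by \<open>j_fun_eq\<close>.\<close>

lemma j_fun_hecke:
  assumes g: "good_level L" and m: "m > 0" and n: "n > 0" and \<tau>: "Im \<tau> > 0"
  shows "(\<Sum>d | d dvd m. \<Sum>i<m div d. j_fun (plicate d L) n ((of_nat d * \<tau> + of_nat i) / of_nat (m div d))) =
    (\<Sum>e | e dvd gcd n m. of_nat e * j_fun (plicate e L) (m * n div e\<^sup>2) \<tau>)"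
proof -
  let ?F = "at (1::complex) within {s. Re s > 1}"
  let ?z = "\<lambda>d i. (of_nat d * \<tau> + of_nat i) / of_nat (m div d)"
  have gd: "good_level (plicate d L)" if "d dvd m" for d
    by (rule good_level_plicate[OF g dvd_pos_cofactor(1)[OF m that]])
  have "((\<lambda>s. \<Sum>d | d dvd m. \<Sum>i<m div d. Niebur_G (plicate d L) n (?z d i) s) \<longlongrightarrow>
      (\<Sum>d | d dvd m. \<Sum>i<m div d. j_fun (plicate d L) n (?z d i))) ?F"
    by (intro tendsto_sum j_fun_eq(2) gd n Im_hecke_point_pos[OF m _ \<tau>]) auto
  moreover have "\<forall>\<^sub>F s in ?F. (\<Sum>d | d dvd m. \<Sum>i<m div d. Niebur_G (plicate d L) n (?z d i) s) =
      (\<Sum>e | e dvd gcd n m. of_nat e * Niebur_G (plicate e L) (m * n div e\<^sup>2) \<tau> s)"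
    unfolding eventually_at_filter by (intro always_eventually allI impI Niebur_G_hecke[OF g m n \<tau>]) simp
  ultimately have 1: "((\<lambda>s. \<Sum>e | e dvd gcd n m. of_nat e * Niebur_G (plicate e L) (m * n div e\<^sup>2) \<tau> s) \<longlongrightarrow>
      (\<Sum>d | d dvd m. \<Sum>i<m div d. j_fun (plicate d L) n (?z d i))) ?F"
    by (rule Lim_transform_eventually)
  have 2: "((\<lambda>s. \<Sum>e | e dvd gcd n m. of_nat e * Niebur_G (plicate e L) (m * n div e\<^sup>2) \<tau> s) \<longlongrightarrow>
      (\<Sum>e | e dvd gcd n m. of_nat e * j_fun (plicate e L) (m * n div e\<^sup>2) \<tau>)) ?F"
    by (intro tendsto_sum tendsto_mult tendsto_const j_fun_eq(2) gd \<tau>) (use hecke_index_pos(1)[OF m n] in auto)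
  show ?thesis by (rule tendsto_unique[OF at_1_within_right_halfplane 1 2])
qed

text \<open>A principal part is 2 pi times the seed at s = 1, so the cancellation of translates
  applies to it directly, now with m / d as denominator. Exchanging d and m / d matches the two
  sides.\<close>

lemma sum_principal_parts:
  assumes m: "m > 0" and n: "n > 0" and \<tau>: "Im \<tau> > 0"
  defines "P \<equiv> \<lambda>n z. inverse (ee z) ^ n - cnj (ee z) ^ n"
  shows "(\<Sum>d | d dvd m. \<Sum>i<m div d. P n ((of_nat d * \<tau> + of_nat i) / of_nat (m div d))) =
    (\<Sum>e | e dvd gcd n m. of_nat e * P (m * n div e\<^sup>2) \<tau>)"
proof -
  have P: "P n z = 2 * of_real pi * seed n 1 z" if "n > 0" "Im z > 0" for n z
    unfolding P_def using seed_at_one[OF that] by simp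
  have fin: "finite {d. d dvd m}" using m by simp
  have "(\<Sum>d | d dvd m. \<Sum>i<m div d. P n ((of_nat d * \<tau> + of_nat i) / of_nat (m div d))) =
      (\<Sum>d | d dvd m. if m div d dvd n then of_nat (m div d) * P ((n div (m div d)) * d) \<tau> else 0)"
  proof (rule sum.cong[OF refl])
    fix d assume "d \<in> {d. d dvd m}"
    then have d: "d dvd m" by simp
    note p = dvd_pos_cofactor[OF m d]
    have "(\<Sum>i<m div d. P n ((of_nat d * \<tau> + of_nat i) / of_nat (m div d))) =
        2 * of_real pi * (\<Sum>i<m div d. seed n 1 ((of_nat d * \<tau> + of_nat i) / of_nat (m div d)))"
      by (simp only: P[OF n Im_hecke_point_pos[OF m d \<tau>]] sum_distrib_left)
    also have "\<dots> = (if m div d dvd n then of_nat (m div d) * (2 * of_real pi * seed ((n div (m div d)) * d) 1 \<tau>) else 0)"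
      unfolding sum_seed_translates[OF p(2)] by simp
    also have "\<dots> = (if m div d dvd n then of_nat (m div d) * P ((n div (m div d)) * d) \<tau> else 0)"
      using dvd_pos_cofactor(2)[OF n, of "m div d"] p by (auto simp: P[OF _ \<tau>])
    finally show "(\<Sum>i<m div d. P n ((of_nat d * \<tau> + of_nat i) / of_nat (m div d))) =
        (if m div d dvd n then of_nat (m div d) * P ((n div (m div d)) * d) \<tau> else 0)" .
  qed
  also have "\<dots> = (\<Sum>e | e dvd m. if e dvd n then of_nat e * P ((n div e) * (m div e)) \<tau> else 0)"
    by (rule sum.reindex_bij_witness[of _ "\<lambda>d. m div d" "\<lambda>d. m div d"]) (use m in auto)
  also have "\<dots> = (\<Sum>e | e dvd gcd n m. of_nat e * P ((n div e) * (m div e)) \<tau>)"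
    by (rule sum.mono_neutral_cong_right) (use fin in auto)
  also have "\<dots> = (\<Sum>e | e dvd gcd n m. of_nat e * P (m * n div e\<^sup>2) \<tau>)"
    by (rule sum.cong[OF refl]) (simp only: mem_Collect_eq hecke_index_pos(2)[OF m n])
  finally show ?thesis .
qed

text \<open>Let \<open>Im \<tau> \<rightarrow> \<infinity>\<close> in the identity for the \<open>j\<close>-functions, after cancelling the principal parts.\<close>

lemma coeff_j_hecke:
  assumes g: "good_level L" and m: "m > 0" and n: "n > 0"
  shows "(\<Sum>d | d dvd m. of_nat (m div d) * coeff_j (plicate d L) n 0) =
    (\<Sum>e | e dvd gcd n m. of_nat e * coeff_j (plicate e L) (m * n div e\<^sup>2) 0)"
proof -
  let ?F = "filtercomap Im at_top :: complex filter"
  let ?z = "\<lambda>\<tau> d i. (of_nat d * \<tau> + of_nat i) / of_nat (m div d)"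
  define R where "R L n \<tau> = j_fun L n \<tau> - (inverse (ee \<tau>) ^ n - cnj (ee \<tau>) ^ n)" for L n \<tau>
  have gd: "good_level (plicate d L)" if "d dvd m" for d
    by (rule good_level_plicate[OF g dvd_pos_cofactor(1)[OF m that]])
  have z: "filterlim (\<lambda>\<tau>. ?z \<tau> d i) ?F ?F" if d: "d dvd m" for d i
    unfolding filterlim_filtercomap_iff comp_def Im_hecke_point[OF m d]
    by (rule filterlim_tendsto_pos_mult_at_top[OF tendsto_const _ filterlim_Im_at_top])
      (use dvd_pos_cofactor[OF m d] in simp)
  have lim: "(R (plicate d L) n' \<longlongrightarrow> coeff_j (plicate d L) n' 0) ?F" if "d dvd m" "n' > 0" for d n'
    unfolding R_def[abs_def] by (rule coeff_j_limit[OF gd[OF that(1)] that(2)])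
  have eq: "(\<Sum>d | d dvd m. \<Sum>i<m div d. R (plicate d L) n (?z \<tau> d i)) =
      (\<Sum>e | e dvd gcd n m. of_nat e * R (plicate e L) (m * n div e\<^sup>2) \<tau>)" if "Im \<tau> > 0" for \<tau>
    unfolding R_def right_diff_distrib[of "of_nat _"] sum_subtractf
    by (simp only: j_fun_hecke[OF g m n that] sum_principal_parts[OF m n that, unfolded sum_subtractf right_diff_distrib])
  have "((\<lambda>\<tau>. \<Sum>d | d dvd m. \<Sum>i<m div d. R (plicate d L) n (?z \<tau> d i)) \<longlongrightarrow>
      (\<Sum>d | d dvd m. \<Sum>i<m div d. coeff_j (plicate d L) n 0)) ?F"
    by (intro tendsto_sum filterlim_compose[OF lim z]) (use n in auto)
  moreover have "\<forall>\<^sub>F \<tau> in ?F. (\<Sum>d | d dvd m. \<Sum>i<m div d. R (plicate d L) n (?z \<tau> d i)) =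
      (\<Sum>e | e dvd gcd n m. of_nat e * R (plicate e L) (m * n div e\<^sup>2) \<tau>)"
    using eventually_filtercomapI[OF eventually_gt_at_top[of 0], of Im] by eventually_elim (rule eq)
  ultimately have 1: "((\<lambda>\<tau>. \<Sum>e | e dvd gcd n m. of_nat e * R (plicate e L) (m * n div e\<^sup>2) \<tau>) \<longlongrightarrow>
      (\<Sum>d | d dvd m. \<Sum>i<m div d. coeff_j (plicate d L) n 0)) ?F"
    by (rule Lim_transform_eventually)
  have 2: "((\<lambda>\<tau>. \<Sum>e | e dvd gcd n m. of_nat e * R (plicate e L) (m * n div e\<^sup>2) \<tau>) \<longlongrightarrow>
      (\<Sum>e | e dvd gcd n m. of_nat e * coeff_j (plicate e L) (m * n div e\<^sup>2) 0)) ?F"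
    by (intro tendsto_sum tendsto_mult tendsto_const lim) (use hecke_index_pos(1)[OF m n] in auto)
  \<comment> \<open>Needed for uniqueness of limits: the filter of heights tending to infinity is
    nontrivial because every height occurs.\<close>
  have "surj Im" by (rule surjI[of _ "\<lambda>y. Complex 0 y"]) simp
  then have "?F \<noteq> bot" by (intro filtercomap_neq_bot_surj) auto
  from tendsto_unique[OF this 1 2] show ?thesis by simp
qed

text \<open>A sum of m / d translates contains the constant term m / d times; this is the weight
  with which constants enter \<open>coeff_j_hecke\<close>.\<close>

lemma J_fun_hecke:
  assumes g: "good_level L" and m: "m > 0" and n: "n > 0" and \<tau>: "Im \<tau> > 0"
  shows "(\<Sum>d | d dvd m. U_star (m div d) (J_fun (plicate d L) n) (of_nat d * \<tau>)) =
    (\<Sum>e | e dvd gcd n m. of_nat e * J_fun (plicate e L) (m * n div e\<^sup>2) \<tau>)"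
proof -
  have "(\<Sum>d | d dvd m. U_star (m div d) (J_fun (plicate d L) n) (of_nat d * \<tau>)) =
      (\<Sum>d | d dvd m. \<Sum>i<m div d. j_fun (plicate d L) n ((of_nat d * \<tau> + of_nat i) / of_nat (m div d))) -
      (\<Sum>d | d dvd m. of_nat (m div d) * coeff_j (plicate d L) n 0)"
    using n by (simp add: U_star_def J_fun_def sum_subtractf)
  also have "\<dots> = (\<Sum>e | e dvd gcd n m. of_nat e * j_fun (plicate e L) (m * n div e\<^sup>2) \<tau>) -
      (\<Sum>e | e dvd gcd n m. of_nat e * coeff_j (plicate e L) (m * n div e\<^sup>2) 0)"
    by (simp only: j_fun_hecke[OF g m n \<tau>] coeff_j_hecke[OF g m n])
  also have "\<dots> = (\<Sum>e | e dvd gcd n m. of_nat e * J_fun (plicate e L) (m * n div e\<^sup>2) \<tau>)"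
    unfolding sum_subtractf[symmetric]
  proof (rule sum.cong[OF refl])
    fix e assume "e \<in> {e. e dvd gcd n m}"
    \<comment> \<open>A positive index excludes the special value 1 of \<open>J_fun\<close> at index
      0.\<close>
    then have "m * n div e\<^sup>2 \<noteq> 0" using hecke_index_pos(1)[OF m n, of e] by fastforce
    then show "of_nat e * j_fun (plicate e L) (m * n div e\<^sup>2) \<tau> - of_nat e * coeff_j (plicate e L) (m * n div e\<^sup>2) 0 =
        of_nat e * J_fun (plicate e L) (m * n div e\<^sup>2) \<tau>"
      unfolding J_fun_def by (simp only: if_False right_diff_distrib)
  qed
  finally show ?thesis .
qed

section \<open>Composition over the prime powers of m\<close>

lemma sum_divisors_prime_power:
  fixes f :: "nat \<Rightarrow> 'a :: comm_monoid_add"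
  assumes "prime p"
  shows "(\<Sum>d | d dvd p ^ k. f d) = (\<Sum>i\<le>k. f (p ^ i))"
proof -
  have "{d. d dvd p ^ k} = (\<lambda>i. p ^ i) ` {..k}" using divides_primepow_nat[OF assms, of _ k] by auto
  moreover have "inj_on (\<lambda>i. p ^ i) {..k}" using prime_gt_1_nat[OF assms] by (auto simp: inj_on_def)
  ultimately show ?thesis by (simp add: sum.reindex)
qed

lemma sum_divisors_gcd_prime_power:
  fixes f :: "nat \<Rightarrow> 'a :: comm_monoid_add"
  assumes "prime p"
  shows "(\<Sum>d | d dvd gcd n (p ^ k). f d) = (\<Sum>j | p ^ j dvd gcd n (p ^ k). f (p ^ j))"
proof -
  have "{d. d dvd gcd n (p ^ k)} = (\<lambda>i. p ^ i) ` {j. p ^ j dvd gcd n (p ^ k)}"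
    using divides_primepow_nat[OF assms, of _ k] by auto
  moreover have "inj_on (\<lambda>i. p ^ i) {j. p ^ j dvd gcd n (p ^ k)}" using prime_gt_1_nat[OF assms] by (auto simp: inj_on_def)
  ultimately show ?thesis by (simp add: sum.reindex)
qed

text \<open>A divisor of A B factors uniquely into a divisor of A and one of B. As these parts are
  coprime, their product divides n exactly when both do.\<close>

lemma sum_divisors_gcd_coprime:
  fixes f :: "nat \<Rightarrow> 'a :: comm_monoid_add" and A B n :: nat
  assumes cop: "coprime A B"
  shows "(\<Sum>d | d dvd gcd n (A * B). f d) = (\<Sum>a | a dvd gcd n A. \<Sum>b | b dvd gcd n B. f (a * b))"
proof -
  have cop': "coprime a b" if "a dvd A" "b dvd B" for a b using cop that by (meson coprime_divisors)
  have "bij_betw (\<lambda>(a, b). a * b) ({a. a dvd gcd n A} \<times> {b. b dvd gcd n B}) {d. d dvd gcd n (A * B)}"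
  proof (rule bij_betw_imageI)
    show "inj_on (\<lambda>(a, b). a * b) ({a. a dvd gcd n A} \<times> {b. b dvd gcd n B})"
    proof (rule inj_onI, clarify)
      fix a b a' b' assume *: "a dvd gcd n A" "b dvd gcd n B" "a' dvd gcd n A" "b' dvd gcd n B" "a * b = a' * b'"
      then have c: "coprime a b'" "coprime a' b" using cop'[of a b'] cop'[of a' b] by auto
      have "a dvd a'" using c(1) *(5) by (metis coprime_dvd_mult_left_iff dvd_triv_left)
      moreover have "a' dvd a" using c(2) *(5) by (metis coprime_dvd_mult_left_iff dvd_triv_left)
      moreover have "b dvd b'" using c(2) *(5) by (metis coprime_commute coprime_dvd_mult_right_iff dvd_triv_right)
      moreover have "b' dvd b" using c(1) *(5) by (metis coprime_commute coprime_dvd_mult_right_iff dvd_triv_right)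
      ultimately show "a = a' \<and> b = b'" by (simp add: dvd_antisym)
    qed
    show "(\<lambda>(a, b). a * b) ` ({a. a dvd gcd n A} \<times> {b. b dvd gcd n B}) = {d. d dvd gcd n (A * B)}"
    proof (intro equalityI subsetI)
      fix d assume "d \<in> {d. d dvd gcd n (A * B)}"
      then have d: "d dvd n" "d dvd A * B" by auto
      then obtain a b where ab: "d = a * b" "a dvd A" "b dvd B" using division_decomp by blast
      then have "a dvd n" "b dvd n" using d(1) by (auto dest: dvd_mult_left dvd_mult_right)
      then show "d \<in> (\<lambda>(a, b). a * b) ` ({a. a dvd gcd n A} \<times> {b. b dvd gcd n B})"
        using ab by (intro image_eqI[of _ _ "(a, b)"]) auto
    qed (auto intro: divides_mult mult_dvd_mono cop')
  qed
  from sum.reindex_bij_betw[OF this, of f] show ?thesis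
    by (simp add: sum.cartesian_product case_prod_unfold)
qed

text \<open>The last operator of the list is evaluated by \<open>J_fun_hecke\<close>, the earlier
  ones by the combination through which \<open>T_list\<close> rewrites them. Since p is coprime to
  the product M of the remaining powers, the divisor sums multiply, and indices and plicates
  combine.\<close>

lemma T_list_eq:
  assumes "good_level L" "n > 0" "Im \<tau> > 0" "\<forall>(p, k)\<in>set xs. prime p" "distinct (map fst xs)"
  shows "T_list xs L n \<tau> =
    (let M = prod_list (map (\<lambda>(p, k). p ^ k) xs)
     in \<Sum>d | d dvd gcd n M. of_nat d * J_fun (plicate d L) (M * n div d\<^sup>2) \<tau>)"
  using assms
proof (induction xs L n \<tau> rule: T_list.induct)
  case (1 L n \<tau>)
  have "{d. d dvd gcd n 1} = {1}" by auto
  then show ?case unfolding T_list.simps list.map prod_list.Nil Let_def using plicate_1[OF 1(1)] by simp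
next
  case (2 p k L n \<tau>)
  then have p: "prime p" by simp
  have "T_prime_power p k L n \<tau> = (\<Sum>i\<le>k. U_star (p ^ k div p ^ i) (J_fun (plicate (p ^ i) L) n) (of_nat (p ^ i) * \<tau>))"
    unfolding T_prime_power_def using prime_gt_0_nat[OF p] by (intro sum.cong refl) (simp add: power_diff)
  also have "\<dots> = (\<Sum>d | d dvd p ^ k. U_star (p ^ k div d) (J_fun (plicate d L) n) (of_nat d * \<tau>))"
    by (rule sum_divisors_prime_power[OF p, symmetric])
  also have "\<dots> = (\<Sum>d | d dvd gcd n (p ^ k). of_nat d * J_fun (plicate d L) (p ^ k * n div d\<^sup>2) \<tau>)"
    by (rule J_fun_hecke) (use 2 prime_gt_0_nat[OF p] in auto)
  finally show ?case by (simp add: Let_def)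
next
  case (3 p k x xs L n \<tau>)
  define M where "M = prod_list (map (\<lambda>(p, k). p ^ k) (x # xs))"
  have p: "prime p" using 3 by simp
  have p0: "p > 0" by (rule prime_gt_0_nat[OF p])
  have cop: "coprime p M"
  proof -
    have "coprime p (case y of (p, k) \<Rightarrow> p ^ k)" if y: "y \<in> set (x # xs)" for y
    proof -
      obtain q l where q: "y = (q, l)" by (cases y)
      have "prime q" using 3(5) y by (auto simp: q)
      moreover have "q \<in> fst ` set (x # xs)" using y by (force simp: q)
      then have "q \<noteq> p" using 3(6) by auto
      ultimately show ?thesis using primes_coprime[OF p] by (auto simp: q)
    qed
    then have "\<forall>y\<in>set (map (\<lambda>(p, k). p ^ k) (x # xs)). coprime p y" by auto
    then show ?thesis unfolding M_def by (intro prod_list_coprime_right) auto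
  qed
  have "T_list ((p, k) # x # xs) L n \<tau> =
      (\<Sum>j | p ^ j dvd gcd n (p ^ k). of_nat (p ^ j) * T_list (x # xs) (plicate (p ^ j) L) (p ^ k * n div p ^ (2 * j)) \<tau>)"
    by simp
  also have "\<dots> = (\<Sum>j | p ^ j dvd gcd n (p ^ k). \<Sum>d | d dvd gcd n M.
      of_nat (p ^ j * d) * J_fun (plicate (p ^ j * d) L) ((p ^ k * M) * n div (p ^ j * d)\<^sup>2) \<tau>)"
  proof (rule sum.cong[OF refl])
    fix j assume j: "j \<in> {j. p ^ j dvd gcd n (p ^ k)}"
    define a where "a = p ^ j"
    obtain n1 where n1: "n = a * n1" using j by (auto simp: a_def)
    obtain k1 where k1: "p ^ k = a * k1" using j by (auto simp: a_def)
    have a: "a > 0" using p0 by (simp add: a_def)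
    have n': "p ^ k * n div p ^ (2 * j) = k1 * n1"
    proof -
      have "p ^ (2 * j) = a * a" by (simp add: a_def power2_eq_square[symmetric] power_mult[symmetric] mult.commute)
      moreover have "p ^ k * n = (a * a) * (k1 * n1)" unfolding n1 k1 by (simp add: mult_ac)
      ultimately show ?thesis using a by simp
    qed
    have pos: "k1 > 0" "n1 > 0" using k1 n1 p0 3(3) by (auto intro: Nat.gr0I)
    have "coprime (p ^ k) M" "coprime a M" using cop by (simp_all add: a_def)
    then have cM: "coprime k1 M" "coprime a M" unfolding k1 by simp_all
    \<comment> \<open>The index changes only by powers of p, which divisors of M do not
      notice.\<close>
    have dv: "d dvd k1 * n1 \<longleftrightarrow> d dvd n" if "d dvd M" for d
    proof -
      have "coprime k1 d" "coprime a d" using cM that by (meson coprime_divisors dvd_refl)+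
      then show ?thesis unfolding n1 by (simp add: coprime_dvd_mult_right_iff coprime_commute)
    qed
    have "T_list (x # xs) (plicate a L) (k1 * n1) \<tau> =
        (\<Sum>d | d dvd gcd (k1 * n1) M. of_nat d * J_fun (plicate d (plicate a L)) (M * (k1 * n1) div d\<^sup>2) \<tau>)"
      using "3.IH"[OF j] 3(2-6) good_level_plicate[OF 3(2) a] pos
      unfolding n' M_def[symmetric] Let_def a_def[symmetric] by simp
    also have "{d. d dvd gcd (k1 * n1) M} = {d. d dvd gcd n M}" using dv by auto
    also have "(\<Sum>d | d dvd gcd n M. of_nat d * J_fun (plicate d (plicate a L)) (M * (k1 * n1) div d\<^sup>2) \<tau>) =
        (\<Sum>d | d dvd gcd n M. of_nat d * J_fun (plicate (a * d) L) ((p ^ k * M) * n div (a * d)\<^sup>2) \<tau>)"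
    proof (rule sum.cong[OF refl])
      fix d assume "d \<in> {d. d dvd gcd n M}"
      then have d: "d dvd n" by simp
      then have d0: "d > 0" using 3(3) by (auto intro: Nat.gr0I)
      have "(p ^ k * M) * n = a\<^sup>2 * (M * (k1 * n1))" unfolding n1 k1 by (simp add: power2_eq_square mult_ac)
      then have "(p ^ k * M) * n div (a * d)\<^sup>2 = M * (k1 * n1) div d\<^sup>2" 
        unfolding power_mult_distrib by (simp only:) (rule div_mult_mult1, use a in simp)
      then show "of_nat d * J_fun (plicate d (plicate a L)) (M * (k1 * n1) div d\<^sup>2) \<tau> =
          of_nat d * J_fun (plicate (a * d) L) ((p ^ k * M) * n div (a * d)\<^sup>2) \<tau>"
        by (simp only: plicate_plicate[OF 3(2) a d0])
    qed
    finally show "of_nat (p ^ j) * T_list (x # xs) (plicate (p ^ j) L) (p ^ k * n div p ^ (2 * j)) \<tau> =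
        (\<Sum>d | d dvd gcd n M. of_nat (p ^ j * d) * J_fun (plicate (p ^ j * d) L) ((p ^ k * M) * n div (p ^ j * d)\<^sup>2) \<tau>)"
      unfolding n' a_def[symmetric] by (simp add: sum_distrib_left mult.assoc)
  qed
  also have "\<dots> = (\<Sum>a | a dvd gcd n (p ^ k). \<Sum>d | d dvd gcd n M.
      of_nat (a * d) * J_fun (plicate (a * d) L) ((p ^ k * M) * n div (a * d)\<^sup>2) \<tau>)"
    by (rule sum_divisors_gcd_prime_power[OF p, symmetric])
  also have "\<dots> = (\<Sum>d | d dvd gcd n (p ^ k * M). of_nat d * J_fun (plicate d L) ((p ^ k * M) * n div d\<^sup>2) \<tau>)"
    by (rule sum_divisors_gcd_coprime[symmetric]) (use cop in simp)
  finally show ?case unfolding M_def by (simp add: Let_def)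
qed

lemma J_T_eq:
  assumes "good_level L" "n > 0" "m > 0" "Im \<tau> > 0"
  shows "J_T m L n \<tau> = (\<Sum>d | d dvd gcd n m. of_nat d * J_fun (plicate d L) (m * n div d\<^sup>2) \<tau>)"
proof -
  let ?xs = "map (\<lambda>p. (p, multiplicity p m)) (sorted_list_of_set (prime_factors m))"
  have "prod_list (map (\<lambda>(p, k). p ^ k) ?xs) = prod_list (map (\<lambda>p. p ^ multiplicity p m) (sorted_list_of_set (prime_factors m)))"
    by (simp add: o_def)
  also have "\<dots> = (\<Prod>p\<in>prime_factors m. p ^ multiplicity p m)"
    by (subst prod.distinct_set_conv_list[symmetric]) auto
  also have "\<dots> = m" using assms(3) by (simp add: prime_factorization_nat[symmetric])
  finally have m: "prod_list (map (\<lambda>(p, k). p ^ k) ?xs) = m" .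
  have "T_list ?xs L n \<tau> = (\<Sum>d | d dvd gcd n m. of_nat d * J_fun (plicate d L) (m * n div d\<^sup>2) \<tau>)"
    using T_list_eq[OF assms(1,2,4), of ?xs] unfolding m Let_def by (auto simp: o_def)
  then show ?thesis by (simp add: J_T_def)
qed

theorem theorem1p3:
  fixes N n m :: nat and S :: "nat set" and \<tau> :: complex
  assumes "is_level (N, S)" and "n > 0" and "m > 0" and "Im \<tau> > 0"
  shows "J_T m (N, S) n \<tau> =
           (\<Sum>d | d dvd m. U_star (m div d) (J_fun (plicate d (N, S)) n) (of_nat d * \<tau>))
       \<and> (\<Sum>d | d dvd m. U_star (m div d) (J_fun (plicate d (N, S)) n) (of_nat d * \<tau>)) =
           (\<Sum>d | d dvd gcd n m. of_nat d * J_fun (plicate d (N, S)) (m * n div d\<^sup>2) \<tau>)"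
proof -
  have g: "good_level (N, S)" by (rule is_level_imp_good[OF assms(1)])
  show ?thesis
    using J_fun_hecke[OF g assms(3,2,4)] J_T_eq[OF g assms(2,3,4)] by simp
qed


end
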